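(* Let $\phi\colon\mathcal D\to\mathbb D$ be a holomorphic function. Then the set of $\alpha\in\mathbb T$ such that $\mathscr P\mu_\alpha\neq\dfrac{1-|\phi|^2}{|\alpha-\phi|^2}$ (as functions on $\mathcal D$) is $\beta_{\mathbb T}$-negligible.
   Context: "Positive" means $\geq 0$; $\mathbb D$ is the open unit disc in $\mathbb C$, $\mathbb T=\partial\mathbb D$, $\beta_{\mathbb T}$ the normalized Haar measure on $\mathbb T$. A positive Hermitian Jordan triple system is a finite-dimensional complex vector space $Z$ with a triple product $\{x,y,z\}$ that is $\mathbb C$-bilinear and symmetric in $(x,z)$, $\mathbb C$-antilinear in $y$, such that, with $D(a,b)=\{a,b,\cdot\}$, $[D(a,b),D(x,y)]=D(D(a,b)x,y)-D(x,D(b,a)y)$, and such that $\{x,x,x\}=\lambda x$ with $x\neq0$ implies $\lambda>0$. $Z$ carries the scalar product $\langle x|y\rangle=\operatorname{Tr}D(x,y)$. A tripotent is an $x$ with $\{x,x,x\}=x$; two tripotents $x,y$ are orthogonal if $D(x,y)=0$; a non-zero tripotent is maximal if it is orthogonal to no non-zero tripotent. Fix such a $Z$ and a maximal tripotent $e$. Let $Z_\alpha(e)$ be the eigenspace of $D(e,e)$ for the eigenvalue $\alpha$; then $Z=Z_{1/2}(e)\oplus Z_1(e)$. Put $E=Z_{1/2}(e)$, $F=\{x\in Z_1(e):\{e,x,e\}=x\}$ (a real form of $Z_1(e)$), identify $Z_1(e)=F_{\mathbb C}$ and $Z=E\times F_{\mathbb C}$; $F_{\mathbb C}$ is a Jordan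 algebra with product $(z,z')\mapsto\{z,e,z'\}$ and identity $e$. Let $\Omega$ be the interior in $F$ of $\{x^2:x\in F\}$, $\Phi(\zeta,\zeta')=2\{\zeta,\zeta',e\}$ for $\zeta,\zeta'\in E$, $\Phi(\zeta)=\Phi(\zeta,\zeta)$. The symmetric Siegel domain is $\mathcal D=\{(\zeta,z)\in E\times F_{\mathbb C}:\operatorname{Im}z-\Phi(\zeta)\in\Omega\}$, with Šilov boundary $\mathrm b\mathcal D=\{(\zeta,z):\operatorname{Im}z=\Phi(\zeta)\}$. $\beta_{\mathrm b\mathcal D}$ is the image of Lebesgue measure on $E\times F$ under $(\zeta,x)\mapsto(\zeta,x+i\Phi(\zeta))$. $\mathscr C$ is the reproducing kernel of $H^2(\mathcal D)=\{f\in\mathrm{Hol}(\mathcal D):\sup_{h\in\Omega}\int_{\mathrm b\mathcal D}|f(\zeta,z+ih)|^2\,d\beta_{\mathrm b\mathcal D}<\infty\}$ (norm squared equal to this supremum); it extends continuously to $\mathcal D\times\mathrm b\mathcal D$. $\mathscr P(p,q)=|\mathscr C(p,q)|^2/\mathscr C(p,p)$, $p\in\mathcal D$, $q\in\mathrm b\mathcal D$. $\mathcal M_{\mathrm P}(\mathrm b\mathcal D)$ is the set of Radon measures $\mu$ on $\mathrm b\mathcal D$ with $\int\mathscr P((0,ie),\cdot)\,d|\mu|<\infty$, and $(\mathscr P\mu)(p)=\int_{\mathrm b\mathcal D}\mathscr P(p,\cdot)\,d\mu$. For a holomorphic $\phi\colon\mathcal D\to\mathbb D$ and $\alpha\in\mathbb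 T$, $\mu_\alpha=\mu_\alpha[\phi]$ is the largest positive measure in $\mathcal M_{\mathrm P}(\mathrm b\mathcal D)$ (which exists) such that $\mathscr P\mu_\alpha\leq\operatorname{Re}\frac{\alpha+\phi}{\alpha-\phi}=\frac{1-|\phi|^2}{|\alpha-\phi|^2}$ on $\mathcal D$. *)

theory Defs
  imports "HOL-Analysis.Analysis"
begin

section \<open>Positive Hermitian Jordan triple systems\<close>

text \<open>
  An abstract finite-dimensional complex vector space is a type of class \<open>euclidean_space\<close> with
  a compatible complex scalar multiplication. The Euclidean structure of the type serves only to
  provide the canonical topology (and Borel sets, real derivatives); its inner product is
  not used.
\<close>

locale positive_hermitian_jts =
  vector_space scaleC
  for scaleC :: "complex \<Rightarrow> 'a::euclidean_space \<Rightarrow> 'a" (infixr "*C" 75) +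
  fixes triple :: "'a \<Rightarrow> 'a \<Rightarrow> 'a \<Rightarrow> 'a" ("\<lbrace>_,/ _,/ _\<rbrace>")
  assumes scaleC_of_real: "complex_of_real r *C x = r *\<^sub>R x"
    and triple_add_left: "\<lbrace>x + x', y, z\<rbrace> = \<lbrace>x, y, z\<rbrace> + \<lbrace>x', y, z\<rbrace>"
    and triple_scale_left: "\<lbrace>c *C x, y, z\<rbrace> = c *C \<lbrace>x, y, z\<rbrace>"
    and triple_commute: "\<lbrace>x, y, z\<rbrace> = \<lbrace>z, y, x\<rbrace>"
    and triple_add_mid: "\<lbrace>x, y + y', z\<rbrace> = \<lbrace>x, y, z\<rbrace> + \<lbrace>x, y', z\<rbrace>"
    and triple_scale_mid: "\<lbrace>x, c *C y, z\<rbrace> = cnj c *C \<lbrace>x, y, z\<rbrace>"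
    and jordan_identity:
      "\<lbrace>a, b, \<lbrace>x, y, z\<rbrace>\<rbrace> - \<lbrace>x, y, \<lbrace>a, b, z\<rbrace>\<rbrace> = \<lbrace>\<lbrace>a, b, x\<rbrace>, y, z\<rbrace> - \<lbrace>x, \<lbrace>b, a, y\<rbrace>, z\<rbrace>"
    and triple_positive: "\<lbrace>x, x, x\<rbrace> = l *C x \<Longrightarrow> x \<noteq> 0 \<Longrightarrow> Im l = 0 \<and> Re l > 0"
begin

definition D :: "'a \<Rightarrow> 'a \<Rightarrow> 'a \<Rightarrow> 'a" where
  "D a b = (\<lambda>x. \<lbrace>a, b, x\<rbrace>)"

text \<open>Complex trace; here \<open>independent\<close>, \<open>span\<close>, \<open>representation\<close> refer to the complex structure.\<close>

definition ctrace :: "('a \<Rightarrow> 'a) \<Rightarrow> complex" where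
  "ctrace f = (let B = (SOME B. independent B \<and> span B = UNIV)
               in \<Sum>b\<in>B. representation B (f b) b)"

definition jinner :: "'a \<Rightarrow> 'a \<Rightarrow> complex" where
  "jinner x y = ctrace (D x y)"

definition tripotent :: "'a \<Rightarrow> bool" where
  "tripotent x \<longleftrightarrow> \<lbrace>x, x, x\<rbrace> = x"

definition orthogonal_tripotents :: "'a \<Rightarrow> 'a \<Rightarrow> bool" where
  "orthogonal_tripotents x y \<longleftrightarrow> tripotent x \<and> tripotent y \<and> D x y = (\<lambda>_. 0)"

definition maximal_tripotent :: "'a \<Rightarrow> bool" where
  "maximal_tripotent x \<longleftrightarrow>
     tripotent x \<and> x \<noteq> 0 \<and> \<not> (\<exists>y. y \<noteq> 0 \<and> orthogonal_tripotents x y)"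

definition eigenspace :: "('a \<Rightarrow> 'a) \<Rightarrow> complex \<Rightarrow> 'a set" where
  "eigenspace f c = {x. f x = c *C x}"

text \<open>Holomorphy in several variables (on an open set): complex-linear Frechet derivative.\<close>

definition holomorphic_fun :: "('a \<Rightarrow> complex) \<Rightarrow> 'a set \<Rightarrow> bool" where
  "holomorphic_fun f U \<longleftrightarrow>
     (\<forall>p\<in>U. \<exists>f'. (f has_derivative f') (at p) \<and> (\<forall>c v. f' (c *C v) = c * f' v))"

text \<open>
  Lebesgue measure on a real subspace \<open>S\<close> for the Euclidean structure \<open>Re \<langle>x|y\<rangle>\<close>: the image of the
  product Lebesgue measure under the coordinates of an orthonormal basis (the choice of the basis is immaterial).
\<close>

definition real_onb :: "'a set \<Rightarrow> 'a set" where
  "real_onb S = (SOME B. B \<subseteq> S \<and> real_vector.span B = S \<and>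
     (\<forall>b\<in>B. \<forall>c\<in>B. Re (jinner b c) = (if b = c then 1 else 0)))"

definition lebesgue_subspace :: "'a set \<Rightarrow> 'a measure" where
  "lebesgue_subspace S =
     distr (Pi\<^sub>M (real_onb S) (\<lambda>_. lborel :: real measure)) (restrict_space borel S)
       (\<lambda>t. \<Sum>b\<in>real_onb S. t b *\<^sub>R b)"

end


section \<open>The symmetric Siegel domain of a maximal tripotent\<close>

locale symmetric_siegel = positive_hermitian_jts scaleC triple
  for scaleC :: "complex \<Rightarrow> 'a::euclidean_space \<Rightarrow> 'a" (infixr "*C" 75)
    and triple :: "'a \<Rightarrow> 'a \<Rightarrow> 'a \<Rightarrow> 'a" ("\<lbrace>_,/ _,/ _\<rbrace>") +
  fixes e :: 'a
  assumes e_maximal: "maximal_tripotent e"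
begin

definition E :: "'a set" where
  "E = eigenspace (D e e) (1/2)"

definition F :: "'a set" where
  "F = {x \<in> eigenspace (D e e) 1. \<lbrace>e, x, e\<rbrace> = x}"

definition Omega :: "'a set" where
  "Omega = top_of_set F interior_of ((\<lambda>x. \<lbrace>x, e, x\<rbrace>) ` F)"

definition Phi :: "'a \<Rightarrow> 'a \<Rightarrow> 'a" where
  "Phi \<zeta> \<zeta>' = 2 *C \<lbrace>\<zeta>, \<zeta>', e\<rbrace>"

text \<open>
  The pair \<open>(\<zeta>, x + i y)\<close> of \<open>E \<times> F\<^sub>\<complex>\<close> (with \<open>x\<close>, \<open>y\<close> in \<open>F\<close>) is identified with the
  element \<open>\<zeta> + x + i y\<close> of the whole space, which is the direct sum of \<open>E\<close>, \<open>F\<close> and \<open>i F\<close>.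
\<close>

definition point :: "'a \<Rightarrow> 'a \<Rightarrow> 'a \<Rightarrow> 'a" where
  "point \<zeta> x y = \<zeta> + (x + \<i> *C y)"

definition dom :: "'a set" where
  "dom = {point \<zeta> x y | \<zeta> x y. \<zeta> \<in> E \<and> x \<in> F \<and> y \<in> F \<and> y - Phi \<zeta> \<zeta> \<in> Omega}"

definition bdom :: "'a set" where
  "bdom = {point \<zeta> x (Phi \<zeta> \<zeta>) | \<zeta> x. \<zeta> \<in> E \<and> x \<in> F}"

definition beta_bdom :: "'a measure" where
  "beta_bdom = distr (lebesgue_subspace E \<Otimes>\<^sub>M lebesgue_subspace F) (restrict_space borel bdom)
     (\<lambda>(\<zeta>, x). point \<zeta> x (Phi \<zeta> \<zeta>))"


subsection \<open>Hardy space and Cauchy--Szego kernel\<close>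

definition hardy_norm_sq :: "('a \<Rightarrow> complex) \<Rightarrow> ennreal" where
  "hardy_norm_sq f = (SUP h\<in>Omega. \<integral>\<^sup>+ q. ennreal ((cmod (f (q + \<i> *C h)))\<^sup>2) \<partial>beta_bdom)"

text \<open>
  Functions on \<open>dom\<close> are represented by their extension by zero, so that equality of elements of
  \<open>hardy\<close> is equality of functions on \<open>dom\<close>.
\<close>

definition hardy :: "('a \<Rightarrow> complex) set" where
  "hardy = {f. holomorphic_fun f dom \<and> (\<forall>p. p \<notin> dom \<longrightarrow> f p = 0) \<and> hardy_norm_sq f < \<infinity>}"

text \<open>The inner product (linear in the first argument) recovered from the norm by polarization.\<close>

definition hardy_inner :: "('a \<Rightarrow> complex) \<Rightarrow> ('a \<Rightarrow> complex) \<Rightarrow> complex" where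
  "hardy_inner f g =
     (\<Sum>k<4. \<i> ^ k * complex_of_real (enn2real (hardy_norm_sq (\<lambda>p. f p + \<i> ^ k * g p)))) / 4"

definition repr_kernel :: "'a \<Rightarrow> 'a \<Rightarrow> complex" where
  "repr_kernel p q = (THE k. k \<in> hardy \<and> (\<forall>f\<in>hardy. f q = hardy_inner f k)) p"

text \<open>
  The reproducing kernel, holomorphic in \<open>p\<close> and antiholomorphic in \<open>q\<close>, together with its
  continuous extension to \<open>dom \<times> bdom\<close>.
\<close>

definition cauchy_kernel :: "'a \<Rightarrow> 'a \<Rightarrow> complex" where
  "cauchy_kernel p q =
     (if q \<in> dom then repr_kernel p q
      else Lim (at (p, q) within dom \<times> dom) (\<lambda>(p', q'). repr_kernel p' q'))"


subsection \<open>Poisson integrals and Clark measures\<close>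

text \<open>\<open>Re\<close> only converts the type: the diagonal values of the kernel are positive reals.\<close>

definition poisson :: "'a \<Rightarrow> 'a \<Rightarrow> real" where
  "poisson p q = (cmod (cauchy_kernel p q))\<^sup>2 / Re (cauchy_kernel p p)"

text \<open>
  The positive elements of the space of Poisson-integrable Radon measures on \<open>bdom\<close>.
\<close>

definition MP_pos :: "'a measure set" where
  "MP_pos = {\<mu>. sets \<mu> = sets (restrict_space borel bdom)
     \<and> (\<forall>K. compact K \<and> K \<subseteq> bdom \<longrightarrow> emeasure \<mu> K < \<infinity>)
     \<and> (\<integral>\<^sup>+ q. ennreal (poisson (point 0 0 e) q) \<partial>\<mu>) < \<infinity>}"

text \<open>
  For positive measures the Poisson integral is taken in \<open>[0, \<infinity>]\<close>, so that no
  integrability default can interfere.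
\<close>

definition poisson_int :: "'a measure \<Rightarrow> 'a \<Rightarrow> ennreal" where
  "poisson_int \<mu> p = (\<integral>\<^sup>+ q. ennreal (poisson p q) \<partial>\<mu>)"

text \<open>On measures with the same \<open>\<sigma>\<close>-algebra, \<open>\<le>\<close> is the setwise order.\<close>

definition clark_measure :: "('a \<Rightarrow> complex) \<Rightarrow> complex \<Rightarrow> 'a measure" where
  "clark_measure \<phi> \<alpha> = (GREATEST \<mu>. \<mu> \<in> MP_pos \<and>
     (\<forall>p\<in>dom. poisson_int \<mu> p \<le> ennreal (Re ((\<alpha> + \<phi> p) / (\<alpha> - \<phi> p)))))"

end

text \<open>Normalized Haar measure on the unit circle.\<close>

definition circle_haar :: "complex measure" where
  "circle_haar = distr (uniform_measure lborel {0..1}) (restrict_space borel (sphere 0 1))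
     (\<lambda>t. cis (2 * pi * t))"

end

(*
 For a unimodular alpha the function u_alpha = (1 - |phi|^2) / |alpha - phi|^2 has mean 1 over the
 circle.  Translating by i t e moves it off the boundary, and there P[u_alpha(. + i t e)] <=
 u_alpha(. + i t e) by the reproducing property of the Poisson-Szego kernel applied to the bounded
 functions (alpha + r phi) / (alpha - r phi), r < 1.  Both sides have mean 1 in alpha, so for almost
 every alpha equality holds for all t in a sequence tending to 0.  For almost every alpha the
 boundary measures u_alpha(. + i t e) d beta are moreover tight against an integrable weight that
 dominates the Poisson kernels, so a subsequence converges vaguely without loss of Poisson mass, to
 a measure mu with P mu = u_alpha.  A competitor nu with P nu <= u_alpha is the vague limit of the
 measures P nu(. + i t e) d beta, because P(q + i t e, q') is symmetric in q, q' on the boundary and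
 is an approximate identity; hence nu <= mu and mu is the Clark measure.
*)

theory Submission
 imports Defs "HOL-Complex_Analysis.Complex_Analysis" "HOL-Probability.Probability"
  "HOL-Computational_Algebra.Computational_Algebra"
begin

text \<open>The obstacle is mass at infinity. A positive pluriharmonic function need not be the
  Poisson integral of a measure on \<open>bdom\<close>: on a half-plane, Im z is one whose
  representing mass sits at the missing boundary point. Hence the Poisson inequality for a translate
  can be strict for a single \<alpha>, and a vague limit can lose Poisson mass even if every
  translate is represented. Averaging over \<alpha> settles both, since Fatou's lemma in \<alpha>
  bounds the integrals against one fixed weight that exceeds any multiple of the Poisson majorant
  far out.

  No formula for the kernel K is used. The reproducing property, invariance under affine
  automorphisms and K(p + i t e, q) = K(p, q + i t e) yield boundary values, symmetry and the
  approximate identity. The Jordan structure enters through geometry: the cone is convex with e in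
  its interior, Phi is positive, and the trace form supplies the functionals of a peak function.
  Only countably many null sets of \<alpha> can be discarded, so points first range over a countable
  dense set.\<close>

notation LIMSEQ ("((_)/ ----> (_))" [60, 60] 60)

section \<open>Powers, spectral theorem and Peirce theory of the triple system\<close>

context positive_hermitian_jts
begin

subsection \<open>Powers in a Jordan triple system\<close>

lemma triple_add_right: "\<lbrace>x, y, z + z'\<rbrace> = \<lbrace>x, y, z\<rbrace> + \<lbrace>x, y, z'\<rbrace>"
 by (metis triple_add_left triple_commute)

lemma triple_scale_right: "\<lbrace>x, y, c *C z\<rbrace> = c *C \<lbrace>x, y, z\<rbrace>" by (metis triple_scale_left triple_commute)

lemma triple_zero [simp]: "\<lbrace>0, y, z\<rbrace> = 0" "\<lbrace>x, 0, z\<rbrace> = 0" "\<lbrace>x, y, 0\<rbrace> = 0"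
 using triple_add_left[of 0 0] triple_add_mid[of _ 0 0] triple_add_right[of _ _ 0 0] by auto

lemma scaleR_eq: "r *\<^sub>R x = complex_of_real r *C x" by (simp add: scaleC_of_real)

lemma triple_scaleR: "\<lbrace>r *\<^sub>R x, y, z\<rbrace> = r *\<^sub>R \<lbrace>x, y, z\<rbrace>" "\<lbrace>x, r *\<^sub>R y, z\<rbrace> = r *\<^sub>R \<lbrace>x, y, z\<rbrace>"
  "\<lbrace>x, y, r *\<^sub>R z\<rbrace> = r *\<^sub>R \<lbrace>x, y, z\<rbrace>"
 by (simp_all add: scaleR_eq triple_scale_left triple_scale_mid triple_scale_right)

lemma triple_minus: "\<lbrace>- x, y, z\<rbrace> = - \<lbrace>x, y, z\<rbrace>" "\<lbrace>x, - y, z\<rbrace> = - \<lbrace>x, y, z\<rbrace>"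
  "\<lbrace>x, y, - z\<rbrace> = - \<lbrace>x, y, z\<rbrace>" using triple_scaleR[where r = "- 1"] by auto

lemma triple_diff: "\<lbrace>x - x', y, z\<rbrace> = \<lbrace>x, y, z\<rbrace> - \<lbrace>x', y, z\<rbrace>"
  "\<lbrace>x, y - y', z\<rbrace> = \<lbrace>x, y, z\<rbrace> - \<lbrace>x, y', z\<rbrace>" "\<lbrace>x, y, z - z'\<rbrace> = \<lbrace>x, y, z\<rbrace> - \<lbrace>x, y, z'\<rbrace>"
 using triple_add_left[of x "- x'"] triple_add_mid[of x y "- y'"] triple_add_right[of x y z "- z'"] by (auto simp: triple_minus)

lemma triple_sum: "\<lbrace>\<Sum>i\<in>I. f i, y, z\<rbrace> = (\<Sum>i\<in>I. \<lbrace>f i, y, z\<rbrace>)"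
  "\<lbrace>x, \<Sum>i\<in>I. f i, z\<rbrace> = (\<Sum>i\<in>I. \<lbrace>x, f i, z\<rbrace>)" "\<lbrace>x, y, \<Sum>i\<in>I. f i\<rbrace> = (\<Sum>i\<in>I. \<lbrace>x, y, f i\<rbrace>)"
 by (induction I rule: infinite_finite_induct; simp add: triple_add_left triple_add_mid triple_add_right)+

lemmas triple_linear = triple_add_left triple_add_mid triple_add_right triple_scale_left
 triple_scale_mid triple_scale_right triple_scaleR triple_minus triple_diff

lemma jordan: "\<lbrace>a, b, \<lbrace>x, y, z\<rbrace>\<rbrace> = \<lbrace>\<lbrace>a, b, x\<rbrace>, y, z\<rbrace> - \<lbrace>x, \<lbrace>b, a, y\<rbrace>, z\<rbrace> + \<lbrace>x, y, \<lbrace>a, b, z\<rbrace>\<rbrace>"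
 using jordan_identity[of a b x y z] by (simp add: algebra_simps)

text \<open>Two instances of the Jordan identity give a = 2u - b and u = 2a - b, whose only solution
  is a = b = u. The system is solved after pairing with an arbitrary vector, where real arithmetic
  applies.\<close>

lemma quadratic_commute: "\<lbrace>x, x, \<lbrace>x, v, x\<rbrace>\<rbrace> = \<lbrace>x, \<lbrace>x, x, v\<rbrace>, x\<rbrace>"
proof -
 define u where "u = \<lbrace>x, v, \<lbrace>x, x, x\<rbrace>\<rbrace>"
 define a where "a = \<lbrace>x, x, \<lbrace>x, v, x\<rbrace>\<rbrace>"
 define b where "b = \<lbrace>x, \<lbrace>x, x, v\<rbrace>, x\<rbrace>"
 have "a = u + u - b" using jordan[of x x x v x] triple_commute[of "\<lbrace>x, x, x\<rbrace>" v x] unfolding a_def b_def u_def by simp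
 moreover have "u = a + a - b" using jordan[of x v x x x] triple_commute[of "\<lbrace>x, v, x\<rbrace>" x x] triple_commute[of v x x]
  unfolding a_def b_def u_def by (simp add: algebra_simps)
 ultimately have "w \<bullet> a = w \<bullet> b" for w using arg_cong[of a "u + u - b" "(\<bullet>) w"] arg_cong[of u "a + a - b" "(\<bullet>) w"]
  by (simp add: inner_simps)
 then have "a = b" using vector_eq_ldot by blast
 then show ?thesis by (simp add: a_def b_def)
qed

text \<open>The odd power x^(2n+1); a triple product defines no even ones.\<close>

definition triple_power :: "'a => nat => 'a" where
 "triple_power x n = ((%v. \<lbrace>x, x, v\<rbrace>) ^^ n) x"

lemma triple_power_0 [simp]: "triple_power x 0 = x"
 and triple_power_Suc: "triple_power x (Suc n) = \<lbrace>x, x, triple_power x n\<rbrace>" by (simp_all add: triple_power_def)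

lemma quadratic_triple_power: "\<lbrace>x, triple_power x n, x\<rbrace> = triple_power x (Suc n)"
 by (induction n) (simp_all add: triple_power_Suc flip: quadratic_commute)

text \<open>The commutator of D(x, x^(2j+1)) and D(x, x) can be expanded with either operator acting
  as the derivation. The two expansions are opposite, and their sum is this relation.\<close>

lemma triple_power_step:
 "\<lbrace>triple_power x (Suc j), x, z\<rbrace> + \<lbrace>triple_power x 1, triple_power x j, z\<rbrace>
  = 2 *\<^sub>R \<lbrace>x, triple_power x (Suc j), z\<rbrace>" using jordan[of x "triple_power x j" x x z] jordan[of x x x "triple_power x j" z]
  quadratic_triple_power[of x j] triple_commute[of "triple_power x j" x x] by (simp add: triple_power_Suc algebra_simps scaleR_2)

text \<open>Moving one factor D x x from the second slot to the first changes the operator by the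
  commutator \<open>c\<close>, so the operators with i + j = n + 1 form an arithmetic progression.
  \<open>triple_power_step\<close> links its first, second and last terms and forces
  \<open>c\<close> to vanish.\<close>

lemma triple_power_D: "\<lbrace>triple_power x i, triple_power x j, z\<rbrace> = \<lbrace>triple_power x (i + j), x, z\<rbrace>"
proof (induction "i + j" arbitrary: i j z)
 case 0
 then show ?case by simp
next
 case (Suc n)
 let ?p = "triple_power x"
 define c where "c = \<lbrace>x, x, \<lbrace>?p n, x, z\<rbrace>\<rbrace> - \<lbrace>?p n, x, \<lbrace>x, x, z\<rbrace>\<rbrace>"
 have step: "\<lbrace>?p (Suc i), ?p j, z\<rbrace> = \<lbrace>?p i, ?p (Suc j), z\<rbrace> + c" if "i + j = n" for i j
  using jordan[of x x "?p i" "?p j" z] Suc(1)[of i j] that by (simp add: c_def triple_power_Suc algebra_simps)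
 have lin: "\<lbrace>?p i, ?p (Suc n - i), z\<rbrace> = \<lbrace>x, ?p (Suc n), z\<rbrace> + real i *\<^sub>R c" if "i <= Suc n" for i using that
 proof (induction i)
  case (Suc i)
  then show ?case using step[of i "n - i"] by (simp add: Suc_diff_le algebra_simps)
 qed simp
 \<comment> \<open>With T the term for i = 0, the relation reads (T + (n + 1) c) + (T + c) = 2
   T.\<close>
 have "(real n + 2) *\<^sub>R c = 0" using lin[of "Suc n"] lin[of 1] triple_power_step[of x n z] by (simp add: algebra_simps scaleR_2)
 then have c: "c = 0" using of_nat_0_le_iff[of n, where ?'a = real] by (simp add: add_nonneg_eq_0_iff)
 have "\<lbrace>?p i, ?p j, z\<rbrace> = \<lbrace>x, ?p (Suc n), z\<rbrace>" using lin[of i] Suc(2) c by simp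
 also have "\<dots> = \<lbrace>?p (Suc n), x, z\<rbrace>" using lin[of "Suc n"] c by simp
 finally show ?case using Suc(2) by simp
qed

text \<open>\<open>triple_poly x f\<close> is \<open>f (D x x) x\<close>.\<close>

definition triple_poly :: "'a => complex poly => 'a" where
 "triple_poly x f = fold_coeffs (%a v. a *C x + \<lbrace>x, x, v\<rbrace>) f 0"

lemma triple_poly_0 [simp]: "triple_poly x 0 = 0" by (simp add: triple_poly_def)

lemma triple_poly_pCons: "triple_poly x (pCons a f) = a *C x + \<lbrace>x, x, triple_poly x f\<rbrace>"
 by (cases "f = 0 & a = 0") (auto simp: triple_poly_def)

lemma triple_poly_add: "triple_poly x (f + g) = triple_poly x f + triple_poly x g"
 by (induction f g rule: poly_induct2) (auto simp: triple_poly_pCons triple_linear scale_left_distrib)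

lemma triple_poly_smult: "triple_poly x (smult c f) = c *C triple_poly x f"
 by (induction f) (auto simp: triple_poly_pCons triple_linear scale_right_distrib)

lemma triple_poly_diff: "triple_poly x (f - g) = triple_poly x f - triple_poly x g" using triple_poly_add[of x "f - g" g] by simp

lemma triple_poly_sum: "triple_poly x (\<Sum>i\<in>I. f i) = (\<Sum>i\<in>I. triple_poly x (f i))"
 by (induction I rule: infinite_finite_induct) (auto simp: triple_poly_add)

lemma triple_poly_monom: "triple_poly x (monom c n) = c *C triple_power x n"
 by (induction n) (auto simp: monom_0 monom_Suc triple_poly_pCons triple_linear triple_power_Suc)

lemma triple_poly_1 [simp]: "triple_poly x 1 = x" using triple_poly_monom[of x 1 0] by simp

lemma triple_poly_mult_zero: "triple_poly x g = 0 ==> triple_poly x (f * g) = 0"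
 by (induction f) (auto simp: triple_poly_pCons triple_poly_add triple_poly_smult)

lemma funpow_poly_pCons:
 "((%v. \<lbrace>x, x, v\<rbrace>) ^^ i) (triple_poly x (pCons a f)) =
  a *C triple_power x i + ((%v. \<lbrace>x, x, v\<rbrace>) ^^ Suc i) (triple_poly x f)"
 by (induction i) (auto simp: triple_poly_pCons triple_linear triple_power_Suc)

lemma triple_power_shift: "\<lbrace>triple_power x i, triple_power x (Suc j), z\<rbrace> = \<lbrace>triple_power x (Suc i), triple_power x j, z\<rbrace>"
 by (simp add: triple_power_D)

lemma funpow_zero: "((%v. \<lbrace>x, x, v\<rbrace>) ^^ i) 0 = 0" by (induction i) auto

lemma triple_poly_shift1:
 "\<lbrace>((%v. \<lbrace>x, x, v\<rbrace>) ^^ i) (triple_poly x f), triple_power x (Suc j), z\<rbrace> =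
  \<lbrace>((%v. \<lbrace>x, x, v\<rbrace>) ^^ Suc i) (triple_poly x f), triple_power x j, z\<rbrace>"
proof (induction f arbitrary: i)
 case 0
 then show ?case unfolding triple_poly_0 funpow_zero by simp
next
 case (pCons a f)
 show ?case unfolding funpow_poly_pCons triple_add_left triple_scale_left pCons.IH triple_power_shift ..
qed

lemma triple_poly_shift2:
 "\<lbrace>triple_poly x f, ((%v. \<lbrace>x, x, v\<rbrace>) ^^ Suc j) (triple_poly x g), z\<rbrace> =
  \<lbrace>\<lbrace>x, x, triple_poly x f\<rbrace>, ((%v. \<lbrace>x, x, v\<rbrace>) ^^ j) (triple_poly x g), z\<rbrace>"
proof (induction g arbitrary: j)
 case 0
 then show ?case unfolding triple_poly_0 funpow_zero by simp
next
 case (pCons a g)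
 show ?case unfolding funpow_poly_pCons triple_add_mid triple_scale_mid pCons.IH using triple_poly_shift1[of 0 x f j z] by simp
qed

text \<open>Powers of D x x move freely between the first two slots by
  \<open>triple_power_D\<close>; the middle slot is antilinear, which conjugates the coefficients of
  g.\<close>

lemma triple_poly_D:
 "\<lbrace>triple_poly x f, triple_poly x g, z\<rbrace> = \<lbrace>triple_poly x (f * map_poly cnj g), x, z\<rbrace>"
proof (induction g arbitrary: f)
 case 0
 then show ?case by simp
next
 case (pCons b g)
 have "\<lbrace>triple_poly x f, \<lbrace>x, x, triple_poly x g\<rbrace>, z\<rbrace> = \<lbrace>triple_poly x (pCons 0 f), triple_poly x g, z\<rbrace>"
  using triple_poly_shift2[of x f 0 g z] by (simp add: triple_poly_pCons)
 moreover have "map_poly cnj (pCons b g) = pCons (cnj b) (map_poly cnj g)" by (simp add: map_poly_pCons)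
 ultimately show ?case using pCons.IH[of "pCons 0 f"] by (simp add: triple_poly_pCons triple_poly_add triple_poly_smult triple_linear)
qed

lemma triple_poly_commute: "\<lbrace>x, x, \<lbrace>triple_poly x f, x, v\<rbrace>\<rbrace> = \<lbrace>triple_poly x f, x, \<lbrace>x, x, v\<rbrace>\<rbrace>"
 using jordan[of x x "triple_poly x f" x v] triple_poly_shift1[of 0 x f 0 v] by (simp add: triple_power_Suc)

text \<open>The factor X records degrees: the product of x^(2i+1), x^(2j+1) and x^(2k+1) is
  x^(2(i+j+k+1)+1).\<close>

lemma triple_poly_triple:
 "\<lbrace>triple_poly x f, triple_poly x g, triple_poly x h\<rbrace>
  = triple_poly x ([:0, 1:] * (f * map_poly cnj g * h))"
proof -
 have "\<lbrace>triple_poly x f, x, triple_poly x h\<rbrace> = triple_poly x ([:0, 1:] * (f * h))" for f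
 proof (induction h)
  case 0
  then show ?case by simp
 next
  case (pCons a h)
  then show ?case using triple_commute[of "triple_poly x f" x x] by (simp add: triple_poly_pCons triple_linear flip: triple_poly_commute)
     (simp add: triple_poly_add triple_poly_smult triple_linear triple_poly_pCons)
 qed
 then show ?thesis by (simp add: triple_poly_D)
qed

subsection \<open>The spectral theorem\<close>

lemma triple_poly_annihilator: "\<exists>f. f \<noteq> 0 & triple_poly x f = 0"
\<comment> \<open>Linear dependence is stated for a set of vectors, so coinciding powers are split
  off first.\<close>
proof (cases "inj_on (triple_power x) {..DIM('a)}")
 case False
 then obtain i j where ij: "i \<noteq> j" "triple_power x i = triple_power x j" by (auto simp: inj_on_def)
 have "monom (1::complex) i \<noteq> monom 1 j" using ij(1) by (metis degree_monom_eq zero_neq_one)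
 then show ?thesis using ij(2) by (intro exI[of _ "monom 1 i - monom 1 j"]) (simp add: triple_poly_diff triple_poly_monom)
next
 case True
 let ?S = "triple_power x ` {..DIM('a)}"
 have "card ?S = Suc (DIM('a))" using True by (simp add: card_image)
 then have "real_vector.dependent ?S" using independent_card_le[of ?S] by auto
 then obtain u where u: "\<exists>v\<in>?S. u v \<noteq> 0" "(\<Sum>v\<in>?S. u v *\<^sub>R v) = 0" by (subst (asm) real_vector.dependent_finite) auto
 define f where "f = (\<Sum>i\<le>DIM('a). monom (complex_of_real (u (triple_power x i))) i)"
 have "triple_poly x f = (\<Sum>i\<le>DIM('a). u (triple_power x i) *\<^sub>R triple_power x i)"
  by (simp add: f_def triple_poly_sum triple_poly_monom scaleR_eq)
 also have "\<dots> = 0" using u(2) True by (simp add: sum.reindex)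
 finally have 1: "triple_poly x f = 0" .
 obtain k where k: "k <= DIM('a)" "u (triple_power x k) \<noteq> 0" using u(1) by auto
 have "coeff f k = complex_of_real (u (triple_power x k))" using k(1) by (simp add: f_def coeff_sum sum.If_cases if_distrib cong: if_cong)
 with k(2) have "f \<noteq> 0" by auto
 with 1 show ?thesis by blast
qed

text \<open>On \<open>triple_poly x r\<close> the operator D x x acts as the scalar s, so h(D x x)
  acts as h(s).\<close>

lemma triple_poly_eigen:
 assumes "triple_poly x ([:-s, 1:] * r) = 0"
 shows "triple_poly x (h * r) = poly h s *C triple_poly x r"
proof -
 have "poly (h - [:poly h s:]) s = 0" by simp
 then have "[:-s, 1:] dvd h - [:poly h s:]" by (simp only: poly_eq_0_iff_dvd)
 then obtain k where k: "h - [:poly h s:] = [:-s, 1:] * k" by (rule dvdE)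
 have "h * r = (h - [:poly h s:]) * r + smult (poly h s) r" by (simp add: left_diff_distrib)
 also have "(h - [:poly h s:]) * r = k * ([:-s, 1:] * r)" unfolding k by (simp only: mult_ac)
 finally have "h * r = k * ([:-s, 1:] * r) + smult (poly h s) r" .
 then have "triple_poly x (h * r) = triple_poly x (k * ([:-s, 1:] * r)) + poly h s *C triple_poly x r"
  by (simp only: triple_poly_add triple_poly_smult)
 then show ?thesis using triple_poly_mult_zero[OF assms, of k] by simp
qed

lemma poly_map_cnj: "poly (map_poly cnj p) z = cnj (poly p (cnj z))" by (induction p) (simp_all add: map_poly_pCons)

text \<open>Take the annihilator m of least degree. A root s splits off as m = (X - s) r, and y =
  r(D x x) x is nonzero by minimality and satisfies {y, y, y} = l y. Positivity of the triple system
  makes l positive, and this forces s to be real, positive and simple.\<close>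

lemma spectral_polynomial:
 assumes "x \<noteq> 0"
 shows "\<exists>R. finite R & R \<noteq> {} & (\<forall>s\<in>R. s > (0::real)) &
  triple_poly x (\<Prod>s\<in>R. [:- complex_of_real s, 1:]) = 0"
proof -
 define n where "n = (LEAST n. \<exists>f. f \<noteq> 0 & triple_poly x f = 0 & degree f = n)"
 have "\<exists>f. f \<noteq> 0 & triple_poly x f = 0 & degree f = n"
  unfolding n_def by (rule LeastI_ex) (use triple_poly_annihilator in blast)
 then obtain m where m: "m \<noteq> 0" "triple_poly x m = 0" "degree m = n" by blast
 have min: "degree m <= degree f" if "f \<noteq> 0" "triple_poly x f = 0" for f unfolding m(3) n_def by (rule Least_le) (use that in blast)
 have dvd: "m dvd f" if "triple_poly x f = 0" for f
 proof -
  have "triple_poly x (f mod m) = 0" using that triple_poly_mult_zero[OF m(2), of "f div m"] triple_poly_add[of x "f div m * m" "f mod m"] by simp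
  then have "f mod m = 0" using min[of "f mod m"] m(1) degree_mod_less[of m f] by fastforce
  then show ?thesis by auto
 qed
 have root: "Im s = 0 & Re s > 0 & poly (pderiv m) s \<noteq> 0" if s: "poly m s = 0" for s
 proof -
  obtain r where r: "m = [:-s, 1:] * r" using s by (metis dvdE poly_eq_0_iff_dvd)
  have r0: "r \<noteq> 0" using m(1) r by auto
  define y where "y = triple_poly x r"
  have "degree m = Suc (degree r)" unfolding r using r0 by (subst degree_mult_eq) auto
  then have y0: "y \<noteq> 0" unfolding y_def using min[of r] r0 by force
  define l where "l = s * (poly r s * cnj (poly r (cnj s)))"
  have "\<lbrace>y, y, y\<rbrace> = l *C y" using triple_poly_eigen[of x s r "[:0, 1:] * (r * map_poly cnj r)"] m(2) r
   by (simp add: y_def triple_poly_triple l_def poly_map_cnj mult.assoc)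
  from triple_positive[OF this y0] have l: "Im l = 0" "Re l > 0" by auto
  have s0: "s \<noteq> 0" using l by (auto simp: l_def)
  \<comment> \<open>This is the triple product of x, m(D x x) x and x, whose middle entry vanishes;
    it produces the conjugate polynomial of m.\<close>
  have "triple_poly x ([:0, 1:] * map_poly cnj m) = 0" using triple_poly_triple[of x 1 m 1] m(2) by simp
  from dvd[OF this] obtain k where k: "[:0, 1:] * map_poly cnj m = m * k" by (rule dvdE)
  have "poly ([:0, 1:] * map_poly cnj m) s = 0" unfolding k using s by simp
  then have "poly m (cnj s) = 0" using s0 by (simp add: poly_map_cnj)
  \<comment> \<open>\<open>l\<close> has the conjugate of r(cnj s) as a factor, so cnj s is not a
    root of r and must be the root s that was split off.\<close>
  then have real: "cnj s = s" using l by (auto simp: r l_def)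
  then have ims: "Im s = 0" by (simp add: complex_eq_iff)
  have "l = s * of_real ((cmod (poly r s))\<^sup>2)" unfolding l_def real by (simp add: complex_norm_square del: of_real_power)
  then have "Re l = Re s * (cmod (poly r s))\<^sup>2" by simp
  then have "Re s > 0" "poly r s \<noteq> 0" using l(2) by (auto simp: zero_less_mult_iff)
  \<comment> \<open>The derivative of (X - s) r at s is r(s), which is nonzero because
    \<open>l\<close> is: the root is simple.\<close>
  moreover have "poly (pderiv m) s = poly r s" unfolding r pderiv_mult by (simp add: pderiv_pCons)
  ultimately show ?thesis using ims by simp
 qed
 define R where "R = Re ` {z. poly m z = 0}"
 have inj: "complex_of_real ` R = {z. poly m z = 0}"
 proof -
  have "complex_of_real (Re z) = z" if "poly m z = 0" for z using root[OF that] by (simp add: complex_eq_iff)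
  then have "(%z. complex_of_real (Re z)) ` {z. poly m z = 0} = (%z. z) ` {z. poly m z = 0}" by (intro image_cong) auto
  then show ?thesis unfolding R_def image_image by simp
 qed
 have "rsquarefree m" unfolding rsquarefree_roots using root by auto
 from complex_poly_decompose_rsquarefree[OF this]
 have "m = smult (lead_coeff m) (\<Prod>z\<in>complex_of_real ` R. [:- z, 1:])" unfolding inj by simp
 then have *: "m = smult (lead_coeff m) (\<Prod>s\<in>R. [:- complex_of_real s, 1:])" by (subst (asm) prod.reindex) (auto simp: inj_on_def)
 have "triple_poly x (smult (lead_coeff m) (\<Prod>s\<in>R. [:- complex_of_real s, 1:])) = 0" using m(2) * by argo
 then have "triple_poly x (\<Prod>s\<in>R. [:- complex_of_real s, 1:]) = 0" using m(1,2) triple_poly_smult[of x "lead_coeff m"] by simp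
 moreover from this have "R \<noteq> {}" using assms by auto
 moreover have "finite R" unfolding R_def using m(1) by (simp add: poly_roots_finite)
 moreover have "\<forall>s\<in>R. s > 0" using root by (auto simp: R_def)
 ultimately show ?thesis by blast
qed

lemma triple_poly_real_mem:
 assumes "x \<in> W" "0 \<in> W" "\<And>u v. u \<in> W ==> v \<in> W ==> u + v \<in> W" "\<And>r u. u \<in> W ==> r *\<^sub>R u \<in> W"
  "\<And>u. u \<in> W ==> \<lbrace>x, x, u\<rbrace> \<in> W"
 shows "triple_poly x (map_poly complex_of_real g) \<in> W" by (induction g) (auto simp: map_poly_pCons triple_poly_pCons assms scaleC_of_real)

text \<open>The components are Lagrange polynomials in D x x applied to x. The number s is an
  eigenvalue of D x x, hence the square of a singular value, and c s is sqrt s times a tripotent.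
  The last clause later keeps the components inside F and inside the kernel of D e e.\<close>

theorem spectral:
 fixes x :: 'a
 obtains R :: "real set" and c :: "real => 'a" where
  "finite R" "\<And>s. s \<in> R ==> s > 0" "x = (\<Sum>s\<in>R. c s)"
  "\<And>s. s \<in> R ==> \<lbrace>c s, c s, c s\<rbrace> = s *\<^sub>R c s"
  "\<And>s t z. s \<in> R ==> t \<in> R ==> s \<noteq> t ==> \<lbrace>c s, c t, z\<rbrace> = 0"
  "\<And>s W. s \<in> R ==> x \<in> W ==> 0 \<in> W ==> (\<And>u v. u \<in> W ==> v \<in> W ==> u + v \<in> W) ==>
   (\<And>r u. u \<in> W ==> r *\<^sub>R u \<in> W) ==> (\<And>u. u \<in> W ==> \<lbrace>x, x, u\<rbrace> \<in> W) ==> c s \<in> W"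
proof (cases "x = 0")
 case True
 then show ?thesis by (intro that[of "{}" "%_. 0"]) auto
next
 case False
 from spectral_polynomial[OF False] obtain R where R: "finite R" "R \<noteq> {}" "\<And>s. s \<in> R ==> s > (0::real)"
  "triple_poly x (\<Prod>s\<in>R. [:- complex_of_real s, 1:]) = 0" by blast
 \<comment> \<open>The interpolation polynomials are real and embedded by \<open>C\<close>, so that
   the components stay in every real subspace stable under D x x.\<close>
 define C where "C = map_poly complex_of_real"
 have C_mult: "C (p * q) = C p * C q" for p q by (rule poly_eqI) (simp add: C_def coeff_map_poly coeff_mult)
 have C_add: "C (p + q) = C p + C q" for p q by (rule poly_eqI) (simp add: C_def coeff_map_poly)
 have C_sum: "C (\<Sum>i\<in>I. f i) = (\<Sum>i\<in>I. C (f i))" for I :: "real set" and f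
  by (induction I rule: infinite_finite_induct) (auto simp: C_add, simp_all add: C_def)
 have C_prod: "C (\<Prod>i\<in>I. f i) = (\<Prod>i\<in>I. C (f i))" for I :: "real set" and f
  by (induction I rule: infinite_finite_induct) (auto simp: C_mult, simp_all add: C_def one_pCons map_poly_pCons)
 have C_pCons: "C (pCons a p) = pCons (of_real a) (C p)" for a p by (simp add: C_def map_poly_pCons)
 have C_cnj: "map_poly cnj (C p) = C p" for p by (rule poly_eqI) (simp add: C_def coeff_map_poly)
 define M where "M = (\<Prod>s\<in>R. [:- s, 1:])"
 have CM: "triple_poly x (C M) = 0" using R(4) by (simp add: M_def C_prod C_pCons) (simp add: C_def)
 \<comment> \<open>The Lagrange basis polynomials for the nodes R.\<close>
 define g where "g s = (\<Prod>t\<in>R - {s}. smult (1 / (s - t)) [:- t, 1:])" for s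
 have gM: "\<exists>a. [:- s, 1:] * g s = smult a M" if "s \<in> R" for s
 proof -
  have "[:- s, 1:] * g s = smult (\<Prod>t\<in>R - {s}. 1 / (s - t)) M"
   using R(1) that unfolding M_def g_def prod_smult by (simp add: prod.remove[of R s] del: mult_pCons_left)
  then show ?thesis by blast
 qed
 define c where "c s = triple_poly x (C (g s))" for s
 have zero: "triple_poly x (C (h * M)) = 0" for h unfolding C_mult by (rule triple_poly_mult_zero[OF CM])
 have eigen: "\<lbrace>x, x, c s\<rbrace> = s *\<^sub>R c s" if "s \<in> R" for s
 proof -
  obtain a where a: "[:- s, 1:] * g s = smult a M" using gM[OF \<open>s \<in> R\<close>] by blast
  have "triple_poly x (C ([:- s, 1:] * g s)) = 0" unfolding a using zero[of "[:a:]"] by simp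
  moreover have "C ([:- s, 1:] * g s) = pCons 0 (C (g s)) - smult (of_real s) (C (g s))" unfolding C_mult by (simp add: C_pCons) (simp add: C_def)
  ultimately show ?thesis by (simp add: triple_poly_diff triple_poly_smult triple_poly_pCons c_def scaleR_eq)
 qed
 have g_poly: "poly (g s) t = (if s = t then 1 else 0)" if "s \<in> R" "t \<in> R" for s t
  using that R(1) by (auto simp: g_def poly_prod prod_zero_iff simp flip: diff_divide_distrib intro!: prod.neutral)
 \<comment> \<open>The difference has degree below card R but vanishes at all points of R.\<close>
 have "(\<Sum>s\<in>R. g s) - 1 = 0"
 proof (rule ccontr)
  assume *: "(\<Sum>s\<in>R. g s) - 1 \<noteq> 0"
  have dg: "degree (g s) <= card R - 1" if "s \<in> R" for s
  proof -
   have "degree (g s) <= (\<Sum>t\<in>R - {s}. degree (smult (1 / (s - t)) [:- t, 1:]))"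
    unfolding g_def using degree_prod_sum_le[of "R - {s}" "%t. smult (1 / (s - t)) [:- t, 1:]"] R(1) unfolding o_def by blast
   also have "\<dots> <= (\<Sum>t\<in>R - {s}. 1)" by (intro sum_mono) auto
   finally show ?thesis using that R(1) by simp
  qed
  have "degree ((\<Sum>s\<in>R. g s) - 1) <= card R - 1" by (intro degree_diff_le degree_sum_le dg R(1)) auto
  moreover have "card R <= card {t. poly ((\<Sum>s\<in>R. g s) - 1) t = 0}"
   using * R(1) by (intro card_mono poly_roots_finite) (auto simp: poly_sum g_poly)
  ultimately show False using card_poly_roots_bound[OF *] card_gt_0_iff[of R] R(1,2) by linarith
 qed
 then have sum: "x = (\<Sum>s\<in>R. c s)"
  unfolding c_def triple_poly_sum[symmetric] C_sum[symmetric] by (simp add: C_def one_pCons map_poly_pCons flip: one_pCons)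
 have orth: "\<lbrace>c s, c t, z\<rbrace> = 0" if "s \<in> R" "t \<in> R" "s \<noteq> t" for s t z
 proof -
  obtain a where a: "[:- s, 1:] * g s = smult a M" using gM[OF \<open>s \<in> R\<close>] by blast
  have "[:- s, 1:] dvd g t" using g_poly[of t s] that by (simp add: poly_eq_0_iff_dvd)
  then obtain k where "g t = [:- s, 1:] * k" by (auto simp: dvd_def)
  \<comment> \<open>\<open>g s\<close> carries every linear factor of M except the one at s, and
    \<open>g t\<close> supplies that one.\<close>
  then have "g s * g t = (smult a k) * M" using a by (metis mult.assoc mult.commute mult_smult_left)
  then have "triple_poly x (C (g s) * C (g t)) = 0" using zero by (metis C_mult)
  then show ?thesis by (simp add: c_def triple_poly_D C_cnj)
 qed
 \<comment> \<open>Expanding {x, x, c s} = s c s over the components, orthogonality leaves only the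
   term with all three entries equal to c s.\<close>
 have cube: "\<lbrace>c s, c s, c s\<rbrace> = s *\<^sub>R c s" if s: "s \<in> R" for s
 proof -
  have "s *\<^sub>R c s = \<lbrace>(\<Sum>t\<in>R. c t), (\<Sum>t\<in>R. c t), c s\<rbrace>" using eigen[OF s] sum by simp
  also have "\<dots> = (\<Sum>t\<in>R. \<Sum>u\<in>R. \<lbrace>c t, c u, c s\<rbrace>)" unfolding triple_sum(1) unfolding triple_sum(2) ..
  also have "\<dots> = (\<Sum>t\<in>R. \<lbrace>c t, c s, c s\<rbrace>)"
  proof (rule sum.cong[OF refl])
   fix t assume t: "t \<in> R"
   have "(\<Sum>u\<in>R. \<lbrace>c t, c u, c s\<rbrace>) = (\<Sum>u\<in>R. if u = s then \<lbrace>c t, c s, c s\<rbrace> else 0)"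
    using orth[OF s] by (intro sum.cong) (auto simp: triple_commute[of "c t"])
   then show "(\<Sum>u\<in>R. \<lbrace>c t, c u, c s\<rbrace>) = \<lbrace>c t, c s, c s\<rbrace>" using s R(1) by simp
  qed
  also have "\<dots> = (\<Sum>t\<in>R. if t = s then \<lbrace>c s, c s, c s\<rbrace> else 0)" using orth[OF _ s] by (intro sum.cong) auto
  finally show ?thesis using s R(1) by simp
 qed
 show ?thesis
 proof (rule that[OF R(1,3) sum cube orth])
  show "c s \<in> W" if "x \<in> W" "0 \<in> W" "\<And>u v. u \<in> W ==> v \<in> W ==> u + v \<in> W"
   "\<And>r u. u \<in> W ==> r *\<^sub>R u \<in> W" "\<And>u. u \<in> W ==> \<lbrace>x, x, u\<rbrace> \<in> W" for s W
   unfolding c_def C_def by (rule triple_poly_real_mem[OF that])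
 qed auto
qed

end

lemma inner_eqI:
 fixes a b :: "'a::real_inner" shows "(\<And>w. w \<bullet> a = w \<bullet> b) ==> a = b" using vector_eq_ldot by blast

context positive_hermitian_jts
begin

subsection \<open>The trace form\<close>

definition clinear :: "('a => 'a) => bool" where
 "clinear f \<longleftrightarrow> (\<forall>x y. f (x + y) = f x + f y) & (\<forall>c x. f (c *C x) = c *C f x)"

lemma clinearI: "(\<And>x y. f (x + y) = f x + f y) ==> (\<And>c x. f (c *C x) = c *C f x) ==> clinear f" by (simp add: clinear_def)

lemma clinear_add: "clinear f ==> f (x + y) = f x + f y"
 and clinear_scale: "clinear f ==> f (c *C x) = c *C f x" by (simp_all add: clinear_def)

lemma clinear_zero: "clinear f ==> f 0 = 0" using clinear_scale[of f 0 0] by simp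

lemma clinear_sum: "clinear f ==> f (\<Sum>i\<in>I. g i) = (\<Sum>i\<in>I. f (g i))"
 by (induction I rule: infinite_finite_induct) (auto simp: clinear_zero clinear_add)

lemma clinear_D: "clinear (D a b)" by (rule clinearI) (simp_all add: D_def triple_linear)

text \<open>A complex independent set is real independent, so the real dimension of the type bounds
  it.\<close>

lemma finite_independent:
 assumes "independent B" shows "finite B"
proof (rule ccontr)
 assume "infinite B"
 then obtain S where S: "S \<subseteq> B" "finite S" "card S = Suc (DIM('a))" by (meson infinite_arbitrarily_large)
 have "independent S" using assms S(1) independent_mono by blast
 have "real_vector.dependent S" using independent_card_le[of S] S(3) by auto
 then obtain u v where u: "v \<in> S" "u v \<noteq> 0" "(\<Sum>v\<in>S. u v *\<^sub>R v) = 0"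
  by (subst (asm) real_vector.dependent_finite[OF S(2)]) auto
 have "(\<Sum>v\<in>S. complex_of_real (u v) *C v) = 0" using u(3) by (simp add: scaleC_of_real)
 then have "complex_of_real (u v) = 0" using independentD[OF \<open>independent S\<close> S(2) subset_refl] u(1) by (metis (mono_tags))
 then show False using u(2) by simp
qed

definition is_basis :: "'a set => bool" where
 "is_basis B \<longleftrightarrow> independent B & span B = UNIV"

lemma is_basis_finite: "is_basis B ==> finite B" using finite_independent by (simp add: is_basis_def)

lemma representation_linear:
 assumes "is_basis B"
 shows "representation B (x + y) b = representation B x b + representation B y b"
  "representation B (c *C x) b = c * representation B x b"
  "representation B (\<Sum>i\<in>I. f i) b = (\<Sum>i\<in>I. representation B (f i) b)"
 using assms by (simp_all add: is_basis_def representation_add representation_scale representation_sum)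

lemma representation_expand:
 assumes "is_basis B" shows "(\<Sum>b\<in>B. representation B x b *C b) = x" using assms is_basis_finite[OF assms]
 by (intro sum_representation_eq) (auto simp: is_basis_def)

definition trace_wrt :: "'a set => ('a => 'a) => complex" where
 "trace_wrt B f = (\<Sum>b\<in>B. representation B (f b) b)"

text \<open>Expand in one basis, then in the other, and exchange the sums. This frees
  \<open>ctrace\<close> from the arbitrary choice of basis in its definition.\<close>

lemma trace_wrt_cong:
 assumes B: "is_basis B" and C: "is_basis C" and f: "clinear f"
 shows "trace_wrt B f = trace_wrt C f"
proof -
 have "trace_wrt B f = (\<Sum>b\<in>B. representation B (\<Sum>c\<in>C. representation C (f b) c *C c) b)"
  by (simp add: trace_wrt_def representation_expand[OF C])
 also have "\<dots> = (\<Sum>b\<in>B. \<Sum>c\<in>C. representation C (f b) c * representation B c b)" by (simp add: representation_linear[OF B])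
 also have "\<dots> = (\<Sum>c\<in>C. \<Sum>b\<in>B. representation C (f b) c * representation B c b)" by (rule sum.swap)
 also have "\<dots> = (\<Sum>c\<in>C. representation C (f (\<Sum>b\<in>B. representation B c b *C b)) c)"
  by (simp add: clinear_sum[OF f] clinear_scale[OF f] representation_linear[OF C] mult.commute)
 also have "\<dots> = trace_wrt C f" by (simp add: trace_wrt_def representation_expand[OF B])
 finally show ?thesis .
qed

lemma is_basis_exists: "\<exists>B. is_basis B" unfolding is_basis_def by (rule maximal_independent_subset[of UNIV]) auto

lemma ctrace_eq:
 assumes "clinear f" "is_basis B" shows "ctrace f = trace_wrt B f"
proof -
 have "is_basis (SOME B. independent B & span B = UNIV)" using someI_ex[OF is_basis_exists] by (simp add: is_basis_def)
 from trace_wrt_cong[OF this assms(2,1)] show ?thesis by (simp add: ctrace_def trace_wrt_def)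
qed

lemma ctrace_add:
 assumes "clinear f" "clinear g" shows "ctrace (%x. f x + g x) = ctrace f + ctrace g"
proof -
 obtain B where B: "is_basis B" using is_basis_exists by blast
 have "clinear (%x. f x + g x)" using assms by (simp add: clinear_def scale_right_distrib add_ac)
 then show ?thesis using assms B by (simp add: ctrace_eq trace_wrt_def representation_linear sum.distrib)
qed

lemma ctrace_scale:
 assumes "clinear f" shows "ctrace (%x. c *C f x) = c * ctrace f"
proof -
 obtain B where B: "is_basis B" using is_basis_exists by blast
 have "clinear (%x. c *C f x)" using assms by (simp add: clinear_def scale_right_distrib mult.commute)
 then show ?thesis using assms B by (simp add: ctrace_eq trace_wrt_def representation_linear sum_distrib_left)
qed

lemma ctrace_swap:
 assumes f: "clinear f" and g: "clinear g" shows "ctrace (%x. f (g x)) = ctrace (%x. g (f x))"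
proof -
 obtain B where B: "is_basis B" using is_basis_exists by blast
 have *: "trace_wrt B (%x. f (g x)) = (\<Sum>b\<in>B. \<Sum>c\<in>B. representation B (g b) c * representation B (f c) b)"
  if "clinear f" "clinear g" for f g
 proof -
  have "trace_wrt B (%x. f (g x)) = (\<Sum>b\<in>B. representation B (f (\<Sum>c\<in>B. representation B (g b) c *C c)) b)"
   by (simp add: trace_wrt_def representation_expand[OF B])
  then show ?thesis by (simp add: clinear_sum[OF that(1)] clinear_scale[OF that(1)] representation_linear[OF B])
 qed
 have "trace_wrt B (%x. f (g x)) = trace_wrt B (%x. g (f x))"
  unfolding *[OF f g] *[OF g f] by (subst sum.swap) (simp add: mult.commute)
 moreover have "clinear (%x. f (g x))" "clinear (%x. g (f x))" using f g by (simp_all add: clinear_def)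
 ultimately show ?thesis using ctrace_eq[OF _ B] by simp
qed

text \<open>The integer is the rank: in a basis extending one of the range, each vector of the range
  contributes 1 and every other vector 0.\<close>

lemma ctrace_idempotent:
 assumes P: "clinear P" "\<And>x. P (P x) = P x"
 shows "\<exists>n::nat. ctrace P = of_nat n & (P v \<noteq> 0 --> n > 0)"
proof -
 have sub: "subspace (range P)" unfolding subspace_def using P(1) clinear_zero[OF P(1)] by (auto simp: clinear_def) (metis rangeI)+
 obtain B1 where B1: "B1 \<subseteq> range P" "independent B1" "range P \<subseteq> span B1" by (rule maximal_independent_subset[of "range P"])
 have span1: "span B1 = range P" using B1(3) span_minimal[OF B1(1) sub] by blast
 obtain B where B: "B1 \<subseteq> B" "independent B" "UNIV \<subseteq> span B" by (rule maximal_independent_subset_extend[OF subset_UNIV B1(2)])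
 then have basis: "is_basis B" by (auto simp: is_basis_def)
 have fin: "finite B" by (rule is_basis_finite[OF basis])
 have "representation B (P b) b = (if b \<in> B1 then 1 else 0)" if "b \<in> B" for b
 proof (cases "b \<in> B1")
  case True
  then obtain z where "b = P z" using B1(1) by blast
  then have "P b = b" using P(2) by simp
  then show ?thesis using True representation_basis[OF B(2) that] by simp
 next
  case False
  have "P b \<in> span B1" unfolding span1 by simp
  then have "representation B (P b) = representation B1 (P b)" using B by (intro representation_extend) auto
  then have "representation B (P b) b = 0" using False representation_ne_zero by metis
  then show ?thesis using False by simp
 qed
 then have "trace_wrt B P = (\<Sum>b\<in>B. if b \<in> B1 then 1 else 0)" by (simp add: trace_wrt_def)
 also have "\<dots> = of_nat (card B1)" using fin B(1) by (simp add: sum.If_cases Int_absorb1)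
 finally have "ctrace P = of_nat (card B1)" using ctrace_eq[OF P(1) basis] by simp
 moreover have "card B1 > 0" if "P v \<noteq> 0"
 proof -
  have "B1 \<noteq> {}" using span1 that by auto
  then show ?thesis using fin B(1) finite_subset by (auto simp: card_gt_0_iff)
 qed
 ultimately show ?thesis by blast
qed

subsection \<open>Peirce decomposition\<close>

lemma tripotentD: "tripotent u ==> \<lbrace>u, u, u\<rbrace> = u" by (simp add: tripotent_def)

text \<open>The linear system of \<open>quadratic_commute\<close> once more, simplified by {u, u, u}
  = u.\<close>

lemma peirce_TQ:
 assumes "tripotent u"
 shows "\<lbrace>u, u, \<lbrace>u, v, u\<rbrace>\<rbrace> = \<lbrace>u, v, u\<rbrace>" "\<lbrace>u, \<lbrace>u, u, v\<rbrace>, u\<rbrace> = \<lbrace>u, v, u\<rbrace>"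
proof -
 show *: "\<lbrace>u, u, \<lbrace>u, v, u\<rbrace>\<rbrace> = \<lbrace>u, v, u\<rbrace>"
 proof -
  define a b q where "a = \<lbrace>u, u, \<lbrace>u, v, u\<rbrace>\<rbrace>" and "b = \<lbrace>u, \<lbrace>u, u, v\<rbrace>, u\<rbrace>" and "q = \<lbrace>u, v, u\<rbrace>"
  have 1: "a = q + q - b" using jordan[of u u u v u] tripotentD[OF assms] by (simp add: a_def b_def q_def)
  have 2: "q = a + a - b" using jordan[of u v u u u] tripotentD[OF assms] triple_commute[of "\<lbrace>u, v, u\<rbrace>" u u] triple_commute[of v u u]
   by (simp add: a_def b_def q_def algebra_simps)
  have "w \<bullet> a = w \<bullet> q" for w using arg_cong[OF 1, of "(\<bullet>) w"] arg_cong[OF 2, of "(\<bullet>) w"] by (simp add: inner_simps)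
  then have "a = q" using vector_eq_ldot by blast
  then show ?thesis by (simp add: a_def q_def)
 qed
 show "\<lbrace>u, \<lbrace>u, u, v\<rbrace>, u\<rbrace> = \<lbrace>u, v, u\<rbrace>" using * quadratic_commute[of u v] by simp
qed

lemma peirce_QQ:
 assumes "tripotent u"
 shows "\<lbrace>u, \<lbrace>u, v, u\<rbrace>, u\<rbrace> = 2 *\<^sub>R \<lbrace>u, u, \<lbrace>u, u, v\<rbrace>\<rbrace> - \<lbrace>u, u, v\<rbrace>"
 using jordan[of v u u u u] tripotentD[OF assms] triple_commute[of v u u] triple_commute[of "\<lbrace>u, u, v\<rbrace>" u u]
 by (simp add: algebra_simps scaleR_2)

text \<open>Write D for D u u and Q for v |-> {u, v, u}. Then Q Q = 2 D^2 - D and D fixes the range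
  of Q, so (D - 1)(2 D^2 - D) = 0: the possible eigenvalues are 0, 1/2 and 1.\<close>

lemma peirce_cubic:
 assumes "tripotent u"
 shows "2 *\<^sub>R \<lbrace>u, u, \<lbrace>u, u, \<lbrace>u, u, v\<rbrace>\<rbrace>\<rbrace> = 3 *\<^sub>R \<lbrace>u, u, \<lbrace>u, u, v\<rbrace>\<rbrace> - \<lbrace>u, u, v\<rbrace>"
proof -
 have "2 *\<^sub>R \<lbrace>u, u, \<lbrace>u, u, \<lbrace>u, u, v\<rbrace>\<rbrace>\<rbrace> - \<lbrace>u, u, \<lbrace>u, u, v\<rbrace>\<rbrace> = 2 *\<^sub>R \<lbrace>u, u, \<lbrace>u, u, v\<rbrace>\<rbrace> - \<lbrace>u, u, v\<rbrace>"
  using peirce_TQ(1)[OF assms, of "\<lbrace>u, v, u\<rbrace>"] unfolding peirce_QQ[OF assms] by (simp add: triple_linear)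
 note * = arg_cong[OF this, of "(\<bullet>) w" for w]
 show ?thesis by (rule inner_eqI, use * in \<open>simp add: inner_simps\<close>)
qed

text \<open>The Peirce projections for the eigenvalues 1 and 1/2 of \<open>D u u\<close>.\<close>

definition peirce1 :: "'a => 'a => 'a" where
 "peirce1 u v = 2 *\<^sub>R \<lbrace>u, u, \<lbrace>u, u, v\<rbrace>\<rbrace> - \<lbrace>u, u, v\<rbrace>"

definition peirce2 :: "'a => 'a => 'a" where
 "peirce2 u v = 4 *\<^sub>R (\<lbrace>u, u, v\<rbrace> - \<lbrace>u, u, \<lbrace>u, u, v\<rbrace>\<rbrace>)"

lemma scaleR_scaleC: "r *\<^sub>R (c *C v) = c *C (r *\<^sub>R v)" by (simp add: scaleR_eq mult.commute)

lemma clinear_peirce: "clinear (peirce1 u)" "clinear (peirce2 u)"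
 by (auto intro!: clinearI simp: peirce1_def peirce2_def triple_linear algebra_simps scale_right_diff_distrib scaleR_scaleC)

lemma peirce_T:
 assumes "tripotent u"
 shows "\<lbrace>u, u, peirce1 u v\<rbrace> = peirce1 u v" "\<lbrace>u, u, peirce2 u v\<rbrace> = (1/2) *\<^sub>R peirce2 u v"
proof -
 note * = arg_cong[OF peirce_cubic[OF assms, of v], of "(\<bullet>) w" for w]
 show "\<lbrace>u, u, peirce1 u v\<rbrace> = peirce1 u v"
 proof (rule inner_eqI)
  fix w show "w \<bullet> \<lbrace>u, u, peirce1 u v\<rbrace> = w \<bullet> peirce1 u v"
   using *[of w] by (simp add: peirce1_def triple_linear inner_simps)
 qed
 show "\<lbrace>u, u, peirce2 u v\<rbrace> = (1/2) *\<^sub>R peirce2 u v"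
 proof (rule inner_eqI)
  fix w show "w \<bullet> \<lbrace>u, u, peirce2 u v\<rbrace> = w \<bullet> (1/2) *\<^sub>R peirce2 u v"
   using *[of w] by (simp add: peirce2_def triple_linear inner_simps)
 qed
qed

lemma peirce_sum: "\<lbrace>u, u, v\<rbrace> = peirce1 u v + (1/2) *\<^sub>R peirce2 u v"
 by (rule inner_eqI) (simp add: peirce1_def peirce2_def inner_simps)

lemma peirce_idem:
 assumes "tripotent u"
 shows "peirce1 u (peirce1 u v) = peirce1 u v" "peirce2 u (peirce2 u v) = peirce2 u v"
 unfolding peirce1_def[of u "peirce1 u v"] peirce2_def[of u "peirce2 u v"] peirce_T[OF assms] triple_scaleR
 by (rule inner_eqI, simp add: inner_simps)+

text \<open>The trace is the rank of \<open>peirce1 u\<close> plus half the rank of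
  \<open>peirce2 u\<close>, and \<open>peirce1 u\<close> fixes u.\<close>

lemma ctrace_tripotent:
 assumes "tripotent u"
 shows "\<exists>r\<ge>0. ctrace (D u u) = complex_of_real r & (u \<noteq> 0 --> r > 0)"
proof -
 obtain n where n: "ctrace (peirce1 u) = of_nat n" "peirce1 u u \<noteq> 0 --> n > 0"
  using ctrace_idempotent[OF clinear_peirce(1), of u u] peirce_idem[OF assms] by blast
 obtain m where m: "ctrace (peirce2 u) = of_nat m" using ctrace_idempotent[OF clinear_peirce(2), of u u] peirce_idem[OF assms] by blast
 have "D u u = (%v. peirce1 u v + (1/2) *C peirce2 u v)" using peirce_sum[of u] by (auto simp: D_def scaleR_eq)
 moreover have "clinear (%x. (1/2) *C peirce2 u x)" using clinear_peirce(2)[of u] by (simp add: clinear_def scale_right_distrib mult.commute)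
 ultimately have "ctrace (D u u) = complex_of_real (real n + real m / 2)" using clinear_peirce by (simp add: ctrace_add ctrace_scale n m)
 moreover have "peirce1 u u = u" using tripotentD[OF assms] by (simp add: peirce1_def scaleR_2)
 ultimately show ?thesis using n(2) by (intro exI[of _ "real n + real m / 2"]) auto
qed

lemma jinner_add_left: "jinner (x + y) z = jinner x z + jinner y z"
proof -
 have "D (x + y) z = (%v. D x z v + D y z v)" by (simp add: D_def triple_linear)
 then show ?thesis by (simp add: jinner_def ctrace_add clinear_D)
qed

lemma jinner_add_right: "jinner x (y + z) = jinner x y + jinner x z"
proof -
 have "D x (y + z) = (%v. D x y v + D x z v)" by (simp add: D_def triple_linear)
 then show ?thesis by (simp add: jinner_def ctrace_add clinear_D)
qed

lemma jinner_scale_left: "jinner (c *C x) y = c * jinner x y"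
proof -
 have "D (c *C x) y = (%v. c *C D x y v)" by (simp add: D_def triple_linear)
 then show ?thesis by (simp add: jinner_def ctrace_scale clinear_D)
qed

lemma jinner_scale_right: "jinner x (c *C y) = cnj c * jinner x y"
proof -
 have "D x (c *C y) = (%v. cnj c *C D x y v)" by (simp add: D_def triple_linear)
 then show ?thesis by (simp add: jinner_def ctrace_scale clinear_D)
qed

lemma jinner_scaleR: "jinner (r *\<^sub>R x) y = r * jinner x y" "jinner x (r *\<^sub>R y) = r * jinner x y"
 by (simp_all add: scaleR_eq jinner_scale_left jinner_scale_right)

lemma jinner_zero [simp]: "jinner 0 y = 0" "jinner x 0 = 0" using jinner_scaleR[of 0 0 y] jinner_scaleR(2)[of x 0 0] by auto

lemma jinner_minus: "jinner (- x) y = - jinner x y" "jinner x (- y) = - jinner x y"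
 using jinner_scaleR(1)[of "- 1" x y] jinner_scaleR(2)[of x "- 1" y] by auto

lemma jinner_diff: "jinner (x - y) z = jinner x z - jinner y z" "jinner x (y - z) = jinner x y - jinner x z"
 using jinner_add_left[of x "- y" z] jinner_add_right[of x y "- z"] by (simp_all add: jinner_minus)

lemma jinner_sum: "jinner (\<Sum>i\<in>I. f i) y = (\<Sum>i\<in>I. jinner (f i) y)"
  "jinner x (\<Sum>i\<in>I. f i) = (\<Sum>i\<in>I. jinner x (f i))"
 by (induction I rule: infinite_finite_induct; simp add: jinner_add_left jinner_add_right)+

lemmas jinner_linear = jinner_add_left jinner_add_right jinner_scale_left jinner_scale_right
 jinner_scaleR jinner_minus jinner_diff

text \<open>The trace of the Jordan identity: its left side is a commutator and has trace
  zero.\<close>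

lemma jinner_assoc: "jinner \<lbrace>a, b, x\<rbrace> y = jinner x \<lbrace>b, a, y\<rbrace>"
proof -
 let ?f = "%v. D a b (D x y v)" and ?g = "%v. D x y (D a b v)"
 have lin: "clinear ?f" "clinear ?g" using clinear_D by (simp_all add: clinear_def)
 have "clinear (%v. (-1) *C ?g v)" using lin(2) by (simp add: clinear_def)
 then have "ctrace (%v. ?f v + (-1) *C ?g v) = ctrace ?f - ctrace ?g" using lin by (simp add: ctrace_add ctrace_scale del: scale_minus_left)
 also have "\<dots> = 0" using ctrace_swap[OF clinear_D clinear_D] by simp
 also have "(%v. ?f v + (-1) *C ?g v) = (%v. D \<lbrace>a, b, x\<rbrace> y v + (-1) *C D x \<lbrace>b, a, y\<rbrace> v)"
  using jordan_identity[of a b x y] by (auto simp: D_def)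
 also have "ctrace \<dots> = jinner \<lbrace>a, b, x\<rbrace> y - jinner x \<lbrace>b, a, y\<rbrace>"
 proof -
  have "clinear (%v. (-1) *C D x \<lbrace>b, a, y\<rbrace> v)" using clinear_D by (simp add: clinear_def)
  then show ?thesis by (simp add: ctrace_add ctrace_scale clinear_D jinner_def del: scale_minus_left)
 qed
 finally show ?thesis by simp
qed

text \<open>By the spectral theorem \<open>D x x\<close> is a positive combination of the operators \<open>D u u\<close> of tripotents.\<close>

lemma D_diag:
 "\<exists>U s. finite U & (\<forall>u\<in>U. tripotent u & u \<noteq> 0 & s u > (0::real)) &
  (\<forall>v. \<lbrace>x, x, v\<rbrace> = (\<Sum>u\<in>U. s u *\<^sub>R \<lbrace>u, u, v\<rbrace>)) & (x \<noteq> 0 --> U \<noteq> {})"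
proof -
 obtain R c where R: "finite R" "\<And>s. s \<in> R ==> s > (0::real)" "x = (\<Sum>s\<in>R. c s)"
  "\<And>s. s \<in> R ==> \<lbrace>c s, c s, c s\<rbrace> = s *\<^sub>R c s"
  "\<And>s t z. s \<in> R ==> t \<in> R ==> s \<noteq> t ==> \<lbrace>c s, c t, z\<rbrace> = 0" using spectral[of x] by metis
 define R' where "R' = {s \<in> R. c s \<noteq> 0}"
 define e where "e s = (1 / sqrt s) *\<^sub>R c s" for s
 have trip: "tripotent (e s)" if "s \<in> R" for s using R(2,4)[OF that] by (simp add: e_def tripotent_def triple_scaleR field_simps)
 have eq: "\<lbrace>x, x, v\<rbrace> = (\<Sum>s\<in>R'. s *\<^sub>R \<lbrace>e s, e s, v\<rbrace>)" for v
 proof -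
  have "\<lbrace>x, x, v\<rbrace> = (\<Sum>s\<in>R. \<Sum>t\<in>R. \<lbrace>c s, c t, v\<rbrace>)" unfolding R(3) triple_sum(1) unfolding triple_sum(2) ..
  also have "\<dots> = (\<Sum>s\<in>R. \<lbrace>c s, c s, v\<rbrace>)"
  proof (rule sum.cong[OF refl])
   fix s assume s: "s \<in> R"
   have "(\<Sum>t\<in>R. \<lbrace>c s, c t, v\<rbrace>) = (\<Sum>t\<in>R. if t = s then \<lbrace>c s, c s, v\<rbrace> else 0)"
    using R(5) s by (intro sum.cong) auto
   then show "(\<Sum>t\<in>R. \<lbrace>c s, c t, v\<rbrace>) = \<lbrace>c s, c s, v\<rbrace>" using s R(1) by simp
  qed
  also have "\<dots> = (\<Sum>s\<in>R'. \<lbrace>c s, c s, v\<rbrace>)" unfolding R'_def using R(1) by (intro sum.mono_neutral_right) auto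
  also have "\<dots> = (\<Sum>s\<in>R'. s *\<^sub>R \<lbrace>e s, e s, v\<rbrace>)"
  proof (rule sum.cong[OF refl])
   fix s assume "s \<in> R'"
   then have "s > 0" using R(2) by (simp add: R'_def)
   then show "\<lbrace>c s, c s, v\<rbrace> = s *\<^sub>R \<lbrace>e s, e s, v\<rbrace>" by (simp add: e_def triple_scaleR)
  qed
  finally show ?thesis .
 qed
 have ne: "e s \<noteq> 0" if "s \<in> R'" for s using that R(2) by (fastforce simp: R'_def e_def)
 have inj: "inj_on e R'" 
 proof (rule inj_onI, rule ccontr)
  fix s t assume *: "s \<in> R'" "t \<in> R'" "e s = e t" "s \<noteq> t"
  have "\<lbrace>c s, c t, c s\<rbrace> = 0" using R(5)[of s t] *(1,2,4) by (simp add: R'_def)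
  then have "\<lbrace>e s, e t, e s\<rbrace> = 0" by (simp add: e_def triple_scaleR)
  then have "\<lbrace>e s, e s, e s\<rbrace> = 0" using *(3) by simp
  then show False using *(1) trip[of s] ne[of s] by (simp add: R'_def tripotent_def)
 qed
 have inv: "the_inv_into R' e (e s) = s" if "s \<in> R'" for s using the_inv_into_f_f[OF inj that] .
 show ?thesis
 proof (intro exI[of _ "e ` R'"] exI[of _ "the_inv_into R' e"] conjI ballI allI)
  show "finite (e ` R')" using R(1) by (simp add: R'_def)
  fix u assume u: "u \<in> e ` R'"
  then obtain s where s: "s \<in> R'" "u = e s" by blast
  then have "s \<in> R" by (simp add: R'_def)
  then show "tripotent u" "u \<noteq> 0" "the_inv_into R' e u > 0" using R(2) trip ne[OF s(1)] inv[OF s(1)] by (simp_all add: s(2))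
 next
  show "\<lbrace>x, x, v\<rbrace> = (\<Sum>u\<in>e ` R'. the_inv_into R' e u *\<^sub>R \<lbrace>u, u, v\<rbrace>)" for v
   unfolding eq sum.reindex[OF inj] by (intro sum.cong) (simp_all add: inv)
  show "x \<noteq> 0 --> e ` R' \<noteq> {}"
  proof (intro impI notI)
   assume that: "x \<noteq> 0" and "e ` R' = {}"
   then have "\<forall>s\<in>R. c s = 0" by (auto simp: R'_def)
   then have "x = 0" using R(3) by simp
   with that show False by simp
  qed
 qed
qed

text \<open>By \<open>D_diag\<close> the trace of D x x is a positive combination of the traces of
  tripotents.\<close>

lemma jinner_pos_real: "\<exists>r\<ge>0. jinner x x = complex_of_real r & (x \<noteq> 0 --> r > 0)"
proof -
 obtain U s where U: "finite U" "\<And>u. u \<in> U ==> tripotent u & u \<noteq> 0 & s u > (0::real)"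
  "\<And>v. \<lbrace>x, x, v\<rbrace> = (\<Sum>u\<in>U. s u *\<^sub>R \<lbrace>u, u, v\<rbrace>)" "x \<noteq> 0 ==> U \<noteq> {}"
  using D_diag[of x] by blast
 obtain r where r: "\<And>u. u \<in> U ==> r u > 0 & ctrace (D u u) = complex_of_real (r u)" using ctrace_tripotent U(2) by metis
 have "ctrace (%v. \<Sum>u\<in>V. s u *\<^sub>R \<lbrace>u, u, v\<rbrace>) = (\<Sum>u\<in>V. s u * ctrace (D u u)) &
   clinear (%v. \<Sum>u\<in>V. s u *\<^sub>R \<lbrace>u, u, v\<rbrace>)" if "finite V" for V using that
 proof (induction V)
  case empty
  have "clinear (%v. 0 *C D x x v)" by (simp add: clinear_def)
  then show ?case using ctrace_scale[OF clinear_D, of 0 x x] by simp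
 next
  case (insert u V)
  have lin: "clinear (%v. s u *\<^sub>R \<lbrace>u, u, v\<rbrace>)"
   by (auto intro!: clinearI simp: triple_linear scaleR_right_distrib scaleR_scaleC)
  have "ctrace (%v. s u *\<^sub>R \<lbrace>u, u, v\<rbrace>) = s u * ctrace (D u u)"
   using ctrace_scale[OF clinear_D, of "s u" u u] by (simp add: D_def scaleR_eq)
  moreover have "clinear (%v. s u *\<^sub>R \<lbrace>u, u, v\<rbrace> + (\<Sum>u\<in>V. s u *\<^sub>R \<lbrace>u, u, v\<rbrace>))"
   using lin insert.IH unfolding clinear_def by (simp add: scale_right_distrib add_ac)
  ultimately show ?case using insert lin ctrace_add[OF lin conjunct2[OF insert.IH]] by simp
 qed
 from conjunct1[OF this[OF U(1)]] have "jinner x x = (\<Sum>u\<in>U. s u * ctrace (D u u))" by (simp add: jinner_def D_def U(3))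
 also have "\<dots> = complex_of_real (\<Sum>u\<in>U. s u * r u)" using r by simp
 finally have "jinner x x = complex_of_real (\<Sum>u\<in>U. s u * r u)" .
 moreover have "(\<Sum>u\<in>U. s u * r u) >= 0" using U(2) r by (intro sum_nonneg) (simp add: less_imp_le)
 moreover have "(\<Sum>u\<in>U. s u * r u) > 0" if "x \<noteq> 0" using U(1,2,4) r that by (intro sum_pos) auto
 ultimately show ?thesis by blast
qed

lemma jinner_pos: "x \<noteq> 0 ==> Re (jinner x x) > 0" and jinner_nonneg: "Re (jinner x x) >= 0"
 and jinner_im [simp]: "Im (jinner x x) = 0" using jinner_pos_real[of x] by auto

text \<open>The diagonal is real; at x + y and at x + \<i> y this amounts to hermitian
  symmetry.\<close>

lemma jinner_cnj: "jinner y x = cnj (jinner x y)"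
proof -
 have "Im (jinner (x + y) (x + y)) = 0" "Im (jinner (x + \<i> *C y) (x + \<i> *C y)) = 0" by simp_all
 then show ?thesis by (simp add: jinner_linear complex_eq_iff del: jinner_im) (simp add: algebra_simps)
qed

text \<open>\<open>peirce1 u\<close> and \<open>peirce2 u\<close> are idempotent, and self-adjoint
  by \<open>jinner_assoc\<close>; hence \<open>peirce1 u\<close> plus half of
  \<open>peirce2 u\<close>, which is D u u, is positive.\<close>

lemma jinner_T_nonneg:
 assumes "tripotent u" shows "Re (jinner \<lbrace>u, u, v\<rbrace> v) >= 0"
proof -
 have sa: "jinner (peirce1 u v) w = jinner v (peirce1 u w)" "jinner (peirce2 u v) w = jinner v (peirce2 u w)" for v w
  by (simp_all add: peirce1_def peirce2_def jinner_linear jinner_assoc)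
 have "jinner (peirce1 u v) v = jinner (peirce1 u v) (peirce1 u v)"
  "jinner (peirce2 u v) v = jinner (peirce2 u v) (peirce2 u v)" using sa peirce_idem[OF assms] by metis+
 then show ?thesis using jinner_nonneg[of "peirce1 u v"] jinner_nonneg[of "peirce2 u v"] unfolding peirce_sum[of u v] by (simp add: jinner_linear)
qed

lemma jinner_D_nonneg: "Re (jinner \<lbrace>x, x, v\<rbrace> v) >= 0"
proof -
 obtain U s where U: "finite U" "\<And>u. u \<in> U ==> tripotent u & u \<noteq> 0 & s u > (0::real)"
  "\<And>v. \<lbrace>x, x, v\<rbrace> = (\<Sum>u\<in>U. s u *\<^sub>R \<lbrace>u, u, v\<rbrace>)" "x \<noteq> 0 ==> U \<noteq> {}"
  using D_diag[of x] by blast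
 show ?thesis unfolding U(3) jinner_sum jinner_scaleR Re_sum using U(2) jinner_T_nonneg by (intro sum_nonneg) (simp add: less_imp_le)
qed

end

section \<open>Continuity of the operations, and the trace form against the norm of the type\<close>

context positive_hermitian_jts
begin

lemma bounded_bilinear_scaleC: "bounded_bilinear scaleC" unfolding bilinear_conv_bounded_bilinear[symmetric] bilinear_def
 by (auto intro!: linearI simp: scale_left_distrib scale_right_distrib scaleR_eq scaleR_conv_of_real mult.commute)

lemma bounded_bilinear_jinner: "bounded_bilinear jinner" unfolding bilinear_conv_bounded_bilinear[symmetric] bilinear_def
 by (auto intro!: linearI simp: jinner_linear scaleR_conv_of_real)

lemma bounded_bilinear_triple12: "bounded_bilinear (%x y. \<lbrace>x, y, z\<rbrace>)"
 and bounded_bilinear_triple13: "bounded_bilinear (%x z. \<lbrace>x, y, z\<rbrace>)"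
 unfolding bilinear_conv_bounded_bilinear[symmetric] bilinear_def by (auto intro!: linearI simp: triple_linear)

lemma norm_scaleC_bound: "\<exists>K>0. \<forall>c x. norm (c *C x) <= K * cmod c * norm x"
 using bounded_bilinear.pos_bounded[OF bounded_bilinear_scaleC] by (metis mult.commute mult.left_commute)

lemma jinner_bound: "\<exists>K>0. \<forall>x y. cmod (jinner x y) <= K * norm x * norm y"
 using bounded_bilinear.pos_bounded[OF bounded_bilinear_jinner] by (metis mult.commute mult.left_commute)

text \<open>The norm of the type has no relation to the triple product; the minimum of the form on
  the compact unit sphere compares the two.\<close>

lemma jinner_coercive: "\<exists>c>0. \<forall>x. c * (norm x)\<^sup>2 <= Re (jinner x x)"
proof -
 have cont: "continuous_on (sphere 0 1) (%x. Re (jinner x x))"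
  by (intro continuous_intros bounded_bilinear.continuous_on[OF bounded_bilinear_jinner])
 obtain b :: 'a where "b \<in> Basis" using nonempty_Basis by blast
 then have "sphere (0::'a) 1 \<noteq> {}" by (auto intro!: exI[of _ b])
 from continuous_attains_inf[OF compact_sphere this cont] obtain u
  where u: "norm u = 1" "\<And>x. norm x = 1 ==> Re (jinner u u) <= Re (jinner x x)" by auto
 have "Re (jinner u u) * (norm x)\<^sup>2 <= Re (jinner x x)" for x
 proof (cases "x = 0")
  case False
  have "Re (jinner u u) <= Re (jinner ((1 / norm x) *\<^sub>R x) ((1 / norm x) *\<^sub>R x))" using False by (intro u(2)) simp
  also have "\<dots> = Re (jinner x x) / (norm x)\<^sup>2" by (simp add: jinner_linear power2_eq_square)
  finally show ?thesis using False by (simp add: field_simps)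
 qed simp
 moreover have "u \<noteq> 0" using u(1) by auto
 ultimately show ?thesis using jinner_pos by blast
qed

text \<open>A nonzero spectral component of x, divided by sqrt s, is such a tripotent, and the last
  clause of \<open>spectral\<close> keeps it in W.\<close>

lemma tripotent_component:
 assumes "x \<noteq> 0" "x \<in> W" "0 \<in> W" "\<And>u v. u \<in> W ==> v \<in> W ==> u + v \<in> W"
  "\<And>r u. u \<in> W ==> r *\<^sub>R u \<in> W" "\<And>u. u \<in> W ==> \<lbrace>x, x, u\<rbrace> \<in> W"
 shows "\<exists>u\<in>W. u \<noteq> 0 & tripotent u"
proof -
 obtain R c where R: "finite R" "\<And>s. s \<in> R ==> s > (0::real)" "x = (\<Sum>s\<in>R. c s)"
  "\<And>s. s \<in> R ==> \<lbrace>c s, c s, c s\<rbrace> = s *\<^sub>R c s" "\<And>s. s \<in> R ==> c s \<in> W"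
  using spectral[of x] assms(2-6) by metis
 then obtain s where s: "s \<in> R" "c s \<noteq> 0" using assms(1) by (metis sum.neutral)
 have "tripotent ((1 / sqrt s) *\<^sub>R c s)" using R(2,4)[OF s(1)] by (simp add: tripotent_def triple_scaleR field_simps)
 then show ?thesis using R(2,5)[OF s(1)] s(2) assms(5) by (intro bexI[of _ "(1 / sqrt s) *\<^sub>R c s"]) auto
qed

end

section \<open>Peirce spaces of e and the symmetric cone\<close>

context symmetric_siegel
begin

subsection \<open>Peirce decomposition for the maximal tripotent\<close>

lemma e_tripotent: "tripotent e" and e_nonzero: "e \<noteq> 0" and eee [simp]: "\<lbrace>e, e, e\<rbrace> = e"
 using e_maximal by (auto simp: maximal_tripotent_def tripotent_def)

text \<open>Maximality excludes the eigenvalue 0: the kernel of D e e is stable under D v v for each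
  of its members v, so a nonzero kernel would contain a nonzero tripotent, and that tripotent would
  be orthogonal to e.\<close>

lemma peirce0_trivial:
 assumes "\<lbrace>e, e, v\<rbrace> = 0" shows "v = 0"
proof (rule ccontr)
 assume "v \<noteq> 0"
 define W where "W = {y. \<lbrace>e, e, y\<rbrace> = 0}"
 have "\<lbrace>e, e, \<lbrace>v, v, u\<rbrace>\<rbrace> = 0" if "\<lbrace>e, e, u\<rbrace> = 0" for u using jordan[of e e v v u] that assms by simp
 then have "\<exists>u\<in>W. u \<noteq> 0 & tripotent u"
  using \<open>v \<noteq> 0\<close> assms by (intro tripotent_component[of v]) (auto simp: W_def triple_linear)
 then obtain u where u: "\<lbrace>e, e, u\<rbrace> = 0" "u \<noteq> 0" "tripotent u" by (auto simp: W_def)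
 have "\<lbrace>e, u, e\<rbrace> = 0" using peirce_TQ(2)[OF e_tripotent, of u] u(1) by simp
 moreover have "\<lbrace>u, e, e\<rbrace> = 0" using u(1) triple_commute[of u e e] by simp
 \<comment> \<open>The commutator of D(e, e) and D(e, u) is D(e, u) when D(e, e) acts as the
   derivation, and 0 when D(e, u) does.\<close>
 ultimately have "\<lbrace>e, u, z\<rbrace> = 0" for z using jordan[of e e e u z] jordan[of e u e e z] u(1) by simp
 then have "orthogonal_tripotents e u" using u(3) e_tripotent by (simp add: orthogonal_tripotents_def D_def)
 then show False using e_maximal u(2) by (auto simp: maximal_tripotent_def)
qed

definition prE :: "'a => 'a" where "prE v = peirce2 e v"
text \<open>The conjugation z |-> {e, z, e} of the eigenspace for 1 has F as its fixed points;
  \<open>prF\<close> and \<open>prG\<close> are the real and imaginary parts with respect to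
  it.\<close>

definition prF :: "'a => 'a" where "prF v = (1/2) *\<^sub>R (peirce1 e v + \<lbrace>e, peirce1 e v, e\<rbrace>)"
definition prG :: "'a => 'a" where "prG v = (- \<i> / 2) *C (peirce1 e v - \<lbrace>e, peirce1 e v, e\<rbrace>)"

text \<open>D e e kills the difference of the two sides, so \<open>peirce0_trivial\<close>
  applies.\<close>

lemma peirce_resolution: "v = peirce1 e v + peirce2 e v"
proof -
 have "\<lbrace>e, e, v - (peirce1 e v + peirce2 e v)\<rbrace> = 0"
 proof (rule inner_eqI)
  fix w show "w \<bullet> \<lbrace>e, e, v - (peirce1 e v + peirce2 e v)\<rbrace> = w \<bullet> 0"
   using arg_cong[OF peirce_sum[of e v], of "(\<bullet>) w"] by (simp add: triple_linear peirce_T[OF e_tripotent] inner_simps)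
 qed
 from peirce0_trivial[OF this] show ?thesis by simp
qed

lemma E_iff: "v \<in> E \<longleftrightarrow> \<lbrace>e, e, v\<rbrace> = (1/2) *\<^sub>R v" by (simp add: E_def eigenspace_def D_def scaleR_eq)

lemma F_iff: "v \<in> F \<longleftrightarrow> \<lbrace>e, e, v\<rbrace> = v & \<lbrace>e, v, e\<rbrace> = v"
 by (simp add: F_def eigenspace_def D_def)

lemma QQ_on_peirce1: "\<lbrace>e, e, v\<rbrace> = v ==> \<lbrace>e, \<lbrace>e, v, e\<rbrace>, e\<rbrace> = v"
 by (simp add: peirce_QQ[OF e_tripotent] scaleR_2)

lemma prE_mem [simp]: "prE v \<in> E" by (simp add: E_iff prE_def peirce_T[OF e_tripotent])

lemma prF_mem [simp]: "prF v \<in> F" using peirce_T(1)[OF e_tripotent, of v] QQ_on_peirce1[of "peirce1 e v"]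
 by (simp add: F_iff prF_def triple_linear peirce_TQ[OF e_tripotent] add.commute)

lemma prG_mem [simp]: "prG v \<in> F" using peirce_T(1)[OF e_tripotent, of v] QQ_on_peirce1[of "peirce1 e v"]
 by (simp add: F_iff prG_def triple_linear peirce_TQ[OF e_tripotent])
   (simp add: scale_right_diff_distrib)

lemma point_pr: "point (prE v) (prF v) (prG v) = v"
proof -
 have "prF v + \<i> *C prG v = peirce1 e v" by (simp add: prF_def prG_def scaleR_eq flip: scale_right_distrib scale_right_diff_distrib)
    (simp add: scale_right_distrib flip: scale_left_distrib)
 then show ?thesis using peirce_resolution[of v] by (simp add: point_def prE_def add.commute)
qed

lemma E_subspace: "0 \<in> E" "\<zeta> \<in> E ==> \<zeta>' \<in> E ==> \<zeta> + \<zeta>' \<in> E" "\<zeta> \<in> E ==> c *C \<zeta> \<in> E" "\<zeta> \<in> E ==> r *\<^sub>R \<zeta> \<in> E"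
  "\<zeta> \<in> E ==> - \<zeta> \<in> E" "\<zeta> \<in> E ==> \<zeta>' \<in> E ==> \<zeta> - \<zeta>' \<in> E"
 by (auto simp: E_iff triple_linear algebra_simps scaleR_scaleC)

lemma F_subspace: "0 \<in> F" "x \<in> F ==> y \<in> F ==> x + y \<in> F" "x \<in> F ==> r *\<^sub>R x \<in> F"
  "x \<in> F ==> - x \<in> F" "x \<in> F ==> y \<in> F ==> x - y \<in> F" by (auto simp: F_iff triple_linear)

lemma e_mem_F [simp]: "e \<in> F" by (simp add: F_iff)

lemma pr_add: "prE (v + w) = prE v + prE w" "prF (v + w) = prF v + prF w" "prG (v + w) = prG v + prG w" using clinear_peirce[of e]
 by (simp_all add: prE_def prF_def prG_def clinear_add triple_linear algebra_simps scale_right_distrib scale_right_diff_distrib)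

lemma pr_scaleR: "prE (r *\<^sub>R v) = r *\<^sub>R prE v" "prF (r *\<^sub>R v) = r *\<^sub>R prF v" "prG (r *\<^sub>R v) = r *\<^sub>R prG v"
 using clinear_peirce[of e]
 by (simp_all add: prE_def prF_def prG_def scaleR_eq clinear_scale triple_linear scale_right_distrib scale_right_diff_distrib mult.commute)

lemma prE_scale: "prE (c *C v) = c *C prE v" using clinear_peirce[of e] by (simp add: prE_def clinear_scale)

lemma bounded_linear_pr: "bounded_linear prE" "bounded_linear prF" "bounded_linear prG"
 unfolding linear_conv_bounded_linear[symmetric] by (auto intro!: linearI simp: pr_add pr_scaleR)

lemma peirce_on_E: "\<zeta> \<in> E ==> peirce1 e \<zeta> = 0" "\<zeta> \<in> E ==> peirce2 e \<zeta> = \<zeta>"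
 by (rule inner_eqI, simp add: E_iff peirce1_def peirce2_def triple_linear inner_simps)+

lemma peirce_on_1: "\<lbrace>e, e, z\<rbrace> = z ==> peirce1 e z = z" "\<lbrace>e, e, z\<rbrace> = z ==> peirce2 e z = 0"
 by (simp_all add: peirce1_def peirce2_def scaleR_2)

lemma pr_E [simp]: assumes "\<zeta> \<in> E" shows "prE \<zeta> = \<zeta>" "prF \<zeta> = 0" "prG \<zeta> = 0"
 using peirce_on_E[OF assms] by (simp_all add: prE_def prF_def prG_def)

lemma pr_F [simp]: assumes "x \<in> F" shows "prE x = 0" "prF x = x" "prG x = 0"
 using assms peirce_on_1[of x] by (simp_all add: prE_def prF_def prG_def F_iff flip: scaleR_2)

lemma pr_iF [simp]: assumes "x \<in> F" shows "prE (\<i> *C x) = 0" "prF (\<i> *C x) = 0" "prG (\<i> *C x) = x"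
proof -
 have *: "\<lbrace>e, e, \<i> *C x\<rbrace> = \<i> *C x" "\<lbrace>e, \<i> *C x, e\<rbrace> = - (\<i> *C x)"
  using assms by (simp_all add: F_iff triple_linear)
 show "prE (\<i> *C x) = 0" "prF (\<i> *C x) = 0" using peirce_on_1[OF *(1)] * by (simp_all add: prE_def prF_def)
 have "prG (\<i> *C x) = (- \<i> / 2) *C (2 *\<^sub>R (\<i> *C x))" using peirce_on_1[OF *(1)] * by (simp add: prG_def scaleR_2)
 then show "prG (\<i> *C x) = x" by (simp add: scaleR_eq)
qed

lemma pr_point [simp]:
 assumes "\<zeta> \<in> E" "x \<in> F" "y \<in> F"
 shows "prE (point \<zeta> x y) = \<zeta>" "prF (point \<zeta> x y) = x" "prG (point \<zeta> x y) = y" using assms by (simp_all add: point_def pr_add)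

lemma pr_i1:
 assumes "\<lbrace>e, e, w\<rbrace> = w"
 shows "prG (\<i> *C w) = prF w" "prF (\<i> *C w) = - prG w" "prE w = 0"
proof -
 have *: "\<lbrace>e, e, \<i> *C w\<rbrace> = \<i> *C w" using assms by (simp add: triple_linear)
 show "prE w = 0" using peirce_on_1[OF assms] by (simp add: prE_def)
 show "prG (\<i> *C w) = prF w" "prF (\<i> *C w) = - prG w" using peirce_on_1[OF assms] peirce_on_1[OF *]
  by (simp_all add: prG_def prF_def triple_linear scaleR_eq scale_right_distrib scale_right_diff_distrib)
qed

lemma Phi_add: "Phi (a + b) c = Phi a c + Phi b c" "Phi a (b + c) = Phi a b + Phi a c" by (simp_all add: Phi_def triple_linear scale_right_distrib)

lemma Phi_scale: "Phi (c *C a) b = c *C Phi a b" by (simp add: Phi_def triple_linear mult.commute)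

lemma Phi_minus: "Phi (- a) b = - Phi a b" "Phi a (- b) = - Phi a b" by (simp_all add: Phi_def triple_linear)

lemma Phi_0 [simp]: "Phi 0 a = 0" "Phi a 0 = 0" by (simp_all add: Phi_def)

lemma Phi_1:
 assumes "a \<in> E" "b \<in> E" shows "\<lbrace>e, e, Phi a b\<rbrace> = Phi a b"
 using jordan[of e e a b e] assms by (simp add: Phi_def triple_linear E_iff)

text \<open>The derivation rule for D(b, a), applied to {e, e, e} = e. Thus \<open>Phi\<close> is
  hermitian for the conjugation defining F, and \<open>Phi a a\<close> lies in F.\<close>

lemma Phi_Q:
 assumes "a \<in> E" "b \<in> E" shows "\<lbrace>e, Phi a b, e\<rbrace> = Phi b a"
proof -
 have T: "\<lbrace>e, e, \<lbrace>b, a, e\<rbrace>\<rbrace> = \<lbrace>b, a, e\<rbrace>"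
  using jordan[of e e b a e] assms by (simp add: E_iff triple_linear)
 have "\<lbrace>e, \<lbrace>a, b, e\<rbrace>, e\<rbrace> = \<lbrace>b, a, e\<rbrace>"
  using jordan[of b a e e e] T triple_commute[of "\<lbrace>b, a, e\<rbrace>" e e] by simp
 then show ?thesis by (simp add: Phi_def triple_linear)
qed

lemma Phi_mem_F [simp]: "a \<in> E ==> Phi a a \<in> F" using Phi_1 Phi_Q by (simp add: F_iff)

lemma prF_Phi:
 assumes "a \<in> E" "b \<in> E" shows "2 *\<^sub>R prF (Phi a b) = Phi a b + Phi b a"
 using peirce_on_1[OF Phi_1[OF assms]] Phi_Q[OF assms] by (simp add: prF_def)

lemma bounded_bilinear_Phi: "bounded_bilinear Phi" unfolding bilinear_conv_bounded_bilinear[symmetric] bilinear_def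
 by (auto intro!: linearI simp: Phi_add) (simp_all add: Phi_def triple_linear scaleR_eq mult.commute)

lemma continuous_Phi [continuous_intros]:
 "continuous_on S f ==> continuous_on S g ==> continuous_on S (%x. Phi (f x) (g x))"
 by (rule bounded_bilinear.continuous_on[OF bounded_bilinear_Phi])

lemma continuous_pr [continuous_intros]:
 "continuous_on S f ==> continuous_on S (%x. prE (f x))"
 "continuous_on S f ==> continuous_on S (%x. prF (f x))"
 "continuous_on S f ==> continuous_on S (%x. prG (f x))"
 by (rule bounded_linear.continuous_on[OF bounded_linear_pr(1)] bounded_linear.continuous_on[OF bounded_linear_pr(2)]
   bounded_linear.continuous_on[OF bounded_linear_pr(3)]; assumption)+

lemma continuous_scaleC [continuous_intros]:
 "continuous_on S f ==> continuous_on S g ==> continuous_on S (%x. f x *C g x)"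
 by (rule bounded_bilinear.continuous_on[OF bounded_bilinear_scaleC])

lemma continuous_jinner [continuous_intros]:
 "continuous_on S f ==> continuous_on S g ==> continuous_on S (%x. jinner (f x) (g x))"
 by (rule bounded_bilinear.continuous_on[OF bounded_bilinear_jinner])

subsection \<open>The symmetric cone\<close>

text \<open>D(y, e) commutes with itself, and {e, y, e} = y turns the vanishing commutator into the
  claim that multiplication by the square of y is D(y, y).\<close>

lemma square_D: "y \<in> F ==> \<lbrace>\<lbrace>y, e, y\<rbrace>, e, v\<rbrace> = \<lbrace>y, y, v\<rbrace>"
 using jordan[of y e y e v] by (simp add: F_iff)

lemma square_D_polar:
 assumes "y \<in> F" "w \<in> F" shows "2 *\<^sub>R \<lbrace>\<lbrace>y, e, w\<rbrace>, e, v\<rbrace> = \<lbrace>y, w, v\<rbrace> + \<lbrace>w, y, v\<rbrace>"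
 using square_D[OF F_subspace(2)[OF assms], of v] square_D[OF assms(1), of v] square_D[OF assms(2), of v]
  triple_commute[of w e y] by (simp add: triple_linear scaleR_2 algebra_simps)

text \<open>Expanded with D(e, e) as the derivation, its commutator with D(u, e) vanishes; expanded
  the other way it is the difference of D(u, e) and D(e, u), up to sign.\<close>

lemma D_F_commute:
 assumes "u \<in> F" shows "\<lbrace>u, e, v\<rbrace> = \<lbrace>e, u, v\<rbrace>"
 using jordan[of u e e e v] jordan[of e e u e v] assms triple_commute[of u e e] by (simp add: F_iff)

lemma jordan_product_1:
 assumes "y \<in> F" "w \<in> F" shows "\<lbrace>e, e, \<lbrace>y, e, w\<rbrace>\<rbrace> = \<lbrace>y, e, w\<rbrace>"
 using jordan[of e e y e w] assms by (simp add: F_iff)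

text \<open>On F the operator D x x is multiplication by the square of x. The Jordan identity for
  {x, x, {e, u, e}} then gives twice {x, x, u} minus its conjugate, so {x, x, u} is real.\<close>

lemma D_F_mem:
 assumes "x \<in> F" "u \<in> F" shows "\<lbrace>x, x, u\<rbrace> \<in> F"
proof -
 have T: "\<lbrace>e, e, \<lbrace>x, x, u\<rbrace>\<rbrace> = \<lbrace>x, x, u\<rbrace>" using jordan[of e e x x u] assms by (simp add: F_iff)
 have w: "\<lbrace>x, x, e\<rbrace> = \<lbrace>x, e, x\<rbrace>"
  using square_D[OF assms(1), of e] jordan_product_1[OF assms(1,1)] triple_commute[of "\<lbrace>x, e, x\<rbrace>" e e] by simp
 have "\<lbrace>e, u, \<lbrace>x, x, e\<rbrace>\<rbrace> = \<lbrace>x, x, u\<rbrace>"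
  using D_F_commute[OF assms(2), of "\<lbrace>x, e, x\<rbrace>"] square_D[OF assms(1), of u]
   triple_commute[of u e "\<lbrace>x, e, x\<rbrace>"] by (simp add: w)
 moreover from this have "\<lbrace>\<lbrace>x, x, e\<rbrace>, u, e\<rbrace> = \<lbrace>x, x, u\<rbrace>" using triple_commute by metis
 ultimately have "\<lbrace>e, \<lbrace>x, x, u\<rbrace>, e\<rbrace> = \<lbrace>x, x, u\<rbrace>"
  using jordan[of x x e u e] assms(2) by (simp add: F_iff)
 then show ?thesis using T by (simp add: F_iff)
qed

text \<open>Positivity of multiplication by x is visibly stable under sums and positive multiples,
  which is not visible for squares. \<open>cone_square\<close> and \<open>square_in_cone\<close>
  connect the two descriptions.\<close>

definition cone :: "'a set" where
 "cone = {x \<in> F. \<forall>v. Re (jinner \<lbrace>x, e, v\<rbrace> v) >= 0}"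

text \<open>The spectral components of x are multiples of tripotents \<open>f s\<close> in F with
  vanishing mutual Jordan products. Positivity of x rules out a negative part of \<open>f s\<close>,
  so each is an idempotent and x has a square root in their span.\<close>

lemma cone_square:
 assumes x: "x \<in> cone" shows "\<exists>y\<in>F. x = \<lbrace>y, e, y\<rbrace>"
proof -
 have xF: "x \<in> F" using x by (simp add: cone_def)
 obtain R c where R: "finite R" "\<And>s. s \<in> R ==> s > (0::real)" "x = (\<Sum>s\<in>R. c s)"
  "\<And>s. s \<in> R ==> \<lbrace>c s, c s, c s\<rbrace> = s *\<^sub>R c s"
  "\<And>s t z. s \<in> R ==> t \<in> R ==> s \<noteq> t ==> \<lbrace>c s, c t, z\<rbrace> = 0"
  "\<And>s. s \<in> R ==> c s \<in> F" using spectral[of x] xF F_subspace D_F_mem[OF xF] by metis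
 define f where "f s = (1 / sqrt s) *\<^sub>R c s" for s
 have fF: "f s \<in> F" if "s \<in> R" for s using R(6)[OF that] by (simp add: f_def F_subspace)
 have cf: "c s = sqrt s *\<^sub>R f s" if "s \<in> R" for s using R(2)[OF that] by (simp add: f_def)
 have fff: "\<lbrace>f s, f s, f s\<rbrace> = f s" if "s \<in> R" for s using R(2,4)[OF that] by (simp add: f_def triple_scaleR field_simps)
 have orth: "\<lbrace>f s, f t, z\<rbrace> = 0" if "s \<in> R" "t \<in> R" "s \<noteq> t" for s t z
  using R(5)[OF that] by (simp add: f_def triple_scaleR)
 have prod0: "\<lbrace>f s, e, f t\<rbrace> = 0" if "s \<in> R" "t \<in> R" "s \<noteq> t" for s t
 proof -
  have "\<lbrace>\<lbrace>f s, e, f t\<rbrace>, e, e\<rbrace> = 0"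
   using square_D_polar[OF fF[OF that(1)] fF[OF that(2)], of e] orth[of s t e] orth[of t s e] that by simp
  then show ?thesis using jordan_product_1[OF fF[OF that(1)] fF[OF that(2)]] triple_commute[of "\<lbrace>f s, e, f t\<rbrace>" e e] by simp
 qed
 \<comment> \<open>Let p be the Jordan square of \<open>f s\<close>. Multiplication by x sends p - f
   s to its multiple by - sqrt s, so positivity of x forces p = f s.\<close>
 have idem: "\<lbrace>f s, e, f s\<rbrace> = f s" if s: "s \<in> R" for s
 proof -
  define p where "p = \<lbrace>f s, e, f s\<rbrace>"
  have pt: "\<lbrace>f t, e, p\<rbrace> = (if t = s then f s else 0)" if t: "t \<in> R" for t
  proof -
   have "\<lbrace>f t, e, p\<rbrace> = \<lbrace>f t, f s, f s\<rbrace>"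
    using triple_commute[of "f t" e p] square_D[OF fF[OF s], of "f t"] triple_commute[of "f t" "f s" "f s"] by (simp add: p_def)
   then show ?thesis using fff[OF s] orth[OF t s] by auto
  qed
  have "\<lbrace>x, e, p - f s\<rbrace> = (\<Sum>t\<in>R. \<lbrace>c t, e, p - f s\<rbrace>)" unfolding R(3) triple_sum(1) ..
  also have "\<dots> = (\<Sum>t\<in>R. if t = s then sqrt s *\<^sub>R (f s - p) else 0)"
   using pt prod0[OF _ s] cf by (intro sum.cong) (auto simp: triple_linear p_def[symmetric] scaleR_right_diff_distrib)
  also have "\<dots> = - sqrt s *\<^sub>R (p - f s)" using R(1) s by (simp add: algebra_simps)
  finally have "Re (jinner \<lbrace>x, e, p - f s\<rbrace> (p - f s)) = - sqrt s * Re (jinner (p - f s) (p - f s))" by (simp only: jinner_scaleR) simp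
  moreover have "Re (jinner \<lbrace>x, e, p - f s\<rbrace> (p - f s)) >= 0" using x unfolding cone_def by blast
  ultimately have "sqrt s * Re (jinner (p - f s) (p - f s)) <= 0" by linarith
  then have "Re (jinner (p - f s) (p - f s)) <= 0" using R(2)[OF s] by (simp add: mult_le_0_iff)
  then have "p - f s = 0" using jinner_pos[of "p - f s"] by force
  then show ?thesis by (simp add: p_def)
 qed
 \<comment> \<open>In terms of the idempotents, x has the coefficients sqrt s; its square root
   therefore has the fourth roots of s.\<close>
 define y where "y = (\<Sum>s\<in>R. sqrt (sqrt s) *\<^sub>R f s)"
 have "y \<in> F" unfolding y_def using R(1) fF by (induction R rule: infinite_finite_induct) (auto intro: F_subspace)
 moreover have "\<lbrace>y, e, y\<rbrace> = x"
 proof -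
  have "\<lbrace>y, e, y\<rbrace> = (\<Sum>s\<in>R. \<lbrace>sqrt (sqrt s) *\<^sub>R f s, e, y\<rbrace>)" by (subst (1) y_def) (rule triple_sum(1))
  also have "\<dots> = (\<Sum>s\<in>R. c s)"
  proof (rule sum.cong[OF refl])
   fix s assume s: "s \<in> R"
   have "\<lbrace>sqrt (sqrt s) *\<^sub>R f s, e, y\<rbrace> = (\<Sum>t\<in>R. \<lbrace>sqrt (sqrt s) *\<^sub>R f s, e, sqrt (sqrt t) *\<^sub>R f t\<rbrace>)"
    unfolding y_def by (rule triple_sum(3))
   also have "\<dots> = (\<Sum>t\<in>R. if t = s then sqrt s *\<^sub>R f s else 0)"
    using prod0[OF s] idem[OF s] R(2)[OF s] by (intro sum.cong) (auto simp: triple_linear)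
   finally show "\<lbrace>sqrt (sqrt s) *\<^sub>R f s, e, y\<rbrace> = c s" using R(1) s cf[OF s] by simp
  qed
  finally show ?thesis using R(3) by simp
 qed
 ultimately show ?thesis by blast
qed

lemma square_in_cone:
 assumes "y \<in> F" "\<lbrace>y, e, y\<rbrace> \<in> F" shows "\<lbrace>y, e, y\<rbrace> \<in> cone"
 using assms square_D[OF assms(1)] jinner_D_nonneg by (simp add: cone_def)

text \<open>Near an interior point, squares may be replaced by members of \<open>cone\<close>, for
  which convexity is available.\<close>

lemma Omega_iff: "x \<in> Omega \<longleftrightarrow> x \<in> F & (\<exists>d>0. \<forall>y\<in>F. norm (y - x) < d --> y \<in> cone)"
proof
 assume "x \<in> Omega"
 then obtain T where T: "openin (top_of_set F) T" "x \<in> T" "T \<subseteq> (%x. \<lbrace>x, e, x\<rbrace>) ` F"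
  by (auto simp: Omega_def interior_of_def)
 have "T \<subseteq> F" using T(1) openin_imp_subset by blast
 obtain d where d: "d > 0" "ball x d \<inter> F \<subseteq> T" using T(1,2) openin_contains_ball by metis
 have "y \<in> cone" if "y \<in> F" "norm (y - x) < d" for y
 proof -
  have "y \<in> T" using d(2) that by (auto simp: dist_norm norm_minus_commute)
  then show ?thesis using T(3) that(1) square_in_cone by auto
 qed
 then show "x \<in> F & (\<exists>d>0. \<forall>y\<in>F. norm (y - x) < d --> y \<in> cone)"
  using d(1) T(2) \<open>T \<subseteq> F\<close> by auto
next
 assume *: "x \<in> F & (\<exists>d>0. \<forall>y\<in>F. norm (y - x) < d --> y \<in> cone)"
 then obtain d where d: "d > 0" "\<And>y. y \<in> F ==> norm (y - x) < d ==> y \<in> cone" by blast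
 have "openin (top_of_set F) (F \<inter> ball x d)" by (simp add: openin_open_Int)
 moreover have "F \<inter> ball x d \<subseteq> (%x. \<lbrace>x, e, x\<rbrace>) ` F"
  using d(2) cone_square by (auto simp: dist_norm norm_minus_commute image_iff)
 ultimately show "x \<in> Omega" using * d(1) unfolding Omega_def interior_of_def by auto
qed

lemma Omega_F: "x \<in> Omega ==> x \<in> F" by (simp add: Omega_iff)

lemma Omega_cone: "x \<in> Omega ==> x \<in> cone" unfolding Omega_iff by fastforce

lemma openin_Omega: "openin (top_of_set F) Omega" by (simp add: Omega_def)

lemma cone_add: "x \<in> cone ==> y \<in> cone ==> x + y \<in> cone" by (simp add: cone_def F_subspace triple_linear jinner_linear)

lemma cone_scaleR: "x \<in> cone ==> t >= 0 ==> t *\<^sub>R x \<in> cone" by (simp add: cone_def F_subspace triple_linear jinner_linear)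

lemma Omega_add: assumes "x \<in> Omega" "y \<in> cone" shows "x + y \<in> Omega"
proof -
 have F: "x \<in> F" "y \<in> F" using assms by (auto simp: Omega_iff cone_def)
 obtain d where d: "d > 0" "\<And>y. y \<in> F ==> norm (y - x) < d ==> y \<in> cone" using assms(1) by (auto simp: Omega_iff)
 have "z \<in> cone" if "z \<in> F" "norm (z - (x + y)) < d" for z
 proof -
  have "z - y \<in> cone" using that F by (intro d(2)) (auto simp: F_subspace algebra_simps)
  from cone_add[OF this assms(2)] show ?thesis by simp
 qed
 then show ?thesis using F d(1) by (auto simp: Omega_iff F_subspace)
qed

lemma Omega_scaleR: assumes "x \<in> Omega" "t > 0" shows "t *\<^sub>R x \<in> Omega"
proof -
 obtain d where d: "d > 0" "\<And>y. y \<in> F ==> norm (y - x) < d ==> y \<in> cone" using assms(1) by (auto simp: Omega_iff)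
 have "z \<in> cone" if "z \<in> F" "norm (z - t *\<^sub>R x) < t * d" for z
 proof -
  have "(1 / t) *\<^sub>R z - x = (1 / t) *\<^sub>R (z - t *\<^sub>R x)" using assms(2) by (simp add: algebra_simps)
  then have eq: "norm ((1 / t) *\<^sub>R z - x) = norm (z - t *\<^sub>R x) / t" using assms(2) by simp
  have "norm ((1 / t) *\<^sub>R z - x) < d" unfolding eq using that(2) assms(2) by (simp add: pos_divide_less_eq mult.commute)
  then have "(1 / t) *\<^sub>R z \<in> cone" using that(1) by (intro d(2)) (auto simp: F_subspace)
  from cone_scaleR[OF this, of t] show ?thesis using assms(2) by simp
 qed
 then show ?thesis using assms d(1) unfolding Omega_iff by (intro conjI exI[of _ "t * d"]) (auto simp: F_subspace)
qed

text \<open>By \<open>peirce_resolution\<close> the eigenvalues of D e e are 1/2 and 1.\<close>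

lemma D_e_coercive: "Re (jinner \<lbrace>e, e, v\<rbrace> v) >= Re (jinner v v) / 2"
proof -
 have "jinner v v = jinner (peirce1 e v) v + jinner (peirce2 e v) v" by (subst (1) peirce_resolution) (simp add: jinner_linear)
 moreover have "jinner \<lbrace>e, e, v\<rbrace> v = jinner (peirce1 e v) v + jinner (peirce2 e v) v / 2"
  by (subst peirce_sum) (simp add: jinner_linear)
 moreover have "Re (jinner (peirce1 e v) v) >= 0"
 proof -
  have "jinner (peirce1 e v) w = jinner v (peirce1 e w)" for v w by (simp add: peirce1_def jinner_linear jinner_assoc)
  then have "jinner (peirce1 e v) v = jinner (peirce1 e v) (peirce1 e v)"  using peirce_idem(1)[OF e_tripotent] by metis
  then show ?thesis using jinner_nonneg by simp
 qed
 ultimately show ?thesis by simp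
qed

text \<open>Multiplication by e is bounded below by 1/2, so positivity survives a small change of e.
  The radius c / (2 K L) weighs this bound against the norms K of the product and L of the
  form.\<close>

lemma e_mem_Omega [simp]: "e \<in> Omega"
proof -
 obtain K where K: "K > 0" "\<And>x v. norm \<lbrace>x, e, v\<rbrace> <= norm x * norm v * K"
  using bounded_bilinear.pos_bounded[OF bounded_bilinear_triple13] by blast
 obtain L where L: "L > 0" "\<And>x y. cmod (jinner x y) <= L * norm x * norm y" using jinner_bound by blast
 obtain c where c: "c > 0" "\<And>x. c * (norm x)\<^sup>2 <= Re (jinner x x)" using jinner_coercive by blast
 have "y \<in> cone" if y: "y \<in> F" "norm (y - e) < c / (2 * K * L)" for y
 proof -
  have "Re (jinner \<lbrace>y, e, v\<rbrace> v) >= 0" for v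
  proof -
   have "cmod (jinner \<lbrace>y - e, e, v\<rbrace> v) <= L * norm \<lbrace>y - e, e, v\<rbrace> * norm v" by (rule L(2))
   also have "\<dots> <= L * (norm (y - e) * norm v * K) * norm v" using L(1) K by (intro mult_right_mono mult_left_mono) auto
   also have "\<dots> = norm (y - e) * (K * L * (norm v)\<^sup>2)" by (simp add: power2_eq_square)
   also have "\<dots> <= c / (2 * K * L) * (K * L * (norm v)\<^sup>2)" using y(2) K(1) L(1) by (intro mult_right_mono) auto
   also have "\<dots> = c * (norm v)\<^sup>2 / 2" using K(1) L(1) by (simp add: field_simps)
   also have "\<dots> <= Re (jinner v v) / 2" using c(2)[of v] by simp
   finally have "\<bar>Re (jinner \<lbrace>y - e, e, v\<rbrace> v)\<bar> <= Re (jinner v v) / 2" using abs_Re_le_cmod order_trans by blast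
   moreover have "jinner \<lbrace>y, e, v\<rbrace> v = jinner \<lbrace>y - e, e, v\<rbrace> v + jinner \<lbrace>e, e, v\<rbrace> v"
    by (simp add: triple_linear jinner_linear)
   ultimately show ?thesis using D_e_coercive[of v] by simp
  qed
  then show ?thesis using y(1) by (simp add: cone_def)
 qed
 then show ?thesis unfolding Omega_iff using c(1) K(1) L(1) by (intro conjI exI[of _ "c / (2 * K * L)"]) auto
qed

lemma zero_notin_Omega: "0 \<notin> Omega"
proof
 assume "0 \<in> Omega"
 then obtain d where d: "d > 0" "\<And>y. y \<in> F ==> norm (y - 0) < d ==> y \<in> cone" unfolding Omega_iff by blast
 define t where "t = - d / (2 * norm e)"
 have "t *\<^sub>R e \<in> cone" using d(1) e_nonzero by (intro d(2)) (auto simp: F_subspace t_def)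
 then have "Re (jinner \<lbrace>t *\<^sub>R e, e, e\<rbrace> e) >= 0" unfolding cone_def by blast
 then have "t * Re (jinner e e) >= 0" by (simp add: triple_linear jinner_linear)
 moreover have "t < 0" using d(1) e_nonzero by (simp add: t_def)
 ultimately show False using jinner_pos[OF e_nonzero] by (simp add: zero_le_mult_iff)
qed

lemma Omega_minus_e:
 assumes "h \<in> Omega" shows "\<exists>d>0. \<forall>t. \<bar>t\<bar> < d --> h - t *\<^sub>R e \<in> Omega"
proof -
 obtain d where d: "d > 0" "ball h d \<inter> F \<subseteq> Omega" using openin_Omega assms openin_contains_ball by metis
 have "h - t *\<^sub>R e \<in> Omega" if "\<bar>t\<bar> < d / norm e" for t
  using d(2) that e_nonzero assms by (auto simp: dist_norm field_simps F_subspace Omega_F intro!: subsetD[OF d(2)])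
 then show ?thesis using d(1) e_nonzero by (intro exI[of _ "d / norm e"]) auto
qed

end

section \<open>Holomorphic functions of several variables and the affine geometry of the
  domain\<close>

context positive_hermitian_jts
begin

subsection \<open>Holomorphic functions of several variables\<close>

lemma holomorphic_fun_const: "holomorphic_fun (%_. c) U" unfolding holomorphic_fun_def by (auto intro!: exI[of _ "%_. 0"])

lemma holomorphic_fun_linear:
 assumes "bounded_linear f" "\<And>c v. f (c *C v) = c * f v"
 shows "holomorphic_fun f U" unfolding holomorphic_fun_def using assms bounded_linear_imp_has_derivative by blast

lemma holomorphic_fun_jinner: "holomorphic_fun (%p. jinner p a) U"
 by (intro holomorphic_fun_linear bounded_bilinear.bounded_linear_left[OF bounded_bilinear_jinner])
   (simp add: jinner_linear)

lemma holomorphic_fun_add: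
 assumes "holomorphic_fun f U" "holomorphic_fun g U" shows "holomorphic_fun (%p. f p + g p) U" unfolding holomorphic_fun_def
proof
 fix p assume "p \<in> U"
 then obtain f' g' where *: "(f has_derivative f') (at p)" "\<forall>c v. f' (c *C v) = c * f' v"
  "(g has_derivative g') (at p)" "\<forall>c v. g' (c *C v) = c * g' v" using assms unfolding holomorphic_fun_def by blast
 show "\<exists>h. ((%p. f p + g p) has_derivative h) (at p) & (\<forall>c v. h (c *C v) = c * h v)"
  using * by (intro exI[of _ "%v. f' v + g' v"]) (auto intro!: derivative_intros simp: algebra_simps)
qed

lemma holomorphic_fun_mult:
 assumes "holomorphic_fun f U" "holomorphic_fun g U" shows "holomorphic_fun (%p. f p * g p) U" unfolding holomorphic_fun_def
proof
 fix p assume "p \<in> U"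
 then obtain f' g' where *: "(f has_derivative f') (at p)" "\<forall>c v. f' (c *C v) = c * f' v"
  "(g has_derivative g') (at p)" "\<forall>c v. g' (c *C v) = c * g' v" using assms unfolding holomorphic_fun_def by blast
 show "\<exists>h. ((%p. f p * g p) has_derivative h) (at p) & (\<forall>c v. h (c *C v) = c * h v)"
  using * by (intro exI[of _ "%v. f p * g' v + f' v * g p"]) (auto intro!: derivative_intros simp: algebra_simps)
qed

lemma holomorphic_fun_inverse:
 assumes "holomorphic_fun f U" "\<And>p. p \<in> U ==> f p \<noteq> 0" shows "holomorphic_fun (%p. inverse (f p)) U"
 unfolding holomorphic_fun_def
proof
 fix p assume p: "p \<in> U"
 then obtain f' where *: "(f has_derivative f') (at p)" "\<forall>c v. f' (c *C v) = c * f' v" using assms unfolding holomorphic_fun_def by blast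
 show "\<exists>h. ((%p. inverse (f p)) has_derivative h) (at p) & (\<forall>c v. h (c *C v) = c * h v)"
  by (rule exI[of _ "%v. - (inverse (f p) * f' v * inverse (f p))"], rule conjI,
    rule Deriv.has_derivative_inverse[OF assms(2)[OF p] *(1)]) (use *(2) in \<open>simp add: algebra_simps\<close>)
qed

lemma holomorphic_fun_cmult: "holomorphic_fun f U ==> holomorphic_fun (%p. c * f p) U"
 by (rule holomorphic_fun_mult[OF holomorphic_fun_const])

lemma holomorphic_fun_diff:
 assumes "holomorphic_fun f U" "holomorphic_fun g U" shows "holomorphic_fun (%p. f p - g p) U"
 using holomorphic_fun_add[OF assms(1) holomorphic_fun_cmult[OF assms(2), of "- 1"]] by simp

lemma holomorphic_fun_divide:
 assumes "holomorphic_fun f U" "holomorphic_fun g U" "\<And>p. p \<in> U ==> g p \<noteq> 0"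
 shows "holomorphic_fun (%p. f p / g p) U" unfolding divide_inverse by (intro holomorphic_fun_mult holomorphic_fun_inverse assms)

lemma holomorphic_fun_prod:
 assumes "\<And>i. i \<in> I ==> holomorphic_fun (f i) U" shows "holomorphic_fun (%p. \<Prod>i\<in>I. f i p) U"
 using assms by (induction I rule: infinite_finite_induct) (auto intro: holomorphic_fun_const holomorphic_fun_mult)

lemma holomorphic_fun_power:
 assumes "holomorphic_fun f U" shows "holomorphic_fun (%p. f p ^ n) U"
 by (induction n) (auto intro: holomorphic_fun_const holomorphic_fun_mult assms)

lemma holomorphic_fun_subset: "holomorphic_fun f U ==> V \<subseteq> U ==> holomorphic_fun f V" unfolding holomorphic_fun_def by blast

lemma holomorphic_fun_affine:
 assumes f: "holomorphic_fun f U" and L: "bounded_linear L" "\<And>c v. L (c *C v) = c *C L v"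
  and g: "\<And>p. g p = b + L p" "\<And>p. p \<in> V ==> g p \<in> U"
 shows "holomorphic_fun (%p. f (g p)) V" unfolding holomorphic_fun_def
proof
 fix p assume p: "p \<in> V"
 obtain f' where *: "(f has_derivative f') (at (g p))" "\<forall>c v. f' (c *C v) = c * f' v"
  using f g(2)[OF p] unfolding holomorphic_fun_def by blast
 have "(g has_derivative L) (at p)" unfolding g(1)[abs_def] by (auto intro!: derivative_eq_intros bounded_linear_imp_has_derivative L)
 from has_derivative_compose[OF this *(1)]
 show "\<exists>h. ((%p. f (g p)) has_derivative h) (at p) & (\<forall>c v. h (c *C v) = c * h v)"
  using *(2) L(2) by (intro exI[of _ "%v. f' (L v)"]) auto
qed

lemma holomorphic_fun_translate:
 assumes "holomorphic_fun f U" "\<And>p. p \<in> V ==> p + b \<in> U"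
 shows "holomorphic_fun (%p. f (p + b)) V"
 by (rule holomorphic_fun_affine[OF assms(1), of "%x. x" _ b]) (auto simp: assms add.commute)

lemma holomorphic_fun_cong:
 assumes "holomorphic_fun f U" "open U" "\<And>p. p \<in> U ==> g p = f p" shows "holomorphic_fun g U" unfolding holomorphic_fun_def
proof
 fix p assume p: "p \<in> U"
 obtain f' where *: "(f has_derivative f') (at p)" "\<forall>c v. f' (c *C v) = c * f' v" using assms(1) p unfolding holomorphic_fun_def by blast
 have "(g has_derivative f') (at p)" using has_derivative_transform_within_open[OF *(1) assms(2) p] assms(3) by metis
 then show "\<exists>f'. (g has_derivative f') (at p) & (\<forall>c v. f' (c *C v) = c * f' v)" using *(2) by blast
qed

lemma holomorphic_fun_continuous: "holomorphic_fun f U ==> continuous_on U f" unfolding holomorphic_fun_def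
 by (meson continuous_at_imp_continuous_on has_derivative_continuous)

text \<open>Reduction to one variable: on a complex line, a complex-linear derivative is
  multiplication by a number.\<close>

lemma holomorphic_fun_line:
 assumes "holomorphic_fun f U" "\<And>w. w \<in> S ==> p + w *C v \<in> U"
 shows "(%w. f (p + w *C v)) holomorphic_on S"
proof -
 have "\<exists>d. ((%w. f (p + w *C v)) has_field_derivative d) (at w)" if "w \<in> S" for w
 proof -
  obtain f' where *: "(f has_derivative f') (at (p + w *C v))" "\<forall>c v. f' (c *C v) = c * f' v"
   using assms(1) assms(2)[OF \<open>w \<in> S\<close>] unfolding holomorphic_fun_def by blast
  have "((%w. p + w *C v) has_derivative (%w. w *C v)) (at w)" by (auto intro!: derivative_eq_intros bounded_linear_imp_has_derivative
     bounded_bilinear.bounded_linear_left[OF bounded_bilinear_scaleC])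
  from has_derivative_compose[OF this *(1)]
  have "((%w. f (p + w *C v)) has_derivative (%x. x * f' v)) (at w)" using *(2) by simp
  moreover have "(%x. x * f' v) = (*) (f' v)" by (auto simp: mult.commute)
  ultimately show ?thesis unfolding has_field_derivative_def by auto
 qed
 then show ?thesis by (intro holomorphic_onI) (metis field_differentiable_at_within field_differentiable_def)
qed

end

context symmetric_siegel
begin

subsection \<open>Geometry of the Siegel domain\<close>

text \<open>Im z - Phi(\<zeta>). The domain is where it lies in \<open>Omega\<close>, the boundary
  where it vanishes, so an affine map is judged by its effect on it.\<close>

definition height :: "'a => 'a" where
 "height p = prG p - Phi (prE p) (prE p)"

lemma dom_iff: "p \<in> dom \<longleftrightarrow> height p \<in> Omega"
proof
 assume "p \<in> dom"
 then show "height p \<in> Omega" by (auto simp: dom_def height_def)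
next
 assume *: "height p \<in> Omega"
 show "p \<in> dom" unfolding dom_def by (rule CollectI, rule exI[of _ "prE p"], rule exI[of _ "prF p"], rule exI[of _ "prG p"])
    (use * in \<open>simp add: height_def point_pr\<close>)
qed

lemma bdom_iff: "p \<in> bdom \<longleftrightarrow> height p = 0"
proof
 assume "p \<in> bdom"
 then show "height p = 0" by (auto simp: bdom_def height_def)
next
 assume *: "height p = 0"
 show "p \<in> bdom" unfolding bdom_def by (rule CollectI, rule exI[of _ "prE p"], rule exI[of _ "prF p"])
    (use * point_pr[of p] in \<open>simp add: height_def\<close>)
qed

lemma height_F [simp]: "height p \<in> F" by (simp add: height_def F_subspace)

lemma continuous_height [continuous_intros]: "continuous_on S f ==> continuous_on S (%x. height (f x))"
 unfolding height_def by (intro continuous_intros)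

lemma height_up [simp]: "h \<in> F ==> height (p + \<i> *C h) = height p + h" by (simp add: height_def pr_add)

lemma height_real [simp]: "x \<in> F ==> height (p + x) = height p" by (simp add: height_def pr_add)

lemma open_dom: "open dom"
proof -
 obtain U where U: "open U" "Omega = F \<inter> U" using openin_Omega by (auto simp: openin_open)
 have "dom = height -` U" using U(2) dom_iff by auto
 then show ?thesis using open_vimage[OF U(1) continuous_height[OF continuous_on_id]] by simp
qed

lemma closed_bdom: "closed bdom"
proof -
 have "bdom = height -` {0}" using bdom_iff by auto
 then show ?thesis using closed_vimage[OF closed_singleton[of 0] continuous_height[OF continuous_on_id]] by simp
qed

lemma borel_dom [measurable]: "dom \<in> sets borel" and borel_bdom [measurable]: "bdom \<in> sets borel" using open_dom closed_bdom by auto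

lemma zero_in_cone [simp]: "0 \<in> cone" by (simp add: cone_def F_subspace)

lemma e_in_cone [simp]: "t >= 0 ==> t *\<^sub>R e \<in> cone" using cone_scaleR[OF Omega_cone[OF e_mem_Omega]] by simp

lemma e_in_Omega [simp]: "t > 0 ==> t *\<^sub>R e \<in> Omega" by (simp add: Omega_scaleR)

lemma cone_F: "x \<in> cone ==> x \<in> F" by (simp add: cone_def)

lemma bdom_disjoint_dom: "p \<in> bdom ==> p \<notin> dom" using zero_notin_Omega by (simp add: bdom_iff dom_iff)

lemma bdom_up: "q \<in> bdom ==> h \<in> Omega ==> q + \<i> *C h \<in> dom" by (simp add: bdom_iff dom_iff Omega_F)

lemma dom_up: "p \<in> dom ==> h \<in> cone ==> p + \<i> *C h \<in> dom" by (simp add: dom_iff Omega_add cone_F)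

lemma dom_real: "p \<in> dom ==> x \<in> F ==> p + x \<in> dom" by (simp add: dom_iff)

text \<open>Since e lies in \<open>Omega\<close>, this translation carries \<open>bdom\<close> into
  \<open>dom\<close> for t > 0; it serves as the inward normal direction.\<close>

definition up :: "real => 'a => 'a" where "up t p = p + \<i> *C (t *\<^sub>R e)"

lemma up_0 [simp]: "up 0 p = p" by (simp add: up_def)

lemma up_up [simp]: "up s (up t p) = up (s + t) p" by (simp add: up_def scaleR_left_distrib scale_right_distrib add_ac)

lemma up_eq: "up t p = p + complex_of_real t *C (\<i> *C e)" by (simp add: up_def scaleR_eq mult.commute)

lemma up_dom: "p \<in> dom \<or> p \<in> bdom ==> t > 0 ==> up t p \<in> dom" using dom_up bdom_up by (auto simp: up_def)

lemma up_dom': "p \<in> dom ==> t >= 0 ==> up t p \<in> dom" using dom_up by (auto simp: up_def)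

lemma height_up' [simp]: "height (up t p) = height p + t *\<^sub>R e" by (simp add: up_def F_subspace)

lemma down_dom:
 assumes "p \<in> dom" shows "\<exists>d>0. \<forall>t. \<bar>t\<bar> < d --> up (- t) p \<in> dom"
 using Omega_minus_e[of "height p"] assms by (simp add: dom_iff)

lemma continuous_up [continuous_intros]:
 "continuous_on S f ==> continuous_on S g ==> continuous_on S (%x. up (f x) (g x))" unfolding up_def by (intro continuous_intros)

lemma base_point: "point 0 0 e = up 1 0" "up 1 0 \<in> dom" "0 \<in> bdom"
proof -
 have "prE 0 = 0" "prG 0 = 0" using pr_scaleR[of 0 0] by auto
 then show 0: "0 \<in> bdom" by (simp add: bdom_iff height_def)
 show "up 1 0 \<in> dom" using up_dom[of 0 1] 0 by simp
 show "point 0 0 e = up 1 0" by (simp add: point_def up_def)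
qed

text \<open>The group of affine automorphisms acting simply transitively on \<open>bdom\<close>.\<close>

definition heis :: "'a => 'a => 'a => 'a" where
 "heis a x p = p + (a + x) + \<i> *C (2 *\<^sub>R Phi (prE p) a + Phi a a)"

lemma heis_0 [simp]: "heis 0 0 p = p" by (simp add: heis_def)

lemma heis_real: "heis 0 x p = p + x" by (simp add: heis_def)

lemma prE_Phi [simp]: "a \<in> E ==> b \<in> E ==> prE (Phi a b) = 0" "a \<in> E ==> b \<in> E ==> prE (\<i> *C Phi a b) = 0"
 using pr_i1(3)[OF Phi_1] by (simp_all add: prE_scale)

text \<open>The vector 2 Phi(\<zeta>, a) need not lie in F. Its real part adds Phi(\<zeta>, a) +
  Phi(a, \<zeta>) to the imaginary coordinate, exactly the mixed terms of Phi(\<zeta> + a), so that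
  \<open>height\<close> is preserved.\<close>

lemma heis_pr:
 assumes "a \<in> E" "x \<in> F"
 shows "prE (heis a x p) = prE p + a"
  "prG (heis a x p) = prG p + (Phi (prE p) a + Phi a (prE p)) + Phi a a"
  "prF (heis a x p) = prF p + (x - 2 *\<^sub>R prG (Phi (prE p) a))"
proof -
 let ?w = "2 *\<^sub>R Phi (prE p) a + Phi a a"
 have *: "\<lbrace>e, e, ?w\<rbrace> = ?w" using assms Phi_1 by (simp add: triple_linear)
 show "prE (heis a x p) = prE p + a" using assms pr_i1(3)[OF *] prE_scale[of \<i> ?w] by (simp add: heis_def pr_add)
 show "prG (heis a x p) = prG p + (Phi (prE p) a + Phi a (prE p)) + Phi a a"
  using assms pr_i1(1)[OF *] prF_Phi[of "prE p" a] by (simp add: heis_def pr_add pr_scaleR)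
 show "prF (heis a x p) = prF p + (x - 2 *\<^sub>R prG (Phi (prE p) a))"
  using assms pr_i1(2)[OF *] by (simp add: heis_def pr_add pr_scaleR algebra_simps)
qed

lemma height_heis [simp]: "a \<in> E ==> x \<in> F ==> height (heis a x p) = height p" by (simp add: height_def heis_pr Phi_add)

lemma heis_inverse:
 assumes "a \<in> E" "x \<in> F" shows "heis (- a) (- x) (heis a x p) = p"
proof -
 have "heis (- a) (- x) (heis a x p) = heis a x p + (- a - x) + \<i> *C (2 *\<^sub>R Phi (prE p + a) (- a) + Phi a a)"
  using assms by (simp add: heis_def[of "- a"] heis_pr Phi_minus)
 then show ?thesis by (simp add: heis_def Phi_add Phi_minus scale_right_distrib scale_right_diff_distrib scaleR_2)
qed

lemma heis_up [simp]: "a \<in> E ==> x \<in> F ==> heis a x (up t p) = up t (heis a x p)" by (simp add: heis_def up_def pr_add F_subspace)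

lemma heis_upF: "a \<in> E ==> x \<in> F ==> h \<in> F ==> heis a x (p + \<i> *C h) = heis a x p + \<i> *C h" by (simp add: heis_def pr_add)

lemma heis_dom [simp]: "a \<in> E ==> x \<in> F ==> heis a x p \<in> dom \<longleftrightarrow> p \<in> dom" by (simp add: dom_iff)

lemma heis_bdom [simp]: "a \<in> E ==> x \<in> F ==> heis a x p \<in> bdom \<longleftrightarrow> p \<in> bdom" by (simp add: bdom_iff)

lemma heis_to_base:
 assumes "q \<in> bdom" shows "heis (prE q) (prF q) 0 = q"
proof -
 have "prG q = Phi (prE q) (prE q)" using assms by (simp add: bdom_iff height_def)
 moreover have "prE 0 = 0" using pr_scaleR[of 0 0] by auto
 ultimately show ?thesis using point_pr[of q] by (simp add: heis_def point_def add.assoc)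
qed

lemma continuous_heis [continuous_intros]:
 "continuous_on S f ==> continuous_on S g ==> continuous_on S k ==> continuous_on S (%x. heis (f x) (g x) (k x))"
 unfolding heis_def by (intro continuous_intros)

text \<open>The variable enters \<open>Phi\<close> in its complex linear argument, so the map is
  complex affine.\<close>

lemma holomorphic_fun_heis:
 assumes "holomorphic_fun f dom" "a \<in> E" "x \<in> F"
 shows "holomorphic_fun (%p. f (heis a x p)) dom"
proof (rule holomorphic_fun_affine[OF assms(1), where b = "a + x + \<i> *C Phi a a" and L = "%p. p + (2 * \<i>) *C Phi (prE p) a"])
 show "bounded_linear (%p. p + (2 * \<i>) *C Phi (prE p) a)" unfolding linear_conv_bounded_linear[symmetric]
  by (auto intro!: linearI simp: pr_add pr_scaleR Phi_add scale_right_distrib scaleR_right_distrib)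
    (simp add: scaleR_eq Phi_scale mult.commute)
 show "c *C v + (2 * \<i>) *C Phi (prE (c *C v)) a = c *C (v + (2 * \<i>) *C Phi (prE v) a)" for c v
  by (simp add: prE_scale Phi_scale scale_right_distrib mult_ac)
 show "heis a x p = a + x + \<i> *C Phi a a + (p + (2 * \<i>) *C Phi (prE p) a)" for p
  by (simp add: heis_def scale_right_distrib scaleR_eq mult.commute add_ac)
qed (use assms in simp)

subsection \<open>A decaying holomorphic function\<close>

lemma jinner_square_e: "y \<in> F ==> jinner \<lbrace>y, e, y\<rbrace> e = jinner y y" using jinner_assoc[of y e y e] by (simp add: F_iff)

lemma jinner_Phi_e: "\<zeta> \<in> E ==> jinner (Phi \<zeta> \<zeta>) e = jinner \<zeta> \<zeta>"
 using jinner_assoc[of e \<zeta> \<zeta> e] triple_commute[of e \<zeta> \<zeta>] triple_commute[of \<zeta> e e]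
 by (simp add: Phi_def E_iff jinner_linear mult.commute)

lemma jinner_E_F: "\<zeta> \<in> E ==> x \<in> F ==> jinner \<zeta> x = 0"
 using jinner_assoc[of e e \<zeta> x] by (simp add: E_iff F_iff jinner_linear)

lemma jinner_F_real:
 assumes "x \<in> F" "y \<in> F" shows "Im (jinner x y) = 0"
proof -
 have "jinner x y = jinner e \<lbrace>e, x, y\<rbrace>" using assms jinner_assoc[of e x e y] D_F_commute[OF assms(1), of y] by (simp add: F_iff)
 moreover have "jinner y x = jinner e \<lbrace>e, x, y\<rbrace>"
  using assms jinner_assoc[of e y e x] D_F_commute[OF assms(1), of y] D_F_commute[OF assms(2), of x]
   triple_commute[of x e y] by (simp add: F_iff)
 ultimately show ?thesis using jinner_cnj[of x y] by (metis complex_cnj_cnj cnj.simps(2) equal_neg_zero)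
qed

text \<open>The vectors of A represent linear forms that are nonnegative on the cone, definite on
  the values of \<open>Phi\<close>, and jointly large on F. They are the data of the peak function
  \<open>Psi\<close>.\<close>

definition separating :: "'a set => real => bool" where
 "separating A c \<longleftrightarrow> finite A & A \<noteq> {} & A \<subseteq> F & c > 0 & (\<forall>a\<in>A. \<forall>y\<in>cone. 0 <= Re (jinner y a)) &
  (\<forall>a\<in>A. \<forall>\<zeta>\<in>E. c * (norm \<zeta>)\<^sup>2 <= Re (jinner (Phi \<zeta> \<zeta>) a)) &
  (\<forall>x\<in>F. \<exists>a\<in>A. c * norm x <= \<bar>Re (jinner x a)\<bar>)"

text \<open>The form given by e takes a square of y to \<open>jinner y y\<close> and
  \<open>Phi \<zeta> \<zeta>\<close> to \<open>jinner \<zeta> \<zeta>\<close>. Small perturbations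
  of e retain half of this positivity, and their differences from e span F.\<close>

lemma separating_exists: "\<exists>A c. separating A c"
proof -
 obtain c where c: "c > 0" "\<And>x. c * (norm x)\<^sup>2 <= Re (jinner x x)" using jinner_coercive by blast
 obtain L where L: "L > 0" "\<And>x y. cmod (jinner x y) <= L * norm x * norm y" using jinner_bound by blast
 obtain K where K: "K > 0" "\<And>x v. norm \<lbrace>x, e, v\<rbrace> <= norm x * norm v * K"
  using bounded_bilinear.pos_bounded[OF bounded_bilinear_triple13] by blast
 obtain M where M: "M > 0" "\<And>x y. norm (Phi x y) <= norm x * norm y * M" using bounded_bilinear.pos_bounded[OF bounded_bilinear_Phi] by blast
 obtain N where N: "N > 0" "\<And>x. norm (prF x) <= norm x * N" using bounded_linear.pos_bounded[OF bounded_linear_pr(2)] by blast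
 \<comment> \<open>Chosen so that d times the pairing with any \<open>prF b\<close> is at most half
   of the form: L bounds \<open>jinner\<close>, N bounds \<open>prF\<close>, and K + M covers both
   squares and values of \<open>Phi\<close>.\<close>
 define d where "d = c / (2 * L * (K + M) * N)"
 have d: "d > 0" using c(1) L(1) K(1) M(1) N(1) by (simp add: d_def)
 have small: "\<bar>d * Re (jinner u (prF b))\<bar> <= Re (jinner y y) / 2"
  if "norm u <= (K + M) * (norm y)\<^sup>2" "b \<in> Basis" for u y b
 proof -
  have "norm (prF b) <= N" using N(2)[of b] that(2) by simp
  have "\<bar>Re (jinner u (prF b))\<bar> <= L * norm u * norm (prF b)" using L(2)[of u "prF b"] abs_Re_le_cmod order_trans by blast
  also have "\<dots> <= L * ((K + M) * (norm y)\<^sup>2) * N"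
   using that(1) \<open>norm (prF b) <= N\<close> L(1) K(1) M(1) by (intro mult_mono) auto
  finally have "d * \<bar>Re (jinner u (prF b))\<bar> <= d * (L * ((K + M) * (norm y)\<^sup>2) * N)" using d by (intro mult_left_mono) auto
  also have "\<dots> = (d * (2 * L * (K + M) * N)) * (norm y)\<^sup>2 / 2" by simp
  also have "\<dots> = c * (norm y)\<^sup>2 / 2" using K(1) M(1) L(1) N(1) by (simp add: d_def)
  also have "\<dots> <= Re (jinner y y) / 2" using c(2)[of y] by simp
  finally show ?thesis using d by (simp add: abs_mult)
 qed
 define A where "A = insert e ((%b. e + d *\<^sub>R prF b) ` Basis)"
 \<comment> \<open>c / 2 is the definiteness kept on E; the other term is what remains on F after
   division by d and summation over the basis.\<close>
 define k where "k = min (c / 2) (d * c / (2 * DIM('a)))"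
 have "0 <= Re (jinner y a)" if "a \<in> A" "y \<in> cone" for a y
 proof -
  obtain z where z: "z \<in> F" "y = \<lbrace>z, e, z\<rbrace>" using cone_square[OF \<open>y \<in> cone\<close>] by blast
  have "norm y <= K * (norm z)\<^sup>2" using K(2)[of z z] z(2) by (simp add: power2_eq_square mult_ac)
  also have "\<dots> <= (K + M) * (norm z)\<^sup>2" using M(1) by (intro mult_right_mono) auto
  finally have "norm y <= (K + M) * (norm z)\<^sup>2" .
  from small[OF this] have "\<bar>d * Re (jinner y (prF b))\<bar> <= Re (jinner z z) / 2" if "b \<in> Basis" for b using that by blast
  then show ?thesis using that(1) jinner_square_e[OF z(1)] jinner_nonneg[of z] z(2) by (fastforce simp: A_def jinner_linear)
 qed
 moreover have "k * (norm \<zeta>)\<^sup>2 <= Re (jinner (Phi \<zeta> \<zeta>) a)" if "a \<in> A" "\<zeta> \<in> E" for a \<zeta>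
 proof -
  have "norm (Phi \<zeta> \<zeta>) <= M * (norm \<zeta>)\<^sup>2" using M(2)[of \<zeta> \<zeta>] by (simp add: power2_eq_square mult_ac)
  also have "\<dots> <= (K + M) * (norm \<zeta>)\<^sup>2" using K(1) by (intro mult_right_mono) auto
  finally have "norm (Phi \<zeta> \<zeta>) <= (K + M) * (norm \<zeta>)\<^sup>2" .
  from small[OF this] have *: "\<bar>d * Re (jinner (Phi \<zeta> \<zeta>) (prF b))\<bar> <= Re (jinner \<zeta> \<zeta>) / 2" if "b \<in> Basis" for b
   using that by blast
  have "k * (norm \<zeta>)\<^sup>2 <= c / 2 * (norm \<zeta>)\<^sup>2" by (intro mult_right_mono) (auto simp: k_def)
  also have "\<dots> <= Re (jinner \<zeta> \<zeta>) / 2" using c(2)[of \<zeta>] by simp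
  also have "\<dots> <= Re (jinner (Phi \<zeta> \<zeta>) a)"
   using that(1) jinner_Phi_e[OF that(2)] jinner_nonneg[of \<zeta>] * by (fastforce simp: A_def jinner_linear)
  finally show ?thesis .
 qed
 moreover have "\<exists>a\<in>A. k * norm x <= \<bar>Re (jinner x a)\<bar>" if x: "x \<in> F" for x
 proof (rule ccontr)
  assume "\<not> ?thesis"
  then have *: "\<bar>Re (jinner x a)\<bar> < k * norm x" if "a \<in> A" for a using that by force
  have k0: "k >= 0" using c(1) d by (simp add: k_def)
  have b: "\<bar>Re (jinner x (prF b))\<bar> < c * norm x / DIM('a)" if b: "b \<in> Basis" for b
  proof -
   have mem: "e + d *\<^sub>R prF b \<in> A" "e \<in> A" using b unfolding A_def by blast+
   \<comment> \<open>Two members of A differ by d times \<open>prF b\<close>; if both forms are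
     small at x, then so is this coordinate.\<close>
   have "d * \<bar>Re (jinner x (prF b))\<bar> = \<bar>Re (jinner x (e + d *\<^sub>R prF b)) - Re (jinner x e)\<bar>"
    using d by (simp add: jinner_linear abs_mult)
   also have "\<dots> < 2 * (k * norm x)" using *[OF mem(1)] *[OF mem(2)] by linarith
   also have "\<dots> <= 2 * (d * c / (2 * DIM('a)) * norm x)" by (intro mult_left_mono mult_right_mono) (auto simp: k_def)
   also have "\<dots> = d * (c * norm x / DIM('a))" by simp
   finally show ?thesis using d by (simp only: mult_less_cancel_left_pos)
  qed
  have x0: "norm x > 0" using *[of e] k0 by (auto simp: A_def)
  have "x = prF (\<Sum>b\<in>Basis. (x \<bullet> b) *\<^sub>R b)" using x by (simp add: euclidean_representation)
  also have "\<dots> = (\<Sum>b\<in>Basis. (x \<bullet> b) *\<^sub>R prF b)"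
   by (simp add: linear_sum[OF bounded_linear.linear[OF bounded_linear_pr(2)]] pr_scaleR)
  finally have "Re (jinner x x) = Re (jinner x (\<Sum>b\<in>Basis. (x \<bullet> b) *\<^sub>R prF b))" by simp
  then have eq: "Re (jinner x x) = (\<Sum>b\<in>Basis. (x \<bullet> b) * Re (jinner x (prF b)))" by (simp add: jinner_sum jinner_linear)
  have "Re (jinner x x) <= (\<Sum>b\<in>Basis. norm x * \<bar>Re (jinner x (prF b))\<bar>)" unfolding eq
  proof (rule sum_mono)
   fix b :: 'a assume "b \<in> Basis"
   then have "\<bar>x \<bullet> b\<bar> * \<bar>Re (jinner x (prF b))\<bar> <= norm x * \<bar>Re (jinner x (prF b))\<bar>"
    by (intro mult_right_mono Basis_le_norm) auto
   then show "(x \<bullet> b) * Re (jinner x (prF b)) <= norm x * \<bar>Re (jinner x (prF b))\<bar>"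
    using abs_ge_self[of "(x \<bullet> b) * Re (jinner x (prF b))"] by (simp add: abs_mult)
  qed
  also have "\<dots> < (\<Sum>b\<in>(Basis::'a set). norm x * (c * norm x / DIM('a)))"
   using b x0 by (intro sum_strict_mono mult_strict_left_mono) auto
  also have "\<dots> = c * (norm x)\<^sup>2" by (simp add: power2_eq_square)
  finally show False using c(2)[of x] by simp
 qed
 moreover have "finite A" "A \<noteq> {}" "A \<subseteq> F" by (auto simp: A_def F_subspace)
 moreover have "k > 0" using c(1) d by (simp add: k_def)
 ultimately have "separating A k" unfolding separating_def by blast
 then show ?thesis by blast
qed

text \<open>A peak function: holomorphic, of modulus at most 1 up to the boundary, equal to 1 at 0
  and decaying in all directions of E and F. It provides nonzero Hardy functions and the approximate
  identity.\<close>

definition Psi :: "'a set => 'a => complex" where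
 "Psi A p = (\<Prod>a\<in>A. \<i> / (jinner p a + \<i>))"

lemma jinner_pr:
 assumes "a \<in> F" shows "Re (jinner p a) = Re (jinner (prF p) a)" "Im (jinner p a) = Re (jinner (prG p) a)"
 by (subst point_pr[of p, symmetric], simp add: point_def jinner_linear jinner_E_F jinner_F_real assms)+

lemma Psi_Im:
 assumes A: "separating A c" "a \<in> A" and p: "height p \<in> cone"
 shows "Im (jinner p a) >= c * (norm (prE p))\<^sup>2"
proof -
 have "prG p = height p + Phi (prE p) (prE p)" by (simp add: height_def)
 then have "Im (jinner p a) = Re (jinner (height p) a) + Re (jinner (Phi (prE p) (prE p)) a)"
  using A jinner_pr(2)[of a p] by (auto simp: separating_def jinner_linear)
 moreover have "Re (jinner (height p) a) >= 0" "Re (jinner (Phi (prE p) (prE p)) a) >= c * (norm (prE p))\<^sup>2"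
  using A p unfolding separating_def by auto
 ultimately show ?thesis by simp
qed

text \<open>The imaginary part of \<open>jinner p a\<close> is nonnegative, so (1 + Im)^2 is at
  least 1 + 2 Im; this linear term retains the decay along E.\<close>

lemma Psi_factor:
 assumes A: "separating A c" "a \<in> A" and p: "height p \<in> cone"
 shows "cmod (jinner p a + \<i>) >= 1" "(cmod (jinner p a + \<i>))\<^sup>2 >= 1 + (Re (jinner (prF p) a))\<^sup>2 + 2 * c * (norm (prE p))\<^sup>2"
  "cmod (\<i> / (jinner p a + \<i>)) <= 1"
proof -
 have c: "c > 0" using A by (simp add: separating_def)
 have aF: "a \<in> F" using A by (auto simp: separating_def)
 define y where "y = Im (jinner p a)"
 have y: "y >= c * (norm (prE p))\<^sup>2" using Psi_Im[OF A p] by (simp add: y_def)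
 moreover have "c * (norm (prE p))\<^sup>2 >= 0" using c by simp
 ultimately have y0: "y >= 0" by linarith
 have "(cmod (jinner p a + \<i>))\<^sup>2 = (Re (jinner (prF p) a))\<^sup>2 + (1 + y)\<^sup>2"
  by (simp add: cmod_power2 jinner_pr(1)[OF aF, of p] y_def add.commute)
 moreover have "(1 + y)\<^sup>2 >= 1 + 2 * y" by (simp add: power2_sum)
 ultimately show *: "(cmod (jinner p a + \<i>))\<^sup>2 >= 1 + (Re (jinner (prF p) a))\<^sup>2 + 2 * c * (norm (prE p))\<^sup>2" using y by simp
 have "2 * c * (norm (prE p))\<^sup>2 >= 0" using c by simp
 then have "(cmod (jinner p a + \<i>))\<^sup>2 >= 1\<^sup>2" using * zero_le_power2[of "Re (jinner (prF p) a)"] unfolding one_power2 by linarith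
 then show 1: "cmod (jinner p a + \<i>) >= 1" by (rule power2_le_imp_le) simp
 then show "cmod (\<i> / (jinner p a + \<i>)) <= 1" by (simp add: norm_divide divide_le_eq)
qed

text \<open>One factor supplies the decay while all others have modulus at most 1. For the decay
  along F it is the factor whose form detects \<open>prF p\<close>.\<close>

lemma Psi_bound:
 assumes A: "separating A c" and p: "height p \<in> cone"
 shows "cmod (Psi A p) <= 1" "(cmod (Psi A p))\<^sup>2 * (1 + c\<^sup>2 * (norm (prF p))\<^sup>2) <= 1"
  "(cmod (Psi A p))\<^sup>2 * (1 + 2 * c * (norm (prE p))\<^sup>2) <= 1" "Psi A p \<noteq> 0"
proof -
 have c: "c > 0" using A by (simp add: separating_def)
 have fin: "finite A" using A by (simp add: separating_def)
 have le: "(cmod (Psi A p))\<^sup>2 * (1 + (Re (jinner (prF p) a))\<^sup>2 + 2 * c * (norm (prE p))\<^sup>2) <= 1" if a: "a \<in> A" for a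
 proof -
  have "cmod (Psi A p) = cmod (\<i> / (jinner p a + \<i>)) * cmod (\<Prod>b\<in>A - {a}. \<i> / (jinner p b + \<i>))"
   unfolding Psi_def by (subst prod.remove[OF fin a]) (rule norm_mult)
  also have "\<dots> <= cmod (\<i> / (jinner p a + \<i>)) * 1" unfolding prod_norm[symmetric] using Psi_factor(3)[OF A _ p]
   by (intro mult_left_mono prod_le_1) auto
  finally have "cmod (Psi A p) <= cmod (\<i> / (jinner p a + \<i>))" by simp
  then have "(cmod (Psi A p))\<^sup>2 <= (cmod (\<i> / (jinner p a + \<i>)))\<^sup>2" by (intro power_mono) auto
  also have "\<dots> = 1 / (cmod (jinner p a + \<i>))\<^sup>2" by (simp add: norm_divide power_divide)
  finally have le1: "(cmod (Psi A p))\<^sup>2 <= 1 / (cmod (jinner p a + \<i>))\<^sup>2" .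
  have pos: "0 < 1 + (Re (jinner (prF p) a))\<^sup>2 + 2 * c * (norm (prE p))\<^sup>2" using c by (intro add_pos_nonneg) auto
  note le1
  also have "1 / (cmod (jinner p a + \<i>))\<^sup>2 <= 1 / (1 + (Re (jinner (prF p) a))\<^sup>2 + 2 * c * (norm (prE p))\<^sup>2)"
   using Psi_factor(2)[OF A a p] pos order.strict_trans2[OF pos Psi_factor(2)[OF A a p]] by (intro divide_left_mono mult_pos_pos) auto
  finally show ?thesis unfolding pos_le_divide_eq[OF pos] .
 qed
 have "cmod (Psi A p) <= 1" unfolding Psi_def prod_norm[symmetric] using Psi_factor(3)[OF A _ p] by (intro prod_le_1) auto
 then show "cmod (Psi A p) <= 1" .
 have sq: "(cmod (Psi A p))\<^sup>2 >= 0" by simp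
 obtain a where a: "a \<in> A" "c * norm (prF p) <= \<bar>Re (jinner (prF p) a)\<bar>" using A unfolding separating_def by (metis prF_mem)
 have "(c * norm (prF p))\<^sup>2 <= \<bar>Re (jinner (prF p) a)\<bar>\<^sup>2" using a(2) c by (intro power_mono) auto
 then have "1 + c\<^sup>2 * (norm (prF p))\<^sup>2 <= 1 + (Re (jinner (prF p) a))\<^sup>2 + 2 * c * (norm (prE p))\<^sup>2"
  using c by (simp add: power_mult_distrib add_increasing2)
 from mult_left_mono[OF this sq] show "(cmod (Psi A p))\<^sup>2 * (1 + c\<^sup>2 * (norm (prF p))\<^sup>2) <= 1" using le[OF a(1)] by simp
 have "1 + 2 * c * (norm (prE p))\<^sup>2 <= 1 + (Re (jinner (prF p) a))\<^sup>2 + 2 * c * (norm (prE p))\<^sup>2" by simp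
 from mult_left_mono[OF this sq] show "(cmod (Psi A p))\<^sup>2 * (1 + 2 * c * (norm (prE p))\<^sup>2) <= 1" using le[OF a(1)] by simp
 have "jinner p a + \<i> \<noteq> 0" if "a \<in> A" for a using Psi_factor(1)[OF A that p] by auto
 then show "Psi A p \<noteq> 0" unfolding Psi_def using fin by (auto simp: prod_zero_iff)
qed

lemma holomorphic_Psi:
 assumes A: "separating A c" shows "holomorphic_fun (Psi A) dom"
proof -
 have "jinner p a + \<i> \<noteq> 0" if "p \<in> dom" "a \<in> A" for p a
  using Psi_factor(1)[OF A that(2), of p] that(1) Omega_cone by (fastforce simp: dom_iff)
 then show ?thesis unfolding Psi_def[abs_def]
  by (intro holomorphic_fun_prod holomorphic_fun_divide holomorphic_fun_const holomorphic_fun_add holomorphic_fun_jinner) auto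
qed

lemma continuous_Psi:
 assumes A: "separating A c" shows "continuous_on (dom \<union> bdom) (Psi A)"
proof -
 have "jinner p a + \<i> \<noteq> 0" if "p \<in> dom \<union> bdom" "a \<in> A" for p a
 proof -
  have "height p \<in> cone" using that(1) Omega_cone by (auto simp: dom_iff bdom_iff)
  then show ?thesis using Psi_factor(1)[OF A that(2), of p] by fastforce
 qed
 then show ?thesis unfolding Psi_def[abs_def] by (intro continuous_intros) auto
qed

lemma Psi_0 [simp]: "Psi A 0 = 1" by (simp add: Psi_def)

end

subsection \<open>Translation-invariant measures\<close>

lemma sigma_finite_cball:
 fixes M :: "'a::euclidean_space measure"
 assumes "sets M = sets borel" "\<And>n::nat. emeasure M (cball 0 (real n)) < \<infinity>"
 shows "sigma_finite_measure M"
proof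
 have "(\<Union>n::nat. cball 0 (real n)) = (UNIV :: 'a set)" by (auto simp: real_arch_simple)
 then show "\<exists>A. countable A & A \<subseteq> sets M & \<Union> A = space M & (\<forall>a\<in>A. emeasure M a \<noteq> \<infinity>)"
  using assms sets_eq_imp_space_eq[OF assms(1)] by (intro exI[of _ "range (%n::nat. cball 0 (real n))"]) (auto simp: less_top)
qed

text \<open>The uniqueness proof for Haar measure: integrate f(x + y) g(y) over both measures and
  use invariance in each variable in turn.\<close>

lemma translation_invariant_exchange:
 fixes M N :: "'a::euclidean_space measure"
 assumes [measurable_cong]: "sets M = sets borel" "sets N = sets borel"
  and fin: "sigma_finite_measure M" "sigma_finite_measure N"
  and M: "\<And>a (f :: 'a => ennreal). f \<in> borel_measurable borel ==> (\<integral>\<^sup>+x. f (x + a) \<partial>M) = (\<integral>\<^sup>+x. f x \<partial>M)"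
  and N: "\<And>a (f :: 'a => ennreal). f \<in> borel_measurable borel ==> (\<integral>\<^sup>+x. f (x + a) \<partial>N) = (\<integral>\<^sup>+x. f x \<partial>N)"
  and [measurable]: "f \<in> borel_measurable borel" "g \<in> borel_measurable borel"
 shows "(\<integral>\<^sup>+x. f x \<partial>M) * (\<integral>\<^sup>+x. g x \<partial>N) = (\<integral>\<^sup>+x. f x \<partial>N) * (\<integral>\<^sup>+x. g (- x) \<partial>M)"
proof -
 interpret P: pair_sigma_finite M N using fin by (simp add: pair_sigma_finite_def)
 have "(\<integral>\<^sup>+x. f x \<partial>M) * (\<integral>\<^sup>+x. g x \<partial>N) = (\<integral>\<^sup>+y. (\<integral>\<^sup>+x. f x \<partial>M) * g y \<partial>N)"
  by (simp add: nn_integral_cmult)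
 also have "\<dots> = (\<integral>\<^sup>+y. (\<integral>\<^sup>+x. f (x + y) * g y \<partial>M) \<partial>N)" by (simp add: nn_integral_multc M)
 also have "\<dots> = (\<integral>\<^sup>+x. (\<integral>\<^sup>+y. f (x + y) * g y \<partial>N) \<partial>M)" by (rule P.Fubini') measurable
 also have "\<dots> = (\<integral>\<^sup>+x. (\<integral>\<^sup>+y. f y * g (y - x) \<partial>N) \<partial>M)"
 proof (rule nn_integral_cong)
  fix x
  show "(\<integral>\<^sup>+y. f (x + y) * g y \<partial>N) = (\<integral>\<^sup>+y. f y * g (y - x) \<partial>N)"
   using N[of "%y. f y * g (y - x)" x] by (simp add: add.commute)
 qed
 also have "\<dots> = (\<integral>\<^sup>+y. (\<integral>\<^sup>+x. f y * g (y - x) \<partial>M) \<partial>N)"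
  by (rule P.Fubini'[symmetric]) measurable
 also have "\<dots> = (\<integral>\<^sup>+y. f y * (\<integral>\<^sup>+x. g (- x) \<partial>M) \<partial>N)"
 proof (rule nn_integral_cong)
  fix y
  have "(\<integral>\<^sup>+x. g (- (x + (- y))) \<partial>M) = (\<integral>\<^sup>+x. g (- x) \<partial>M)" by (rule M) measurable
  then show "(\<integral>\<^sup>+x. f y * g (y - x) \<partial>M) = f y * (\<integral>\<^sup>+x. g (- x) \<partial>M)" by (simp add: nn_integral_cmult)
 qed
 also have "\<dots> = (\<integral>\<^sup>+x. f x \<partial>N) * (\<integral>\<^sup>+x. g (- x) \<partial>M)" by (rule nn_integral_multc) measurable
 finally show ?thesis .
qed

lemma nn_integral_lborel_translate:
 fixes f :: "'a::euclidean_space => ennreal"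
 assumes [measurable]: "f \<in> borel_measurable borel"
 shows "(\<integral>\<^sup>+x. f (x + a) \<partial>lborel) = (\<integral>\<^sup>+x. f x \<partial>lborel)"
proof -
 have "(\<integral>\<^sup>+x. f x \<partial>lborel) = (\<integral>\<^sup>+x. f x \<partial>distr lborel borel ((+) a))"
  by (simp add: lborel_distr_plus)
 also have "\<dots> = (\<integral>\<^sup>+x. f (x + a) \<partial>lborel)" by (subst nn_integral_distr) (auto simp: add.commute)
 finally show ?thesis by simp
qed

lemma emeasure_lborel_cball_pos:
 fixes x :: "'a::euclidean_space"
 assumes "r > 0" shows "0 < emeasure lborel (cball x r)" "emeasure lborel (cball x r) < \<infinity>"
proof -
 show "emeasure lborel (cball x r) < \<infinity>" by (rule emeasure_lborel_cball_finite)
 have "emeasure lborel (ball x r) \<noteq> 0" using open_not_negligible[of "ball x r"] assms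
  by (auto simp: negligible_iff_emeasure0 emeasure_completion)
 moreover have "emeasure lborel (ball x r) <= emeasure lborel (cball x r)" by (intro emeasure_mono) auto
 ultimately show "0 < emeasure lborel (cball x r)" by (auto simp: zero_less_iff_neq_zero)
qed

text \<open>\<open>translation_invariant_exchange\<close> with g the indicator of the unit ball,
  which is symmetric. The factor is the ratio of the two masses of this ball, and 0 is
  possible.\<close>

lemma translation_invariant_lborel:
 fixes M :: "'a::euclidean_space measure"
 assumes S: "sets M = sets borel" and fin: "\<And>n::nat. emeasure M (cball 0 (real n)) < \<infinity>"
  and M: "\<And>a (f :: 'a => ennreal). f \<in> borel_measurable borel ==> (\<integral>\<^sup>+x. f (x + a) \<partial>M) = (\<integral>\<^sup>+x. f x \<partial>M)"
 shows "\<exists>k\<ge>0. \<forall>f\<in>borel_measurable borel. (\<integral>\<^sup>+x. f x \<partial>M) = ennreal k * (\<integral>\<^sup>+x. f x \<partial>lborel)"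
proof -
 define k where "k = emeasure M (cball 0 1) / emeasure lborel (cball (0::'a) 1)"
 note L = emeasure_lborel_cball_pos[of 1 "0::'a"]
 have k: "k < \<infinity>" using fin[of 1] L by (auto simp: k_def ennreal_divide_eq_top_iff less_top[symmetric])
 have "(\<integral>\<^sup>+x. f x \<partial>M) = k * (\<integral>\<^sup>+x. f x \<partial>lborel)" if [measurable]: "f \<in> borel_measurable borel" for f
 proof -
  have "(\<integral>\<^sup>+x. f x \<partial>M) * (\<integral>\<^sup>+x. indicator (cball (0::'a) 1) x \<partial>lborel)
    = (\<integral>\<^sup>+x. f x \<partial>lborel) * (\<integral>\<^sup>+x. indicator (cball 0 1) (- x) \<partial>M)"
  proof (rule translation_invariant_exchange)
   show "sets M = sets borel" by (rule S)
   show "sigma_finite_measure M" by (rule sigma_finite_cball[OF S fin])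
   show "(\<integral>\<^sup>+x. f (x + a) \<partial>M) = (\<integral>\<^sup>+x. f x \<partial>M)" if "f \<in> borel_measurable borel" for a and f :: "'a => ennreal"
    by (rule M[OF that])
  qed (auto intro: nn_integral_lborel_translate sigma_finite_lborel that borel_measurable_indicator)
  also have "(%x::'a. indicator (cball 0 1) (- x) :: ennreal) = indicator (cball 0 1)" by (auto simp: indicator_def fun_eq_iff)
  finally have "(\<integral>\<^sup>+x. f x \<partial>M) * emeasure lborel (cball (0::'a) 1) = (\<integral>\<^sup>+x. f x \<partial>lborel) * emeasure M (cball 0 1)"
   by (simp add: S)
  moreover have "(\<integral>\<^sup>+x. f x \<partial>M) = (\<integral>\<^sup>+x. f x \<partial>M) * emeasure lborel (cball (0::'a) 1) / emeasure lborel (cball (0::'a) 1)"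
   using L ennreal_mult_divide_eq[of "emeasure lborel (cball (0::'a) 1)"] by (simp add: less_top[symmetric])
  ultimately have "(\<integral>\<^sup>+x. f x \<partial>M) = (\<integral>\<^sup>+x. f x \<partial>lborel) * emeasure M (cball 0 1) / emeasure lborel (cball (0::'a) 1)"
   by argo
  then show ?thesis by (simp add: k_def ennreal_times_divide mult.commute)
 qed
 then show ?thesis using k by (intro exI[of _ "enn2real k"]) (auto simp: less_top)
qed

lemma nn_integral_inverse_1_plus_square: "(\<integral>\<^sup>+(x::real). ennreal (1 / (1 + x\<^sup>2)) \<partial>lborel) < \<infinity>"
proof -
 have "integrable lborel (%x::real. inverse (1 + x\<^sup>2))" using integrable_inverse_1_plus_square by (simp add: set_integrable_def)
 then have "(\<integral>\<^sup>+(x::real). ennreal (norm (inverse (1 + x\<^sup>2))) \<partial>lborel) < \<infinity>"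
  by (simp add: integrable_iff_bounded)
 then show ?thesis by (simp add: inverse_eq_divide)
qed

lemma PiM_lborel_translate:
 fixes f :: "('i => real) => ennreal"
 assumes [simp]: "finite I" and [measurable]: "f \<in> borel_measurable (PiM I (%_. lborel))"
 shows "(\<integral>\<^sup>+t. f (\<lambda>i\<in>I. t i + c i) \<partial>PiM I (%_. lborel)) = (\<integral>\<^sup>+t. f t \<partial>PiM I (%_. lborel))"
proof -
 interpret product_sigma_finite "%_::'i. lborel :: real measure" by standard
 let ?P = "PiM I (%_. lborel :: real measure)"
 have [measurable]: "(%t. \<lambda>i\<in>I. t i + c i) \<in> ?P \<rightarrow>\<^sub>M ?P" by measurable
 have "distr ?P ?P (%t. \<lambda>i\<in>I. t i + c i) = ?P"
 proof (rule PiM_eqI)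
  fix A :: "'i => real set" assume A: "\<And>i. i \<in> I ==> A i \<in> sets lborel"
  have eq: "(%t. \<lambda>i\<in>I. t i + c i) -` Pi\<^sub>E I A \<inter> space ?P = Pi\<^sub>E I (%i. (%x. x + c i) -` A i)"
   by (auto simp: space_PiM PiE_iff extensional_def)
  have meas: "(%x. x + c i) -` A i \<in> sets lborel" if "i \<in> I" for i
   using measurable_sets[of "%x. x + c i" lborel lborel "A i"] A[OF that] by simp
  have e: "emeasure lborel ((%x. x + c i) -` A i) = emeasure lborel (A i)" if "i \<in> I" for i
  proof -
   have "emeasure lborel (A i) = emeasure (distr lborel borel ((+) (c i))) (A i)" by (simp add: lborel_distr_plus)
   also have "\<dots> = emeasure lborel ((+) (c i) -` A i)" using A[OF that] by (subst emeasure_distr) auto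
   also have "(+) (c i) -` A i = (%x. x + c i) -` A i" by (auto simp: add.commute)
   finally show ?thesis by simp
  qed
  have "emeasure (distr ?P ?P (%t. \<lambda>i\<in>I. t i + c i)) (Pi\<^sub>E I A) = emeasure ?P (Pi\<^sub>E I (%i. (%x. x + c i) -` A i))"
   using A by (subst emeasure_distr) (auto simp: eq intro!: sets_PiM_I_finite)
  also have "\<dots> = (\<Prod>i\<in>I. emeasure lborel ((%x. x + c i) -` A i))" using meas by (intro emeasure_PiM) auto
  also have "\<dots> = (\<Prod>i\<in>I. emeasure lborel (A i))" using e by (intro prod.cong) auto
  finally show "emeasure (distr ?P ?P (%t. \<lambda>i\<in>I. t i + c i)) (Pi\<^sub>E I A) = (\<Prod>i\<in>I. emeasure lborel (A i))" .
 qed simp_all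
 then have "(\<integral>\<^sup>+t. f t \<partial>?P) = (\<integral>\<^sup>+t. f t \<partial>distr ?P ?P (%t. \<lambda>i\<in>I. t i + c i))" by simp
 also have "\<dots> = (\<integral>\<^sup>+t. f (\<lambda>i\<in>I. t i + c i) \<partial>?P)" by (rule nn_integral_distr) measurable
 finally show ?thesis by simp
qed

subsection \<open>Circle means\<close>

text \<open>Cauchy's formula for the square of F. On the circle K bounds r / |u - w|: it is 1 at the
  centre and 2 within half the radius.\<close>

lemma circle_sq_bound:
 fixes r R :: real
 assumes F: "F holomorphic_on ball w0 R" and r: "0 < r" "r < R" and w: "cmod (w - w0) < r"
  and K: "0 <= K" "\<And>u. cmod (u - w0) = r ==> r <= K * cmod (u - w)"
 shows "ennreal ((cmod (F w))\<^sup>2) <= ennreal K * (\<integral>\<^sup>+\<theta>\<in>{0..1}. ennreal ((cmod (F (w0 + r * cis (2 * pi * \<theta>))))\<^sup>2) \<partial>lborel)"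
proof -
 define g where "g u = (F u)\<^sup>2" for u
 have g: "g holomorphic_on ball w0 R" unfolding g_def using F by (intro holomorphic_intros)
 have sub: "cball w0 r \<subseteq> ball w0 R" using r by auto
 have "continuous_on (cball w0 r) g" "g holomorphic_on ball w0 r" using holomorphic_on_imp_continuous_on[OF g] g sub ball_subset_cball[of w0 r]
  by (blast intro: continuous_on_subset holomorphic_on_subset order_trans)+
 then have "((%u. g u / (u - w)) has_contour_integral (2 * of_real pi * \<i> * g w)) (circlepath w0 r)"
  using w by (intro Cauchy_integral_circlepath) auto
 then have I: "((%x. g (circlepath w0 r x) / (circlepath w0 r x - w) * vector_derivative (circlepath w0 r) (at x within {0..1}))
   has_integral (2 * of_real pi * \<i> * g w)) {0..1}" by (simp add: has_contour_integral_def)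
 define h where "h \<theta> = (cmod (F (w0 + r * cis (2 * pi * \<theta>))))\<^sup>2" for \<theta>
 have path: "circlepath w0 r x = w0 + r * cis (2 * pi * x)" for x by (simp add: circlepath cis_conv_exp mult_ac)
 have contF: "continuous_on UNIV (%x. F (w0 + r * cis (2 * pi * x)))"
  by (rule continuous_on_compose2[OF holomorphic_on_imp_continuous_on[OF F]])
    (use r in \<open>auto intro!: continuous_intros simp: dist_norm norm_mult\<close>)
 then have conth: "continuous_on UNIV h" unfolding h_def by (intro continuous_intros)
 have hint: "h integrable_on {0..1}" by (rule integrable_continuous_interval) (rule continuous_on_subset[OF conth], simp)
 have bound: "norm (g (circlepath w0 r x) / (circlepath w0 r x - w) * vector_derivative (circlepath w0 r) (at x within {0..1}))
   <= 2 * pi * K * h x" if x: "x \<in> {0..1}" for x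
 proof -
  have vd: "cmod (vector_derivative (circlepath w0 r) (at x within {0..1})) = 2 * pi * r"
   using x r by (simp add: vector_derivative_circlepath01 norm_mult)
  have d: "r <= K * cmod (circlepath w0 r x - w)" using r by (intro K(2)) (simp add: path norm_mult)
  then have pos: "cmod (circlepath w0 r x - w) > 0" using r(1) K(1) by (cases "circlepath w0 r x = w") auto
  have "norm (g (circlepath w0 r x) / (circlepath w0 r x - w) * vector_derivative (circlepath w0 r) (at x within {0..1}))
    = h x * (2 * pi) * (r / cmod (circlepath w0 r x - w))" unfolding norm_mult norm_divide vd by (simp add: g_def h_def path norm_power)
  also have "\<dots> <= h x * (2 * pi) * K" using d pos by (intro mult_left_mono) (auto simp: pos_divide_le_eq h_def)
  finally show ?thesis by (simp add: mult_ac)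
 qed
 have "norm (integral {0..1} (%x. g (circlepath w0 r x) / (circlepath w0 r x - w) * vector_derivative (circlepath w0 r) (at x within {0..1})))
   <= integral {0..1} (%x. 2 * pi * K * h x)"
  by (rule integral_norm_bound_integral) (use I hint bound in \<open>auto intro: integrable_on_mult_right\<close>)
 then have "2 * pi * (cmod (F w))\<^sup>2 <= 2 * pi * K * integral {0..1} h" using integral_unique[OF I] by (simp add: g_def norm_mult norm_power)
 then have le: "(cmod (F w))\<^sup>2 <= K * integral {0..1} h" by simp
 have "((%x. if x \<in> {0..1} then h x else 0) has_integral integral {0..1} h) UNIV"
  using hint by (simp only: has_integral_restrict_UNIV integrable_integral)
 moreover have "(%x. if x \<in> {0..1} then h x else 0) \<in> borel_measurable borel"
  using borel_measurable_continuous_onI[OF conth] by measurable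
 ultimately have "(\<integral>\<^sup>+x. ennreal (if x \<in> {0..1} then h x else 0) \<partial>lborel) = ennreal (integral {0..1} h)"
  by (intro nn_integral_has_integral_lborel) (auto simp: h_def)
 also have "(\<integral>\<^sup>+x. ennreal (if x \<in> {0..1} then h x else 0) \<partial>lborel) = (\<integral>\<^sup>+x\<in>{0..1}. ennreal (h x) \<partial>lborel)"
  by (intro nn_integral_cong) (auto simp: indicator_def)
 finally have "ennreal (integral {0..1} h) = (\<integral>\<^sup>+x\<in>{0..1}. ennreal (h x) \<partial>lborel)" ..
 then show ?thesis using le K(1) unfolding h_def[symmetric] by (metis ennreal_leI ennreal_mult')
qed

lemma circle_mean_sq:
 fixes r R :: real
 assumes "F holomorphic_on ball w0 R" "0 < r" "r < R"
 shows "ennreal ((cmod (F w0))\<^sup>2) <= (\<integral>\<^sup>+\<theta>\<in>{0..1}. ennreal ((cmod (F (w0 + r * cis (2 * pi * \<theta>))))\<^sup>2) \<partial>lborel)"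
 using circle_sq_bound[OF assms, of w0 1] assms by simp

lemma circle_sq_bound2:
 fixes r R :: real
 assumes "F holomorphic_on ball w0 R" "0 < r" "r < R" and w: "cmod (w - w0) <= r / 2"
 shows "ennreal ((cmod (F w))\<^sup>2) <= 2 * (\<integral>\<^sup>+\<theta>\<in>{0..1}. ennreal ((cmod (F (w0 + r * cis (2 * pi * \<theta>))))\<^sup>2) \<partial>lborel)"
proof -
 have "r <= 2 * cmod (u - w)" if "cmod (u - w0) = r" for u using norm_triangle_ineq[of "u - w" "w - w0"] that w by simp
 then show ?thesis using circle_sq_bound[OF assms(1-3), of w 2] w assms(2) by simp
qed

text \<open>The maximum principle for subharmonic functions of \<open>Im\<close> on a half-plane, in integrated form.\<close>

lemma bounded_submean_decreasing:
 fixes g :: "real => real"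
 assumes cont: "continuous_on {0..} g" and bdd: "\<And>s. s >= 0 ==> g s <= B"
  and submean: "\<And>s. s > 0 ==> g s <= integral {0..1} (%\<theta>. g (s + s * sin (2 * pi * \<theta>)))"
  and s: "s >= 0"
 shows "g s <= g 0"
proof -
 have main: "g s <= g 0 + \<eta> * s" if \<eta>: "\<eta> > 0" for \<eta>
 proof (rule ccontr)
  assume neg: "\<not> g s <= g 0 + \<eta> * s"
  \<comment> \<open>Since g is bounded, the term - \<eta> t lets p attain a maximum on the unbounded
    half-line.\<close>
  define p where "p t = g t - g 0 - \<eta> * t" for t
  have contp: "continuous_on {0..} p" unfolding p_def by (intro continuous_intros cont)
  have ps: "p s > 0" using neg by (simp add: p_def)
  \<comment> \<open>Beyond this point the bound B makes p nonpositive.\<close>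
  define T where "T = max s ((B - g 0) / \<eta>)"
  have T: "T >= 0" "s <= T" using s by (auto simp: T_def)
  have "continuous_on {0..T} p" using continuous_on_subset[OF contp] by auto
  from continuous_attains_sup[OF compact_Icc _ this] T obtain m
   where m: "m \<in> {0..T}" "\<And>t. t \<in> {0..T} ==> p t <= p m" by auto
  have pm: "p m > 0" using m(2)[of s] ps s T by auto
  have le: "p t <= p m" if "t >= 0" for t
  proof (cases "t <= T")
   case False
   then have "t >= (B - g 0) / \<eta>" by (simp add: T_def)
   then have "p t <= 0" using bdd[OF that] \<eta> by (simp add: p_def pos_divide_le_eq mult.commute)
   then show ?thesis using pm by simp
  qed (use m that in auto)
  have m0: "m > 0" using m(1) pm by (cases "m = 0") (auto simp: p_def)
  have sin1: "m + m * sin (2 * pi * \<theta>) >= 0" for \<theta>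
   using m0 sin_ge_minus_one[of "2 * pi * \<theta>"] mult_left_mono[of "-1" "sin (2 * pi * \<theta>)" m] by simp
  define q where "q \<theta> = p m - p (m + m * sin (2 * pi * \<theta>))" for \<theta>
  have contq: "continuous_on {0..1} (%\<theta>. g (m + m * sin (2 * pi * \<theta>)))"
   by (rule continuous_on_compose2[OF cont]) (use sin1 in \<open>auto intro!: continuous_intros\<close>)
  have contq': "continuous_on {0..1} q" unfolding q_def p_def by (intro continuous_intros contq)
  \<comment> \<open>A linear function equals its mean over the circle, so p inherits the sub-mean
    inequality of g.\<close>
  have sin0: "((%\<theta>. \<eta> * (m * sin (2 * pi * \<theta>))) has_integral 0) {0..1}"
  proof -
   have "((%\<theta>. \<eta> * (m * sin (2 * pi * \<theta>))) has_integral
     (- \<eta> * m * cos (2 * pi * 1) / (2 * pi) - (- \<eta> * m * cos (2 * pi * 0) / (2 * pi)))) {0..1}" by (rule fundamental_theorem_of_calculus)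
      (auto intro!: derivative_eq_intros simp: has_real_derivative_iff_has_vector_derivative[symmetric])
   then show ?thesis by simp
  qed
  have "integral {0..1} q = p m + g 0 + \<eta> * m - integral {0..1} (%\<theta>. g (m + m * sin (2 * pi * \<theta>)))"
  proof -
   have "((%\<theta>. (p m + g 0 + \<eta> * m) - g (m + m * sin (2 * pi * \<theta>)) + \<eta> * (m * sin (2 * pi * \<theta>)))
     has_integral ((1 - 0) *\<^sub>R (p m + g 0 + \<eta> * m) - integral {0..1} (%\<theta>. g (m + m * sin (2 * pi * \<theta>))) + 0)) {0..1}"
    using contq by (intro has_integral_add has_integral_diff sin0 integrable_integral
      integrable_continuous_interval) (auto intro!: has_integral_const_real[of _ 0 1, simplified])
   moreover have "(%\<theta>. (p m + g 0 + \<eta> * m) - g (m + m * sin (2 * pi * \<theta>)) + \<eta> * (m * sin (2 * pi * \<theta>))) = q"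
    by (auto simp: q_def p_def fun_eq_iff algebra_simps)
   ultimately show ?thesis by (simp add: integral_unique)
  qed
  then have "integral {0..1} q <= 0" using submean[OF m0] by (simp add: p_def)
  moreover have qpos: "q \<theta> >= 0" for \<theta> unfolding q_def using le[OF sin1] by simp
  moreover have "integral {0..1} q >= 0" by (rule integral_nonneg[OF integrable_continuous_interval[OF contq']]) (rule qpos)
  ultimately have "integral {0..1} q = 0" by linarith
  then have "(q has_integral 0) (cbox 0 1)" using integrable_integral[OF integrable_continuous_interval[OF contq']] by (simp add: box_real)
  \<comment> \<open>At 3/4 the circle of radius m about height m touches the boundary, where p is 0;
    this contradicts a positive maximum.\<close>
  then have "q (3/4) = 0" using has_integral_0_cbox_imp_0[of 0 1 q "3/4"] contq' qpos by (auto simp: box_real)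
  moreover have "sin (2 * pi * (3/4)) = -1" using sin_3over2_pi by (simp add: mult.commute)
  ultimately have "p m = p 0" by (simp add: q_def)
  then show False using pm by (simp add: p_def)
 qed
 show ?thesis
 proof (rule field_le_epsilon)
  fix d :: real assume d: "d > 0"
  have "g s <= g 0 + d / (s + 1) * s" using main[of "d / (s + 1)"] d s by simp
  also have "d / (s + 1) * s <= d" using d s by (simp add: field_simps)
  finally show "g s <= g 0 + d" by simp
 qed
qed

section \<open>Lebesgue measure on the real subspaces\<close>

context positive_hermitian_jts
begin

subsection \<open>Lebesgue measure on real subspaces\<close>

definition orthonormal :: "'a set => bool" where
 "orthonormal B \<longleftrightarrow> (\<forall>b\<in>B. \<forall>c\<in>B. Re (jinner b c) = (if b = c then 1 else 0))"

lemma orthonormal_coeff: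
 assumes "finite B" "orthonormal B" "c \<in> B"
 shows "Re (jinner (\<Sum>b\<in>B. u b *\<^sub>R b) c) = u c"
proof -
 have "Re (jinner (\<Sum>b\<in>B. u b *\<^sub>R b) c) = (\<Sum>b\<in>B. u b * Re (jinner b c))" by (simp add: jinner_sum jinner_linear)
 also have "\<dots> = (\<Sum>b\<in>B. if b = c then u b else 0)" using assms by (intro sum.cong) (auto simp: orthonormal_def)
 finally show ?thesis using assms by simp
qed

lemma orthonormal_card:
 assumes "finite B" "orthonormal B" shows "card B <= DIM('a)"
proof (rule ccontr)
 assume "\<not> card B <= DIM('a)"
 then have "real_vector.dependent B" using independent_card_le[of B] by auto
 then obtain u v where u: "v \<in> B" "u v \<noteq> 0" "(\<Sum>v\<in>B. u v *\<^sub>R v) = 0"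
  by (subst (asm) real_vector.dependent_finite[OF assms(1)]) auto
 then show False using orthonormal_coeff[OF assms u(1), of u] by simp
qed

text \<open>An orthonormal subset of S of largest cardinality spans S; otherwise the normalized
  residue of a projection could be adjoined.\<close>

lemma real_onb_exists:
 assumes S: "real_vector.subspace S"
 shows "\<exists>B. B \<subseteq> S & real_vector.span B = S & orthonormal B"
proof -
 define P where "P B \<longleftrightarrow> finite B & B \<subseteq> S & orthonormal B" for B
 have "P {}" by (simp add: P_def orthonormal_def)
 moreover have "card B <= DIM('a)" if "P B" for B using that orthonormal_card by (simp add: P_def)
 ultimately obtain B where B: "P B" "\<And>C. P C ==> card C <= card B"
  using ex_has_greatest_nat[of P "{}" card "Suc (DIM('a))"] by (auto simp: less_Suc_eq_le)
 have fin: "finite B" "B \<subseteq> S" "orthonormal B" using B(1) by (auto simp: P_def)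
 have "S \<subseteq> real_vector.span B"
 proof
  fix x assume x: "x \<in> S"
  define z where "z = (\<Sum>b\<in>B. Re (jinner x b) *\<^sub>R b)"
  define y where "y = x - z"
  have z: "z \<in> real_vector.span B" unfolding z_def by (intro real_vector.span_sum real_vector.span_scale real_vector.span_base)
  then have zS: "z \<in> S" using real_vector.span_minimal[OF fin(2) S] by blast
  show "x \<in> real_vector.span B"
  proof (cases "y = 0")
   case True then show ?thesis using z by (simp add: y_def)
  next
   case False
   define r where "r = Re (jinner y y)"
   have r: "r > 0" using jinner_pos[OF False] by (simp add: r_def)
   define w where "w = (1 / sqrt r) *\<^sub>R y"
   have wS: "w \<in> S" using x zS S by (auto simp: w_def y_def real_vector.subspace_scale real_vector.subspace_diff)
   have y0: "Re (jinner y c) = 0" if "c \<in> B" for c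
    using orthonormal_coeff[OF fin(1,3) that, of "%b. Re (jinner x b)"] by (simp add: y_def z_def jinner_linear)
   have w0: "Re (jinner w c) = 0" "Re (jinner c w) = 0" if "c \<in> B" for c
    using y0[OF that] arg_cong[OF jinner_cnj[of c y], of Re] by (simp_all add: w_def jinner_linear)
   have w1: "Re (jinner w w) = 1" using r by (simp add: w_def jinner_linear r_def[symmetric])
   have wB: "w \<notin> B" using w0[of w] w1 by auto
   have "P (insert w B)" unfolding P_def orthonormal_def using fin wS w0 w1 wB by (auto simp: orthonormal_def)
   from B(2)[OF this] show ?thesis using fin(1) wB by simp
  qed
 qed
 then show ?thesis using fin real_vector.span_minimal[OF fin(2) S] by blast
qed

lemma real_onb:
 assumes "real_vector.subspace S"
 shows "real_onb S \<subseteq> S" "real_vector.span (real_onb S) = S" "orthonormal (real_onb S)" "finite (real_onb S)"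
proof -
 have *: "real_onb S \<subseteq> S & real_vector.span (real_onb S) = S & orthonormal (real_onb S)" unfolding real_onb_def orthonormal_def
  by (rule someI_ex) (use real_onb_exists[OF assms] in \<open>simp add: orthonormal_def\<close>)
 then show "real_onb S \<subseteq> S" "real_vector.span (real_onb S) = S" "orthonormal (real_onb S)" by auto
 show "finite (real_onb S)"
 proof (rule ccontr)
  assume "infinite (real_onb S)"
  then obtain T where T: "T \<subseteq> real_onb S" "finite T" "card T = Suc (DIM('a))" by (meson infinite_arbitrarily_large)
  then have "orthonormal T" using * unfolding orthonormal_def by blast
  from orthonormal_card[OF T(2) this] T(3) show False by simp
 qed
qed

text \<open>The measure \<open>lebesgue_subspace S\<close> on the Borel sets of the whole space,
  carried by S. Functions then need no restriction to a subspace.\<close>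

definition LS :: "'a set => 'a measure" where
 "LS S = distr (Pi\<^sub>M (real_onb S) (%_. lborel :: real measure)) borel (%t. \<Sum>b\<in>real_onb S. t b *\<^sub>R b)"

lemma sets_LS [measurable_cong, simp]: "sets (LS S) = sets borel" and space_LS [simp]: "space (LS S) = UNIV" by (simp_all add: LS_def)

lemma measurable_LS_map [measurable]:
 "(%t. \<Sum>b\<in>real_onb S. t b *\<^sub>R b) \<in> borel_measurable (Pi\<^sub>M (real_onb S) (%_. lborel :: real measure))"
 by measurable

lemma nn_integral_LS:
 "f \<in> borel_measurable borel ==>
  (\<integral>\<^sup>+x. f x \<partial>LS S) = (\<integral>\<^sup>+t. f (\<Sum>b\<in>real_onb S. t b *\<^sub>R b) \<partial>Pi\<^sub>M (real_onb S) (%_. lborel :: real measure))"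
 unfolding LS_def by (rule nn_integral_distr) auto

lemma LS_map_mem:
 assumes "real_vector.subspace S" shows "(\<Sum>b\<in>real_onb S. t b *\<^sub>R b) \<in> S"
 using real_onb(1)[OF assms] by (intro real_vector.subspace_sum[OF assms] real_vector.subspace_scale[OF assms]) auto

lemma measurable_lebesgue_subspace_map:
 assumes "real_vector.subspace S"
 shows "(%t. \<Sum>b\<in>real_onb S. t b *\<^sub>R b) \<in> measurable (Pi\<^sub>M (real_onb S) (%_. lborel :: real measure)) (restrict_space borel S)"
 using LS_map_mem[OF assms] by (intro measurable_restrict_space2) auto

lemma nn_integral_lebesgue_subspace:
 assumes S: "real_vector.subspace S" and [measurable]: "f \<in> borel_measurable borel"
 shows "(\<integral>\<^sup>+x. f x \<partial>lebesgue_subspace S) = (\<integral>\<^sup>+x. f x \<partial>LS S)"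
 unfolding lebesgue_subspace_def nn_integral_LS[OF assms(2)] by (rule nn_integral_distr[OF measurable_lebesgue_subspace_map[OF S]])
   (simp only: measurable_distr_eq1 measurable_restrict_space1[OF assms(2)])

lemma borel_subspace: "real_vector.subspace S ==> S \<in> sets (borel :: 'a measure)" by (rule borel_closed, rule closed_subspace)

lemma AE_LS:
 assumes "real_vector.subspace S" shows "AE x in LS S. x \<in> S"
 unfolding LS_def using LS_map_mem[OF assms] borel_subspace[OF assms] by (subst AE_distr_iff) auto

lemma LS_cball:
 assumes S: "real_vector.subspace S" shows "emeasure (LS S) (cball 0 r) < \<infinity>"
proof -
 interpret product_sigma_finite "%_::'a. lborel :: real measure" by standard
 let ?B = "real_onb S" let ?P = "Pi\<^sub>M ?B (%_. lborel :: real measure)"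
 obtain K where K: "K > 0" "\<And>x y. cmod (jinner x y) <= K * norm x * norm y" using jinner_bound by blast
 define C where "C = (\<Sum>b\<in>?B. K * \<bar>r\<bar> * norm b)"
 have C: "\<bar>t b\<bar> <= C" if "norm (\<Sum>b\<in>?B. t b *\<^sub>R b) <= r" "b \<in> ?B" for t b
 proof -
  have "\<bar>t b\<bar> <= cmod (jinner (\<Sum>b\<in>?B. t b *\<^sub>R b) b)"
   using abs_Re_le_cmod[of "jinner (\<Sum>b\<in>?B. t b *\<^sub>R b) b"] orthonormal_coeff[OF real_onb(4)[OF S] real_onb(3)[OF S] that(2), of t]
   by simp
  also have "\<dots> <= K * norm (\<Sum>b\<in>?B. t b *\<^sub>R b) * norm b" by (rule K)
  also have "\<dots> <= K * \<bar>r\<bar> * norm b" using that(1) K(1) by (intro mult_right_mono mult_left_mono) auto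
  also have "\<dots> <= C" unfolding C_def using that(2) real_onb(4)[OF S] K(1) by (intro member_le_sum) auto
  finally show ?thesis .
 qed
 have "emeasure (LS S) (cball 0 r) = emeasure ?P ((%t. \<Sum>b\<in>?B. t b *\<^sub>R b) -` cball 0 r \<inter> space ?P)"
  unfolding LS_def by (rule emeasure_distr) auto
 also have "\<dots> <= emeasure ?P (Pi\<^sub>E ?B (%_. {-C..C}))"
 proof (rule emeasure_mono)
  show "(%t. \<Sum>b\<in>?B. t b *\<^sub>R b) -` cball 0 r \<inter> space ?P \<subseteq> Pi\<^sub>E ?B (%_. {-C..C})"
  proof
   fix t assume t: "t \<in> (%t. \<Sum>b\<in>?B. t b *\<^sub>R b) -` cball 0 r \<inter> space ?P"
   then have "\<bar>t b\<bar> <= C" if "b \<in> ?B" for b using C[OF _ that, of t] by auto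
   then have "t b \<in> {-C..C}" if "b \<in> ?B" for b using that by (force simp: abs_le_iff)
   then show "t \<in> Pi\<^sub>E ?B (%_. {-C..C})" using t by (auto simp: space_PiM PiE_iff)
  qed
 qed (use real_onb(4)[OF S] in \<open>auto intro!: sets_PiM_I_finite\<close>)
 also have "\<dots> = (\<Prod>b\<in>?B. emeasure lborel {-C..C})" using real_onb(4)[OF S] by (intro emeasure_PiM) auto
 also have "\<dots> < \<infinity>"
 proof -
  have "emeasure lborel {-C..C} < top" using emeasure_lborel_cbox_finite[of "-C" C] by (simp add: box_real)
  then show ?thesis by (simp add: power_less_top_ennreal)
 qed
 finally show ?thesis .
qed

lemma sigma_finite_LS: "real_vector.subspace S ==> sigma_finite_measure (LS S)" by (rule sigma_finite_cball[OF sets_LS LS_cball])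

lemma sigma_finite_lebesgue_subspace:
 assumes S: "real_vector.subspace S" shows "sigma_finite_measure (lebesgue_subspace S)"
proof
 have space: "space (lebesgue_subspace S) = S" "sets (lebesgue_subspace S) = sets (restrict_space borel S)"
  by (simp_all add: lebesgue_subspace_def space_restrict_space)
 let ?A = "%n::nat. S \<inter> cball 0 (real n)"
 have A: "?A n \<in> sets (lebesgue_subspace S)" for n unfolding space using borel_subspace[OF S] by (auto simp: sets_restrict_space)
 have "emeasure (lebesgue_subspace S) (?A n) < \<infinity>" for n
 proof -
  have "emeasure (lebesgue_subspace S) (?A n) = (\<integral>\<^sup>+x. indicator (?A n) x \<partial>lebesgue_subspace S)" using A[of n] by simp
  also have "\<dots> = (\<integral>\<^sup>+x. indicator (cball 0 (real n)) x \<partial>lebesgue_subspace S)"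
   by (intro nn_integral_cong) (auto simp: space indicator_def)
  also have "\<dots> = emeasure (LS S) (cball 0 (real n))" by (subst nn_integral_lebesgue_subspace[OF S]) (auto intro!: borel_measurable_indicator)
  finally show ?thesis using LS_cball[OF S] by simp
 qed
 moreover have "(\<Union>n. ?A n) = S" by (auto simp: real_arch_simple)
 ultimately show "\<exists>A. countable A & A \<subseteq> sets (lebesgue_subspace S) & \<Union> A = space (lebesgue_subspace S) &
   (\<forall>a\<in>A. emeasure (lebesgue_subspace S) a \<noteq> \<infinity>)" using A space by (intro exI[of _ "range ?A"]) (auto simp: less_top)
qed

lemma nn_integral_LS_translate:
 assumes S: "real_vector.subspace S" and a: "a \<in> S" and [measurable]: "f \<in> borel_measurable borel"
 shows "(\<integral>\<^sup>+x. f (x + a) \<partial>LS S) = (\<integral>\<^sup>+x. f x \<partial>LS S)"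
proof -
 let ?B = "real_onb S" let ?P = "Pi\<^sub>M ?B (%_. lborel :: real measure)"
 have fin: "finite ?B" by (rule real_onb(4)[OF S])
 have "a \<in> real_vector.span ?B" using a real_onb(2)[OF S] by simp
 then obtain u where u: "a = (\<Sum>b\<in>?B. u b *\<^sub>R b)" using real_vector.span_finite[OF fin] by auto
 have "(\<integral>\<^sup>+x. f x \<partial>LS S) = (\<integral>\<^sup>+t. f (\<Sum>b\<in>?B. t b *\<^sub>R b) \<partial>?P)" by (rule nn_integral_LS) measurable
 also have "\<dots> = (\<integral>\<^sup>+t. f (\<Sum>b\<in>?B. (\<lambda>i\<in>?B. t i + u i) b *\<^sub>R b) \<partial>?P)"
  by (rule PiM_lborel_translate[OF fin, symmetric]) measurable
 also have "\<dots> = (\<integral>\<^sup>+t. f ((\<Sum>b\<in>?B. t b *\<^sub>R b) + a) \<partial>?P)" by (simp add: u scaleR_left_distrib sum.distrib)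
 also have "\<dots> = (\<integral>\<^sup>+x. f (x + a) \<partial>LS S)" by (rule nn_integral_LS[symmetric]) measurable
 finally show ?thesis by simp
qed

lemma LS_nonzero:
 assumes S: "real_vector.subspace S" shows "emeasure (LS S) UNIV \<noteq> 0"
proof -
 interpret product_sigma_finite "%_::'a. lborel :: real measure" by standard
 let ?B = "real_onb S" let ?P = "Pi\<^sub>M ?B (%_. lborel :: real measure)"
 have "emeasure (LS S) UNIV = emeasure ?P (Pi\<^sub>E ?B (%_. UNIV))" unfolding LS_def by (subst emeasure_distr) (auto simp: space_PiM)
 also have "\<dots> = (\<Prod>b\<in>?B. emeasure lborel (UNIV :: real set))" using real_onb(4)[OF S] by (intro emeasure_PiM) auto
 also have "\<dots> \<noteq> 0" by simp
 finally show ?thesis .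
qed

text \<open>Each 1 + t_b^2 is at most C times 1 + norm^2. Hence the power N, once it reaches the
  dimension, is dominated by a product of integrable functions of one variable.\<close>

lemma LS_decay:
 assumes S: "real_vector.subspace S"
 shows "\<exists>n. \<forall>N\<ge>n. (\<integral>\<^sup>+x. ennreal (1 / (1 + (norm x)\<^sup>2) ^ N) \<partial>LS S) < \<infinity>"
proof -
 interpret product_sigma_finite "%_::'a. lborel :: real measure" by standard
 let ?B = "real_onb S" let ?P = "Pi\<^sub>M ?B (%_. lborel :: real measure)"
 have fin: "finite ?B" by (rule real_onb(4)[OF S])
 obtain K where K: "K > 0" "\<And>x y. cmod (jinner x y) <= K * norm x * norm y" using jinner_bound by blast
 define C where "C = (\<Sum>b\<in>?B. (K * norm b)\<^sup>2) + 1"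
 have C1: "C >= 1" by (simp add: C_def sum_nonneg)
 have key: "1 + (t b)\<^sup>2 <= C * (1 + (norm (\<Sum>b\<in>?B. t b *\<^sub>R b))\<^sup>2)" if b: "b \<in> ?B" for t b
 proof -
  let ?x = "\<Sum>b\<in>?B. t b *\<^sub>R b"
  have "\<bar>t b\<bar> <= cmod (jinner ?x b)" using abs_Re_le_cmod[of "jinner ?x b"] orthonormal_coeff[OF fin real_onb(3)[OF S] b, of t] by simp
  also have "\<dots> <= (K * norm b) * norm ?x" using K(2)[of ?x b] by (simp add: mult_ac)
  finally have "\<bar>t b\<bar>\<^sup>2 <= ((K * norm b) * norm ?x)\<^sup>2" by (intro power_mono) auto
  then have "(t b)\<^sup>2 <= (K * norm b)\<^sup>2 * (norm ?x)\<^sup>2" by (simp add: power_mult_distrib)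
  also have "(K * norm b)\<^sup>2 <= (\<Sum>b\<in>?B. (K * norm b)\<^sup>2)" using b fin by (intro member_le_sum) auto
  then have "(K * norm b)\<^sup>2 * (norm ?x)\<^sup>2 <= C * (norm ?x)\<^sup>2" by (intro mult_right_mono) (auto simp: C_def)
  finally show ?thesis using C1 by (simp add: distrib_left)
 qed
 have "(\<integral>\<^sup>+x. ennreal (1 / (1 + (norm x)\<^sup>2) ^ N) \<partial>LS S) < \<infinity>" if N: "N >= card ?B" for N
 proof -
  have "(\<integral>\<^sup>+x. ennreal (1 / (1 + (norm x)\<^sup>2) ^ N) \<partial>LS S)
    = (\<integral>\<^sup>+t. ennreal (1 / (1 + (norm (\<Sum>b\<in>?B. t b *\<^sub>R b))\<^sup>2) ^ N) \<partial>?P)"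
   by (rule nn_integral_LS) measurable
  also have "\<dots> <= (\<integral>\<^sup>+t. ennreal (C ^ card ?B) * (\<Prod>b\<in>?B. ennreal (1 / (1 + (t b)\<^sup>2))) \<partial>?P)"
  proof (rule nn_integral_mono)
   fix t
   let ?y = "1 + (norm (\<Sum>b\<in>?B. t b *\<^sub>R b))\<^sup>2"
   have y: "?y >= 1" by simp
   have pos: "(\<Prod>b\<in>?B. 1 + (t b)\<^sup>2) > 0" by (intro prod_pos) (simp add: add_pos_nonneg)
   have "(\<Prod>b\<in>?B. 1 + (t b)\<^sup>2) <= (\<Prod>b\<in>?B. C * ?y)" using key by (intro prod_mono) auto
   also have "\<dots> = C ^ card ?B * ?y ^ card ?B" by (simp add: power_mult_distrib)
   also have "\<dots> <= C ^ card ?B * ?y ^ N" using C1 y N by (intro mult_left_mono power_increasing) auto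
   finally have "(\<Prod>b\<in>?B. 1 + (t b)\<^sup>2) <= C ^ card ?B * ?y ^ N" .
   then have "1 / ?y ^ N <= C ^ card ?B * (1 / (\<Prod>b\<in>?B. 1 + (t b)\<^sup>2))"
    using pos y by (simp add: divide_simps mult.commute zero_less_power order.strict_trans2[OF zero_less_one])
   also have "1 / (\<Prod>b\<in>?B. 1 + (t b)\<^sup>2) = (\<Prod>b\<in>?B. 1 / (1 + (t b)\<^sup>2))" by (simp add: prod_dividef)
   finally have "ennreal (1 / ?y ^ N) <= ennreal (C ^ card ?B * (\<Prod>b\<in>?B. 1 / (1 + (t b)\<^sup>2)))" by (rule ennreal_leI)
   also have "\<dots> = ennreal (C ^ card ?B) * (\<Prod>b\<in>?B. ennreal (1 / (1 + (t b)\<^sup>2)))"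
    using C1 by (subst prod_ennreal) (auto simp: ennreal_mult')
   finally show "ennreal (1 / ?y ^ N) <= ennreal (C ^ card ?B) * (\<Prod>b\<in>?B. ennreal (1 / (1 + (t b)\<^sup>2)))" .
  qed
  also have "\<dots> = ennreal (C ^ card ?B) * (\<integral>\<^sup>+t. (\<Prod>b\<in>?B. ennreal (1 / (1 + (t b)\<^sup>2))) \<partial>?P)"
   by (rule nn_integral_cmult) measurable
  also have "(\<integral>\<^sup>+t. (\<Prod>b\<in>?B. ennreal (1 / (1 + (t b)\<^sup>2))) \<partial>?P) = (\<Prod>b\<in>?B. \<integral>\<^sup>+(x::real). ennreal (1 / (1 + x\<^sup>2)) \<partial>lborel)"
   using fin by (intro product_nn_integral_prod) auto
  also have "ennreal (C ^ card ?B) * \<dots> < \<infinity>"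
   using nn_integral_inverse_1_plus_square by (auto simp: ennreal_mult_less_top power_less_top_ennreal)
  finally show ?thesis .
 qed
 then show ?thesis by blast
qed

end

section \<open>The boundary measure, its invariance, and volume by slices\<close>

context symmetric_siegel
begin

lemma subspace_E: "real_vector.subspace E" and subspace_F: "real_vector.subspace F" by (auto simp: real_vector.subspace_def E_subspace F_subspace)

lemma sigma_finite_LE: "sigma_finite_measure (LS E)" and sigma_finite_LF: "sigma_finite_measure (LS F)"
 by (auto intro: sigma_finite_LS subspace_E subspace_F)

lemma measurable_pr [measurable]:
 "prE \<in> borel_measurable borel" "prF \<in> borel_measurable borel" "prG \<in> borel_measurable borel"
 using continuous_pr[OF continuous_on_id] by (auto intro: borel_measurable_continuous_onI)

lemma measurable_point [measurable (raw)]: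
 assumes [measurable]: "f \<in> borel_measurable M" "g \<in> borel_measurable M" "h \<in> borel_measurable M"
 shows "(%w. point (f w) (g w) (h w)) \<in> borel_measurable M" unfolding point_def by (intro borel_measurable_add assms)
   (rule measurable_compose[OF assms(3)], rule borel_measurable_continuous_onI, intro continuous_intros)

lemma measurable_Phi [measurable (raw)]:
 assumes [measurable]: "f \<in> borel_measurable M" "g \<in> borel_measurable M"
 shows "(%w. Phi (f w) (g w)) \<in> borel_measurable M" by (rule borel_measurable_continuous_Pair[OF assms]) (auto intro!: continuous_intros)

lemma measurable_up_iF [measurable (raw)]:
 assumes [measurable]: "f \<in> borel_measurable M" "g \<in> borel_measurable M"
 shows "(%w. f w + \<i> *C g w) \<in> borel_measurable M"
 by (rule borel_measurable_continuous_Pair[OF assms]) (auto intro!: continuous_intros)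

definition bpoint :: "'a => 'a => 'a" where "bpoint \<zeta> x = point \<zeta> x (Phi \<zeta> \<zeta>)"

lemma measurable_bpoint [measurable (raw)]:
 assumes [measurable]: "f \<in> borel_measurable M" "g \<in> borel_measurable M"
 shows "(%w. bpoint (f w) (g w)) \<in> borel_measurable M" unfolding bpoint_def by measurable

lemma bpoint_bdom: "\<zeta> \<in> E ==> x \<in> F ==> bpoint \<zeta> x \<in> bdom" by (simp add: bpoint_def bdom_iff height_def)

lemma pr_bpoint [simp]: "\<zeta> \<in> E ==> x \<in> F ==> prE (bpoint \<zeta> x) = \<zeta>" "\<zeta> \<in> E ==> x \<in> F ==> prF (bpoint \<zeta> x) = x"
 by (simp_all add: bpoint_def)

lemma bdom_bpoint: "q \<in> bdom ==> q = bpoint (prE q) (prF q)" using point_pr[of q] by (simp add: bdom_iff height_def bpoint_def)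

text \<open>The measure \<open>beta_bdom\<close>, transported to the whole space.\<close>

definition bB :: "'a measure" where
 "bB = distr (LS E \<Otimes>\<^sub>M LS F) borel (%(\<zeta>, x). bpoint \<zeta> x)"

abbreviation nn_integral_bB_syntax :: "('a => ennreal) => ennreal" (binder "IB " 10)
 where "nn_integral_bB_syntax f \<equiv> nn_integral bB f"

lemma sets_bB [measurable_cong, simp]: "sets bB = sets borel" and space_bB [simp]: "space bB = UNIV" by (simp_all add: bB_def)

lemma nn_integral_bB:
 assumes [measurable]: "f \<in> borel_measurable borel"
 shows "(IB q. f q) = (\<integral>\<^sup>+\<zeta>. (\<integral>\<^sup>+x. f (bpoint \<zeta> x) \<partial>LS F) \<partial>LS E)"
proof -
 interpret F: sigma_finite_measure "LS F" by (rule sigma_finite_LF)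
 show ?thesis unfolding bB_def by (subst nn_integral_distr) (auto simp: split_beta F.nn_integral_fst[symmetric])
qed

lemma nn_integral_beta_bdom:
 assumes [measurable]: "f \<in> borel_measurable borel"
 shows "(\<integral>\<^sup>+q. f q \<partial>beta_bdom) = (IB q. f q)"
proof -
 interpret lF: sigma_finite_measure "lebesgue_subspace F" by (rule sigma_finite_lebesgue_subspace[OF subspace_F])
 interpret F: sigma_finite_measure "LS F" by (rule sigma_finite_LF)
 let ?L = "lebesgue_subspace E \<Otimes>\<^sub>M lebesgue_subspace F"
 have sp: "space (lebesgue_subspace S) = S" "sets (lebesgue_subspace S) = sets (restrict_space borel S)" for S
  by (simp_all add: lebesgue_subspace_def space_restrict_space)
 have id: "(%x. x) \<in> borel_measurable (lebesgue_subspace S)" for S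
  by (simp add: measurable_cong_sets[OF sp(2) refl] measurable_restrict_space1)
 have m1: "fst \<in> borel_measurable ?L" "snd \<in> borel_measurable ?L"
  using measurable_compose[OF measurable_fst id] measurable_compose[OF measurable_snd id] by auto
 then have g0: "(%z. point (fst z) (snd z) (Phi (fst z) (fst z))) \<in> borel_measurable ?L" by measurable
 have g: "(%(\<zeta>, x). point \<zeta> x (Phi \<zeta> \<zeta>)) \<in> measurable ?L (restrict_space borel bdom)"
  using g0 bpoint_bdom by (intro measurable_restrict_space2) (auto simp: split_beta space_pair_measure sp bpoint_def)
 have "(\<integral>\<^sup>+q. f q \<partial>beta_bdom) = (\<integral>\<^sup>+z. f (case z of (\<zeta>, x) => point \<zeta> x (Phi \<zeta> \<zeta>)) \<partial>?L)"
  unfolding beta_bdom_def by (rule nn_integral_distr[OF g])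
   (simp only: measurable_distr_eq1 measurable_restrict_space1[OF assms])
 also have "\<dots> = (\<integral>\<^sup>+\<zeta>. (\<integral>\<^sup>+x. f (bpoint \<zeta> x) \<partial>lebesgue_subspace F) \<partial>lebesgue_subspace E)"
  using g0 by (subst lF.nn_integral_fst[symmetric]) (auto simp: split_beta bpoint_def)
 also have "\<dots> = (\<integral>\<^sup>+\<zeta>. (\<integral>\<^sup>+x. f (bpoint \<zeta> x) \<partial>LS F) \<partial>lebesgue_subspace E)"
  by (intro nn_integral_cong nn_integral_lebesgue_subspace subspace_F) measurable
 also have "\<dots> = (\<integral>\<^sup>+\<zeta>. (\<integral>\<^sup>+x. f (bpoint \<zeta> x) \<partial>LS F) \<partial>LS E)"
  by (intro nn_integral_lebesgue_subspace subspace_E) measurable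
 finally show ?thesis by (simp add: nn_integral_bB)
qed

lemma bB_cball: "emeasure bB (cball 0 r) < \<infinity>"
proof -
 obtain N where N: "N > 0" "\<And>x. norm (prF x) <= norm x * N" using bounded_linear.pos_bounded[OF bounded_linear_pr(2)] by blast
 obtain M where M: "M > 0" "\<And>x. norm (prE x) <= norm x * M" using bounded_linear.pos_bounded[OF bounded_linear_pr(1)] by blast
 have "emeasure bB (cball 0 r) = (IB q. indicator (cball 0 r) q)" by simp
 also have "\<dots> = (\<integral>\<^sup>+\<zeta>. (\<integral>\<^sup>+x. indicator (cball 0 r) (bpoint \<zeta> x) \<partial>LS F) \<partial>LS E)"
  by (rule nn_integral_bB) (auto intro!: borel_measurable_indicator)
 also have "\<dots> <= (\<integral>\<^sup>+\<zeta>. (\<integral>\<^sup>+x. indicator (cball 0 (r * M)) \<zeta> * indicator (cball 0 (r * N)) x \<partial>LS F) \<partial>LS E)"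
 proof (rule nn_integral_mono_AE, use AE_LS[OF subspace_E] in eventually_elim)
  fix \<zeta> assume \<zeta>: "\<zeta> \<in> E"
  show "(\<integral>\<^sup>+x. indicator (cball 0 r) (bpoint \<zeta> x) \<partial>LS F) <= (\<integral>\<^sup>+x. indicator (cball 0 (r * M)) \<zeta> * indicator (cball 0 (r * N)) x \<partial>LS F)"
  proof (rule nn_integral_mono_AE, use AE_LS[OF subspace_F] in eventually_elim)
   fix x assume x: "x \<in> F"
   show "(indicator (cball 0 r) (bpoint \<zeta> x) :: ennreal) <= indicator (cball 0 (r * M)) \<zeta> * indicator (cball 0 (r * N)) x"
   proof (cases "norm (bpoint \<zeta> x) <= r")
    case True
    have "norm \<zeta> <= r * M" using order_trans[OF M(2)[of "bpoint \<zeta> x"] mult_right_mono[OF True less_imp_le[OF M(1)]]] \<zeta> x by simp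
    moreover have "norm x <= r * N" using order_trans[OF N(2)[of "bpoint \<zeta> x"] mult_right_mono[OF True less_imp_le[OF N(1)]]] \<zeta> x by simp
    ultimately show ?thesis by (simp add: indicator_def)
   qed (simp add: indicator_def)
  qed
 qed
 also have "\<dots> = emeasure (LS E) (cball 0 (r * M)) * emeasure (LS F) (cball 0 (r * N))"
  by (simp add: nn_integral_cmult nn_integral_multc borel_measurable_indicator)
 also have "\<dots> < \<infinity>" using LS_cball[OF subspace_E, of "r * M"] LS_cball[OF subspace_F, of "r * N"] by (simp add: ennreal_mult_less_top)
 finally show ?thesis .
qed

lemma sigma_finite_bB: "sigma_finite_measure bB" by (rule sigma_finite_cball[OF sets_bB bB_cball])

lemma AE_bB: "AE q in bB. q \<in> bdom"
proof -
 have "(IB q. indicator (- bdom) q) = (\<integral>\<^sup>+\<zeta>. (\<integral>\<^sup>+x. indicator (- bdom) (bpoint \<zeta> x) \<partial>LS F) \<partial>LS E)"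
  by (rule nn_integral_bB) (auto intro!: borel_measurable_indicator)
 also have "\<dots> = (\<integral>\<^sup>+\<zeta>. 0 \<partial>LS E)"
 proof (rule nn_integral_cong_AE, use AE_LS[OF subspace_E] in eventually_elim)
  fix \<zeta> assume \<zeta>: "\<zeta> \<in> E"
  have "(\<integral>\<^sup>+x. indicator (- bdom) (bpoint \<zeta> x) \<partial>LS F) = (\<integral>\<^sup>+x. 0 \<partial>LS F)"
   by (rule nn_integral_cong_AE, use AE_LS[OF subspace_F] in eventually_elim) (use \<zeta> bpoint_bdom in auto)
  then show "(\<integral>\<^sup>+x. indicator (- bdom) (bpoint \<zeta> x) \<partial>LS F) = 0" by simp
 qed
 finally have "emeasure bB (- bdom) = 0" by (simp add: borel_comp)
 then show ?thesis by (intro AE_I[of _ _ "- bdom"]) (auto intro: borel_comp)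
qed

lemma nn_integral_bB_cong:
 "(\<And>q. q \<in> bdom ==> f q = g q) ==> (IB q. f q) = (IB q. g q)" using AE_bB by (intro nn_integral_cong_AE) auto

lemma heis_bpoint:
 assumes "a \<in> E" "x \<in> F" "\<zeta> \<in> E" "y \<in> F"
 shows "heis a x (bpoint \<zeta> y) = bpoint (\<zeta> + a) (y + (x - 2 *\<^sub>R prG (Phi \<zeta> a)))"
proof -
 have "heis a x (bpoint \<zeta> y) \<in> bdom" using assms bpoint_bdom by simp
 from bdom_bpoint[OF this] show ?thesis using assms by (simp add: heis_pr)
qed

lemma measurable_heis [measurable (raw)]:
 assumes [measurable]: "f \<in> borel_measurable M"
 shows "(%w. heis a x (f w)) \<in> borel_measurable M"
 by (rule measurable_compose[OF assms], rule borel_measurable_continuous_onI, intro continuous_intros)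

text \<open>In the coordinates of \<open>bpoint\<close>, x is translated by a vector depending on
  \<zeta> and \<zeta> by a. Each iterated integral absorbs its own translation.\<close>

lemma bB_heis:
 assumes a: "a \<in> E" and x: "x \<in> F" and [measurable]: "f \<in> borel_measurable borel"
 shows "(IB q. f (heis a x q)) = (IB q. f q)"
proof -
 interpret F: sigma_finite_measure "LS F" by (rule sigma_finite_LF)
 define g where "g \<zeta> = (\<integral>\<^sup>+y. f (bpoint \<zeta> y) \<partial>LS F)" for \<zeta>
 have [measurable]: "g \<in> borel_measurable borel" unfolding g_def by measurable
 have "(IB q. f (heis a x q)) = (\<integral>\<^sup>+\<zeta>. (\<integral>\<^sup>+y. f (heis a x (bpoint \<zeta> y)) \<partial>LS F) \<partial>LS E)"
  by (rule nn_integral_bB) measurable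
 also have "\<dots> = (\<integral>\<^sup>+\<zeta>. g (\<zeta> + a) \<partial>LS E)"
 proof (rule nn_integral_cong_AE, use AE_LS[OF subspace_E] in eventually_elim)
  fix \<zeta> assume \<zeta>: "\<zeta> \<in> E"
  have "(\<integral>\<^sup>+y. f (heis a x (bpoint \<zeta> y)) \<partial>LS F) = (\<integral>\<^sup>+y. f (bpoint (\<zeta> + a) (y + (x - 2 *\<^sub>R prG (Phi \<zeta> a)))) \<partial>LS F)"
   by (rule nn_integral_cong_AE, use AE_LS[OF subspace_F] in eventually_elim) (simp add: heis_bpoint a x \<zeta>)
  also have "\<dots> = g (\<zeta> + a)" unfolding g_def by (rule nn_integral_LS_translate[OF subspace_F]) (auto simp: x F_subspace)
  finally show "(\<integral>\<^sup>+y. f (heis a x (bpoint \<zeta> y)) \<partial>LS F) = g (\<zeta> + a)" .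
 qed
 also have "\<dots> = (\<integral>\<^sup>+\<zeta>. g \<zeta> \<partial>LS E)" by (rule nn_integral_LS_translate[OF subspace_E a]) measurable
 also have "\<dots> = (IB q. f q)" unfolding g_def by (rule nn_integral_bB[symmetric]) measurable
 finally show ?thesis .
qed

lemma bB_translate:
 assumes "x \<in> F" "f \<in> borel_measurable borel"
 shows "(IB q. f (q + x)) = (IB q. f q)" using bB_heis[OF E_subspace(1) assms] by (simp add: heis_real)

text \<open>The product measure V in the three coordinates is translation invariant, hence a
  multiple of Lebesgue measure, and the factor is not 0 because V is not. This avoids any
  computation of a Jacobian.\<close>

lemma volume_slices:
 "\<exists>c>0. \<forall>f\<in>borel_measurable borel.
   (\<integral>\<^sup>+p. f p \<partial>lborel) = ennreal c * (\<integral>\<^sup>+h. (IB q. f (q + \<i> *C h)) \<partial>LS F)"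
proof -
 interpret F: sigma_finite_measure "LS F" by (rule sigma_finite_LF)
 interpret E: sigma_finite_measure "LS E" by (rule sigma_finite_LE)
 interpret EF: pair_sigma_finite "LS E" "LS F" by standard
 interpret FF: pair_sigma_finite "LS F" "LS F" by standard
 define V :: "'a measure" where "V = distr (LS E \<Otimes>\<^sub>M (LS F \<Otimes>\<^sub>M LS F)) borel (%(\<zeta>, x, y). point \<zeta> x y)"
 have sV: "sets V = sets borel" by (simp add: V_def)
 have V: "(\<integral>\<^sup>+p. f p \<partial>V) = (\<integral>\<^sup>+\<zeta>. (\<integral>\<^sup>+x. (\<integral>\<^sup>+y. f (point \<zeta> x y) \<partial>LS F) \<partial>LS F) \<partial>LS E)"
  if [measurable]: "f \<in> borel_measurable borel" for f unfolding V_def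
  by (subst nn_integral_distr) (auto simp: split_beta FF.nn_integral_fst[symmetric] F.nn_integral_fst[symmetric])
 have fin: "emeasure V (cball 0 r) < \<infinity>" for r
 proof -
  obtain N where N: "N > 0" "\<And>x. norm (prF x) <= norm x * N" using bounded_linear.pos_bounded[OF bounded_linear_pr(2)] by blast
  obtain M where M: "M > 0" "\<And>x. norm (prE x) <= norm x * M" using bounded_linear.pos_bounded[OF bounded_linear_pr(1)] by blast
  obtain L where L: "L > 0" "\<And>x. norm (prG x) <= norm x * L" using bounded_linear.pos_bounded[OF bounded_linear_pr(3)] by blast
  have "emeasure V (cball 0 r) = (\<integral>\<^sup>+q. indicator (cball 0 r) q \<partial>V)" by (simp add: sV)
  also have "\<dots> = (\<integral>\<^sup>+\<zeta>. (\<integral>\<^sup>+x. (\<integral>\<^sup>+y. indicator (cball 0 r) (point \<zeta> x y) \<partial>LS F) \<partial>LS F) \<partial>LS E)"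
   by (rule V) (auto intro!: borel_measurable_indicator)
  also have "\<dots> <= (\<integral>\<^sup>+\<zeta>. (\<integral>\<^sup>+x. (\<integral>\<^sup>+y. indicator (cball 0 (r * M)) \<zeta> * (indicator (cball 0 (r * N)) x * indicator (cball 0 (r * L)) y) \<partial>LS F) \<partial>LS F) \<partial>LS E)"
  proof (rule nn_integral_mono_AE, use AE_LS[OF subspace_E] in eventually_elim, rule nn_integral_mono_AE,
    use AE_LS[OF subspace_F] in eventually_elim, rule nn_integral_mono_AE, use AE_LS[OF subspace_F] in eventually_elim)
   fix \<zeta> x y assume m: "\<zeta> \<in> E" "x \<in> F" "y \<in> F"
   show "(indicator (cball 0 r) (point \<zeta> x y) :: ennreal) <= indicator (cball 0 (r * M)) \<zeta> * (indicator (cball 0 (r * N)) x * indicator (cball 0 (r * L)) y)"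
   proof (cases "norm (point \<zeta> x y) <= r")
    case True
    have "norm \<zeta> <= r * M" using order_trans[OF M(2)[of "point \<zeta> x y"] mult_right_mono[OF True less_imp_le[OF M(1)]]] m by simp
    moreover have "norm x <= r * N" using order_trans[OF N(2)[of "point \<zeta> x y"] mult_right_mono[OF True less_imp_le[OF N(1)]]] m by simp
    moreover have "norm y <= r * L" using order_trans[OF L(2)[of "point \<zeta> x y"] mult_right_mono[OF True less_imp_le[OF L(1)]]] m by simp
    ultimately show ?thesis by (simp add: indicator_def)
   qed (simp add: indicator_def)
  qed
  also have "\<dots> = emeasure (LS E) (cball 0 (r * M)) * (emeasure (LS F) (cball 0 (r * N)) * emeasure (LS F) (cball 0 (r * L)))"
     proof -
   have [measurable]: "(indicator (cball 0 c) :: 'a => ennreal) \<in> borel_measurable borel" for c by (rule borel_measurable_indicator) simp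
   have "(\<integral>\<^sup>+x. (\<integral>\<^sup>+y. a * (indicator (cball 0 (r * N)) x * indicator (cball 0 (r * L)) y) \<partial>LS F) \<partial>LS F)
     = a * (emeasure (LS F) (cball 0 (r * N)) * emeasure (LS F) (cball 0 (r * L)))" for a :: ennreal
   proof -
    have "(\<integral>\<^sup>+y. a * (indicator (cball 0 (r * N)) x * indicator (cball 0 (r * L)) y) \<partial>LS F)
      = a * indicator (cball 0 (r * N)) x * emeasure (LS F) (cball 0 (r * L))" for x by (subst mult.assoc[symmetric], subst nn_integral_cmult) auto
    then show ?thesis by (simp add: nn_integral_multc nn_integral_cmult mult.assoc)
   qed
   then show ?thesis by (simp add: nn_integral_multc)
  qed
  also have "\<dots> < \<infinity>" using LS_cball[OF subspace_E] LS_cball[OF subspace_F] by (simp add: ennreal_mult_less_top)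
  finally show ?thesis .
 qed
 have inv: "(\<integral>\<^sup>+p. f (p + v) \<partial>V) = (\<integral>\<^sup>+p. f p \<partial>V)" if [measurable]: "f \<in> borel_measurable borel" for f v
 proof -
  have p: "point \<zeta> x y + v = point (\<zeta> + prE v) (x + prF v) (y + prG v)" for \<zeta> x y
   by (subst (1) point_pr[of v, symmetric]) (simp add: point_def scale_right_distrib)
  have "(\<integral>\<^sup>+p. f (p + v) \<partial>V) = (\<integral>\<^sup>+\<zeta>. (\<integral>\<^sup>+x. (\<integral>\<^sup>+y. f (point (\<zeta> + prE v) (x + prF v) (y + prG v)) \<partial>LS F) \<partial>LS F) \<partial>LS E)"
   by (subst V) (auto simp: p)
  also have "\<dots> = (\<integral>\<^sup>+\<zeta>. (\<integral>\<^sup>+x. (\<integral>\<^sup>+y. f (point (\<zeta> + prE v) (x + prF v) y) \<partial>LS F) \<partial>LS F) \<partial>LS E)"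
   by (intro nn_integral_cong nn_integral_LS_translate[OF subspace_F]) auto
  also have "\<dots> = (\<integral>\<^sup>+\<zeta>. (\<integral>\<^sup>+x. (\<integral>\<^sup>+y. f (point (\<zeta> + prE v) x y) \<partial>LS F) \<partial>LS F) \<partial>LS E)"
   by (intro nn_integral_cong nn_integral_LS_translate[OF subspace_F]) auto
  also have "\<dots> = (\<integral>\<^sup>+\<zeta>. (\<integral>\<^sup>+x. (\<integral>\<^sup>+y. f (point \<zeta> x y) \<partial>LS F) \<partial>LS F) \<partial>LS E)"
   by (intro nn_integral_LS_translate[OF subspace_E]) auto
  finally show ?thesis by (simp add: V)
 qed
 obtain k where k: "k >= 0" "\<And>f. f \<in> borel_measurable borel ==> (\<integral>\<^sup>+p. f p \<partial>V) = ennreal k * (\<integral>\<^sup>+p. f p \<partial>lborel)"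
  using translation_invariant_lborel[OF sV fin inv] by blast
 have Vnz: "(\<integral>\<^sup>+p. 1 \<partial>V) \<noteq> 0" by (subst V) (use LS_nonzero[OF subspace_E] LS_nonzero[OF subspace_F] in auto)
 then have k0: "k \<noteq> 0" using k(2)[of "%_. 1"] by auto
 have slices: "(\<integral>\<^sup>+p. f p \<partial>V) = (\<integral>\<^sup>+h. (IB q. f (q + \<i> *C h)) \<partial>LS F)"
  if [measurable]: "f \<in> borel_measurable borel" for f
 proof -
  have "(\<integral>\<^sup>+h. (IB q. f (q + \<i> *C h)) \<partial>LS F) = (\<integral>\<^sup>+h. (\<integral>\<^sup>+\<zeta>. (\<integral>\<^sup>+x. f (bpoint \<zeta> x + \<i> *C h) \<partial>LS F) \<partial>LS E) \<partial>LS F)"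
   by (intro nn_integral_cong nn_integral_bB) measurable
  also have "\<dots> = (\<integral>\<^sup>+\<zeta>. (\<integral>\<^sup>+h. (\<integral>\<^sup>+x. f (bpoint \<zeta> x + \<i> *C h) \<partial>LS F) \<partial>LS F) \<partial>LS E)"
   by (rule EF.Fubini') measurable
  also have "\<dots> = (\<integral>\<^sup>+\<zeta>. (\<integral>\<^sup>+x. (\<integral>\<^sup>+h. f (bpoint \<zeta> x + \<i> *C h) \<partial>LS F) \<partial>LS F) \<partial>LS E)"
   by (intro nn_integral_cong FF.Fubini') measurable
  also have "\<dots> = (\<integral>\<^sup>+\<zeta>. (\<integral>\<^sup>+x. (\<integral>\<^sup>+h. f (point \<zeta> x h) \<partial>LS F) \<partial>LS F) \<partial>LS E)"
  proof (rule nn_integral_cong_AE, use AE_LS[OF subspace_E] in eventually_elim, rule nn_integral_cong)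
   fix \<zeta> x assume "\<zeta> \<in> E"
   \<comment> \<open>For fixed \<zeta> the height and the imaginary coordinate differ by
     \<open>Phi \<zeta> \<zeta>\<close>, a translation in F.\<close>
   have "bpoint \<zeta> x + \<i> *C h = point \<zeta> x (h + Phi \<zeta> \<zeta>)" for h by (simp add: bpoint_def point_def scale_right_distrib)
   then show "(\<integral>\<^sup>+h. f (bpoint \<zeta> x + \<i> *C h) \<partial>LS F) = (\<integral>\<^sup>+h. f (point \<zeta> x h) \<partial>LS F)"
    using nn_integral_LS_translate[OF subspace_F Phi_mem_F[OF \<open>\<zeta> \<in> E\<close>], of "%h. f (point \<zeta> x h)"] by simp
  qed
  finally show ?thesis by (simp add: V)
 qed
 show ?thesis
 proof (intro exI[of _ "1 / k"] conjI ballI)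
  show "1 / k > 0" using k(1) k0 by simp
  fix f :: "'a => ennreal" assume f: "f \<in> borel_measurable borel"
  have "ennreal (1 / k) * (\<integral>\<^sup>+h. (IB q. f (q + \<i> *C h)) \<partial>LS F) = ennreal (1 / k) * (ennreal k * (\<integral>\<^sup>+p. f p \<partial>lborel))"
   using slices[OF f] k(2)[OF f] by simp
  also have "\<dots> = ennreal (1 / k * k) * (\<integral>\<^sup>+p. f p \<partial>lborel)"
   using k(1) by (subst ennreal_mult) (simp_all add: mult.assoc)
  also have "\<dots> = (\<integral>\<^sup>+p. f p \<partial>lborel)" using k0 by simp
  finally show "(\<integral>\<^sup>+p. f p \<partial>lborel) = ennreal (1 / k) * (\<integral>\<^sup>+h. (IB q. f (q + \<i> *C h)) \<partial>LS F)" ..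
 qed
qed

end

section \<open>The Hardy space as a limit of its slices\<close>

context symmetric_siegel
begin

subsection \<open>Slices of Hardy functions\<close>

text \<open>Extension by zero, as in \<open>hardy\<close>, also makes the function Borel on the
  whole space.\<close>

definition hfun :: "('a => complex) => bool" where
 "hfun f \<longleftrightarrow> holomorphic_fun f dom & (\<forall>p. p \<notin> dom --> f p = 0)"

lemma hfun_measurable: assumes "hfun f" shows "f \<in> borel_measurable borel"
proof -
 have "(%p. if p \<in> dom then f p else 0) \<in> borel_measurable borel"
  using assms holomorphic_fun_continuous by (intro borel_measurable_continuous_on_if) (auto simp: hfun_def)
 moreover have "(%p. if p \<in> dom then f p else 0) = f" using assms by (auto simp: hfun_def)
 ultimately show ?thesis by simp
qed

definition G :: "('a => complex) => 'a => ennreal" where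
 "G f h = (IB q. ennreal ((cmod (f (q + \<i> *C h)))\<^sup>2))"

lemma hardy_norm_sq_G:
 assumes "hfun f" shows "hardy_norm_sq f = (SUP h\<in>Omega. G f h)" unfolding hardy_norm_sq_def G_def
 using hfun_measurable[OF assms] by (intro SUP_cong nn_integral_beta_bdom) auto

lemma hardy_iff: "f \<in> hardy \<longleftrightarrow> hfun f & hardy_norm_sq f < \<infinity>" by (auto simp: hardy_def hfun_def)

lemma hardyD: assumes "f \<in> hardy" shows "hfun f" "hardy_norm_sq f < \<infinity>" "hardy_norm_sq f = (SUP h\<in>Omega. G f h)"
  "f \<in> borel_measurable borel" "holomorphic_fun f dom" using assms hardy_norm_sq_G hfun_measurable by (auto simp: hardy_iff hfun_def)

lemma G_le: "f \<in> hardy ==> h \<in> Omega ==> G f h <= hardy_norm_sq f" using hardyD(3) by (auto intro: SUP_upper)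

lemma G_finite: "f \<in> hardy ==> h \<in> Omega ==> G f h < \<infinity>" using G_le hardyD(2) by (metis le_less_trans)

lemma Omega_line:
 assumes "h \<in> Omega" "k \<in> F" shows "\<exists>R>0. \<forall>s. \<bar>s\<bar> < R --> h + s *\<^sub>R k \<in> Omega"
proof -
 obtain d where d: "d > 0" "ball h d \<inter> F \<subseteq> Omega" using openin_Omega assms(1) openin_contains_ball by metis
 have "h + s *\<^sub>R k \<in> Omega" if "\<bar>s\<bar> < d / (norm k + 1)" for s
 proof -
  have "\<bar>s\<bar> * norm k <= \<bar>s\<bar> * (norm k + 1)" by (intro mult_left_mono) auto
  also have "\<dots> < d" using that by (simp add: pos_less_divide_eq add_nonneg_pos)
  finally have "h + s *\<^sub>R k \<in> ball h d" by (simp add: dist_norm)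
  then show ?thesis using d(2) Omega_F[OF assms(1)] assms(2) by (auto simp: F_subspace)
 qed
 then show ?thesis using d(1) by (intro exI[of _ "d / (norm k + 1)"]) (auto simp: add_nonneg_pos)
qed

lemma line_rewrite:
 "q + \<i> *C h + (complex_of_real r * cis t) *C k = (q + (r * cos t) *\<^sub>R k) + \<i> *C (h + (r * sin t) *\<^sub>R k)"
proof -
 have "complex_of_real r * cis t = complex_of_real (r * cos t) + \<i> * complex_of_real (r * sin t)" by (simp add: complex_eq_iff)
 then show ?thesis by (simp add: scaleR_eq scale_left_distrib scale_right_distrib)
qed

text \<open>On a complex circle in direction k, the real part is a translation in F, under which
  \<open>bB\<close> is invariant. Only the change of height remains.\<close>

lemma circle_slices:
 assumes "hfun f" "k \<in> F"
 shows "(IB q. (\<integral>\<^sup>+\<theta>\<in>{0..1}. ennreal ((cmod (f (q + \<i> *C h + (complex_of_real r * cis (2 * pi * \<theta>)) *C k)))\<^sup>2) \<partial>lborel))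
  = (\<integral>\<^sup>+\<theta>\<in>{0..1}. G f (h + (r * sin (2 * pi * \<theta>)) *\<^sub>R k) \<partial>lborel)"
proof -
 have [measurable]: "f \<in> borel_measurable borel" by (rule hfun_measurable[OF assms(1)])
 interpret B: sigma_finite_measure bB by (rule sigma_finite_bB)
 interpret P: pair_sigma_finite bB "lborel :: real measure" by standard
 have m: "(%\<theta>. (r * sin (2 * pi * \<theta>)) *\<^sub>R k) \<in> borel_measurable borel"
   "(%\<theta>. (r * cos (2 * pi * \<theta>)) *\<^sub>R k) \<in> borel_measurable borel"
  by (auto intro!: borel_measurable_continuous_onI continuous_intros)
 note [measurable] = m
 have "(IB q. (\<integral>\<^sup>+\<theta>\<in>{0..1}. ennreal ((cmod (f (q + \<i> *C h + (complex_of_real r * cis (2 * pi * \<theta>)) *C k)))\<^sup>2) \<partial>lborel))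
   = (\<integral>\<^sup>+\<theta>. (IB q. ennreal ((cmod (f ((q + (r * cos (2 * pi * \<theta>)) *\<^sub>R k) + \<i> *C (h + (r * sin (2 * pi * \<theta>)) *\<^sub>R k))))\<^sup>2)
     * indicator {0..1} \<theta>) \<partial>lborel)" unfolding line_rewrite by (rule P.Fubini'[symmetric]) measurable
 also have "\<dots> = (\<integral>\<^sup>+\<theta>\<in>{0..1}. G f (h + (r * sin (2 * pi * \<theta>)) *\<^sub>R k) \<partial>lborel)"
 proof (rule nn_integral_cong)
  fix \<theta>
  have "(IB q. ennreal ((cmod (f ((q + (r * cos (2 * pi * \<theta>)) *\<^sub>R k) + \<i> *C (h + (r * sin (2 * pi * \<theta>)) *\<^sub>R k))))\<^sup>2))
    = G f (h + (r * sin (2 * pi * \<theta>)) *\<^sub>R k)" unfolding G_def using assms(2)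
   by (intro bB_translate[of "(r * cos (2 * pi * \<theta>)) *\<^sub>R k"
     "%q. ennreal ((cmod (f (q + \<i> *C (h + (r * sin (2 * pi * \<theta>)) *\<^sub>R k))))\<^sup>2)"]) (auto simp: F_subspace)
  then show "(IB q. ennreal ((cmod (f ((q + (r * cos (2 * pi * \<theta>)) *\<^sub>R k) + \<i> *C (h + (r * sin (2 * pi * \<theta>)) *\<^sub>R k))))\<^sup>2)
     * indicator {0..1} \<theta>) = G f (h + (r * sin (2 * pi * \<theta>)) *\<^sub>R k) * indicator {0..1} \<theta>" by (subst nn_integral_multc) auto
 qed
 finally show ?thesis .
qed

lemma line_holomorphic:
 assumes "hfun f" "k \<in> F" "\<And>s. \<bar>s\<bar> < R ==> h + s *\<^sub>R k \<in> Omega" "q \<in> bdom"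
 shows "(%w. f (q + \<i> *C h + w *C k)) holomorphic_on ball 0 R"
proof (rule holomorphic_fun_line)
 show "holomorphic_fun f dom" using assms(1) by (simp add: hfun_def)
 fix w :: complex assume w: "w \<in> ball 0 R"
 have eq: "q + \<i> *C h + w *C k = (q + Re w *\<^sub>R k) + \<i> *C (h + Im w *\<^sub>R k)"
  using line_rewrite[of q h "cmod w" "Arg w" k] rcis_cmod_Arg[of w] by (simp add: rcis_def) (metis Re_rcis Im_rcis rcis_cmod_Arg)
 have "h + Im w *\<^sub>R k \<in> Omega" using w abs_Im_le_cmod[of w] by (intro assms(3)) simp
 moreover have "q + Re w *\<^sub>R k \<in> bdom" using assms(2,4) by (simp add: bdom_iff F_subspace)
 ultimately show "q + \<i> *C h + w *C k \<in> dom" unfolding eq by (intro bdom_up)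
qed

lemma G_submean:
 assumes f: "hfun f" and k: "k \<in> F" and R: "\<And>s. \<bar>s\<bar> < R ==> h + s *\<^sub>R k \<in> Omega" and r: "0 < r" "r < R"
 shows "G f h <= (\<integral>\<^sup>+\<theta>\<in>{0..1}. G f (h + (r * sin (2 * pi * \<theta>)) *\<^sub>R k) \<partial>lborel)"
proof -
 have "G f h <= (IB q. (\<integral>\<^sup>+\<theta>\<in>{0..1}. ennreal ((cmod (f (q + \<i> *C h + (complex_of_real r * cis (2 * pi * \<theta>)) *C k)))\<^sup>2) \<partial>lborel))"
  unfolding G_def
 proof (rule nn_integral_mono_AE, use AE_bB in eventually_elim)
  fix q assume "q \<in> bdom"
  from circle_mean_sq[OF line_holomorphic[OF f k R this] r]
  show "ennreal ((cmod (f (q + \<i> *C h)))\<^sup>2) <= (\<integral>\<^sup>+\<theta>\<in>{0..1}. ennreal ((cmod (f (q + \<i> *C h + (complex_of_real r * cis (2 * pi * \<theta>)) *C k)))\<^sup>2) \<partial>lborel)"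
   by simp
 qed
 then show ?thesis using circle_slices[OF f k] by simp
qed

text \<open>Dominated convergence: within half the radius, one circle mean M bounds all the
  integrands, and M is integrable because the slices it averages are bounded by the Hardy
  norm.\<close>

lemma G_tendsto:
 assumes f: "f \<in> hardy" and h: "h \<in> Omega" and k: "k \<in> F" and X: "X ----> (0::real)"
 shows "(%n. G f (h + X n *\<^sub>R k)) ----> G f h"
proof -
 note hf = hardyD[OF f]
 note [measurable] = hf(4)
 obtain R where R: "R > 0" "\<And>s. \<bar>s\<bar> < R ==> h + s *\<^sub>R k \<in> Omega" using Omega_line[OF h k] by blast
 define r where "r = R / 2"
 have r: "0 < r" "r < R" using R(1) by (auto simp: r_def)
 \<comment> \<open>Y is eventually X, but stays in the half disc for every index, as the domination
   requires.\<close>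
 define Y where "Y n = (if \<bar>X n\<bar> <= r / 2 then X n else 0)" for n
 have ev: "\<forall>\<^sub>F n in sequentially. Y n = X n"
 proof -
  have "\<forall>\<^sub>F n in sequentially. dist (X n) 0 < r / 2" using tendstoD[OF X, of "r / 2"] r(1) by simp
  then show ?thesis by eventually_elim (simp add: Y_def)
 qed
 have Y: "Y ----> 0" using X ev by (subst tendsto_cong[OF ev])
 have Yb: "\<bar>Y n\<bar> <= r / 2" for n using r(1) by (simp add: Y_def)
 define M where "M q = 2 * (\<integral>\<^sup>+\<theta>\<in>{0..1}. ennreal ((cmod (f (q + \<i> *C h + (complex_of_real r * cis (2 * pi * \<theta>)) *C k)))\<^sup>2) \<partial>lborel)" for q
 have m: "(%\<theta>. (complex_of_real r * cis (2 * pi * \<theta>)) *C k) \<in> borel_measurable borel"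
  by (auto intro!: borel_measurable_continuous_onI continuous_intros)
 note [measurable] = m
 have M[measurable]: "M \<in> borel_measurable borel" unfolding M_def by measurable
 have Mfin: "(IB q. M q) < \<infinity>"
 proof -
  have "(IB q. M q) = 2 * (\<integral>\<^sup>+\<theta>\<in>{0..1}. G f (h + (r * sin (2 * pi * \<theta>)) *\<^sub>R k) \<partial>lborel)"
   unfolding M_def circle_slices[OF hf(1) k, symmetric] by (rule nn_integral_cmult) measurable
  also have "(\<integral>\<^sup>+\<theta>\<in>{0..1}. G f (h + (r * sin (2 * pi * \<theta>)) *\<^sub>R k) \<partial>lborel) <= (\<integral>\<^sup>+\<theta>\<in>{0..1::real}. hardy_norm_sq f \<partial>lborel)"
  proof (rule nn_integral_mono)
   fix \<theta> :: real
   have "\<bar>r * sin (2 * pi * \<theta>)\<bar> <= r" using r(1) abs_sin_le_one[of "2 * pi * \<theta>"] by (simp add: abs_mult mult_left_le)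
   then have "h + (r * sin (2 * pi * \<theta>)) *\<^sub>R k \<in> Omega" using r(2) by (intro R(2)) linarith
   then show "G f (h + (r * sin (2 * pi * \<theta>)) *\<^sub>R k) * indicator {0..1} \<theta> <= hardy_norm_sq f * indicator {0..1} \<theta>"
    by (intro mult_right_mono G_le[OF f]) auto
  qed
  also have "\<dots> = hardy_norm_sq f" by (simp add: nn_integral_cmult_indicator)
  finally have "(IB q. M q) <= 2 * hardy_norm_sq f" by (simp add: mult_left_mono)
  then show ?thesis using hf(2) by (auto simp: ennreal_mult_less_top intro: le_less_trans)
 qed
 have "(%n. G f (h + Y n *\<^sub>R k)) ----> G f h" unfolding G_def
 proof (rule nn_integral_dominated_convergence[where w = M])
  show "AE q in bB. ennreal ((cmod (f (q + \<i> *C (h + Y n *\<^sub>R k))))\<^sup>2) <= M q" for n using AE_bB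
  proof eventually_elim
   fix q assume q: "q \<in> bdom"
   have "cmod (complex_of_real (Y n) * \<i> - 0) <= r / 2" using Yb[of n] by (simp add: norm_mult)
   from circle_sq_bound2[OF line_holomorphic[OF hf(1) k R(2) q] r this]
   show "ennreal ((cmod (f (q + \<i> *C (h + Y n *\<^sub>R k))))\<^sup>2) <= M q"
    by (simp add: M_def scale_right_distrib scaleR_eq mult.commute add.assoc)
  qed
  show "AE q in bB. (%n. ennreal ((cmod (f (q + \<i> *C (h + Y n *\<^sub>R k))))\<^sup>2)) ----> ennreal ((cmod (f (q + \<i> *C h)))\<^sup>2)"
   using AE_bB
  proof eventually_elim
   fix q assume q: "q \<in> bdom"
   have cont: "continuous_on dom f" using hf(5) holomorphic_fun_continuous by blast
   have inD: "q + \<i> *C (h + Y n *\<^sub>R k) \<in> dom" for n using Yb[of n] r by (intro bdom_up[OF q] R(2)) linarith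
   have "(%n. q + \<i> *C (h + Y n *\<^sub>R k)) ----> q + \<i> *C (h + 0 *\<^sub>R k)"
    using Y by (intro tendsto_intros bounded_bilinear.tendsto[OF bounded_bilinear_scaleC])
   then have lim: "(%n. q + \<i> *C (h + Y n *\<^sub>R k)) ----> q + \<i> *C h" by simp
   have "(%n. f (q + \<i> *C (h + Y n *\<^sub>R k))) ----> f (q + \<i> *C h)"
    by (rule continuous_on_tendsto_compose[OF cont lim bdom_up[OF q h]]) (use inD in simp)
   then show "(%n. ennreal ((cmod (f (q + \<i> *C (h + Y n *\<^sub>R k))))\<^sup>2)) ----> ennreal ((cmod (f (q + \<i> *C h)))\<^sup>2)"
    by (intro tendsto_intros)
  qed
 qed (use Mfin in measurable)
 moreover have "\<forall>\<^sub>F n in sequentially. G f (h + Y n *\<^sub>R k) = G f (h + X n *\<^sub>R k)" using ev by eventually_elim simp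
 ultimately show ?thesis by (rule Lim_transform_eventually)
qed

text \<open>Along h + t k the slice norm is bounded, continuous and sub-mean, so the half-plane
  maximum principle bounds it by its value at t = 0.\<close>

lemma G_antimono:
 assumes f: "f \<in> hardy" and h: "h \<in> Omega" and k: "k \<in> cone" and s: "s >= 0"
 shows "G f (h + s *\<^sub>R k) <= G f h"
proof -
 have kF: "k \<in> F" by (rule cone_F[OF k])
 define g where "g t = enn2real (G f (h + t *\<^sub>R k))" for t
 have inO: "h + t *\<^sub>R k \<in> Omega" if "t >= 0" for t using Omega_add[OF h cone_scaleR[OF k that]] .
 have fin: "G f (h + t *\<^sub>R k) < \<infinity>" if "t >= 0" for t using G_finite[OF f inO[OF that]] .
 have eq: "G f (h + t *\<^sub>R k) = ennreal (g t)" if "t >= 0" for t using fin[OF that] by (simp add: g_def)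
 have cont: "continuous_on {0..} g"
 proof (rule continuous_on_sequentiallyI)
  fix X :: "nat => real" and t assume X: "\<forall>n. X n \<in> {0..}" "t \<in> {0..}" "X ----> t"
  have "(%n. G f ((h + t *\<^sub>R k) + (X n - t) *\<^sub>R k)) ----> G f (h + t *\<^sub>R k)"
   using X by (intro G_tendsto[OF f inO kF]) (auto intro: LIM_zero)
  then have "(%n. G f (h + X n *\<^sub>R k)) ----> G f (h + t *\<^sub>R k)" by (simp add: scaleR_left_diff_distrib)
  then show "(%n. g (X n)) ----> g t" unfolding g_def using fin[of t] X(2) by (intro tendsto_enn2real) auto
 qed
 have "g s <= g 0"
 proof (rule bounded_submean_decreasing[OF cont _ _ s])
  show "g t <= enn2real (hardy_norm_sq f)" if "t >= 0" for t
   unfolding g_def using G_le[OF f inO[OF that]] hardyD(2)[OF f] by (intro enn2real_mono) auto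
  fix t :: real assume t: "t > 0"
  obtain d where d: "d > 0" "\<And>u. \<bar>u\<bar> < d ==> h + u *\<^sub>R k \<in> Omega" using Omega_line[OF h kF] by blast
  \<comment> \<open>The circle of radius t about h + t k just touches height h; the room d below h
    makes it lie inside a larger disc of holomorphy.\<close>
  have R: "h + t *\<^sub>R k + u *\<^sub>R k \<in> Omega" if "\<bar>u\<bar> < t + d" for u
  proof -
   have "h + (t + u) *\<^sub>R k \<in> Omega" using d(2)[of "t + u"] inO[of "t + u"] that by (cases "t + u >= 0") auto
   then show ?thesis by (simp add: scaleR_left_distrib add.assoc)
  qed
  have nn: "t + t * sin (2 * pi * \<theta>) >= 0" for \<theta>
   using t sin_ge_minus_one[of "2 * pi * \<theta>"] mult_left_mono[of "-1" "sin (2 * pi * \<theta>)" t] by simp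
  have contg: "continuous_on {0..1} (%\<theta>. g (t + t * sin (2 * pi * \<theta>)))"
   by (rule continuous_on_compose2[OF cont]) (use nn in \<open>auto intro!: continuous_intros\<close>)
  have "ennreal (g t) = G f (h + t *\<^sub>R k)" using eq t by simp
  also have "\<dots> <= (\<integral>\<^sup>+\<theta>\<in>{0..1}. G f (h + t *\<^sub>R k + (t * sin (2 * pi * \<theta>)) *\<^sub>R k) \<partial>lborel)"
   using t d(1) by (intro G_submean[OF hardyD(1)[OF f] kF R]) auto
  also have "\<dots> = (\<integral>\<^sup>+\<theta>\<in>{0..1}. ennreal (g (t + t * sin (2 * pi * \<theta>))) \<partial>lborel)"
   using eq[OF nn] by (simp add: scaleR_left_distrib add.assoc)
  also have "\<dots> = ennreal (integral {0..1} (%\<theta>. g (t + t * sin (2 * pi * \<theta>))))"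
   by (intro nn_integral_has_integral_lebesgue' integrable_integral integrable_continuous_interval contg)
     (simp add: g_def)
  finally show "g t <= integral {0..1} (%\<theta>. g (t + t * sin (2 * pi * \<theta>)))"
  proof (subst (asm) ennreal_le_iff)
   show "0 <= integral {0..1} (%\<theta>. g (t + t * sin (2 * pi * \<theta>)))"
    by (intro integral_nonneg integrable_continuous_interval contg) (simp add: g_def)
  qed
 qed
 then have "ennreal (g s) <= ennreal (g 0)" by (rule ennreal_leI)
 then show ?thesis using eq[OF s] eq[of 0] by simp
qed

abbreviation tn :: "nat => real" where "tn n \<equiv> inverse (real (Suc n))"

lemma G_up: "G f (t *\<^sub>R e) = (IB q. ennreal ((cmod (f (up t q)))\<^sup>2))" by (simp add: G_def up_def)

text \<open>For h in \<open>Omega\<close>, some h - \<open>tn n *\<^sub>R e\<close> still lies in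
  the cone, and slice norms decrease along the cone. The supremum is thus a limit over one sequence
  of slices.\<close>

lemma hardy_norm_sq_lim:
 assumes f: "f \<in> hardy" shows "(%n. G f (tn n *\<^sub>R e)) ----> hardy_norm_sq f"
proof -
 have mono: "G f (t *\<^sub>R e) <= G f (s *\<^sub>R e)" if "0 < s" "s <= t" for s t
  using G_antimono[OF f e_in_Omega[OF that(1)] e_in_cone, of "t - s" 1] that by (simp flip: scaleR_left_distrib)
 have "incseq (%n. G f (tn n *\<^sub>R e))" by (intro incseq_SucI mono) (auto simp: field_simps)
 from LIMSEQ_SUP[OF this] have lim: "(%n. G f (tn n *\<^sub>R e)) ----> (SUP n. G f (tn n *\<^sub>R e))" .
 have "(SUP n. G f (tn n *\<^sub>R e)) = hardy_norm_sq f"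
 proof (rule antisym)
  show "(SUP n. G f (tn n *\<^sub>R e)) <= hardy_norm_sq f" by (intro SUP_least G_le[OF f]) simp
  show "hardy_norm_sq f <= (SUP n. G f (tn n *\<^sub>R e))" unfolding hardyD(3)[OF f]
  proof (rule SUP_least)
   fix h assume h: "h \<in> Omega"
   obtain d where d: "d > 0" "\<And>t. \<bar>t\<bar> < d ==> h - t *\<^sub>R e \<in> Omega" using Omega_minus_e[OF h] by blast
   obtain n where n: "tn n < d" using reals_Archimedean[OF d(1)] by blast
   have "h - tn n *\<^sub>R e \<in> cone" using n by (intro Omega_cone d(2)) simp
   from G_antimono[OF f e_in_Omega this, of "tn n" 1] have "G f h <= G f (tn n *\<^sub>R e)" by simp
   also have "\<dots> <= (SUP n. G f (tn n *\<^sub>R e))" by (rule SUP_upper) simp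
   finally show "G f h <= (SUP n. G f (tn n *\<^sub>R e))" .
  qed
 qed
 with lim show ?thesis by simp
qed

subsection \<open>The inner product\<close>

lemma hardy_add:
 assumes f: "f \<in> hardy" and g: "g \<in> hardy" shows "(%p. f p + g p) \<in> hardy"
proof -
 have h: "hfun (%p. f p + g p)" using hardyD(1)[OF f] hardyD(1)[OF g] by (auto simp: hfun_def intro: holomorphic_fun_add)
 note [measurable] = hardyD(4)[OF f] hardyD(4)[OF g]
 have "G (%p. f p + g p) h <= 2 * hardy_norm_sq f + 2 * hardy_norm_sq g" if "h \<in> Omega" for h
 proof -
  have "G (%p. f p + g p) h <= (IB q. 2 * ennreal ((cmod (f (q + \<i> *C h)))\<^sup>2) + 2 * ennreal ((cmod (g (q + \<i> *C h)))\<^sup>2))"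
   unfolding G_def
  proof (rule nn_integral_mono)
   fix q
   let ?a = "f (q + \<i> *C h)" let ?b = "g (q + \<i> *C h)"
   have "(cmod (?a + ?b))\<^sup>2 <= (cmod ?a + cmod ?b)\<^sup>2" by (intro power_mono norm_triangle_ineq) simp
   also have "\<dots> <= 2 * (cmod ?a)\<^sup>2 + 2 * (cmod ?b)\<^sup>2"
    using sum_squares_ge_zero[of "cmod ?a - cmod ?b" 0] by (simp add: power2_eq_square algebra_simps)
   finally have "ennreal ((cmod (?a + ?b))\<^sup>2) <= ennreal (2 * (cmod ?a)\<^sup>2 + 2 * (cmod ?b)\<^sup>2)" by (rule ennreal_leI)
   then show "ennreal ((cmod (?a + ?b))\<^sup>2) <= 2 * ennreal ((cmod ?a)\<^sup>2) + 2 * ennreal ((cmod ?b)\<^sup>2)"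
    by (simp add: ennreal_plus ennreal_mult)
  qed
  also have "\<dots> = 2 * G f h + 2 * G g h" unfolding G_def by (subst nn_integral_add) (auto simp: nn_integral_cmult)
  also have "\<dots> <= 2 * hardy_norm_sq f + 2 * hardy_norm_sq g" using G_le[OF f that] G_le[OF g that] by (intro add_mono mult_left_mono) auto
  finally show ?thesis .
 qed
 then have "hardy_norm_sq (%p. f p + g p) <= 2 * hardy_norm_sq f + 2 * hardy_norm_sq g" unfolding hardy_norm_sq_G[OF h] by (rule SUP_least)
 also have "\<dots> < \<infinity>" using hardyD(2)[OF f] hardyD(2)[OF g] by (simp add: ennreal_mult_less_top)
 finally show ?thesis using h by (simp add: hardy_iff)
qed

lemma hardy_cmult:
 assumes f: "f \<in> hardy" shows "(%p. c * f p) \<in> hardy" 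
  "hardy_norm_sq (%p. c * f p) = ennreal ((cmod c)\<^sup>2) * hardy_norm_sq f"
proof -
 have h: "hfun (%p. c * f p)" using hardyD(1)[OF f] by (auto simp: hfun_def intro: holomorphic_fun_cmult)
 note [measurable] = hardyD(4)[OF f]
 have "G (%p. c * f p) h = ennreal ((cmod c)\<^sup>2) * G f h" for h
  unfolding G_def by (subst nn_integral_cmult[symmetric]) (auto simp: norm_mult power_mult_distrib ennreal_mult)
 then show *: "hardy_norm_sq (%p. c * f p) = ennreal ((cmod c)\<^sup>2) * hardy_norm_sq f"
  unfolding hardy_norm_sq_G[OF h] hardyD(3)[OF f] by (simp add: SUP_mult_left_ennreal)
 then show "(%p. c * f p) \<in> hardy" using h hardyD(2)[OF f] by (simp add: hardy_iff ennreal_mult_less_top)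
qed

lemma hardy_diff:
 assumes "f \<in> hardy" "g \<in> hardy" shows "(%p. f p - g p) \<in> hardy"
 using hardy_add[OF assms(1) hardy_cmult(1)[OF assms(2), of "-1"]] by simp

lemma hardy_sq_integrable:
 assumes f: "f \<in> hardy" and t: "t > 0" shows "integrable bB (%q. (cmod (f (up t q)))\<^sup>2)"
proof -
 note [measurable] = hardyD(4)[OF f]
 have "G f (t *\<^sub>R e) < \<infinity>" using G_finite[OF f] t by simp
 then have "(IB q. ennreal (norm ((cmod (f (up t q)))\<^sup>2))) < \<infinity>" unfolding G_up by simp
 moreover have "(%q. (cmod (f (up t q)))\<^sup>2) \<in> borel_measurable bB" unfolding up_def by measurable
 ultimately show ?thesis by (simp add: integrable_iff_bounded)
qed

lemma measurable_cnj [measurable]: "cnj \<in> borel_measurable borel" by (intro borel_measurable_continuous_onI continuous_intros)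

lemma hardy_prod_integrable:
 assumes f: "f \<in> hardy" and g: "g \<in> hardy" and t: "t > 0"
 shows "integrable bB (%q. f (up t q) * cnj (g (up t q)))"
proof (rule Bochner_Integration.integrable_bound)
 note [measurable] = hardyD(4)[OF f] hardyD(4)[OF g]
 show "integrable bB (%q. (cmod (f (up t q)))\<^sup>2 + (cmod (g (up t q)))\<^sup>2)"
  by (intro Bochner_Integration.integrable_add hardy_sq_integrable f g t)
 show "(%q. f (up t q) * cnj (g (up t q))) \<in> borel_measurable bB" unfolding up_def by measurable
 show "AE q in bB. norm (f (up t q) * cnj (g (up t q))) <= norm ((cmod (f (up t q)))\<^sup>2 + (cmod (g (up t q)))\<^sup>2)"
 proof (rule AE_I2)
  fix q
  have "2 * (cmod (f (up t q)) * cmod (g (up t q))) <= (cmod (f (up t q)))\<^sup>2 + (cmod (g (up t q)))\<^sup>2"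
   using sum_squares_ge_zero[of "cmod (f (up t q)) - cmod (g (up t q))" 0] by (simp add: power2_eq_square algebra_simps)
  moreover have "cmod (f (up t q)) * cmod (g (up t q)) >= 0" by simp
  ultimately have "cmod (f (up t q)) * cmod (g (up t q)) <= (cmod (f (up t q)))\<^sup>2 + (cmod (g (up t q)))\<^sup>2" by linarith
  then show "norm (f (up t q) * cnj (g (up t q))) <= norm ((cmod (f (up t q)))\<^sup>2 + (cmod (g (up t q)))\<^sup>2)" by (simp add: norm_mult)
 qed
qed

definition slice_inner :: "('a => complex) => ('a => complex) => real => complex" where
 "slice_inner f g t = (\<integral>q. f (up t q) * cnj (g (up t q)) \<partial>bB)"

lemma G_eq_integral:
 assumes "f \<in> hardy" "t > 0" shows "enn2real (G f (t *\<^sub>R e)) = (\<integral>q. (cmod (f (up t q)))\<^sup>2 \<partial>bB)"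
 using nn_integral_eq_integral[OF hardy_sq_integrable[OF assms]] by (simp add: G_up)

lemma polarization_sum:
 "(\<Sum>k<4. \<i> ^ k * complex_of_real ((cmod (a + \<i> ^ k * b))\<^sup>2)) / 4 = a * cnj b"
proof -
 have *: "(\<Sum>k<4. u k) = u 0 + u 1 + u 2 + u 3" for u :: "nat => complex" by (simp add: eval_nat_numeral)
 have i3: "\<i> ^ 3 = - \<i>" by (simp add: eval_nat_numeral)
 show ?thesis unfolding * i3 complex_norm_square by (simp add: algebra_simps)
qed

lemma polarization_slice:
 assumes f: "f \<in> hardy" and g: "g \<in> hardy" and t: "t > 0"
 shows "(\<Sum>k<4. \<i> ^ k * complex_of_real (enn2real (G (%p. f p + \<i> ^ k * g p) (t *\<^sub>R e)))) / 4 = slice_inner f g t"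
proof -
 have m: "(%p. f p + \<i> ^ k * g p) \<in> hardy" for k by (intro hardy_add f hardy_cmult(1) g)
 have i: "integrable bB (%q. complex_of_real ((cmod (f (up t q) + \<i> ^ k * g (up t q)))\<^sup>2))" for k
  using hardy_sq_integrable[OF m t, of k] by (subst complex_of_real_integrable_eq)
 have "(\<Sum>k<4. \<i> ^ k * complex_of_real (enn2real (G (%p. f p + \<i> ^ k * g p) (t *\<^sub>R e)))) / 4
   = (\<Sum>k<4. \<i> ^ k * (\<integral>q. complex_of_real ((cmod (f (up t q) + \<i> ^ k * g (up t q)))\<^sup>2) \<partial>bB)) / 4"
  by (simp only: G_eq_integral[OF m t] integral_complex_of_real)
 also have "\<dots> = (\<integral>q. (\<Sum>k<4. \<i> ^ k * complex_of_real ((cmod (f (up t q) + \<i> ^ k * g (up t q)))\<^sup>2)) / 4 \<partial>bB)"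
  using i by (subst integral_divide_zero, subst Bochner_Integration.integral_sum) auto
 finally show ?thesis unfolding polarization_sum slice_inner_def .
qed

text \<open>Polarization of suprema does not look additive. On each slice it is an inner product of
  L^2, and the sesquilinear rules follow in the limit.\<close>

lemma hardy_inner_lim:
 assumes f: "f \<in> hardy" and g: "g \<in> hardy"
 shows "(%n. slice_inner f g (tn n)) ----> hardy_inner f g"
proof -
 have m: "(%p. f p + \<i> ^ k * g p) \<in> hardy" for k by (intro hardy_add f hardy_cmult(1) g)
 have "(%n. enn2real (G (%p. f p + \<i> ^ k * g p) (tn n *\<^sub>R e))) ----> enn2real (hardy_norm_sq (%p. f p + \<i> ^ k * g p))" for k
  using hardy_norm_sq_lim[OF m] hardyD(2)[OF m] by (intro tendsto_enn2real) auto
 then have "(%n. (\<Sum>k<4. \<i> ^ k * complex_of_real (enn2real (G (%p. f p + \<i> ^ k * g p) (tn n *\<^sub>R e)))) / 4) ----> hardy_inner f g"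
  unfolding hardy_inner_def by (intro tendsto_divide tendsto_sum tendsto_mult tendsto_const tendsto_of_real) auto
 then show ?thesis by (subst (asm) polarization_slice[OF f g]) auto
qed

lemma hardy_inner_add:
 assumes "f \<in> hardy" "g \<in> hardy" "k \<in> hardy"
 shows "hardy_inner (%p. f p + g p) k = hardy_inner f k + hardy_inner g k"
proof (rule LIMSEQ_unique[OF hardy_inner_lim[OF hardy_add[OF assms(1,2)] assms(3)]])
 have "slice_inner (%p. f p + g p) k (tn n) = slice_inner f k (tn n) + slice_inner g k (tn n)" for n unfolding slice_inner_def
  by (subst Bochner_Integration.integral_add[symmetric])
    (auto intro!: hardy_prod_integrable assms simp: algebra_simps)
 then show "(%n. slice_inner (%p. f p + g p) k (tn n)) ----> hardy_inner f k + hardy_inner g k"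
  by (simp add: tendsto_add[OF hardy_inner_lim[OF assms(1,3)] hardy_inner_lim[OF assms(2,3)]] del: of_nat_Suc)
qed

lemma hardy_inner_cmult:
 assumes "f \<in> hardy" "k \<in> hardy"
 shows "hardy_inner (%p. c * f p) k = c * hardy_inner f k"
proof (rule LIMSEQ_unique[OF hardy_inner_lim[OF hardy_cmult(1)[OF assms(1)] assms(2)]])
 have "slice_inner (%p. c * f p) k (tn n) = c * slice_inner f k (tn n)" for n unfolding slice_inner_def by (simp add: mult.assoc)
 then show "(%n. slice_inner (%p. c * f p) k (tn n)) ----> c * hardy_inner f k"
  by (simp add: tendsto_mult_left[OF hardy_inner_lim[OF assms]] del: of_nat_Suc)
qed

lemma hardy_inner_cnj:
 assumes "f \<in> hardy" "g \<in> hardy" shows "hardy_inner g f = cnj (hardy_inner f g)"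
proof (rule LIMSEQ_unique[OF hardy_inner_lim[OF assms(2,1)]])
 have "slice_inner g f (tn n) = cnj (slice_inner f g (tn n))" for n
  unfolding slice_inner_def by (subst Bochner_Integration.integral_cnj[symmetric]) (simp add: mult.commute)
 then show "(%n. slice_inner g f (tn n)) ----> cnj (hardy_inner f g)" by (simp add: tendsto_cnj[OF hardy_inner_lim[OF assms]] del: of_nat_Suc)
qed

lemma hardy_inner_self:
 assumes f: "f \<in> hardy" shows "hardy_inner f f = complex_of_real (enn2real (hardy_norm_sq f))"
proof (rule LIMSEQ_unique[OF hardy_inner_lim[OF f f]])
 have "slice_inner f f (tn n) = complex_of_real (enn2real (G f (tn n *\<^sub>R e)))" for n
  unfolding slice_inner_def by (subst G_eq_integral[OF f]) (auto simp flip: complex_norm_square integral_complex_of_real)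
 moreover have "(%n. enn2real (G f (tn n *\<^sub>R e))) ----> enn2real (hardy_norm_sq f)"
  using hardy_norm_sq_lim[OF f] hardyD(2)[OF f] by (intro tendsto_enn2real) auto
 ultimately show "(%n. slice_inner f f (tn n)) ----> complex_of_real (enn2real (hardy_norm_sq f))"
  by (simp add: tendsto_of_real del: of_nat_Suc)
qed

text \<open>It turns the L^2 pairing over the slice at height t into an inner product of Hardy
  functions (\<open>hardy_inner_shift\<close>), to which the reproducing property applies.\<close>

definition shift :: "real => ('a => complex) => 'a => complex" where
 "shift t f p = (if p \<in> dom then f (up t p) else 0)"

lemma hfun_restrict:
 assumes "holomorphic_fun f dom" shows "hfun (%p. if p \<in> dom then f p else 0)"
 unfolding hfun_def using holomorphic_fun_cong[OF assms open_dom] by auto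

lemma hfun_shift:
 assumes "hfun f" "t >= 0" shows "hfun (shift t f)"
proof -
 have "holomorphic_fun (%p. f (up t p)) dom"
  unfolding up_def using assms dom_up by (intro holomorphic_fun_translate[of f dom]) (auto simp: hfun_def)
 from hfun_restrict[OF this] show ?thesis by (simp add: shift_def[abs_def])
qed

lemma G_shift:
 assumes "h \<in> Omega" shows "G (shift t f) h = G f (h + t *\<^sub>R e)" unfolding G_def
proof (rule nn_integral_bB_cong)
 fix q assume "q \<in> bdom"
 then have "q + \<i> *C h \<in> dom" using assms by (rule bdom_up)
 then show "ennreal ((cmod (shift t f (q + \<i> *C h)))\<^sup>2) = ennreal ((cmod (f (q + \<i> *C (h + t *\<^sub>R e))))\<^sup>2)"
  by (simp add: shift_def up_def scale_right_distrib add.assoc)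
qed

text \<open>The slices of the shifted function are slices of f above height t, and along multiples
  of e they return to the slice at t by continuity.\<close>

lemma shift_hardy:
 assumes f: "f \<in> hardy" and t: "t > 0"
 shows "shift t f \<in> hardy" "hardy_norm_sq (shift t f) = G f (t *\<^sub>R e)"
proof -
 have h: "hfun (shift t f)" using hfun_shift[OF hardyD(1)[OF f]] t by simp
 have "hardy_norm_sq (shift t f) <= hardy_norm_sq f" unfolding hardy_norm_sq_G[OF h]
  using G_shift G_le[OF f Omega_add] t by (intro SUP_least) (simp)
 then show S: "shift t f \<in> hardy" using h hardyD(2)[OF f] by (auto simp: hardy_iff intro: le_less_trans)
 have "(%n. G (shift t f) (tn n *\<^sub>R e)) ----> G f (t *\<^sub>R e)"
 proof -
  have "(%n. G f (t *\<^sub>R e + tn n *\<^sub>R e)) ----> G f (t *\<^sub>R e)"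
   using t by (intro G_tendsto[OF f] LIMSEQ_inverse_real_of_nat) auto
  then show ?thesis by (subst G_shift) (auto simp: add.commute)
 qed
 from LIMSEQ_unique[OF hardy_norm_sq_lim[OF S] this] show "hardy_norm_sq (shift t f) = G f (t *\<^sub>R e)" .
qed

lemma hardy_inner_shift:
 assumes f: "f \<in> hardy" and g: "g \<in> hardy" and t: "t > 0"
 shows "hardy_inner (shift t f) (shift t g) = slice_inner f g t"
proof -
 have m: "(%p. f p + \<i> ^ k * g p) \<in> hardy" for k by (intro hardy_add f hardy_cmult(1) g)
 have "(%p. shift t f p + \<i> ^ k * shift t g p) = shift t (%p. f p + \<i> ^ k * g p)" for k by (auto simp: shift_def)
 then have "hardy_norm_sq (%p. shift t f p + \<i> ^ k * shift t g p) = G (%p. f p + \<i> ^ k * g p) (t *\<^sub>R e)" for k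
  using shift_hardy(2)[OF m t] by simp
 then show ?thesis unfolding hardy_inner_def by (simp add: polarization_slice[OF f g t])
qed

end

section \<open>Interior estimates and completeness of the Hardy space\<close>

context positive_hermitian_jts
begin

subsection \<open>Volume means and derivative bounds\<close>

text \<open>Balls of the trace form are invariant under unimodular scalars, which Euclidean balls of
  the type need not be.\<close>

definition cB :: "real => 'a set" where "cB r = {v. Re (jinner v v) <= r\<^sup>2}"

lemma cB_rot: "cmod c = 1 ==> c *C v \<in> cB r \<longleftrightarrow> v \<in> cB r"
proof -
 assume c: "cmod c = 1"
 have "jinner (c *C v) (c *C v) = (c * cnj c) * jinner v v" by (simp add: jinner_linear)
 also have "c * cnj c = 1" using c by (simp flip: complex_norm_square)
 finally show ?thesis by (simp add: cB_def)
qed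

lemma cB_scale: "v \<in> cB r ==> cmod w <= t ==> w *C v \<in> cB (t * r)"
proof -
 assume v: "v \<in> cB r" and w: "cmod w <= t"
 have "jinner (w *C v) (w *C v) = (w * cnj w) * jinner v v" by (simp add: jinner_linear)
 also have "w * cnj w = complex_of_real ((cmod w)\<^sup>2)" by (simp only: complex_norm_square)
 finally have "Re (jinner (w *C v) (w *C v)) = (cmod w)\<^sup>2 * Re (jinner v v)" by (simp del: of_real_power)
 also have "\<dots> <= t\<^sup>2 * r\<^sup>2" using v w jinner_nonneg[of v] by (intro mult_mono power_mono) (auto simp: cB_def)
 finally show ?thesis by (simp add: cB_def power_mult_distrib)
qed

lemma closed_cB: "closed (cB r)"
 unfolding cB_def by (intro closed_Collect_le continuous_intros bounded_bilinear.continuous_on[OF bounded_bilinear_jinner])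

lemma borel_cB [measurable]: "cB r \<in> sets borel" using closed_cB by auto

lemma cB_bounded: "\<exists>K>0. \<forall>r\<ge>0. cB r \<subseteq> cball 0 (K * r)"
proof -
 obtain c where c: "c > 0" "\<And>x. c * (norm x)\<^sup>2 <= Re (jinner x x)" using jinner_coercive by blast
 have "norm v <= (1 / sqrt c) * r" if "r >= 0" "v \<in> cB r" for r v
 proof (rule power2_le_imp_le)
  have "c * (norm v)\<^sup>2 <= r\<^sup>2" using c(2)[of v] that(2) by (simp add: cB_def)
  then show "(norm v)\<^sup>2 <= ((1 / sqrt c) * r)\<^sup>2" using c(1) by (simp add: power_mult_distrib power_divide field_simps)
  show "0 <= (1 / sqrt c) * r" using c(1) that(1) by simp
 qed
 then show ?thesis using c(1) by (intro exI[of _ "1 / sqrt c"]) auto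
qed

lemma cB_volume:
 assumes "r > 0" shows "0 < emeasure lborel (cB r)" "emeasure lborel (cB r) < \<infinity>"
proof -
 obtain K where K: "cB r \<subseteq> cball 0 (K * r)" using cB_bounded assms by (meson less_imp_le)
 have "emeasure lborel (cB r) <= emeasure lborel (cball (0::'a) (K * r))" using K by (intro emeasure_mono) auto
 also have "\<dots> < \<infinity>" by (rule emeasure_lborel_cball_finite)
 finally show "emeasure lborel (cB r) < \<infinity>" .
 obtain L where L: "L > 0" "\<And>x y. cmod (jinner x y) <= L * norm x * norm y" using jinner_bound by blast
 have "v \<in> cB r" if "norm v <= r / sqrt L" for v
 proof -
  have "Re (jinner v v) <= L * (norm v)\<^sup>2"  using L(2)[of v v] complex_Re_le_cmod[of "jinner v v"] by (simp add: power2_eq_square mult.assoc)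
  also have "\<dots> <= L * (r / sqrt L)\<^sup>2" using that L(1) by (intro mult_left_mono power_mono) auto
  also have "\<dots> = r\<^sup>2" using L(1) by (simp add: power_divide)
  finally show ?thesis by (simp add: cB_def)
 qed
 then have "cball 0 (r / sqrt L) \<subseteq> cB r" by auto
 then have "emeasure lborel (cball (0::'a) (r / sqrt L)) <= emeasure lborel (cB r)" by (intro emeasure_mono) auto
 moreover have "0 < emeasure lborel (cball (0::'a) (r / sqrt L))" using assms L(1) by (intro emeasure_lborel_cball_pos) auto
 ultimately show "0 < emeasure lborel (cB r)" by order
qed

lemma measurable_scaleC_left [measurable]: "(%v. c *C v) \<in> borel_measurable borel"
 by (intro borel_measurable_continuous_onI linear_continuous_on
   bounded_bilinear.bounded_linear_right[OF bounded_bilinear_scaleC])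

text \<open>The rotated Lebesgue measure is translation invariant, hence a multiple of Lebesgue
  measure; the invariant set \<open>cB 1\<close>, of positive finite volume, fixes the factor as
  1.\<close>

lemma nn_integral_rotate:
 assumes c: "cmod c = 1" and [measurable]: "f \<in> borel_measurable borel"
 shows "(\<integral>\<^sup>+v. f (c *C v) \<partial>lborel) = (\<integral>\<^sup>+v. f v \<partial>lborel)"
proof -
 define M where "M = distr lborel borel (%v. c *C v)"
 have cc: "cnj c * c = 1" "c * cnj c = 1" using c by (simp_all add: mult.commute flip: complex_norm_square)
 have M: "(\<integral>\<^sup>+v. f v \<partial>M) = (\<integral>\<^sup>+v. f (c *C v) \<partial>lborel)" if "f \<in> borel_measurable borel" for f
  using that unfolding M_def by (subst nn_integral_distr) auto
 obtain K where K: "K > 0" "\<And>c x. norm (c *C x) <= K * cmod c * norm x" using norm_scaleC_bound by blast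
 have fin: "emeasure M (cball 0 (real n)) < \<infinity>" for n
 proof -
  have "emeasure M (cball 0 (real n)) = emeasure lborel ((%v. c *C v) -` cball 0 (real n))" unfolding M_def by (subst emeasure_distr) auto
  also have "\<dots> <= emeasure lborel (cball (0::'a) (K * real n))"
  proof (rule emeasure_mono)
   show "(%v. c *C v) -` cball 0 (real n) \<subseteq> cball 0 (K * real n)"
   proof
    fix v assume "v \<in> (%v. c *C v) -` cball 0 (real n)"
    then have "norm (c *C v) <= real n" by simp
    moreover have "norm (cnj c *C (c *C v)) <= K * norm (c *C v)" using K(2)[of "cnj c" "c *C v"] c by simp
    ultimately have "norm v <= K * real n" using cc K(1) by (simp add: order_trans[OF _ mult_left_mono])
    then show "v \<in> cball 0 (K * real n)" by simp
   qed
  qed simp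
  also have "\<dots> < \<infinity>" by (rule emeasure_lborel_cball_finite)
  finally show ?thesis .
 qed
 have inv: "(\<integral>\<^sup>+v. f (v + a) \<partial>M) = (\<integral>\<^sup>+v. f v \<partial>M)" if [measurable]: "f \<in> borel_measurable borel" for f a
 proof -
  have "(\<integral>\<^sup>+v. f (v + a) \<partial>M) = (\<integral>\<^sup>+v. f (c *C (v + cnj c *C a)) \<partial>lborel)"
   using cc by (subst M) (auto simp: scale_right_distrib)
  also have "\<dots> = (\<integral>\<^sup>+v. f (c *C v) \<partial>lborel)"
   by (rule nn_integral_lborel_translate[of "%v. f (c *C v)"]) measurable
  finally show ?thesis by (simp add: M)
 qed
 obtain k where k: "k >= 0" "\<And>f. f \<in> borel_measurable borel ==> (\<integral>\<^sup>+v. f v \<partial>M) = ennreal k * (\<integral>\<^sup>+v. f v \<partial>lborel)"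
  using translation_invariant_lborel[of M] fin inv by (auto simp: M_def)
 have [measurable]: "(indicator (cB 1) :: 'a => ennreal) \<in> borel_measurable borel" by (rule borel_measurable_indicator) (rule borel_cB)
 have "(\<integral>\<^sup>+v. indicator (cB 1) v \<partial>M) = (\<integral>\<^sup>+v. indicator (cB 1) (c *C v) \<partial>lborel)" by (rule M) measurable
 also have "\<dots> = (\<integral>\<^sup>+v. indicator (cB 1) v \<partial>lborel)" by (intro nn_integral_cong) (simp add: indicator_def cB_rot[OF c])
 finally have "ennreal k * emeasure lborel (cB 1) = 1 * emeasure lborel (cB 1)" using k(2)[of "indicator (cB 1)"] by simp
 then have "ennreal k * emeasure lborel (cB 1) / emeasure lborel (cB 1) = 1 * emeasure lborel (cB 1) / emeasure lborel (cB 1)" by simp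
 then have "ennreal k = 1" using cB_volume[of 1] by (simp add: ennreal_mult_divide_eq less_top[symmetric] del: mult_1)

 then show ?thesis using k(2)[OF assms(2)] M[OF assms(2)] by simp
qed

text \<open>The one-variable circle mean in each complex direction v, integrated over a ball that
  the rotations preserve.\<close>

lemma volume_mean:
 assumes f: "holomorphic_fun f U" "f \<in> borel_measurable borel"
  and r: "0 < r" "r < R" and sub: "\<And>v. v \<in> cB R ==> p + v \<in> U"
 shows "ennreal ((cmod (f p))\<^sup>2) * emeasure lborel (cB r) <= (\<integral>\<^sup>+v. indicator (cB r) v * ennreal ((cmod (f (p + v)))\<^sup>2) \<partial>lborel)"
proof -
 note [measurable] = f(2)
 have [measurable]: "(indicator (cB r) :: 'a => ennreal) \<in> borel_measurable borel" by (rule borel_measurable_indicator) (rule borel_cB)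
 have m: "(%z. cis (2 * pi * snd z) *C fst z) \<in> borel_measurable (borel \<Otimes>\<^sub>M borel)"
  by (subst borel_prod) (auto intro!: borel_measurable_continuous_onI continuous_intros
    bounded_bilinear.continuous_on[OF bounded_bilinear_scaleC])
 have m'[measurable]: "(%z. cis (2 * pi * snd z) *C fst z) \<in> borel_measurable ((lborel::'a measure) \<Otimes>\<^sub>M (lborel :: real measure))"
  using m by (simp cong: measurable_cong_sets sets_pair_measure_cong)
 have m''[measurable]: "(%z. cis (2 * pi * fst z) *C snd z) \<in> borel_measurable ((lborel :: real measure) \<Otimes>\<^sub>M (lborel::'a measure))"
  using measurable_compose[OF measurable_pair_swap' m'] by (simp add: split_beta)
 have P: "pair_sigma_finite (lborel :: 'a measure) (lborel :: real measure)" by standard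
 have [measurable]: "(%\<theta>. cis (2 * pi * \<theta>) *C v) \<in> borel_measurable borel" for v
  by (auto intro!: borel_measurable_continuous_onI continuous_intros
    bounded_bilinear.continuous_on[OF bounded_bilinear_scaleC])
 let ?h = "%v. ennreal ((cmod (f (p + v)))\<^sup>2)"
 have "ennreal ((cmod (f p))\<^sup>2) * emeasure lborel (cB r) = (\<integral>\<^sup>+v. indicator (cB r) v * ennreal ((cmod (f p))\<^sup>2) \<partial>lborel)"
  by (simp add: nn_integral_multc mult.commute)
 also have "\<dots> <= (\<integral>\<^sup>+v. (\<integral>\<^sup>+\<theta>. indicator (cB r) v * ?h (cis (2 * pi * \<theta>) *C v) * indicator {0..1} \<theta> \<partial>lborel) \<partial>lborel)"
 proof (rule nn_integral_mono)
  fix v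
  show "indicator (cB r) v * ennreal ((cmod (f p))\<^sup>2) <= (\<integral>\<^sup>+\<theta>. indicator (cB r) v * ?h (cis (2 * pi * \<theta>) *C v) * indicator {0..1} \<theta> \<partial>lborel)"
  proof (cases "v \<in> cB r")
   case True
   have "(%w. f (p + w *C v)) holomorphic_on ball 0 (R / r)"
   proof (rule holomorphic_fun_line[OF f(1)])
    fix w :: complex assume "w \<in> ball 0 (R / r)"
    then have "w *C v \<in> cB (R / r * r)" by (intro cB_scale True) simp
    then show "p + w *C v \<in> U" using r by (intro sub) simp
   qed
   from circle_mean_sq[OF this, of 1] r
   have "ennreal ((cmod (f p))\<^sup>2) <= (\<integral>\<^sup>+\<theta>\<in>{0..1}. ?h (cis (2 * pi * \<theta>) *C v) \<partial>lborel)" by simp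
   then show ?thesis using True by simp
  qed simp
 qed
 also have "\<dots> = (\<integral>\<^sup>+\<theta>. (\<integral>\<^sup>+v. indicator (cB r) v * ?h (cis (2 * pi * \<theta>) *C v) * indicator {0..1} \<theta> \<partial>lborel) \<partial>lborel)"
  by (rule pair_sigma_finite.Fubini'[OF P, symmetric]) measurable
 also have "\<dots> = (\<integral>\<^sup>+(\<theta>::real). (\<integral>\<^sup>+v. indicator (cB r) v * ?h v \<partial>lborel) * indicator {0..1} \<theta> \<partial>lborel)"
 proof (rule nn_integral_cong)
  fix \<theta> :: real
  have "(\<integral>\<^sup>+v. indicator (cB r) v * ?h (cis (2 * pi * \<theta>) *C v) \<partial>lborel)
    = (\<integral>\<^sup>+v. indicator (cB r) (cis (2 * pi * \<theta>) *C v) * ?h (cis (2 * pi * \<theta>) *C v) \<partial>lborel)"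
   by (intro nn_integral_cong) (simp add: indicator_def cB_rot)
  also have "\<dots> = (\<integral>\<^sup>+v. indicator (cB r) v * ?h v \<partial>lborel)"
   by (rule nn_integral_rotate[of _ "%v. indicator (cB r) v * ?h v"]) simp_all
  finally show "(\<integral>\<^sup>+v. indicator (cB r) v * ?h (cis (2 * pi * \<theta>) *C v) * indicator {0..1} \<theta> \<partial>lborel) = (\<integral>\<^sup>+v. indicator (cB r) v * ?h v \<partial>lborel) * indicator {0..1} \<theta>"
   by (subst nn_integral_multc) simp_all
 qed
 also have "\<dots> = (\<integral>\<^sup>+v. indicator (cB r) v * ?h v \<partial>lborel)" by (simp add: nn_integral_cmult_indicator)
 finally show ?thesis .
qed

definition scaleC_const :: real where "scaleC_const = (SOME K. K > 0 & (\<forall>c x. norm (c *C x) <= K * cmod c * norm x))"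

lemma scaleC_const: "scaleC_const > 0" "norm (c *C x) <= scaleC_const * cmod c * norm x"
 using someI_ex[OF norm_scaleC_bound] by (auto simp: scaleC_const_def)

text \<open>Cauchy's inequality on the complex line through x in direction v. With radius R / (4
  scaleC_const norm v), even the doubled disc moves x by at most R / 2 and stays in the
  ball.\<close>

lemma deriv_bound:
 assumes g: "holomorphic_fun g (ball p R)" and M: "\<And>x. x \<in> ball p R ==> cmod (g x) <= M"
  and x: "x \<in> ball p (R / 2)" and d: "(g has_derivative g') (at x)" "\<And>c v. g' (c *C v) = c * g' v" and R: "R > 0"
 shows "cmod (g' v) <= (4 * scaleC_const / R * M) * norm v"
proof (cases "v = 0")
 case True
 have "g' 0 = 0" using d(2)[of 0 0] by simp
 then show ?thesis using True by simp
next
 case False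
 define \<rho> where "\<rho> = R / (4 * scaleC_const * norm v)"
 have \<rho>: "\<rho> > 0" using R scaleC_const(1) False by (simp add: \<rho>_def)
 have inb: "x + w *C v \<in> ball p R" if "cmod w <= 2 * \<rho>" for w
 proof -
  have "norm (w *C v) <= scaleC_const * (2 * \<rho>) * norm v"
   using scaleC_const(2)[of w v] that scaleC_const(1) by (meson mult_left_mono mult_right_mono norm_ge_zero order_trans less_imp_le)
  also have "\<dots> = R / 2" using scaleC_const(1) False by (simp add: \<rho>_def field_simps)
  finally have "dist p (x + w *C v) < R" using x dist_triangle[of p "x + w *C v" x] by (simp add: dist_norm)
  then show ?thesis by simp
 qed
 define F where "F w = g (x + w *C v)" for w
 have F: "F holomorphic_on ball 0 (2 * \<rho>)" unfolding F_def by (rule holomorphic_fun_line[OF g]) (use inb in auto)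
 have "((%w. x + w *C v) has_derivative (%w. w *C v)) (at 0)" by (auto intro!: derivative_eq_intros bounded_linear_imp_has_derivative
    bounded_bilinear.bounded_linear_left[OF bounded_bilinear_scaleC])
 from has_derivative_compose[OF this, of g g'] d
 have "(F has_derivative (%w. w * g' v)) (at 0)" by (simp add: F_def[abs_def])
 moreover have "(%w. w * g' v) = (*) (g' v)" by (auto simp: mult.commute)
 ultimately have "(F has_field_derivative g' v) (at 0)" by (simp add: has_field_derivative_def)
 then have "deriv F 0 = g' v" by (rule DERIV_imp_deriv)
 moreover have "cmod ((deriv ^^ 1) F 0) <= fact 1 * M / \<rho> ^ 1"
 proof (rule Cauchy_inequality)
  show "F holomorphic_on ball 0 \<rho>" using F \<rho> by (elim holomorphic_on_subset) auto
  show "continuous_on (cball 0 \<rho>) F" using holomorphic_on_imp_continuous_on[OF F] \<rho> by (elim continuous_on_subset) auto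
  show "cmod (F w) <= M" if "norm (0 - w) = \<rho>" for w unfolding F_def using that \<rho> by (intro M inb) simp
 qed (rule \<rho>)
 ultimately have "cmod (g' v) <= M / \<rho>" by simp
 then show ?thesis by (simp add: \<rho>_def mult_ac)
qed

lemma lipschitz_bound:
 assumes g: "holomorphic_fun g (ball p R)" and M: "\<And>x. x \<in> ball p R ==> cmod (g x) <= M"
  and x: "x \<in> ball p (R / 2)" "y \<in> ball p (R / 2)" and R: "R > 0"
 shows "cmod (g x - g y) <= (4 * scaleC_const / R * M) * norm (x - y)"
proof -
 have "\<forall>x\<in>ball p (R / 2). \<exists>g'. (g has_derivative g') (at x) & (\<forall>c v. g' (c *C v) = c * g' v)"
  using g R unfolding holomorphic_fun_def by auto
 then obtain g' where g': "\<And>x. x \<in> ball p (R / 2) ==> (g has_derivative g' x) (at x) & (\<forall>c v. g' x (c *C v) = c * g' x v)"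
  by metis
 show ?thesis
 proof (rule differentiable_bound[OF convex_ball _ _ x])
  fix z assume z: "z \<in> ball p (R / 2)"
  then show "(g has_derivative g' z) (at z within ball p (R / 2))" using g' has_derivative_at_withinI by blast
  show "onorm (g' z) <= 4 * scaleC_const / R * M" using deriv_bound[OF g M z] g'[OF z] R by (intro onorm_le) auto
 qed
qed

end

context symmetric_siegel
begin

lemma dom_ball: assumes "p \<in> dom" shows "\<exists>R>0. cball p R \<subseteq> dom" using open_dom assms open_contains_cball by blast

lemma local_mean:
 assumes p: "p \<in> dom"
 shows "\<exists>r>0. \<exists>C\<ge>0. \<exists>R. ball p r \<subseteq> dom & cball p R \<subseteq> dom &
  (\<forall>g. hfun g --> (\<forall>x\<in>ball p r. ennreal ((cmod (g x))\<^sup>2) <= ennreal C * (\<integral>\<^sup>+y\<in>cball p R. ennreal ((cmod (g y))\<^sup>2) \<partial>lborel)))"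
proof -
 obtain R where R: "R > 0" "cball p R \<subseteq> dom" using dom_ball[OF p] by blast
 obtain K where K: "K > 0" "\<And>r. r >= 0 ==> cB r \<subseteq> cball 0 (K * r)" using cB_bounded by blast
 define s where "s = R / (2 * K)"
 have s: "s > 0" "K * s = R / 2" using R(1) K(1) by (simp_all add: s_def)
 have sub: "x + v \<in> cball p R" if "x \<in> ball p (R / 2)" "v \<in> cB s" for x v
 proof -
  have "norm v <= R / 2" using K(2)[of s] s that(2) by auto
  then show ?thesis using that(1) dist_triangle[of p "x + v" x] by (simp add: dist_norm)
 qed
 have subr: "cB (s / 2) \<subseteq> cB s" using s(1) by (auto simp: cB_def intro: order_trans power_mono)
 define C where "C = enn2real (1 / emeasure lborel (cB (s / 2)))"
 note vol = cB_volume[of "s / 2"]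
 have main: "ennreal ((cmod (g x))\<^sup>2) <= ennreal C * (\<integral>\<^sup>+y\<in>cball p R. ennreal ((cmod (g y))\<^sup>2) \<partial>lborel)"
  if g: "hfun g" and x: "x \<in> ball p (R / 2)" for g x
 proof -
  note [measurable] = hfun_measurable[OF g]
  have [measurable]: "(indicator (cB r) :: 'a => ennreal) \<in> borel_measurable borel" for r by (rule borel_measurable_indicator) (rule borel_cB)
  let ?I = "\<integral>\<^sup>+y\<in>cball p R. ennreal ((cmod (g y))\<^sup>2) \<partial>lborel"
  have "ennreal ((cmod (g x))\<^sup>2) * emeasure lborel (cB (s / 2)) <= (\<integral>\<^sup>+v. indicator (cB (s / 2)) v * ennreal ((cmod (g (x + v)))\<^sup>2) \<partial>lborel)"
   using g s(1) sub[OF x] R(2) by (intro volume_mean[of g dom _ s]) (auto simp: hfun_def)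
  also have "\<dots> = (\<integral>\<^sup>+v. indicator (cB (s / 2)) (v - x) * ennreal ((cmod (g v))\<^sup>2) \<partial>lborel)"
   using nn_integral_lborel_translate[of "%v. indicator (cB (s / 2)) (v - x) * ennreal ((cmod (g v))\<^sup>2)" x] by (simp add: add.commute)
  also have "\<dots> <= ?I"
  proof (rule nn_integral_mono)
   fix v
   show "indicator (cB (s / 2)) (v - x) * ennreal ((cmod (g v))\<^sup>2) <= ennreal ((cmod (g v))\<^sup>2) * indicator (cball p R) v"
    using sub[OF x, of "v - x"] subr by (auto simp: indicator_def)
  qed
  finally have le: "ennreal ((cmod (g x))\<^sup>2) * emeasure lborel (cB (s / 2)) <= ?I" .
  have "ennreal C = 1 / emeasure lborel (cB (s / 2))"
   using vol s(1) unfolding C_def by (subst ennreal_enn2real) (auto simp: ennreal_divide_eq_top_iff less_top[symmetric])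
  then have "ennreal C * ?I = ?I / emeasure lborel (cB (s / 2))" by (subst mult.commute) (simp only: ennreal_times_divide mult_1_right)
  moreover have "ennreal ((cmod (g x))\<^sup>2) <= ?I / emeasure lborel (cB (s / 2))"
  proof -
   have "ennreal ((cmod (g x))\<^sup>2) = ennreal ((cmod (g x))\<^sup>2) * emeasure lborel (cB (s / 2)) / emeasure lborel (cB (s / 2))"
    using vol s(1) by (subst ennreal_mult_divide_eq) (auto simp: less_top[symmetric])
   also have "\<dots> <= ?I / emeasure lborel (cB (s / 2))" by (rule divide_right_mono_ennreal[OF le])
   finally show ?thesis .
  qed
  ultimately show ?thesis by simp
 qed
 have "ball p (R / 2) \<subseteq> dom" using R by (auto intro!: subsetD[OF R(2)])
 then show ?thesis using R main by (intro exI[of _ "R / 2"] conjI exI[of _ C] exI[of _ R]) (auto simp: C_def)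
qed

text \<open>A compact ball in \<open>dom\<close> meets slices of bounded height only. Cutting the
  volume integral of \<open>local_mean\<close> into slices bounds it by the Hardy norm times the
  volume V of these heights.\<close>

lemma eval_bound:
 assumes p: "p \<in> dom"
 shows "\<exists>r>0. \<exists>C\<ge>0. ball p r \<subseteq> dom & (\<forall>f\<in>hardy. \<forall>x\<in>ball p r. (cmod (f x))\<^sup>2 <= C * enn2real (hardy_norm_sq f))"
proof -
 obtain r C R where r: "r > 0" "C >= 0" "ball p r \<subseteq> dom" "cball p R \<subseteq> dom"
  and le: "\<And>g x. hfun g ==> x \<in> ball p r ==> ennreal ((cmod (g x))\<^sup>2) <= ennreal C * (\<integral>\<^sup>+y\<in>cball p R. ennreal ((cmod (g y))\<^sup>2) \<partial>lborel)"
  using local_mean[OF p] by blast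
 obtain c where c: "c > 0" "\<And>f. f \<in> borel_measurable borel ==>
   (\<integral>\<^sup>+p. f p \<partial>lborel) = ennreal c * (\<integral>\<^sup>+h. (IB q. f (q + \<i> *C h)) \<partial>LS F)" using volume_slices by blast
 have "compact (height ` cball p R)" by (intro compact_continuous_image continuous_intros compact_cball)
 then obtain M where M: "\<And>x. x \<in> cball p R ==> norm (height x) <= M" by (meson bounded_iff compact_imp_bounded imageI)
 define V where "V = emeasure (LS F) (cball 0 M)"
 have V: "V < \<infinity>" unfolding V_def by (rule LS_cball[OF subspace_F])
 have [measurable]: "(indicator (cball p R) :: 'a => ennreal) \<in> borel_measurable borel" for p R by (rule borel_measurable_indicator) simp
 have main: "(cmod (f x))\<^sup>2 <= C * c * enn2real V * enn2real (hardy_norm_sq f)" if f: "f \<in> hardy" and x: "x \<in> ball p r" for f x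
 proof -
  note [measurable] = hardyD(4)[OF f]
  have e1: "(\<integral>\<^sup>+y\<in>cball p R. ennreal ((cmod (f y))\<^sup>2) \<partial>lborel)
    = ennreal c * (\<integral>\<^sup>+h. (IB q. ennreal ((cmod (f (q + \<i> *C h)))\<^sup>2) * indicator (cball p R) (q + \<i> *C h)) \<partial>LS F)"
   by (rule c(2)) measurable
  have "(\<integral>\<^sup>+h. (IB q. ennreal ((cmod (f (q + \<i> *C h)))\<^sup>2) * indicator (cball p R) (q + \<i> *C h)) \<partial>LS F)
    <= (\<integral>\<^sup>+h. hardy_norm_sq f * indicator (cball 0 M) h \<partial>LS F)"
  proof (rule nn_integral_mono_AE, use AE_LS[OF subspace_F] in eventually_elim)
   fix h assume h: "h \<in> F"
   have hh: "h \<in> Omega & norm h <= M" if "q \<in> bdom" "q + \<i> *C h \<in> cball p R" for q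
   proof -
    have "height (q + \<i> *C h) = h" using that(1) h by (simp add: bdom_iff)
    then show ?thesis using M[OF that(2)] that(2) r(4) dom_iff by fastforce
   qed
   show "(IB q. ennreal ((cmod (f (q + \<i> *C h)))\<^sup>2) * indicator (cball p R) (q + \<i> *C h)) <= hardy_norm_sq f * indicator (cball 0 M) h"
   proof (cases "h \<in> Omega & norm h <= M")
    case True
    have "(IB q. ennreal ((cmod (f (q + \<i> *C h)))\<^sup>2) * indicator (cball p R) (q + \<i> *C h)) <= G f h"
     unfolding G_def by (intro nn_integral_mono) (simp add: indicator_def)
    also have "\<dots> <= hardy_norm_sq f" using True by (intro G_le[OF f]) simp
    finally show ?thesis using True by simp
   next
    case False
    have "(IB q. ennreal ((cmod (f (q + \<i> *C h)))\<^sup>2) * indicator (cball p R) (q + \<i> *C h)) = (IB q. 0)"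
     using hh False by (intro nn_integral_bB_cong) (auto simp: indicator_def)
    then show ?thesis by simp
   qed
  qed
  also have "\<dots> = hardy_norm_sq f * V" unfolding V_def by (rule nn_integral_cmult_indicator) simp
  finally have "(\<integral>\<^sup>+y\<in>cball p R. ennreal ((cmod (f y))\<^sup>2) \<partial>lborel) <= ennreal c * (hardy_norm_sq f * V)"
   unfolding e1 by (rule mult_left_mono) simp
  then have "ennreal ((cmod (f x))\<^sup>2) <= ennreal C * (ennreal c * (hardy_norm_sq f * V))"
   by (intro order_trans[OF le[OF hardyD(1)[OF f] x]] mult_left_mono) auto
  also have "\<dots> = ennreal (C * c * enn2real V * enn2real (hardy_norm_sq f))"
  proof -
   have *: "hardy_norm_sq f = ennreal (enn2real (hardy_norm_sq f))" "V = ennreal (enn2real V)"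
    using hardyD(2)[OF f] V by (auto intro!: ennreal_enn2real[symmetric])
   have "ennreal C * (ennreal c * (ennreal a * ennreal b)) = ennreal (C * c * b * a)" if "a >= 0" "b >= 0" for a b
    using that r(2) c(1) by (simp add: ennreal_mult[symmetric] mult_ac)
   from this[of "enn2real (hardy_norm_sq f)" "enn2real V"] show ?thesis unfolding *[symmetric] by simp
  qed
  finally show ?thesis using r(2) c(1) by (subst (asm) ennreal_le_iff) auto
 qed
 show ?thesis using r c(1) main by (intro exI[of _ r] conjI exI[of _ "C * c * enn2real V"]) auto
qed

definition hn :: "('a => complex) => real" where "hn f = enn2real (hardy_norm_sq f)"

lemma hn_nonneg [simp]: "hn f >= 0" by (simp add: hn_def)

lemma hn_eq: "f \<in> hardy ==> hardy_norm_sq f = ennreal (hn f)" using hardyD(2)[of f] by (simp add: hn_def)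

lemma hardy_inner_self': "f \<in> hardy ==> hardy_inner f f = complex_of_real (hn f)" using hardy_inner_self by (simp add: hn_def)

text \<open>Values and, by Cauchy's estimate, derivatives are controlled by the Hardy norm locally
  uniformly. Both converge, and complex linearity of the derivative passes to the limit.\<close>

lemma hardy_limit:
 assumes f: "\<And>n. f n \<in> hardy" and cauchy: "\<And>eps. eps > 0 ==> \<exists>N. \<forall>m\<ge>N. \<forall>n\<ge>N. hn (%p. f m p - f n p) <= eps"
 shows "\<exists>g. hfun g & (\<forall>p. (%n. f n p) ----> g p)"
proof -
 define g where "g p = lim (%n. f n p)" for p
 have local: "\<exists>r>0. ball p r \<subseteq> dom & (\<forall>x\<in>ball p r. (%n. f n x) ----> g x &
   (\<exists>g'. (g has_derivative g') (at x) & (\<forall>c v. g' (c *C v) = c * g' v)))" if p: "p \<in> dom" for p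
 proof -
  obtain R C where R: "R > 0" "C >= 0" "ball p R \<subseteq> dom"
   and ev: "\<And>f x. f \<in> hardy ==> x \<in> ball p R ==> (cmod (f x))\<^sup>2 <= C * hn f" using eval_bound[OF p] unfolding hn_def by blast
  have ev': "cmod (f x) <= sqrt (C * hn f)" if "f \<in> hardy" "x \<in> ball p R" for f x using ev[OF that] by (simp add: real_le_rsqrt)
  define S where "S = ball p (R / 2)"
  have "\<forall>n. \<forall>x\<in>S. \<exists>d. (f n has_derivative d) (at x) & (\<forall>c v. d (c *C v) = c * d v)"
  proof (intro allI ballI)
   fix n x assume "x \<in> S"
   then have "x \<in> dom" using R by (auto simp: S_def intro!: subsetD[OF R(3)])
   then show "\<exists>d. (f n has_derivative d) (at x) & (\<forall>c v. d (c *C v) = c * d v)"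
    using hardyD(5)[OF f[of n]] by (auto simp: holomorphic_fun_def)
  qed
  then obtain f' where f': "\<And>n x. x \<in> S ==> (f n has_derivative f' n x) (at x) & (\<forall>c v. f' n x (c *C v) = c * f' n x v)"
   by metis
  define L where "L = 4 * scaleC_const / R"
  have L: "L >= 0" using scaleC_const(1) R(1) by (simp add: L_def)
  have diff: "cmod (f' m x v - f' n x v) <= L * sqrt (C * hn (%p. f m p - f n p)) * norm v" if x: "x \<in> S" for m n x v unfolding L_def
  proof (rule deriv_bound[of "%p. f m p - f n p" p R])
   have h: "(%p. f m p - f n p) \<in> hardy" by (intro hardy_diff f)
   show "holomorphic_fun (%p. f m p - f n p) (ball p R)" using holomorphic_fun_subset[OF hardyD(5)[OF h] R(3)] .
   show "cmod (f m x - f n x) <= sqrt (C * hn (%p. f m p - f n p))" if "x \<in> ball p R" for x using ev'[OF h that] .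
   show "((%p. f m p - f n p) has_derivative (%v. f' m x v - f' n x v)) (at x)" using f'[OF x] by (intro has_derivative_diff) auto
   show "f' m x (c *C v) - f' n x (c *C v) = c * (f' m x v - f' n x v)" for c v using f'[OF x] by (simp add: algebra_simps)
  qed (use x R in \<open>auto simp: S_def\<close>)
  have uc: "\<exists>N. \<forall>m\<ge>N. \<forall>n\<ge>N. \<forall>x\<in>S. \<forall>v. cmod (f' m x v - f' n x v) <= eps * norm v" if eps: "eps > 0" for eps
  proof -
   \<comment> \<open>Solves L sqrt (C d) <= eps; the summands 1 guard against L = 0 and C =
     0.\<close>
   define d where "d = (eps / (L + 1))\<^sup>2 / (C + 1)"
   have d: "d > 0" using eps L R(2) by (simp add: d_def)
   obtain N where N: "\<And>m n. m >= N ==> n >= N ==> hn (%p. f m p - f n p) <= d" using cauchy[OF d] by blast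
   have "cmod (f' m x v - f' n x v) <= eps * norm v" if "m >= N" "n >= N" "x \<in> S" for m n x v
   proof -
    have "C * hn (%p. f m p - f n p) <= (C + 1) * d" using N[OF that(1,2)] R(2) d by (intro mult_mono) auto
    also have "\<dots> = (eps / (L + 1))\<^sup>2" using R(2) by (simp add: d_def)
    finally have "sqrt (C * hn (%p. f m p - f n p)) <= eps / (L + 1)" using eps L by (intro real_le_lsqrt) auto
    then have "L * sqrt (C * hn (%p. f m p - f n p)) <= L * (eps / (L + 1))" using L by (rule mult_left_mono)
    also have "\<dots> <= eps" using eps L by (simp add: field_simps)
    finally have "L * sqrt (C * hn (%p. f m p - f n p)) * norm v <= eps * norm v" by (rule mult_right_mono) simp
    then show ?thesis using diff[OF that(3), of m v n] by linarith
   qed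
   then show ?thesis by blast
  qed
  have pc: "Cauchy (%n. f n x)" if x: "x \<in> ball p R" for x
  proof (rule metric_CauchyI)
   fix eps :: real assume eps: "eps > 0"
   define d where "d = (eps / 2)\<^sup>2 / (C + 1)"
   have d: "d > 0" using eps R(2) by (simp add: d_def)
   obtain N where N: "\<And>m n. m >= N ==> n >= N ==> hn (%p. f m p - f n p) <= d" using cauchy[OF d] by blast
   have "dist (f m x) (f n x) < eps" if "m >= N" "n >= N" for m n
   proof -
    have h: "(%p. f m p - f n p) \<in> hardy" by (intro hardy_diff f)
    have "C * hn (%p. f m p - f n p) <= (C + 1) * d" using N[OF that] R(2) d by (intro mult_mono) auto
    also have "\<dots> = (eps / 2)\<^sup>2" using R(2) by (simp add: d_def)
    finally have "sqrt (C * hn (%p. f m p - f n p)) <= eps / 2" using eps by (intro real_le_lsqrt) auto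
    then show ?thesis using ev'[OF h x] eps by (simp add: dist_norm)
   qed
   then show "\<exists>M. \<forall>m\<ge>M. \<forall>n\<ge>M. dist (f m x) (f n x) < eps" by blast
  qed
  have conv: "(%n. f n x) ----> g x" if "x \<in> ball p R" for x
   using pc[OF that] unfolding g_def by (simp add: Cauchy_convergent convergent_LIMSEQ_iff[symmetric])
  define g' where "g' x v = lim (%n. f' n x v)" for x v
  have conv': "(%n. f' n x v) ----> g' x v" if x: "x \<in> S" for x v
  proof -
   have "Cauchy (%n. f' n x v)"
   proof (rule metric_CauchyI)
    fix eps :: real assume eps: "eps > 0"
    have "eps / (norm v + 1) > 0" using eps by (simp add: add_nonneg_pos)
    from uc[OF this] x obtain N where N: "\<And>m n. m >= N ==> n >= N ==> cmod (f' m x v - f' n x v) <= eps / (norm v + 1) * norm v"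
     by blast
    have "eps / (norm v + 1) * norm v < eps" using eps by (simp add: pos_divide_less_eq add_nonneg_pos distrib_left)
    then show "\<exists>M. \<forall>m\<ge>M. \<forall>n\<ge>M. dist (f' m x v) (f' n x v) < eps"
     using N by (intro exI[of _ N]) (auto simp: dist_norm intro: le_less_trans)
   qed
   then show ?thesis unfolding g'_def by (simp add: Cauchy_convergent convergent_LIMSEQ_iff[symmetric])
  qed
  have "\<exists>g0. \<forall>x\<in>S. (%n. f n x) ----> g0 x & (g0 has_derivative g' x) (at x within S)"
  proof (rule has_derivative_sequence[where f' = f' and g' = g'])
   show "convex S" by (simp add: S_def)
   show "(f n has_derivative f' n x) (at x within S)" if "x \<in> S" for n x using f'[OF that] has_derivative_at_withinI by blast
   show "p \<in> S" using R(1) by (simp add: S_def)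
   show "(%n. f n p) ----> g p" using R(1) by (intro conv) simp
   fix eps :: real assume "eps > 0"
   then obtain N where N: "\<And>m n x v. m >= N ==> n >= N ==> x \<in> S ==> cmod (f' m x v - f' n x v) <= eps * norm v" using uc by blast
   have "cmod (f' n x h - g' x h) <= eps * norm h" if "n >= N" "x \<in> S" for n x h
   proof (rule LIMSEQ_le_const2)
    show "(%m. cmod (f' n x h - f' m x h)) ----> cmod (f' n x h - g' x h)" by (intro tendsto_intros conv' that)
    show "\<exists>N. \<forall>m\<ge>N. cmod (f' n x h - f' m x h) <= eps * norm h" using N that by blast
   qed
   then show "\<forall>\<^sub>F n in sequentially. \<forall>x\<in>S. \<forall>h. norm (f' n x h - g' x h) <= eps * norm h"
    unfolding eventually_sequentially by blast
  qed
  then obtain g0 where g0: "\<And>x. x \<in> S ==> (%n. f n x) ----> g0 x" "\<And>x. x \<in> S ==> (g0 has_derivative g' x) (at x within S)" by blast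
  have SR: "S \<subseteq> ball p R" using R(1) by (auto simp: S_def)
  have eq: "g0 x = g x" if "x \<in> S" for x using LIMSEQ_unique[OF g0(1)[OF that] conv] that SR by blast
  have "(g has_derivative g' x) (at x) & (\<forall>c v. g' x (c *C v) = c * g' x v)" if x: "x \<in> S" for x
  proof
   have "(g0 has_derivative g' x) (at x)" using g0(2)[OF x] at_within_open[OF x] by (simp add: S_def)
   then show "(g has_derivative g' x) (at x)" by (rule has_derivative_transform_within_open[OF _ _ x]) (use eq in \<open>auto simp: S_def\<close>)
   have "g' x (c *C v) = c * g' x v" for c v
   proof (rule LIMSEQ_unique[OF conv'[OF x]])
    show "(%n. f' n x (c *C v)) ----> c * g' x v" using f'[OF x] tendsto_mult_left[OF conv'[OF x, of v], of c] by simp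
   qed
   then show "\<forall>c v. g' x (c *C v) = c * g' x v" by blast
  qed
  then show ?thesis using R conv SR by (intro exI[of _ "R / 2"]) (auto simp: S_def subset_iff, blast)
 qed
 define g1 where "g1 p = (if p \<in> dom then g p else 0)" for p
 have "holomorphic_fun g dom" unfolding holomorphic_fun_def
 proof
  fix p assume "p \<in> dom"
  then obtain r where "r > 0" "\<And>x. x \<in> ball p r ==> \<exists>g'. (g has_derivative g') (at x) & (\<forall>c v. g' (c *C v) = c * g' v)"
   using local by metis
  then show "\<exists>g'. (g has_derivative g') (at p) & (\<forall>c v. g' (c *C v) = c * g' v)" by simp
 qed
 from hfun_restrict[OF this] have "hfun g1" by (simp add: g1_def[abs_def])
 moreover have "(%n. f n p) ----> g1 p" for p
 proof (cases "p \<in> dom")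
  case True
  then show ?thesis using local[OF True] by (auto simp: g1_def)
 next
  case False
  then have "f n p = 0" for n using hardyD(1)[OF f[of n]] by (simp add: hfun_def)
  then show ?thesis using False by (simp add: g1_def)
 qed
 ultimately show ?thesis by blast
qed

text \<open>Fatou's lemma on each slice, then the supremum over heights.\<close>

lemma hardy_fatou:
 assumes f: "\<And>n. f n \<in> hardy" and g: "hfun g" "\<And>p. (%n. f n p) ----> g p"
  and b: "(%n. hn (f n)) ----> l"
 shows "g \<in> hardy" "hn g <= l"
proof -
 have [measurable]: "f n \<in> borel_measurable borel" for n by (rule hardyD(4)[OF f])
 have l: "l >= 0" using b by (rule LIMSEQ_le_const) simp
 have "G g h <= ennreal l" if h: "h \<in> Omega" for h
 proof -
  have "G g h = (IB q. liminf (%n. ennreal ((cmod (f n (q + \<i> *C h)))\<^sup>2)))" unfolding G_def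
   by (intro nn_integral_cong lim_imp_Liminf[symmetric] tendsto_intros g(2)) auto
  also have "\<dots> <= liminf (%n. G (f n) h)" unfolding G_def by (rule nn_integral_liminf) measurable
  also have "\<dots> <= liminf (%n. ennreal (hn (f n)))" using G_le[OF f h] hn_eq[OF f] by (intro Liminf_mono always_eventually) simp
  also have "\<dots> = ennreal l" using b by (intro lim_imp_Liminf tendsto_ennrealI) auto
  finally show ?thesis .
 qed
 then have le: "hardy_norm_sq g <= ennreal l" unfolding hardy_norm_sq_G[OF g(1)] by (rule SUP_least)
 then show "g \<in> hardy" using g(1) by (auto simp: hardy_iff intro: le_less_trans)
 show "hn g <= l" using enn2real_mono[OF le] l by (simp add: hn_def)
qed

end

section \<open>The reproducing kernel on the domain\<close>

context symmetric_siegel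
begin

subsection \<open>The reproducing kernel\<close>

text \<open>A power of \<open>Psi\<close>: of the n + m factors, n are spent on decay along E and m
  on decay along F, uniformly in the height.\<close>

lemma hardy_nonvanishing: "\<exists>f\<in>hardy. \<forall>p\<in>dom. f p \<noteq> 0"
proof -
 interpret LF: sigma_finite_measure "LS F" by (rule sigma_finite_LF)
 obtain A c where A: "separating A c" using separating_exists by blast
 obtain n m where nm: "\<And>N. N >= n ==> (\<integral>\<^sup>+x. ennreal (1 / (1 + (norm x)\<^sup>2) ^ N) \<partial>LS E) < \<infinity>"
   "\<And>N. N >= m ==> (\<integral>\<^sup>+x. ennreal (1 / (1 + (norm x)\<^sup>2) ^ N) \<partial>LS F) < \<infinity>"
  using LS_decay[OF subspace_E] LS_decay[OF subspace_F] by blast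
 have c: "c > 0" using A by (simp add: separating_def)
 \<comment> \<open>A common decay constant for E and F; d <= 1 absorbs the constant term of 1 +
   t^2.\<close>
 define d where "d = min 1 (min (c\<^sup>2) (2 * c))"
 have d: "d > 0" "d <= 1" "d <= c\<^sup>2" "d <= 2 * c" using c by (auto simp: d_def)
 define f where "f p = (if p \<in> dom then Psi A p ^ (n + m) else 0)" for p
 have hf: "hfun f" unfolding f_def[abs_def] by (intro hfun_restrict holomorphic_fun_power holomorphic_Psi[OF A])
 define I where "I = (\<integral>\<^sup>+x. ennreal (1 / (1 + (norm x)\<^sup>2) ^ n) \<partial>LS E) * (\<integral>\<^sup>+x. ennreal (1 / (1 + (norm x)\<^sup>2) ^ m) \<partial>LS F)"
 have I: "I < \<infinity>" unfolding I_def using nm(1)[of n] nm(2)[of m] by (simp add: ennreal_mult_less_top)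
 have [measurable]: "f \<in> borel_measurable borel" by (rule hfun_measurable[OF hf])
 have "G f h <= ennreal ((1 / d) ^ (n + m)) * I" if h: "h \<in> Omega" for h
 proof -
  have "G f h = (\<integral>\<^sup>+\<zeta>. (\<integral>\<^sup>+x. ennreal ((cmod (f (bpoint \<zeta> x + \<i> *C h)))\<^sup>2) \<partial>LS F) \<partial>LS E)"
   unfolding G_def by (rule nn_integral_bB) measurable
  also have "\<dots> <= (\<integral>\<^sup>+\<zeta>. (\<integral>\<^sup>+x. ennreal ((1 / d) ^ (n + m)) * (ennreal (1 / (1 + (norm \<zeta>)\<^sup>2) ^ n) * ennreal (1 / (1 + (norm x)\<^sup>2) ^ m)) \<partial>LS F) \<partial>LS E)"
  proof (rule nn_integral_mono_AE, use AE_LS[OF subspace_E] in eventually_elim, rule nn_integral_mono_AE,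
    use AE_LS[OF subspace_F] in eventually_elim)
   fix \<zeta> x assume m1: "\<zeta> \<in> E" "x \<in> F"
   let ?p = "bpoint \<zeta> x + \<i> *C h"
   have pD: "?p \<in> dom" using bdom_up[OF bpoint_bdom[OF m1] h] .
   have hc: "height ?p \<in> cone" using pD Omega_cone by (simp add: dom_iff)
   have pr: "prE ?p = \<zeta>" "prF ?p = x" using m1 Omega_F[OF h] by (simp_all add: pr_add)
   define u where "u = (cmod (Psi A ?p))\<^sup>2"
   have u: "u >= 0" by (simp add: u_def)
   have bd: "u <= (1 / d) * (1 / (1 + t\<^sup>2))" if "u * (1 + k * t\<^sup>2) <= 1" "d <= k" for k t
   proof -
    have "d * (1 + t\<^sup>2) <= 1 + k * t\<^sup>2" using that(2) d(2) mult_right_mono[OF that(2), of "t\<^sup>2"] by (simp add: distrib_left)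
    from mult_left_mono[OF this u] have "u * (d * (1 + t\<^sup>2)) <= 1" using that(1) by linarith
    moreover have "d * (1 + t\<^sup>2) > 0" using d(1) by (intro mult_pos_pos) (auto intro: add_pos_nonneg)
    ultimately have "u <= 1 / (d * (1 + t\<^sup>2))" by (simp add: pos_le_divide_eq)
    then show ?thesis by simp
   qed
   have b1: "u <= (1 / d) * (1 / (1 + (norm \<zeta>)\<^sup>2))" using Psi_bound(3)[OF A hc] d(4) by (intro bd[of "2 * c"]) (simp_all add: u_def pr)
   have b2: "u <= (1 / d) * (1 / (1 + (norm x)\<^sup>2))" using Psi_bound(2)[OF A hc] d(3) by (intro bd[of "c\<^sup>2"]) (simp_all add: u_def pr)
   have "(cmod (f ?p))\<^sup>2 = u ^ n * u ^ m" using pD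
    by (simp add: f_def norm_power u_def power_add[symmetric] power_mult[symmetric] mult.commute add.commute)
   also have "\<dots> <= ((1 / d) * (1 / (1 + (norm \<zeta>)\<^sup>2))) ^ n * ((1 / d) * (1 / (1 + (norm x)\<^sup>2))) ^ m"
    using b1 b2 u d(1) by (intro mult_mono power_mono) auto
   also have "\<dots> = (1 / d) ^ (n + m) * ((1 / (1 + (norm \<zeta>)\<^sup>2) ^ n) * (1 / (1 + (norm x)\<^sup>2) ^ m))"
    by (simp add: power_mult_distrib power_add power_divide)
   finally have "ennreal ((cmod (f ?p))\<^sup>2) <= ennreal ((1 / d) ^ (n + m) * ((1 / (1 + (norm \<zeta>)\<^sup>2) ^ n) * (1 / (1 + (norm x)\<^sup>2) ^ m)))"
    by (rule ennreal_leI)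
   also have "\<dots> = ennreal ((1 / d) ^ (n + m)) * (ennreal (1 / (1 + (norm \<zeta>)\<^sup>2) ^ n) * ennreal (1 / (1 + (norm x)\<^sup>2) ^ m))"
    using d(1) by (subst ennreal_mult; (subst ennreal_mult)?) auto
   finally show "ennreal ((cmod (f ?p))\<^sup>2) <= ennreal ((1 / d) ^ (n + m)) * (ennreal (1 / (1 + (norm \<zeta>)\<^sup>2) ^ n) * ennreal (1 / (1 + (norm x)\<^sup>2) ^ m))" .
  qed
  also have "\<dots> = ennreal ((1 / d) ^ (n + m)) * I" unfolding I_def by (simp add: nn_integral_cmult nn_integral_multc)
  finally show ?thesis .
 qed
 then have "hardy_norm_sq f <= ennreal ((1 / d) ^ (n + m)) * I" unfolding hardy_norm_sq_G[OF hf] by (rule SUP_least)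
 also have "\<dots> < \<infinity>" using I by (simp add: ennreal_mult_less_top)
 finally have "f \<in> hardy" using hf by (simp add: hardy_iff)
 moreover have "f p \<noteq> 0" if "p \<in> dom" for p using Psi_bound(4)[OF A, of p] that Omega_cone by (simp add: f_def dom_iff)
 ultimately show ?thesis by blast
qed

lemma hardy_inner_add_right:
 assumes "f \<in> hardy" "g \<in> hardy" "k \<in> hardy"
 shows "hardy_inner k (%p. f p + g p) = hardy_inner k f + hardy_inner k g"
 using hardy_inner_cnj[OF hardy_add[OF assms(1,2)] assms(3)] hardy_inner_cnj[OF assms(1,3)] hardy_inner_cnj[OF assms(2,3)]
  hardy_inner_add[OF assms] by simp

lemma hardy_inner_cmult_right:
 assumes "f \<in> hardy" "k \<in> hardy"
 shows "hardy_inner k (%p. c * f p) = cnj c * hardy_inner k f"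
 using hardy_inner_cnj[OF hardy_cmult(1)[OF assms(1)] assms(2)] hardy_inner_cnj[OF assms] hardy_inner_cmult[OF assms] by simp

lemma hn_add_cmult:
 assumes f: "f \<in> hardy" and g: "g \<in> hardy"
 shows "hn (%p. f p + c * g p) = hn f + 2 * Re (c * hardy_inner g f) + (cmod c)\<^sup>2 * hn g"
proof -
 have cg: "(%p. c * g p) \<in> hardy" by (rule hardy_cmult(1)[OF g])
 have s: "(%p. f p + c * g p) \<in> hardy" by (rule hardy_add[OF f cg])
 have "complex_of_real (hn (%p. f p + c * g p)) = hardy_inner (%p. f p + c * g p) (%p. f p + c * g p)"
  by (rule hardy_inner_self'[OF s, symmetric])
 also have "\<dots> = hn f + c * hardy_inner g f + cnj (c * hardy_inner g f) + (c * cnj c) * hn g"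
  using hardy_inner_add[OF f cg s] hardy_inner_add_right[OF f cg f] hardy_inner_add_right[OF f cg cg]
   hardy_inner_cmult[OF g f] hardy_inner_cmult[OF g cg] hardy_inner_cmult_right[OF g g] hardy_inner_cmult_right[OF g f]
   hardy_inner_cnj[OF g f] hardy_inner_self'[OF f] hardy_inner_self'[OF g] by (simp add: algebra_simps)
 finally have "Re (complex_of_real (hn (%p. f p + c * g p))) = Re (hn f + c * hardy_inner g f + cnj (c * hardy_inner g f) + (c * cnj c) * hn g)"
  by simp
 then show ?thesis by (simp add: complex_norm_square[symmetric] cmod_power2 power2_eq_square)
qed

text \<open>Riesz representation by an extremal problem: the element g of least norm with g(q) = 1
  is orthogonal to every u vanishing at q, and g divided by its squared norm represents evaluation
  at q.\<close>

lemma kernel_exists: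
 assumes q: "q \<in> dom" shows "\<exists>k\<in>hardy. \<forall>f\<in>hardy. f q = hardy_inner f k"
proof -
 define S where "S = {f \<in> hardy. f q = 1}"
 obtain f0 where f0: "f0 \<in> hardy" "f0 q \<noteq> 0" using hardy_nonvanishing q by blast
 have "(%p. (1 / f0 q) * f0 p) \<in> S" unfolding S_def using hardy_cmult(1)[OF f0(1), of "1 / f0 q"] f0(2) by simp
 then have ne: "S \<noteq> {}" by blast
 define I where "I = Inf (hn ` S)"
 have bdd: "bdd_below (hn ` S)" by (rule bdd_belowI[of _ 0]) auto
 have I: "I <= hn f" if "f \<in> S" for f unfolding I_def using that bdd by (intro cInf_lower) auto
 have "\<exists>f\<in>S. hn f < I + tn n" for n using cInf_lessD[of "hn ` S" "I + tn n"] ne by (auto simp: I_def)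
 then obtain f where f: "\<And>n. f n \<in> S" "\<And>n. hn (f n) < I + tn n" by metis
 have fh: "f n \<in> hardy" "f n q = 1" for n using f(1) by (auto simp: S_def)
 \<comment> \<open>The midpoint of two competitors is a competitor, so the parallelogram law makes a
   minimizing sequence Cauchy.\<close>
 have par: "hn (%p. f m p - f n p) <= 2 * tn m + 2 * tn n" for m n
 proof -
  have "(%p. (1/2) * (f m p + f n p)) \<in> S"
   unfolding S_def using fh hardy_cmult(1)[OF hardy_add[OF fh(1)[of m] fh(1)[of n]], of "1/2"] by simp
  from I[OF this] have "4 * I <= hn (%p. f m p + f n p)" using hardy_cmult(2)[OF hardy_add[OF fh(1)[of m] fh(1)[of n]], of "1/2"]
   by (simp add: hn_def enn2real_mult power2_eq_square)
  moreover have "hn (%p. f m p - f n p) + hn (%p. f m p + f n p) = 2 * hn (f m) + 2 * hn (f n)"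
   using hn_add_cmult[OF fh(1)[of m] fh(1)[of n], of "-1"] hn_add_cmult[OF fh(1)[of m] fh(1)[of n], of 1] by simp
  ultimately show ?thesis using f(2)[of m] f(2)[of n] by linarith
 qed
 have cauchy: "\<exists>N. \<forall>m\<ge>N. \<forall>n\<ge>N. hn (%p. f m p - f n p) <= eps" if eps: "eps > 0" for eps
 proof -
  obtain N where N: "tn N < eps / 4" using reals_Archimedean[of "eps / 4"] eps by auto
  have mono: "tn k <= tn N" if "k >= N" for k using that by (simp add: field_simps)
  have "hn (%p. f m p - f n p) <= eps" if "m >= N" "n >= N" for m n using par[of m n] N mono[OF that(1)] mono[OF that(2)] by linarith
  then show ?thesis by blast
 qed
 obtain g where g: "hfun g" "\<And>p. (%n. f n p) ----> g p" using hardy_limit[OF fh(1) cauchy] by blast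
 have "(%n. hn (f n)) ----> I"
 proof (rule tendsto_sandwich)
  show "\<forall>\<^sub>F n in sequentially. I <= hn (f n)" using I f(1) by simp
  show "\<forall>\<^sub>F n in sequentially. hn (f n) <= I + tn n" using f(2) by (simp add: less_imp_le)
  show "(%n. I + tn n) ----> I" using tendsto_add[OF tendsto_const LIMSEQ_inverse_real_of_nat, of I] by simp
 qed simp
 from hardy_fatou[OF fh(1) g this] have gh: "g \<in> hardy" "hn g <= I" by auto
 have gq: "g q = 1" using LIMSEQ_unique[OF g(2)[of q]] fh(2) by simp
 have gS: "g \<in> S" using gh gq by (simp add: S_def)
 have orth: "hardy_inner u g = 0" if u: "u \<in> hardy" "u q = 0" for u
 proof (rule ccontr)
  assume nz: "hardy_inner u g \<noteq> 0"
  define a where "a = hardy_inner u g"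
  define t where "t = 1 / (hn u + 1)"
  have t: "t > 0" by (simp add: t_def add_nonneg_pos)
  \<comment> \<open>If u were not orthogonal to g, adding c u would lower the squared norm by at
    least t |a|^2.\<close>
  define c where "c = - (complex_of_real t * cnj a)"
  have "(%p. g p + c * u p) \<in> S" unfolding S_def using hardy_add[OF gh(1) hardy_cmult(1)[OF u(1)]] gq u(2) by simp
  from I[OF this] have "I <= hn g + 2 * Re (c * a) + (cmod c)\<^sup>2 * hn u" unfolding hn_add_cmult[OF gh(1) u(1)] a_def .
  moreover have "Re (c * a) = - t * (cmod a)\<^sup>2"
  proof -
   have "c * a = - (complex_of_real t * (a * cnj a))" by (simp add: c_def)
   also have "\<dots> = complex_of_real (- t * (cmod a)\<^sup>2)" by (simp add: complex_norm_square[symmetric])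
   finally show ?thesis by simp
  qed
  moreover have "(cmod c)\<^sup>2 * hn u <= t * (cmod a)\<^sup>2"
  proof -
   have "(cmod c)\<^sup>2 * hn u = t * (t * hn u) * (cmod a)\<^sup>2" using t by (simp add: c_def norm_mult power_mult_distrib power2_eq_square)
   also have "\<dots> <= t * 1 * (cmod a)\<^sup>2" using t by (intro mult_right_mono mult_left_mono) (auto simp: t_def divide_le_eq add_nonneg_pos)
   finally show ?thesis by simp
  qed
  ultimately have "t * (cmod a)\<^sup>2 <= 0" using gh(2) by simp
  then show False using t nz by (simp add: a_def mult_le_0_iff)
 qed
 have hg: "hn g > 0"
 proof (rule ccontr)
  assume "\<not> hn g > 0"
  then have 0: "hn g = 0" using hn_nonneg[of g] by linarith
  obtain r C where r: "r > 0" "\<And>x. x \<in> ball q r ==> (cmod (g x))\<^sup>2 <= C * hn g"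
   using eval_bound[OF q] gh(1) unfolding hn_def by blast
  from r(2)[of q] r(1) 0 gq show False by simp
 qed
 define k where "k p = complex_of_real (1 / hn g) * g p" for p
 have kh: "k \<in> hardy" unfolding k_def by (rule hardy_cmult(1)[OF gh(1)])
 have "u q = hardy_inner u k" if u: "u \<in> hardy" for u
 proof -
  have "(%p. - u q * g p) \<in> hardy" by (rule hardy_cmult(1)[OF gh(1)])
  from orth[OF hardy_add[OF u this]] have "hardy_inner (%p. u p + - u q * g p) g = 0" using gq by simp
  then have "hardy_inner u g = u q * hn g"
   using hardy_inner_add[OF u hardy_cmult(1)[OF gh(1)] gh(1), of "- u q"] hardy_inner_cmult[OF gh(1) gh(1), of "- u q"]
    hardy_inner_self'[OF gh(1)] by simp
  then show ?thesis unfolding k_def using hardy_inner_cmult_right[OF gh(1) u, of "complex_of_real (1 / hn g)"] hg by simp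
 qed
 then show ?thesis using kh by blast
qed

lemma kernel_unique:
 assumes q: "q \<in> dom" and k: "k \<in> hardy" "\<forall>f\<in>hardy. f q = hardy_inner f k"
  and k': "k' \<in> hardy" "\<forall>f\<in>hardy. f q = hardy_inner f k'"
 shows "k = k'"
proof
 fix p
 show "k p = k' p"
 proof (cases "p \<in> dom")
  case True
  obtain l where l: "l \<in> hardy" "\<forall>f\<in>hardy. f p = hardy_inner f l" using kernel_exists[OF True] by blast
  have "k p = hardy_inner k l" "k' p = hardy_inner k' l" using l k(1) k'(1) by auto
  moreover have "hardy_inner k l = cnj (l q)" "hardy_inner k' l = cnj (l q)"
   using hardy_inner_cnj[OF l(1) k(1)] hardy_inner_cnj[OF l(1) k'(1)] k(2) k'(2) l(1) by simp_all
  ultimately show ?thesis by simp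
 next
  case False
  then show ?thesis using hardyD(1)[OF k(1)] hardyD(1)[OF k'(1)] by (simp add: hfun_def)
 qed
qed

lemma repr_kernel:
 assumes q: "q \<in> dom"
 shows "(%p. repr_kernel p q) \<in> hardy" "f \<in> hardy ==> f q = hardy_inner f (%p. repr_kernel p q)"
proof -
 obtain k where k: "k \<in> hardy" "\<forall>f\<in>hardy. f q = hardy_inner f k" using kernel_exists[OF q] by blast
 have "(THE k. k \<in> hardy & (\<forall>f\<in>hardy. f q = hardy_inner f k)) = k" using k kernel_unique[OF q] by (intro the_equality) auto
 then have "(%p. repr_kernel p q) = k" by (simp add: repr_kernel_def fun_eq_iff)
 then show "(%p. repr_kernel p q) \<in> hardy" "f \<in> hardy ==> f q = hardy_inner f (%p. repr_kernel p q)" using k by auto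
qed

lemma repr_kernel_eqI:
 assumes "q \<in> dom" "k \<in> hardy" "\<And>f. f \<in> hardy ==> f q = hardy_inner f k"
 shows "k = (%p. repr_kernel p q)"
 using kernel_unique[OF assms(1), of k "%p. repr_kernel p q"] assms repr_kernel[OF assms(1)] by blast

lemma repr_kernel_cnj:
 assumes "p \<in> dom" "q \<in> dom" shows "repr_kernel q p = cnj (repr_kernel p q)"
 using repr_kernel(2)[OF assms(2) repr_kernel(1)[OF assms(1)]] repr_kernel(2)[OF assms(1) repr_kernel(1)[OF assms(2)]]
  hardy_inner_cnj[OF repr_kernel(1)[OF assms(2)] repr_kernel(1)[OF assms(1)]] by simp

lemma repr_kernel_diag:
 assumes "p \<in> dom"
 shows "repr_kernel p p = complex_of_real (hn (%x. repr_kernel x p))" "hn (%x. repr_kernel x p) > 0"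
  "Re (repr_kernel p p) > 0"
proof -
 note k = repr_kernel[OF assms]
 show *: "repr_kernel p p = complex_of_real (hn (%x. repr_kernel x p))" using k(2)[OF k(1)] hardy_inner_self'[OF k(1)] by simp
 show pos: "hn (%x. repr_kernel x p) > 0"
 proof (rule ccontr)
  assume "\<not> ?thesis"
  then have 0: "hn (%x. repr_kernel x p) = 0" using hn_nonneg[of "%x. repr_kernel x p"] by linarith
  have "repr_kernel x p = 0" for x
  proof (cases "x \<in> dom")
   case True
   obtain r C where r: "r > 0" "\<And>f y. f \<in> hardy ==> y \<in> ball x r ==> (cmod (f y))\<^sup>2 <= C * hn f"
    using eval_bound[OF True] unfolding hn_def by blast
   from r(2)[OF k(1), of x] r(1) 0 show ?thesis by simp
  next
   case False
   then show ?thesis using hardyD(1)[OF k(1)] by (simp add: hfun_def)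
  qed
  then have z: "(%x. repr_kernel x p) = (%x. 0 * repr_kernel x p)" by auto
  obtain f where f: "f \<in> hardy" "f p \<noteq> 0" using hardy_nonvanishing assms by blast
  have "f p = hardy_inner f (%x. 0 * repr_kernel x p)" using k(2)[OF f(1)] z by simp
  also have "\<dots> = 0" using hardy_inner_cmult_right[OF k(1) f(1), of 0] by simp
  finally show False using f(2) by simp
 qed
 show "Re (repr_kernel p p) > 0" using * pos by simp
qed

text \<open>Lipschitz bounds in each variable separately, uniform near (a, b), suffice. The second
  variable is reduced to the first by hermitian symmetry.\<close>

lemma continuous_repr_kernel: "continuous_on (dom \<times> dom) (%(p, q). repr_kernel p q)"
proof -
 have "isCont (%(p, q). repr_kernel p q) (a, b)" if ab: "a \<in> dom" "b \<in> dom" for a b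
 proof -
  obtain r C where r: "r > 0" "C >= 0" "ball a r \<subseteq> dom" and C: "\<And>f x. f \<in> hardy ==> x \<in> ball a r ==> (cmod (f x))\<^sup>2 <= C * hn f"
   using eval_bound[OF ab(1)] unfolding hn_def by blast
  obtain s B where s: "s > 0" "B >= 0" "ball b s \<subseteq> dom" and B: "\<And>f x. f \<in> hardy ==> x \<in> ball b s ==> (cmod (f x))\<^sup>2 <= B * hn f"
   using eval_bound[OF ab(2)] unfolding hn_def by blast
  \<comment> \<open>The evaluation bound, applied to the kernel at its own point, reads K(p, p)^2 <=
    C K(p, p).\<close>
  have hnC: "hn (%x. repr_kernel x p) <= C" if "p \<in> ball a r" for p
  proof -
   have pd: "p \<in> dom" using that r(3) by blast
   note k = repr_kernel(1)[OF pd]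
   have "(hn (%x. repr_kernel x p))\<^sup>2 <= C * hn (%x. repr_kernel x p)"
    using C[OF k that] unfolding repr_kernel_diag(1)[OF pd] by simp
   then show ?thesis using repr_kernel_diag(2)[OF pd] by (simp add: power2_eq_square)
  qed
  have hnB: "hn (%x. repr_kernel x p) <= B" if "p \<in> ball b s" for p
  proof -
   have pd: "p \<in> dom" using that s(3) by blast
   note k = repr_kernel(1)[OF pd]
   have "(hn (%x. repr_kernel x p))\<^sup>2 <= B * hn (%x. repr_kernel x p)"
    using B[OF k that] unfolding repr_kernel_diag(1)[OF pd] by simp
   then show ?thesis using repr_kernel_diag(2)[OF pd] by (simp add: power2_eq_square)
  qed
  define M where "M = sqrt (C * B)"
  have M0: "M >= 0" using r(2) s(2) by (simp add: M_def)
  have bound: "cmod (repr_kernel x y) <= M" "cmod (repr_kernel y x) <= M" if "x \<in> ball a r" "y \<in> ball b s" for x y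
  proof -
   have d: "x \<in> dom" "y \<in> dom" using that r(3) s(3) by auto
   have "(cmod (repr_kernel x y))\<^sup>2 <= C * hn (%x. repr_kernel x y)" by (rule C[OF repr_kernel(1)[OF d(2)] that(1)])
   also have "\<dots> <= C * B" using hnB[OF that(2)] r(2) by (rule mult_left_mono)
   finally show 1: "cmod (repr_kernel x y) <= M" unfolding M_def by (rule real_le_rsqrt)
   show "cmod (repr_kernel y x) <= M" using 1 repr_kernel_cnj[OF d] by simp
  qed
  define L where "L = 4 * scaleC_const / r * M + 4 * scaleC_const / s * M"
  have L1: "4 * scaleC_const / r * M <= L" "4 * scaleC_const / s * M <= L" "L >= 0" using M0 r(1) s(1) scaleC_const(1) by (auto simp: L_def)
  have lip: "cmod (repr_kernel x y - repr_kernel a b) <= L * norm (x - a) + L * norm (y - b)"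
   if "x \<in> ball a (r / 2)" "y \<in> ball b (s / 2)" for x y
  proof -
   have xy: "x \<in> ball a r" "y \<in> ball b s" using that r(1) s(1) by auto
   have d: "x \<in> dom" "y \<in> dom" using xy r(3) s(3) by auto
   have "cmod (repr_kernel x y - repr_kernel a y) <= (4 * scaleC_const / r * M) * norm (x - a)"
   proof (rule lipschitz_bound[of "%x. repr_kernel x y" a r])
    show "holomorphic_fun (%x. repr_kernel x y) (ball a r)" using holomorphic_fun_subset[OF hardyD(5)[OF repr_kernel(1)[OF d(2)]] r(3)] .
   qed (use bound xy that r(1) in auto)
   also have "\<dots> <= L * norm (x - a)" using L1 by (intro mult_right_mono) auto
   finally have 1: "cmod (repr_kernel x y - repr_kernel a y) <= L * norm (x - a)" .
   have "cmod (repr_kernel y a - repr_kernel b a) <= (4 * scaleC_const / s * M) * norm (y - b)"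
   proof (rule lipschitz_bound[of "%x. repr_kernel x a" b s])
    show "holomorphic_fun (%x. repr_kernel x a) (ball b s)" using holomorphic_fun_subset[OF hardyD(5)[OF repr_kernel(1)[OF ab(1)]] s(3)] .
   qed (use bound r(1) that s(1) in auto)
   also have "\<dots> <= L * norm (y - b)" using L1 by (intro mult_right_mono) auto
   finally have "cmod (repr_kernel y a - repr_kernel b a) <= L * norm (y - b)" .
   moreover have "repr_kernel y a - repr_kernel b a = cnj (repr_kernel a y - repr_kernel a b)"
    using repr_kernel_cnj[OF ab(1) d(2)] repr_kernel_cnj[OF ab] by simp
   ultimately have 2: "cmod (repr_kernel a y - repr_kernel a b) <= L * norm (y - b)" by (metis complex_mod_cnj)
   have "cmod (repr_kernel x y - repr_kernel a b) <= cmod (repr_kernel x y - repr_kernel a y) + cmod (repr_kernel a y - repr_kernel a b)"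
    using norm_triangle_ineq[of "repr_kernel x y - repr_kernel a y" "repr_kernel a y - repr_kernel a b"] by simp
   then show ?thesis using 1 2 by linarith
  qed
  have "((%z. (case z of (p, q) => repr_kernel p q) - repr_kernel a b) \<longlongrightarrow> 0) (at (a, b))"
  proof (rule Lim_null_comparison)
   have o: "open (ball a (r / 2) \<times> ball b (s / 2))" "(a, b) \<in> ball a (r / 2) \<times> ball b (s / 2)"
    using r(1) s(1) by (auto intro: open_Times)
   show "\<forall>\<^sub>F z in at (a, b). norm ((case z of (p, q) => repr_kernel p q) - repr_kernel a b) <= L * norm (fst z - a) + L * norm (snd z - b)"
    using eventually_at_in_open'[OF o] by eventually_elim (use lip in auto)
   have "((%z. L * norm (fst z - a) + L * norm (snd z - b)) \<longlongrightarrow> L * norm (fst (a, b) - a) + L * norm (snd (a, b) - b)) (at (a, b))"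
    by (intro tendsto_intros)
   then show "((%z. L * norm (fst z - a) + L * norm (snd z - b)) \<longlongrightarrow> 0) (at (a, b))" by simp
  qed
  then show ?thesis unfolding isCont_def by (simp add: LIM_zero_cancel)
 qed
 then show ?thesis by (intro continuous_at_imp_continuous_on) auto
qed

end

section \<open>Boundary values of the kernel and the Poisson kernel\<close>

context symmetric_siegel
begin

subsection \<open>Symmetries and boundary values of the kernel\<close>

lemma hardy_heis:
 assumes a: "a \<in> E" and x: "x \<in> F" and f: "f \<in> hardy"
 shows "(%p. f (heis a x p)) \<in> hardy" "hardy_norm_sq (%p. f (heis a x p)) = hardy_norm_sq f"
proof -
 note [measurable] = hardyD(4)[OF f]
 have h: "hfun (%p. f (heis a x p))" using hardyD(1)[OF f] a x holomorphic_fun_heis by (auto simp: hfun_def)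
 have "G (%p. f (heis a x p)) h = G f h" if "h \<in> Omega" for h unfolding G_def heis_upF[OF a x Omega_F[OF that]]
  by (rule bB_heis[OF a x, of "%q. ennreal ((cmod (f (q + \<i> *C h)))\<^sup>2)"]) measurable
 then show *: "hardy_norm_sq (%p. f (heis a x p)) = hardy_norm_sq f" unfolding hardy_norm_sq_G[OF h] hardyD(3)[OF f] by (intro SUP_cong) auto
 then show "(%p. f (heis a x p)) \<in> hardy" using h hardyD(2)[OF f] by (simp add: hardy_iff)
qed

lemma hardy_inner_heis:
 assumes a: "a \<in> E" and x: "x \<in> F" and f: "f \<in> hardy" and g: "g \<in> hardy"
 shows "hardy_inner (%p. f (heis a x p)) (%p. g (heis a x p)) = hardy_inner f g"
proof -
 have "hardy_norm_sq (%p. f (heis a x p) + \<i> ^ k * g (heis a x p)) = hardy_norm_sq (%p. f p + \<i> ^ k * g p)" for k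
  using hardy_heis(2)[OF a x hardy_add[OF f hardy_cmult(1)[OF g]]] by simp
 then show ?thesis by (simp add: hardy_inner_def)
qed

text \<open>The affine automorphism acts unitarily on the Hardy space, and reproducing kernels are
  unique.\<close>

lemma repr_kernel_heis:
 assumes a: "a \<in> E" and x: "x \<in> F" and q: "q \<in> dom"
 shows "repr_kernel (heis a x p) (heis a x q) = repr_kernel p q"
proof -
 have hq: "heis a x q \<in> dom" using a x q by simp
 note k = repr_kernel[OF hq]
 have "(%p. repr_kernel (heis a x p) (heis a x q)) = (%p. repr_kernel p q)"
 proof (rule repr_kernel_eqI[OF q hardy_heis(1)[OF a x k(1)]])
  fix f assume f: "f \<in> hardy"
  define g where "g p = f (heis (- a) (- x) p)" for p
  have g: "g \<in> hardy" unfolding g_def using hardy_heis(1)[of "- a" "- x" f] a x f by (simp add: E_subspace F_subspace)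
  have fg: "f = (%p. g (heis a x p))" using heis_inverse[OF a x] by (simp add: g_def)
  have "hardy_inner f (%p. repr_kernel (heis a x p) (heis a x q)) = hardy_inner g (%p. repr_kernel p (heis a x q))"
   unfolding fg by (rule hardy_inner_heis[OF a x g k(1)])
  also have "\<dots> = g (heis a x q)" using k(2)[OF g] by simp
  also have "\<dots> = f q" using fg by metis
  finally show "f q = hardy_inner f (%p. repr_kernel (heis a x p) (heis a x q))" by simp
 qed
 then show ?thesis by metis
qed

lemma strip_line:
 assumes "p \<in> dom" shows "\<exists>d>0. \<forall>w. Im w > - d --> p + w *C e \<in> dom"
proof -
 obtain d where d: "d > 0" "\<And>t. \<bar>t\<bar> < d ==> up (- t) p \<in> dom" using down_dom[OF assms] by blast
 have "p + w *C e \<in> dom" if "Im w > - d" for w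
 proof -
  have "w *C e = Re w *\<^sub>R e + complex_of_real (Im w) *C (\<i> *C e)"
   by (subst (1) complex_eq[of w]) (simp add: scale_left_distrib scaleR_eq mult.commute)
  then have eq: "p + w *C e = up (Im w) p + Re w *\<^sub>R e" by (simp add: up_eq)
  have "up (Im w) p \<in> dom" using d(2)[of "- Im w"] up_dom'[OF assms, of "Im w"] that by (cases "Im w >= 0") auto
  then show ?thesis unfolding eq by (intro dom_real F_subspace e_mem_F)
 qed
 then show ?thesis using d(1) by blast
qed

text \<open>Both sides are holomorphic in \<open>w\<close> if \<open>up t\<close> is replaced by the translation by \<open>w *C e\<close>,
 resp. \<open>- cnj w *C e\<close>, and agree for real \<open>w\<close>.\<close>

lemma repr_kernel_up:
 assumes p: "p \<in> dom" and q: "q \<in> dom" and t: "t >= 0"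
 shows "repr_kernel (up t p) q = repr_kernel p (up t q)"
proof -
 obtain d1 where d1: "d1 > 0" "\<And>w. Im w > - d1 ==> p + w *C e \<in> dom" using strip_line[OF p] by blast
 obtain d2 where d2: "d2 > 0" "\<And>w. Im w > - d2 ==> q + w *C e \<in> dom" using strip_line[OF q] by blast
 define d where "d = min d1 d2"
 define S where "S = {w. Im w > - d}"
 have d0: "d > 0" using d1(1) d2(1) by (simp add: d_def)
 define A where "A w = repr_kernel (p + w *C e) q" for w
 define B0 where "B0 u = repr_kernel (q + u *C (- e)) p" for u
 \<comment> \<open>The kernel is antiholomorphic in its second argument; conjugating the variable
   and the value makes it holomorphic in w.\<close>
 define B where "B w = (cnj \<circ> B0 \<circ> cnj) w" for w
 have A: "A holomorphic_on S" unfolding A_def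
  by (rule holomorphic_fun_line[OF hardyD(5)[OF repr_kernel(1)[OF q]]]) (use d1(2) in \<open>auto simp: S_def d_def\<close>)
 have B0: "B0 holomorphic_on (cnj ` S)" unfolding B0_def
 proof (rule holomorphic_fun_line[OF hardyD(5)[OF repr_kernel(1)[OF p]]])
  fix w assume "w \<in> cnj ` S"
  then have "Im (- w) > - d2" by (auto simp: S_def d_def)
  from d2(2)[OF this] show "q + w *C (- e) \<in> dom" by simp
 qed
 have B: "B holomorphic_on S" unfolding B_def[abs_def] using holomorphic_on_compose_cnj_cnj[OF B0] open_halfspace_Im_gt by (auto simp: S_def o_def)
 have B_eq: "B w = repr_kernel p (q + (- cnj w) *C e)" if "w \<in> S" for w
 proof -
  have "q + (- cnj w) *C e \<in> dom" using that by (intro d2(2)) (auto simp: S_def d_def)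
  from repr_kernel_cnj[OF this p] show ?thesis by (simp add: B_def B0_def)
 qed
 have "A (\<i> * t) - B (\<i> * t) = 0"
 proof (rule analytic_continuation[where f = "%w. A w - B w" and S = S and U = "\<real>" and \<xi> = 0])
  show "(%w. A w - B w) holomorphic_on S" by (intro holomorphic_intros A B)
  show "open S" unfolding S_def by (rule open_halfspace_Im_gt)
  show "connected S" unfolding S_def by (intro convex_connected convex_halfspace_Im_gt)
  show "\<real> \<subseteq> S" using d0 by (auto simp: S_def Reals_def)
  show "0 \<in> S" using d0 by (simp add: S_def)
  show "(0::complex) islimpt \<real>"
  proof (subst islimpt_sequential, intro exI conjI allI)
   have "complex_of_real (tn n) \<noteq> 0" for n unfolding of_real_eq_0_iff by (simp del: of_nat_Suc)
   then show "complex_of_real (tn n) \<in> \<real> - {0}" for n by (metis DiffI Reals_of_real singletonD)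
   show "(%n. complex_of_real (tn n)) ----> 0" 
    using tendsto_of_real[OF LIMSEQ_inverse_real_of_nat, where ?'a = complex] by (simp only: of_real_0)
  qed
  show "\<i> * complex_of_real t \<in> S" using d0 t by (simp add: S_def)
  fix z :: complex assume "z \<in> \<real>"
  then obtain r where r: "z = complex_of_real r" by (auto simp: Reals_def)
  have zS: "z \<in> S" using d0 r by (simp add: S_def)
  \<comment> \<open>For real parameters both translations are one and the same automorphism, applied
    to the pair of points.\<close>
  have "repr_kernel (p + r *\<^sub>R e) q = repr_kernel (heis 0 (- (r *\<^sub>R e)) (p + r *\<^sub>R e)) (heis 0 (- (r *\<^sub>R e)) q)"
   by (rule repr_kernel_heis[symmetric]) (auto simp: E_subspace F_subspace q)
  also have "\<dots> = repr_kernel p (q - r *\<^sub>R e)" by (simp add: heis_real)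
  finally show "A z - B z = 0" unfolding B_eq[OF zS] by (simp add: A_def r scaleR_eq)
 qed
 moreover have "\<i> * complex_of_real t \<in> S" using d0 t by (simp add: S_def)
 ultimately show ?thesis using B_eq by (simp add: A_def up_eq mult.commute)
qed

lemma cauchy_kernel_dom: "q \<in> dom ==> cauchy_kernel p q = repr_kernel p q" by (simp add: cauchy_kernel_def)

lemma repr_kernel_near_boundary:
 assumes p: "p \<in> dom" "up (- eps) p \<in> dom" and q: "q \<in> dom" and eps: "eps > 0"
 shows "repr_kernel p q = repr_kernel (up (- eps) p) (up eps q)" using repr_kernel_up[OF p(2) q, of eps] eps by simp

lemma continuous_shifted_kernel:
 assumes eps: "eps > 0"
 shows "continuous_on ({p \<in> dom. up (- eps) p \<in> dom} \<times> (dom \<union> bdom)) (%(p, q). repr_kernel (up (- eps) p) (up eps q))"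
proof -
 have "continuous_on ({p \<in> dom. up (- eps) p \<in> dom} \<times> (dom \<union> bdom)) (%z. (%(p, q). repr_kernel p q) (up (- eps) (fst z), up eps (snd z)))"
  using up_dom eps by (intro continuous_on_compose2[OF continuous_repr_kernel] continuous_intros) auto
 then show ?thesis by (simp add: split_beta)
qed

lemma open_down: "open {p \<in> dom. up (- eps) p \<in> dom}"
proof -
 have "open (up (- eps) -` dom)" by (rule open_vimage[OF open_dom]) (intro continuous_intros)
 then have "open (dom \<inter> up (- eps) -` dom)" using open_dom by blast
 moreover have "{p \<in> dom. up (- eps) p \<in> dom} = dom \<inter> up (- eps) -` dom" by auto
 ultimately show ?thesis by simp
qed

text \<open>Moving a height eps from p to q leaves the kernel unchanged, and the moved kernel is
  continuous up to the boundary in q. This evaluates the limit in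
  \<open>cauchy_kernel\<close>.\<close>

lemma cauchy_kernel_bdom:
 assumes p: "p \<in> dom" "up (- eps) p \<in> dom" and q: "q \<in> bdom" and eps: "eps > 0"
 shows "cauchy_kernel p q = repr_kernel (up (- eps) p) (up eps q)"
proof -
 let ?D = "{p \<in> dom. up (- eps) p \<in> dom}"
 let ?f = "%(p, q). repr_kernel (up (- eps) p) (up eps q)"
 have "(?f \<longlongrightarrow> ?f (p, q)) (at (p, q) within ?D \<times> (dom \<union> bdom))"
  using continuous_shifted_kernel[OF eps] p q unfolding continuous_on_def by blast
 then have "(?f \<longlongrightarrow> ?f (p, q)) (at (p, q) within ?D \<times> dom)" by (rule tendsto_within_subset) auto
 then have 1: "((%(p, q). repr_kernel p q) \<longlongrightarrow> ?f (p, q)) (at (p, q) within ?D \<times> dom)"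
 proof (rule Lim_transform_eventually)
  show "\<forall>\<^sub>F z in at (p, q) within ?D \<times> dom. ?f z = (%(p, q). repr_kernel p q) z"
   unfolding eventually_at_filter using repr_kernel_near_boundary eps by (intro always_eventually) auto
 qed
 \<comment> \<open>The points that can be lowered by eps form a neighbourhood of p, so the smaller
   set yields the same limit.\<close>
 have ev: "at (p, q) within ?D \<times> dom = at (p, q) within dom \<times> dom"
 proof (rule at_within_nhd)
  show "(p, q) \<in> ?D \<times> UNIV" using p by simp
  show "open (?D \<times> (UNIV :: 'a set))" by (intro open_Times open_down open_UNIV)
 qed auto
 \<comment> \<open>\<open>Lim\<close> denotes the limit only at a nontrivial filter.\<close>
 have "(p, q) islimpt dom \<times> dom" unfolding islimpt_sequential
 proof (intro exI conjI allI)
  show "(p, up (tn n) q) \<in> dom \<times> dom - {(p, q)}" for n using p(1) up_dom[of q "tn n"] q bdom_disjoint_dom[OF q] by auto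
  have "(%n. up (tn n) q) ----> up 0 q" by (rule continuous_on_tendsto_compose[of UNIV "%t. up t q"])
     (use LIMSEQ_inverse_real_of_nat in \<open>auto intro!: continuous_intros simp del: up_0 of_nat_Suc\<close>)
  then show "(%n. (p, up (tn n) q)) ----> (p, q)" by (intro tendsto_Pair) auto
 qed
 then have "\<not> trivial_limit (at (p, q) within dom \<times> dom)" by (simp add: trivial_limit_within)
 from tendsto_Lim[OF this 1[unfolded ev]]
 show ?thesis using bdom_disjoint_dom[OF q] by (simp add: cauchy_kernel_def)
qed

text \<open>Zero off \<open>dom\<close> times \<open>bdom\<close>, which makes it jointly Borel on
  the whole space.\<close>

definition CK :: "'a => 'a => complex" where
 "CK p q = (if p \<in> dom & q \<in> bdom then cauchy_kernel p q else 0)"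

lemma CK_up:
 assumes "p \<in> dom" "q \<in> bdom" "eps > 0" shows "CK (up eps p) q = repr_kernel p (up eps q)"
 using cauchy_kernel_bdom[of "up eps p" eps q] assms up_dom'[OF assms(1), of eps] by (simp add: CK_def)

lemma down_point:
 assumes "p \<in> dom" "s > 0"
 obtains eps p0 where "eps > 0" "eps < s" "p0 \<in> dom" "p = up eps p0"
proof -
 obtain d where d: "d > 0" "\<And>t. \<bar>t\<bar> < d ==> up (- t) p \<in> dom" using down_dom[OF assms(1)] by blast
 define eps where "eps = min d s / 2"
 have "eps > 0" "eps < s" "eps < d" using d(1) assms(2) by (auto simp: eps_def min_def)
 then show ?thesis using d(2)[of eps] by (intro that[of eps "up (- eps) p"]) auto
qed

lemma hfun_CK:
 assumes q: "q \<in> bdom" shows "hfun (%p. CK p q)"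
proof -
 have "holomorphic_fun (%p. CK p q) dom" unfolding holomorphic_fun_def
 proof
  fix p assume p: "p \<in> dom"
  obtain eps p0 where eps: "eps > 0" "eps < 1" "p0 \<in> dom" "p = up eps p0" by (rule down_point[OF p zero_less_one])
  let ?D = "{p \<in> dom. up (- eps) p \<in> dom}"
  have "holomorphic_fun (%x. repr_kernel (up (- eps) x) (up eps q)) ?D" unfolding up_def[of "- eps"]
   by (rule holomorphic_fun_translate[OF hardyD(5)[OF repr_kernel(1)]]) (use up_dom[of q eps] q eps in \<open>auto simp: up_def\<close>)
  from holomorphic_fun_cong[OF this open_down] have "holomorphic_fun (%x. CK x q) ?D"
   using cauchy_kernel_bdom[OF _ _ q eps(1)] q by (auto simp: CK_def)
  moreover have "p \<in> ?D" using p eps by simp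
  ultimately show "\<exists>f'. ((%p. CK p q) has_derivative f') (at p) & (\<forall>c v. f' (c *C v) = c * f' v)"
   unfolding holomorphic_fun_def by blast
 qed
 then show ?thesis by (simp add: hfun_def CK_def)
qed

lemma continuous_CK: "continuous_on (dom \<times> bdom) (%(p, q). CK p q)" unfolding continuous_on_eq_continuous_within
proof (clarify)
 fix p q assume p: "p \<in> dom" and q: "q \<in> bdom"
 obtain eps p0 where eps: "eps > 0" "eps < 1" "p0 \<in> dom" "p = up eps p0" by (rule down_point[OF p zero_less_one])
 let ?D = "{p \<in> dom. up (- eps) p \<in> dom}"
 let ?f = "%(p, q). repr_kernel (up (- eps) p) (up eps q)"
 have pD: "p \<in> ?D" using p eps by simp
 have "(?f \<longlongrightarrow> ?f (p, q)) (at (p, q) within ?D \<times> (dom \<union> bdom))"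
  using continuous_shifted_kernel[OF eps(1)] pD q unfolding continuous_on_def by blast
 then have "(?f \<longlongrightarrow> ?f (p, q)) (at (p, q) within ?D \<times> bdom)" by (rule tendsto_within_subset) auto
 then have 1: "((%(p, q). CK p q) \<longlongrightarrow> ?f (p, q)) (at (p, q) within ?D \<times> bdom)"
 proof (rule Lim_transform_eventually)
  show "\<forall>\<^sub>F z in at (p, q) within ?D \<times> bdom. ?f z = (%(p, q). CK p q) z"
   unfolding eventually_at_filter using cauchy_kernel_bdom eps by (intro always_eventually) (auto simp: CK_def)
 qed
 have ev: "at (p, q) within ?D \<times> bdom = at (p, q) within dom \<times> bdom"
 proof (rule at_within_nhd)
  show "(p, q) \<in> ?D \<times> UNIV" using pD by simp
  show "open (?D \<times> (UNIV :: 'a set))" by (intro open_Times open_down open_UNIV)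
 qed auto
 have "?f (p, q) = CK p q" using cauchy_kernel_bdom[OF p _ q eps(1)] pD p q by (simp add: CK_def)
 then show "continuous (at (p, q) within dom \<times> bdom) (%(p, q). CK p q)" using 1 unfolding ev continuous_within by simp
qed

lemma measurable_CK: "(%z. CK (fst z) (snd z)) \<in> borel_measurable (borel \<Otimes>\<^sub>M borel)"
proof -
 have "(%z. if z \<in> dom \<times> bdom then (case z of (p, q) => CK p q) else 0) \<in> borel_measurable borel"
  by (intro borel_measurable_continuous_on_if continuous_CK borel_Times) auto
 moreover have "(%z. if z \<in> dom \<times> bdom then (case z of (p, q) => CK p q) else 0) = (%z. CK (fst z) (snd z))"
  by (auto simp: CK_def fun_eq_iff)
 ultimately show ?thesis by (simp add: borel_prod)
qed

lemma measurable_CK' [measurable (raw)]: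
 assumes "f \<in> borel_measurable M" "g \<in> borel_measurable M" shows "(%x. CK (f x) (g x)) \<in> borel_measurable M"
 using measurable_compose[OF measurable_Pair[OF assms] measurable_CK] by simp

lemma CK_heis:
 assumes a: "a \<in> E" "x \<in> F" and p: "p \<in> dom" and q: "q \<in> bdom"
 shows "CK (heis a x p) (heis a x q) = CK p q"
proof -
 obtain eps p0 where eps: "eps > 0" "eps < 1" "p0 \<in> dom" "p = up eps p0" by (rule down_point[OF p zero_less_one])
 have "CK (heis a x p) (heis a x q) = repr_kernel (heis a x p0) (heis a x (up eps q))" using CK_up[of "heis a x p0" "heis a x q" eps] a q eps by simp
 also have "\<dots> = repr_kernel p0 (up eps q)" using up_dom[of q eps] q eps by (intro repr_kernel_heis a) auto
 also have "\<dots> = CK p q" using CK_up[OF eps(3) q eps(1)] eps(4) by simp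
 finally show ?thesis .
qed

text \<open>Splitting the height t evenly between the two points turns both sides into values of the
  kernel with its arguments exchanged.\<close>

lemma CK_swap:
 assumes q: "q \<in> bdom" "q' \<in> bdom" and t: "t > 0"
 shows "cmod (CK (up t q') q) = cmod (CK (up t q) q')"
proof -
 have d: "up (t / 2) q \<in> dom" "up (t / 2) q' \<in> dom" using q t by (auto intro!: up_dom)
 have "CK (up t q') q = repr_kernel (up (t / 2) q') (up (t / 2) q)" using CK_up[OF d(2) q(1), of "t / 2"] t by simp
 moreover have "CK (up t q) q' = repr_kernel (up (t / 2) q) (up (t / 2) q')" using CK_up[OF d(1) q(2), of "t / 2"] t by simp
 ultimately show ?thesis using repr_kernel_cnj[OF d] by simp
qed

text \<open>The boundary is a single orbit of the maps \<open>heis\<close>, and these commute with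
  \<open>up\<close>.\<close>

lemma kernel_diag_boundary:
 assumes q: "q \<in> bdom" and t: "t > 0"
 shows "repr_kernel (up t q) (up t q) = repr_kernel (up t 0) (up t 0)"
proof -
 have "up t q = heis (prE q) (prF q) (up t 0)" using heis_to_base[OF q] by simp
 then show ?thesis using repr_kernel_heis[of "prE q" "prF q" "up t 0" "up t 0"] up_dom[of 0 t] base_point(3) t by simp
qed

subsection \<open>The Poisson kernel\<close>

definition PK :: "'a => 'a => real" where "PK p q = (cmod (CK p q))\<^sup>2 / Re (repr_kernel p p)"

lemma PK_poisson: "p \<in> dom ==> q \<in> bdom ==> poisson p q = PK p q" by (simp add: poisson_def PK_def CK_def cauchy_kernel_dom)

lemma PK_nonneg [simp]: "p \<in> dom ==> PK p q >= 0" using repr_kernel_diag(3)[of p] by (simp add: PK_def)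

lemma measurable_PK [measurable]: "PK p \<in> borel_measurable borel" unfolding PK_def[abs_def] by measurable

text \<open>Lower p to p0 by some eps < t and let k be the kernel at p0. Then k times the translate
  of f by t - eps is a Hardy function, the integral is its pairing with k over the slice at eps, and
  shifting this slice turns it into a reproducing formula at p.\<close>

lemma CK_norm:
 assumes f: "holomorphic_fun f dom" and M: "\<And>x. x \<in> dom ==> cmod (f x) <= M" and p: "p \<in> dom" and t: "t > 0"
 shows "integrable bB (%q. f (up t q) * complex_of_real ((cmod (CK p q))\<^sup>2))"
  "(\<integral>q. f (up t q) * complex_of_real ((cmod (CK p q))\<^sup>2) \<partial>bB) = f (up t p) * repr_kernel p p"
proof -
 obtain eps p0 where eps: "eps > 0" "eps < t" "p0 \<in> dom" "p = up eps p0" by (rule down_point[OF p t])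
 define k where "k x = repr_kernel x p0" for x
 have k: "k \<in> hardy" unfolding k_def by (rule repr_kernel(1)[OF eps(3)])
 define g where "g x = (if x \<in> dom then f (up (t - eps) x) * k x else 0)" for x
 have "holomorphic_fun (%x. f (up (t - eps) x)) dom" unfolding up_def using dom_up eps(2) by (intro holomorphic_fun_translate[OF f]) auto
 then have hg: "hfun g" unfolding g_def[abs_def] by (intro hfun_restrict holomorphic_fun_mult hardyD(5)[OF k])
 have gk: "cmod (g x) <= cmod (complex_of_real M * k x)" for x
 proof (cases "x \<in> dom")
  case True
  have *: "cmod (f (up (t - eps) x)) <= M" using up_dom'[OF True] eps(2) by (intro M) auto
  then show ?thesis using True order_trans[OF norm_ge_zero *] by (simp add: g_def norm_mult mult_right_mono)
 qed (simp add: g_def)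
 have g: "g \<in> hardy"
 proof -
  have Mk: "(%x. complex_of_real M * k x) \<in> hardy" by (rule hardy_cmult(1)[OF k])
  have "G g h <= G (%x. complex_of_real M * k x) h" for h unfolding G_def using gk by (intro nn_integral_mono ennreal_leI power_mono) auto
  then have "hardy_norm_sq g <= hardy_norm_sq (%x. complex_of_real M * k x)"
   unfolding hardy_norm_sq_G[OF hg] hardyD(3)[OF Mk] by (intro SUP_mono) auto
  then show ?thesis using hg hardyD(2)[OF Mk] by (auto simp: hardy_iff intro: le_less_trans)
 qed
 \<comment> \<open>Shifting the kernel at p0 by eps gives the kernel at p, because height may be
   moved between the arguments.\<close>
 have kp: "shift eps k = (%x. repr_kernel x p)"
 proof
  fix x
  show "shift eps k x = repr_kernel x p" using repr_kernel_up[OF _ eps(3), of x eps] eps hardyD(1)[OF repr_kernel(1)[OF p]]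
   by (cases "x \<in> dom") (auto simp: shift_def k_def hfun_def)
 qed
 have CKk: "CK p q = cnj (k (up eps q))" if q: "q \<in> bdom" for q
 proof -
  have "up eps q \<in> dom" using q eps by (intro up_dom) auto
  then show ?thesis using CK_up[OF eps(3) q eps(1)] repr_kernel_cnj[OF eps(3), of "up eps q"] eps(4) by (simp add: k_def)
 qed
 have eq: "AE q in bB. g (up eps q) * cnj (k (up eps q)) = f (up t q) * complex_of_real ((cmod (CK p q))\<^sup>2)" using AE_bB
 proof eventually_elim
  fix q assume q: "q \<in> bdom"
  have "up eps q \<in> dom" using q eps by (intro up_dom) auto
  then have "g (up eps q) * cnj (k (up eps q)) = f (up t q) * (k (up eps q) * cnj (k (up eps q)))" by (simp add: g_def mult.assoc)
  also have "k (up eps q) * cnj (k (up eps q)) = complex_of_real ((cmod (CK p q))\<^sup>2)"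
   unfolding CKk[OF q] complex_mod_cnj by (simp only: complex_norm_square)
  finally show "g (up eps q) * cnj (k (up eps q)) = f (up t q) * complex_of_real ((cmod (CK p q))\<^sup>2)" .
 qed
 have m1: "(%q. g (up eps q) * cnj (k (up eps q))) \<in> borel_measurable bB"
  using hardy_prod_integrable[OF g k eps(1)] by (rule borel_measurable_integrable)
 have m2: "(%q. f (up t q) * complex_of_real ((cmod (CK p q))\<^sup>2)) \<in> borel_measurable bB"
 proof -
  have f1: "hfun (%x. if x \<in> dom then f x else 0)" by (rule hfun_restrict[OF f])
  have f2: "(%q. (if up t q \<in> dom then f (up t q) else 0) * complex_of_real ((cmod (CK p q))\<^sup>2)) \<in> borel_measurable bB"
   using hfun_measurable[OF f1] unfolding up_def by measurable
  have "(%q. (if up t q \<in> dom then f (up t q) else 0) * complex_of_real ((cmod (CK p q))\<^sup>2)) = (%q. f (up t q) * complex_of_real ((cmod (CK p q))\<^sup>2))"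
   using up_dom t by (auto simp: fun_eq_iff CK_def)
  with f2 show ?thesis by simp
 qed
 show "integrable bB (%q. f (up t q) * complex_of_real ((cmod (CK p q))\<^sup>2))"
  using hardy_prod_integrable[OF g k eps(1)] Bochner_Integration.integrable_cong_AE[OF m1 m2 eq] by simp
 have "(\<integral>q. f (up t q) * complex_of_real ((cmod (CK p q))\<^sup>2) \<partial>bB) = slice_inner g k eps"
  unfolding slice_inner_def by (rule integral_cong_AE[OF m2 m1]) (use eq in auto)
 also have "\<dots> = hardy_inner (shift eps g) (shift eps k)" by (rule hardy_inner_shift[OF g k eps(1), symmetric])
 also have "\<dots> = shift eps g p" unfolding kp by (rule repr_kernel(2)[OF p shift_hardy(1)[OF g eps(1)], symmetric])
 also have "\<dots> = f (up t p) * shift eps k p" using p eps(1) up_dom'[OF p, of eps] by (simp add: shift_def g_def)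
 also have "\<dots> = f (up t p) * repr_kernel p p" unfolding kp ..
 finally show "(\<integral>q. f (up t q) * complex_of_real ((cmod (CK p q))\<^sup>2) \<partial>bB) = f (up t p) * repr_kernel p p" .
qed

lemma PK_reproduces:
 assumes f: "holomorphic_fun f dom" and M: "\<And>x. x \<in> dom ==> cmod (f x) <= M" and p: "p \<in> dom" and t: "t > 0"
 shows "integrable bB (%q. f (up t q) * complex_of_real (PK p q))" "(\<integral>q. f (up t q) * complex_of_real (PK p q) \<partial>bB) = f (up t p)"
proof -
 have c: "repr_kernel p p = complex_of_real (Re (repr_kernel p p))" "Re (repr_kernel p p) \<noteq> 0"
  using repr_kernel_diag(1,3)[OF p] by (metis Re_complex_of_real, simp)
 have eq: "(%q. f (up t q) * complex_of_real (PK p q)) = (%q. f (up t q) * complex_of_real ((cmod (CK p q))\<^sup>2) / complex_of_real (Re (repr_kernel p p)))"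
  by (simp add: PK_def)
 show "integrable bB (%q. f (up t q) * complex_of_real (PK p q))" unfolding eq by (intro integrable_divide CK_norm(1)[OF f M p t])
 have "(\<integral>q. f (up t q) * complex_of_real (PK p q) \<partial>bB) = f (up t p) * repr_kernel p p / complex_of_real (Re (repr_kernel p p))"
  unfolding eq by (subst integral_divide_zero, subst CK_norm(2)[OF f M p t]) auto
 then show "(\<integral>q. f (up t q) * complex_of_real (PK p q) \<partial>bB) = f (up t p)" using c repr_kernel_diag(3)[OF p] by auto
qed

lemma PK_integrable: "p \<in> dom ==> integrable bB (PK p)" and PK_integral: "p \<in> dom ==> (\<integral>q. PK p q \<partial>bB) = 1"
proof -
 assume p: "p \<in> dom"
 note * = PK_reproduces[OF holomorphic_fun_const[of 1 dom], of 1 p 1, OF _ p]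
 show "integrable bB (PK p)" using *(1) by (simp add: complex_of_real_integrable_eq)
 have "complex_of_real (\<integral>q. PK p q \<partial>bB) = 1" using *(2) by simp
 then show "(\<integral>q. PK p q \<partial>bB) = 1" by simp
qed

lemma PK_nn_integral: assumes "p \<in> dom" shows "(IB q. ennreal (PK p q)) = 1"
 using nn_integral_eq_integral[OF PK_integrable[OF assms]] PK_integral[OF assms] assms by simp

text \<open>The numerators agree by \<open>CK_swap\<close>, the denominators because the diagonal
  depends on the height t alone.\<close>

lemma PK_swap:
 assumes q: "q \<in> bdom" "q' \<in> bdom" and t: "t > 0"
 shows "PK (up t q') q = PK (up t q) q'" using CK_swap[OF assms] kernel_diag_boundary[OF q(1) t] kernel_diag_boundary[OF q(2) t] by (simp add: PK_def)

lemma PK_heis: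
 assumes a: "a \<in> E" "x \<in> F" and p: "p \<in> dom" and q: "q \<in> bdom"
 shows "PK (heis a x p) (heis a x q) = PK p q" using CK_heis[OF assms] repr_kernel_heis[OF a p] by (simp add: PK_def)

lemma continuous_PK: "continuous_on (dom \<times> bdom) (%(p, q). PK p q)"
proof -
 have "continuous_on (dom \<times> bdom) (%z. (%(p, q). repr_kernel p q) (fst z, fst z))"
  by (intro continuous_on_compose2[OF continuous_repr_kernel] continuous_intros) auto
 moreover have "Re (repr_kernel (fst z) (fst z)) \<noteq> 0" if "z \<in> dom \<times> bdom" for z using repr_kernel_diag(3)[of "fst z"] that by auto
 ultimately show ?thesis using continuous_CK unfolding split_beta PK_def by (intro continuous_intros) auto
qed

end

section \<open>Approximate identity and an integrable majorant of the Poisson kernels\<close>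

context symmetric_siegel
begin

subsection \<open>The Poisson kernel as an approximate identity\<close>

lemma measurable_Psi [measurable]: "Psi A \<in> borel_measurable borel"
proof -
 have "(%p. jinner p a) \<in> borel_measurable borel" for a by (intro borel_measurable_continuous_onI continuous_intros)
 then show ?thesis unfolding Psi_def[abs_def] by measurable
qed

lemma up_tn_tendsto:
 assumes "X ----> (0::real)" shows "(%n. up (X n) p) ----> p"
proof -
 have "(%n. up (X n) p) ----> up 0 p" by (rule continuous_on_tendsto_compose[of UNIV "%t. up t p", OF _ assms])
    (auto intro!: continuous_intros simp del: up_0)
 then show ?thesis by simp
qed

lemma tn_tendsto: "tn ----> 0" by (rule LIMSEQ_inverse_real_of_nat)

lemma Psi_le_1: "separating A c ==> p \<in> dom \<union> bdom ==> cmod (Psi A p) <= 1"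
 using Psi_bound(1)[of A c p] Omega_cone by (auto simp: dom_iff bdom_iff)

text \<open>The reproducing formula holds for the translates; t tends to 0 by dominated convergence,
  as \<open>Psi\<close> is continuous up to the boundary and bounded by 1.\<close>

lemma Psi_reproduces:
 assumes A: "separating A c" and p: "p \<in> dom"
 shows "integrable bB (%q. Psi A q * complex_of_real (PK p q))" "(\<integral>q. Psi A q * complex_of_real (PK p q) \<partial>bB) = Psi A p"
proof -
 let ?f = "%q. Psi A q * complex_of_real (PK p q)"
 let ?s = "%n q. Psi A (up (tn n) q) * complex_of_real (PK p q)"
 have lim: "(%n. Psi A (up (tn n) x)) ----> Psi A x" if "x \<in> dom \<union> bdom" for x
  by (rule continuous_on_tendsto_compose[OF continuous_Psi[OF A] up_tn_tendsto[OF tn_tendsto] that])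
    (use that up_dom in auto)
 have m: "?f \<in> borel_measurable bB" "?s n \<in> borel_measurable bB" for n unfolding up_def by measurable
 have ae: "AE q in bB. (%n. ?s n q) ----> ?f q" using AE_bB by eventually_elim (intro tendsto_intros lim, simp)
 have bd: "AE q in bB. norm (?s n q) <= PK p q" for n using AE_bB
 proof eventually_elim
  fix q assume "q \<in> bdom"
  then have "cmod (Psi A (up (tn n) q)) <= 1" using up_dom[of q "tn n"] by (intro Psi_le_1[OF A]) auto
  then show "norm (?s n q) <= PK p q" using p by (simp add: norm_mult mult_left_le_one_le)
 qed
 show "integrable bB ?f" by (rule integrable_dominated_convergence[OF m(1) m(2) PK_integrable[OF p] ae bd])
 have "(%n. \<integral>q. ?s n q \<partial>bB) ----> (\<integral>q. ?f q \<partial>bB)"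
  by (rule integral_dominated_convergence[OF m(1) m(2) PK_integrable[OF p] ae bd])
 moreover have "(\<integral>q. ?s n q \<partial>bB) = Psi A (up (tn n) p)" for n
  using Psi_le_1[OF A] by (intro PK_reproduces(2)[OF holomorphic_Psi[OF A] _ p]) auto
 moreover have "(%n. Psi A (up (tn n) p)) ----> Psi A p" using lim p by blast
 ultimately show "(\<integral>q. ?f q \<partial>bB) = Psi A p" using LIMSEQ_unique by auto
qed

lemma bdom_small:
 assumes "\<delta> > 0" shows "\<exists>a>0. \<forall>q\<in>bdom. norm (prE q) < a --> norm (prF q) < a --> norm q < \<delta>"
proof -
 have "continuous_on UNIV (%z. bpoint (fst z) (snd z))" unfolding bpoint_def point_def by (intro continuous_intros)
 then have "isCont (%z. bpoint (fst z) (snd z)) (0, 0)" by (simp add: continuous_on_eq_continuous_at)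
 then obtain d where d: "d > 0" "\<And>z. dist z (0, 0) < d ==> dist (bpoint (fst z) (snd z)) (bpoint 0 0) < \<delta>"
  using assms unfolding continuous_at_eps_delta by fastforce
 have "norm q < \<delta>" if q: "q \<in> bdom" "norm (prE q) < d / 2" "norm (prF q) < d / 2" for q
 proof -
  have "dist (prE q, prF q) (0, 0) <= norm (prE q) + norm (prF q)"
   using norm_triangle_ineq[of "(prE q, 0)" "(0, prF q)"] by (simp add: dist_norm norm_Pair)
  then have "dist (prE q, prF q) (0, 0) < d" using q(2,3) by linarith
  from d(2)[OF this] show ?thesis using bdom_bpoint[OF q(1)] by (simp add: bpoint_def point_def)
 qed
 then show ?thesis using d(1) by (intro exI[of _ "d / 2"]) auto
qed

text \<open>Away from 0 on the boundary, one of the coordinates in E and F is at least a, and the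
  decay of \<open>Psi\<close> keeps its modulus below sqrt \<rho> < 1.\<close>

lemma Psi_peak:
 assumes A: "separating A c" and \<delta>: "\<delta> > 0"
 shows "\<exists>\<eta>>0. \<forall>q\<in>bdom. norm q >= \<delta> --> 1 - Re (Psi A q) >= \<eta>"
proof -
 have c: "c > 0" using A by (simp add: separating_def)
 obtain a where a: "a > 0" "\<And>q. q \<in> bdom ==> norm (prE q) < a ==> norm (prF q) < a ==> norm q < \<delta>"
  using bdom_small[OF \<delta>] by blast
 define s where "s = min (c\<^sup>2 * a\<^sup>2) (2 * c * a\<^sup>2)"
 have s: "s > 0" using c a(1) by (simp add: s_def)
 define \<rho> where "\<rho> = 1 / (1 + s)"
 have \<rho>: "0 < \<rho>" "\<rho> < 1" using s by (simp_all add: \<rho>_def)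
 have "1 - Re (Psi A q) >= 1 - sqrt \<rho>" if q: "q \<in> bdom" "norm q >= \<delta>" for q
 proof -
  have hc: "height q \<in> cone" using q(1) by (simp add: bdom_iff)
  have "norm (prE q) >= a \<or> norm (prF q) >= a" using a(2)[OF q(1)] q(2) by linarith
  then have "(cmod (Psi A q))\<^sup>2 * (1 + s) <= 1"
  proof
   assume "norm (prE q) >= a"
   then have "a\<^sup>2 <= (norm (prE q))\<^sup>2" using a(1) by (intro power_mono) auto
   then have "2 * c * a\<^sup>2 <= 2 * c * (norm (prE q))\<^sup>2" using c by (intro mult_left_mono) auto
   then have "1 + s <= 1 + 2 * c * (norm (prE q))\<^sup>2" by (simp add: s_def)
   then have "(cmod (Psi A q))\<^sup>2 * (1 + s) <= (cmod (Psi A q))\<^sup>2 * (1 + 2 * c * (norm (prE q))\<^sup>2)" by (rule mult_left_mono) simp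
   then show ?thesis using Psi_bound(3)[OF A hc] by linarith
  next
   assume "norm (prF q) >= a"
   then have "a\<^sup>2 <= (norm (prF q))\<^sup>2" using a(1) by (intro power_mono) auto
   then have "c\<^sup>2 * a\<^sup>2 <= c\<^sup>2 * (norm (prF q))\<^sup>2" using c by (intro mult_left_mono) auto
   then have "1 + s <= 1 + c\<^sup>2 * (norm (prF q))\<^sup>2" by (simp add: s_def)
   then have "(cmod (Psi A q))\<^sup>2 * (1 + s) <= (cmod (Psi A q))\<^sup>2 * (1 + c\<^sup>2 * (norm (prF q))\<^sup>2)" by (rule mult_left_mono) simp
   then show ?thesis using Psi_bound(2)[OF A hc] by linarith
  qed
  then have "(cmod (Psi A q))\<^sup>2 <= \<rho>" using s by (simp add: \<rho>_def pos_le_divide_eq)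
  then have "cmod (Psi A q) <= sqrt \<rho>" by (rule real_le_rsqrt)
  then show ?thesis using complex_Re_le_cmod[of "Psi A q"] by linarith
 qed
 moreover have "1 - sqrt \<rho> > 0" using \<rho> by simp
 ultimately show ?thesis by blast
qed

text \<open>The peak function replaces a kernel estimate: 1 - Re Psi is bounded below away from 0,
  while its Poisson integral is its own value at \<open>up (X n) 0\<close>, which tends to
  0.\<close>

lemma PK_approx_base:
 fixes g :: "'a => real"
 assumes [measurable]: "g \<in> borel_measurable borel" and B: "\<And>q. \<bar>g q\<bar> <= B" and cont: "isCont g 0"
  and X: "\<And>n. X n > 0" "X ----> 0"
 shows "(%n. \<integral>q. g q * PK (up (X n) 0) q \<partial>bB) ----> g 0"
proof (rule LIMSEQ_I)
 fix r :: real assume r: "r > 0"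
 obtain A c where A: "separating A c" using separating_exists by blast
 have B0: "B >= 0" using B[of 0] by linarith
 obtain \<delta> where \<delta>: "\<delta> > 0" "\<And>q. norm q < \<delta> ==> \<bar>g q - g 0\<bar> < r / 2"
  using cont[unfolded continuous_at_eps_delta, rule_format, of "r / 2"] r by (auto simp: dist_norm)
 obtain \<eta> where \<eta>: "\<eta> > 0" "\<And>q. q \<in> bdom ==> norm q >= \<delta> ==> 1 - Re (Psi A q) >= \<eta>"
  using Psi_peak[OF A \<delta>(1)] by blast
 \<comment> \<open>The oscillation of g is at most 2 B, which C (1 - Re Psi) dominates outside the
   \<delta>-ball.\<close>
 define C where "C = 2 * B / \<eta>"
 have C: "C >= 0" using B0 \<eta>(1) by (simp add: C_def)
 have pD: "up (X n) 0 \<in> dom" for n using up_dom[of 0 "X n"] base_point(3) X(1) by simp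
 have key: "\<bar>(\<integral>q. g q * PK (up (X n) 0) q \<partial>bB) - g 0\<bar> <= r / 2 + C * (1 - Re (Psi A (up (X n) 0)))" for n
 proof -
  let ?P = "PK (up (X n) 0)"
  note iP = PK_integrable[OF pD[of n]]
  have P0: "?P q >= 0" for q using pD by simp
  have ig: "integrable bB (%q. g q * ?P q)" by (rule Bochner_Integration.integrable_bound[OF integrable_mult_right[OF iP, of B]])
     (auto simp: abs_mult P0 B0 intro!: AE_I2 mult_right_mono B)
  have iPsi: "integrable bB (%q. Re (Psi A q) * ?P q)" using integrable_Re[OF Psi_reproduces(1)[OF A pD[of n]]] by simp
  have Psi: "(\<integral>q. Re (Psi A q) * ?P q \<partial>bB) = Re (Psi A (up (X n) 0))"
   using integral_Re[OF Psi_reproduces(1)[OF A pD[of n]]] Psi_reproduces(2)[OF A pD[of n]] by simp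
  have i2: "integrable bB (%q. (r / 2 + C * (1 - Re (Psi A q))) * ?P q)"
  proof -
   have "integrable bB (%q. (r / 2 + C) * ?P q - C * (Re (Psi A q) * ?P q))"
    by (intro Bochner_Integration.integrable_diff integrable_mult_right iP iPsi)
   moreover have "(%q. (r / 2 + C) * ?P q - C * (Re (Psi A q) * ?P q)) = (%q. (r / 2 + C * (1 - Re (Psi A q))) * ?P q)"
    by (auto simp: algebra_simps)
   ultimately show ?thesis by simp
  qed
  have v2: "(\<integral>q. (r / 2 + C * (1 - Re (Psi A q))) * ?P q \<partial>bB) = r / 2 + C * (1 - Re (Psi A (up (X n) 0)))"
  proof -
   have "(\<integral>q. (r / 2 + C * (1 - Re (Psi A q))) * ?P q \<partial>bB) = (\<integral>q. (r / 2 + C) * ?P q - C * (Re (Psi A q) * ?P q) \<partial>bB)"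
    by (intro Bochner_Integration.integral_cong) (auto simp: algebra_simps)
   also have "\<dots> = (r / 2 + C) * 1 - C * Re (Psi A (up (X n) 0))" using iP iPsi by (simp add: PK_integral[OF pD] Psi)
   finally show ?thesis by (simp add: algebra_simps)
  qed
  have "(\<integral>q. g q * ?P q \<partial>bB) - g 0 = (\<integral>q. g q * ?P q \<partial>bB) - (\<integral>q. g 0 * ?P q \<partial>bB)"
   by (simp add: PK_integral[OF pD])
  also have "\<dots> = (\<integral>q. g q * ?P q - g 0 * ?P q \<partial>bB)" using ig iP by (subst Bochner_Integration.integral_diff) auto
  finally have "\<bar>(\<integral>q. g q * ?P q \<partial>bB) - g 0\<bar> = \<bar>\<integral>q. g q * ?P q - g 0 * ?P q \<partial>bB\<bar>" by simp
  also have "\<dots> <= (\<integral>q. \<bar>g q * ?P q - g 0 * ?P q\<bar> \<partial>bB)"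
   using integral_norm_bound[of bB "%q. g q * ?P q - g 0 * ?P q"] by simp
  also have "\<dots> <= (\<integral>q. (r / 2 + C * (1 - Re (Psi A q))) * ?P q \<partial>bB)"
  proof (rule integral_mono_AE)
   show "integrable bB (%q. \<bar>g q * ?P q - g 0 * ?P q\<bar>)" using ig iP by auto
   show "AE q in bB. \<bar>g q * ?P q - g 0 * ?P q\<bar> <= (r / 2 + C * (1 - Re (Psi A q))) * ?P q" using AE_bB
   proof eventually_elim
    fix q assume q: "q \<in> bdom"
    have nn: "1 - Re (Psi A q) >= 0" using Psi_le_1[OF A, of q] q complex_Re_le_cmod[of "Psi A q"] by auto
    have "\<bar>g q - g 0\<bar> <= r / 2 + C * (1 - Re (Psi A q))"
    proof (cases "norm q < \<delta>")
     case True
     then show ?thesis using \<delta>(2)[OF True] mult_nonneg_nonneg[OF C nn] by linarith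
    next
     case False
     have "\<bar>g q - g 0\<bar> <= 2 * B" using B[of q] B[of 0] by linarith
     also have "\<dots> = C * \<eta>" using \<eta>(1) by (simp add: C_def)
     also have "\<dots> <= C * (1 - Re (Psi A q))" using \<eta>(2)[OF q] False C by (intro mult_left_mono) auto
     finally show ?thesis using r by linarith
    qed
    then have "\<bar>g q - g 0\<bar> * ?P q <= (r / 2 + C * (1 - Re (Psi A q))) * ?P q" using P0 by (rule mult_right_mono)
    moreover have "\<bar>g q * ?P q - g 0 * ?P q\<bar> = \<bar>g q - g 0\<bar> * ?P q" using P0[of q] by (simp add: abs_mult flip: left_diff_distrib)
    ultimately show "\<bar>g q * ?P q - g 0 * ?P q\<bar> <= (r / 2 + C * (1 - Re (Psi A q))) * ?P q" by simp
   qed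
  qed (rule i2)
  finally show ?thesis unfolding v2 .
 qed
 have "(%n. Psi A (up (X n) 0)) ----> Psi A 0" by (rule continuous_on_tendsto_compose[OF continuous_Psi[OF A] up_tn_tendsto[OF X(2)]])
    (use base_point(3) pD in auto)
 then have "(%n. Re (Psi A (up (X n) 0))) ----> 1" using tendsto_Re by fastforce
 then have "(%n. C * (1 - Re (Psi A (up (X n) 0)))) ----> C * (1 - 1)" by (intro tendsto_intros)
 then obtain N where N: "\<And>n. n >= N ==> \<bar>C * (1 - Re (Psi A (up (X n) 0)))\<bar> < r / 2"
  using r LIMSEQ_D[of _ "C * (1 - 1)" "r / 2"] by fastforce
 have "\<bar>(\<integral>q. g q * PK (up (X n) 0) q \<partial>bB) - g 0\<bar> < r" if "n >= N" for n using key[of n] N[OF that] by linarith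
 then show "\<exists>N. \<forall>n\<ge>N. norm ((\<integral>q. g q * PK (up (X n) 0) q \<partial>bB) - g 0) < r" by auto
qed

text \<open>The automorphism taking 0 to q0 transports the statement from the base point.\<close>

lemma PK_approx:
 fixes f :: "'a => real"
 assumes f: "continuous_on UNIV f" "\<And>q. 0 <= f q" "\<And>q. f q <= B" and q0: "q0 \<in> bdom"
  and X: "\<And>n. X n > 0" "X ----> 0"
 shows "(%n. IB q. ennreal (f q * PK (up (X n) q0) q)) ----> ennreal (f q0)"
proof -
 have [measurable]: "f \<in> borel_measurable borel" using f(1) by (rule borel_measurable_continuous_onI)
 define a where "a = prE q0"
 define x where "x = prF q0"
 have ax: "a \<in> E" "x \<in> F" by (simp_all add: a_def x_def)
 have h0: "heis a x 0 = q0" unfolding a_def x_def by (rule heis_to_base[OF q0])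
 define g where "g q = f (heis a x q)" for q
 have contg: "continuous_on UNIV g" unfolding g_def by (rule continuous_on_compose2[OF f(1)]) (auto intro!: continuous_intros)
 have [measurable]: "g \<in> borel_measurable borel" using contg by (rule borel_measurable_continuous_onI)
 have B0: "B >= 0" using f(2,3) order_trans by blast
 have pD: "up (X n) 0 \<in> dom" for n using up_dom[of 0 "X n"] base_point(3) X(1) by simp
 have eq: "(IB q. ennreal (f q * PK (up (X n) q0) q)) = ennreal (\<integral>q. g q * PK (up (X n) 0) q \<partial>bB)" for n
 proof -
  have "(IB q. ennreal (f q * PK (up (X n) q0) q)) = (IB q. ennreal (f (heis a x q) * PK (up (X n) q0) (heis a x q)))"
   by (rule bB_heis[OF ax, symmetric]) measurable
  also have "\<dots> = (IB q. ennreal (g q * PK (up (X n) 0) q))"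
  proof (rule nn_integral_bB_cong)
   fix q assume q: "q \<in> bdom"
   have "up (X n) q0 = heis a x (up (X n) 0)" using heis_up[OF ax] h0 by simp
   then show "ennreal (f (heis a x q) * PK (up (X n) q0) (heis a x q)) = ennreal (g q * PK (up (X n) 0) q)"
    using PK_heis[OF ax pD q] by (simp add: g_def)
  qed
  also have "\<dots> = ennreal (\<integral>q. g q * PK (up (X n) 0) q \<partial>bB)"
  proof (rule nn_integral_eq_integral)
   show "integrable bB (%q. g q * PK (up (X n) 0) q)"
    by (rule Bochner_Integration.integrable_bound[OF integrable_mult_right[OF PK_integrable[OF pD], of B]])
      (use f B0 pD in \<open>auto simp: abs_mult g_def intro!: AE_I2 mult_right_mono\<close>)
  qed (use f pD in \<open>auto simp: g_def\<close>)
  finally show ?thesis .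
 qed
 have "(%n. \<integral>q. g q * PK (up (X n) 0) q \<partial>bB) ----> g 0"
 proof (rule PK_approx_base[OF _ _ _ X])
  show "\<bar>g q\<bar> <= B" for q using f by (simp add: g_def)
  show "isCont g 0" using contg by (simp add: continuous_on_eq_continuous_at)
 qed measurable
 then show ?thesis unfolding eq using h0 by (simp add: g_def tendsto_ennrealI)
qed

subsection \<open>An integrable majorant of the Poisson kernels\<close>

lemma CK_nn_integral:
 assumes "p \<in> dom" shows "(IB q. ennreal ((cmod (CK p q))\<^sup>2)) = ennreal (Re (repr_kernel p p))"
proof -
 note pos = repr_kernel_diag(3)[OF assms]
 have "(IB q. ennreal ((cmod (CK p q))\<^sup>2)) = (IB q. ennreal (Re (repr_kernel p p)) * ennreal (PK p q))"
  using pos by (intro nn_integral_cong) (simp add: PK_def ennreal_mult[symmetric])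
 then show ?thesis by (simp add: nn_integral_cmult PK_nn_integral[OF assms])
qed

lemma continuous_kernel_diag: "continuous_on dom (%p. Re (repr_kernel p p))"
proof -
 have "continuous_on dom (%p. (%(p, q). repr_kernel p q) (p, p))"
  by (intro continuous_on_compose2[OF continuous_repr_kernel] continuous_intros) auto
 then show ?thesis by (intro continuous_intros) simp
qed

text \<open>The mean value inequality in the interior variable bounds the numerator by S, the
  integral of |CK y q|^2 over y in a ball. S is integrable by Tonelli, since each y contributes K(y,
  y); the denominator is bounded below by continuity.\<close>

lemma PK_local_majorant:
 assumes p: "p \<in> dom"
 shows "\<exists>r>0. \<exists>C\<ge>0. \<exists>S\<in>borel_measurable borel. ball p r \<subseteq> dom & (IB q. S q) < \<infinity> &
  (\<forall>x\<in>ball p r. \<forall>q\<in>bdom. ennreal (PK x q) <= ennreal C * S q)"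
proof -
 obtain r C R where r: "r > 0" "C >= 0" "ball p r \<subseteq> dom" "cball p R \<subseteq> dom"
  and le: "\<And>g x. hfun g ==> x \<in> ball p r ==> ennreal ((cmod (g x))\<^sup>2) <= ennreal C * (\<integral>\<^sup>+y\<in>cball p R. ennreal ((cmod (g y))\<^sup>2) \<partial>lborel)"
  using local_mean[OF p] by blast
 define S where "S q = (\<integral>\<^sup>+y\<in>cball p R. ennreal ((cmod (CK y q))\<^sup>2) \<partial>lborel)" for q
 interpret B: sigma_finite_measure bB by (rule sigma_finite_bB)
 have P: "pair_sigma_finite bB (lborel :: 'a measure)" by standard
 have [measurable]: "(indicator (cball p R) :: 'a => ennreal) \<in> borel_measurable borel" for p R by (rule borel_measurable_indicator) simp
 have S[measurable]: "S \<in> borel_measurable borel" unfolding S_def by measurable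
 have "compact ((%y. Re (repr_kernel y y)) ` cball p R)"
  by (intro compact_continuous_image continuous_on_subset[OF continuous_kernel_diag r(4)] compact_cball)
 then have "bounded ((%y. Re (repr_kernel y y)) ` cball p R)" by (rule compact_imp_bounded)
 then obtain M where "\<forall>z\<in>(%y. Re (repr_kernel y y)) ` cball p R. norm z <= M" unfolding bounded_iff by blast
 then have M: "\<bar>Re (repr_kernel y y)\<bar> <= M" if "y \<in> cball p R" for y using that by auto
 have "(IB q. S q) = (\<integral>\<^sup>+y. (IB q. ennreal ((cmod (CK y q))\<^sup>2) * indicator (cball p R) y) \<partial>lborel)"
  unfolding S_def by (rule pair_sigma_finite.Fubini'[OF P, symmetric]) measurable
 also have "\<dots> <= (\<integral>\<^sup>+y. ennreal M * indicator (cball p R) y \<partial>lborel)"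
 proof (rule nn_integral_mono)
  fix y
  show "(IB q. ennreal ((cmod (CK y q))\<^sup>2) * indicator (cball p R) y) <= ennreal M * indicator (cball p R) y"
  proof (cases "y \<in> cball p R")
   case True
   then have "y \<in> dom" using r(4) by blast
   from CK_nn_integral[OF this] show ?thesis using True M[OF True] by (simp add: ennreal_leI)
  qed simp
 qed
 also have "\<dots> = ennreal M * emeasure lborel (cball p R)" by (rule nn_integral_cmult_indicator) simp
 also have "\<dots> < \<infinity>" using emeasure_lborel_cball_finite[of p R] by (simp add: ennreal_mult_less_top)
 finally have Sfin: "(IB q. S q) < \<infinity>" .
 \<comment> \<open>Close to p the diagonal of the kernel exceeds k / 2, which costs the factor 2 /
   k.\<close>
 define k where "k = Re (repr_kernel p p)"
 have k: "k > 0" unfolding k_def by (rule repr_kernel_diag(3)[OF p])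
 have "isCont (%y. Re (repr_kernel y y)) p" using continuous_kernel_diag open_dom p by (simp add: continuous_on_eq_continuous_at)
 then obtain d where d: "d > 0" "\<And>y. dist y p < d ==> dist (Re (repr_kernel y y)) k < k / 2"
  using k unfolding continuous_at_eps_delta k_def by (metis half_gt_zero)
 have main: "ennreal (PK x q) <= ennreal (2 / k * C) * S q" if x: "x \<in> ball p (min r d)" and q: "q \<in> bdom" for x q
 proof -
  have "dist (Re (repr_kernel x x)) k < k / 2" using d(2)[of x] x by (simp add: dist_commute)
  then have "Re (repr_kernel x x) >= k / 2" unfolding dist_real_def by linarith
  then have "PK x q <= (2 / k) * (cmod (CK x q))\<^sup>2"
   unfolding PK_def using k mult_right_mono[of k "2 * Re (repr_kernel x x)" "(cmod (CK x q))\<^sup>2"] by (simp add: divide_simps mult_ac)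
  then have "ennreal (PK x q) <= ennreal (2 / k) * ennreal ((cmod (CK x q))\<^sup>2)" using k by (simp add: ennreal_leI flip: ennreal_mult)
  also have "\<dots> <= ennreal (2 / k) * (ennreal C * S q)" unfolding S_def using x by (intro mult_left_mono le[OF hfun_CK[OF q]]) auto
  also have "\<dots> = ennreal (2 / k * C) * S q" using k r(2) by (subst ennreal_mult) (simp_all add: mult.assoc)
  finally show ?thesis .
 qed
 show ?thesis using r(1,2,3) d(1) k S Sfin main by (intro exI[of _ "min r d"] conjI exI[of _ "2 / k * C"] bexI[of _ S]) auto
qed

text \<open>Countably many of the local balls cover \<open>dom\<close>; a weighted sum of their
  majorants serves all points, with constants depending on the point.\<close>

lemma PK_majorant:
 "\<exists>S\<in>borel_measurable borel. (IB q. S q) < \<infinity> &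
  (\<forall>p\<in>dom. \<exists>r>0. \<exists>C\<ge>0. ball p r \<subseteq> dom & (\<forall>x\<in>ball p r. \<forall>q\<in>bdom. ennreal (PK x q) <= ennreal C * S q))"
proof -
 have "\<forall>p\<in>dom. \<exists>r C S. r > 0 & C >= 0 & S \<in> borel_measurable borel & ball p r \<subseteq> dom & (IB q. S q) < \<infinity> &
  (\<forall>x\<in>ball p r. \<forall>q\<in>bdom. ennreal (PK x q) <= ennreal C * S q)" using PK_local_majorant by blast
 then obtain r C S where rCS: "\<And>p. p \<in> dom ==> r p > 0 & C p >= 0 & S p \<in> borel_measurable borel & ball p (r p) \<subseteq> dom &
   (IB q. S p q) < \<infinity> & (\<forall>x\<in>ball p (r p). \<forall>q\<in>bdom. ennreal (PK x q) <= ennreal (C p) * S p q)" by metis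
 obtain \<F> where \<F>: "\<F> \<subseteq> (%p. ball p (r p)) ` dom" "countable \<F>" "\<Union>\<F> = \<Union>((%p. ball p (r p)) ` dom)"
  using Lindelof[of "(%p. ball p (r p)) ` dom"] by auto
 obtain D where D: "countable D" "D \<subseteq> dom" "\<F> = (%p. ball p (r p)) ` D" using \<F>(1,2) countable_subset_image by metis
 have cover: "\<exists>p\<in>D. x \<in> ball p (r p)" if "x \<in> dom" for x
 proof -
  have "x \<in> \<Union>\<F>" unfolding \<F>(3) using that rCS by force
  then show ?thesis using D(3) by auto
 qed
 then have "D \<noteq> {}" using base_point(2) by blast
 define P where "P = from_nat_into D"
 have PD: "range P = D" unfolding P_def using D(1) \<open>D \<noteq> {}\<close> by (rule range_from_nat_into[rotated])
 have Pdom: "P i \<in> dom" for i using PD D(2) by blast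
 define I where "I i = enn2real (IB q. S (P i) q)" for i
 \<comment> \<open>The i-th majorant then contributes at most 2^-(i+1) to the integral.\<close>
 define w where "w i = (1/2) ^ Suc i / (1 + I i)" for i
 have I0: "I i >= 0" for i by (simp add: I_def)
 have w: "w i > 0" for i using I0[of i] by (simp add: w_def)
 have IS: "(IB q. S (P i) q) = ennreal (I i)" for i using rCS[OF Pdom[of i]] by (simp add: I_def)
 define T where "T q = (\<Sum>i. ennreal (w i) * S (P i) q)" for q
 have mS[measurable]: "S (P i) \<in> borel_measurable borel" for i using rCS[OF Pdom] by blast
 have T: "T \<in> borel_measurable borel" unfolding T_def by measurable
 have "(IB q. T q) = (\<Sum>i. IB q. ennreal (w i) * S (P i) q)" unfolding T_def by (rule nn_integral_suminf) measurable
 also have "\<dots> = (\<Sum>i. ennreal (w i * I i))" using w I0 by (simp add: nn_integral_cmult IS ennreal_mult less_imp_le)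
 also have "\<dots> <= (\<Sum>i. ennreal ((1/2) ^ Suc i))"
 proof (intro suminf_le summableI ennreal_leI)
  fix i
  have "I i / (1 + I i) <= 1" using I0[of i] by simp
  from mult_left_mono[OF this, of "(1/2) ^ Suc i"] show "w i * I i <= (1/2) ^ Suc i" by (simp add: w_def)
 qed
 also have "\<dots> = ennreal 1" using power_half_series by (intro suminf_ennreal_eq) auto
 finally have Tfin: "(IB q. T q) < \<infinity>" by (auto intro: le_less_trans)
 have ST: "S (P i) q <= ennreal (1 / w i) * T q" for i q
 proof -
  have "ennreal (w i) * S (P i) q <= T q"
   unfolding T_def using sum_le_suminf[OF summableI, of "{i}" "%i. ennreal (w i) * S (P i) q"] by simp
  then have "ennreal (1 / w i) * (ennreal (w i) * S (P i) q) <= ennreal (1 / w i) * T q" by (rule mult_left_mono) simp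
  moreover have "ennreal (1 / w i) * (ennreal (w i) * S (P i) q) = S (P i) q"
   using w[of i] by (simp add: mult.assoc[symmetric] ennreal_mult[symmetric])
  ultimately show ?thesis by simp
 qed
 have "\<exists>r>0. \<exists>C\<ge>0. ball p r \<subseteq> dom & (\<forall>x\<in>ball p r. \<forall>q\<in>bdom. ennreal (PK x q) <= ennreal C * T q)" if p: "p \<in> dom" for p
 proof -
  obtain p0 where p0: "p0 \<in> D" "p \<in> ball p0 (r p0)" using cover[OF p] by blast
  then obtain i where i: "p0 = P i" using PD by blast
  obtain s where s: "s > 0" "ball p s \<subseteq> ball p0 (r p0)" using p0(2) open_contains_ball[of "ball p0 (r p0)"] by blast
  have "ennreal (PK x q) <= ennreal (C p0 * (1 / w i)) * T q" if "x \<in> ball p s" "q \<in> bdom" for x q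
  proof -
   have "ennreal (PK x q) <= ennreal (C p0) * S p0 q" using rCS[OF Pdom[of i]] that s(2) i by blast
   also have "\<dots> <= ennreal (C p0) * (ennreal (1 / w i) * T q)" unfolding i by (intro mult_left_mono ST) simp
   also have "\<dots> = ennreal (C p0 * (1 / w i)) * T q" using rCS[OF Pdom[of i]] w[of i] i by (subst ennreal_mult) (auto simp: mult.assoc)
   finally show ?thesis .
  qed
  moreover have "C p0 * (1 / w i) >= 0" using rCS[OF Pdom[of i]] w[of i] i by simp
  moreover have "ball p s \<subseteq> dom" using s(2) rCS[OF Pdom[of i]] i by blast
  ultimately show ?thesis using s(1) by blast
 qed
 then show ?thesis using T Tfin by blast
qed

text \<open>Choose radii beyond which the mass of S is below 2^-(n+1), and add one copy of S outside
  each. The sum remains integrable, but exceeds n S outside the first n balls.\<close>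

lemma tail_weight:
 assumes [measurable]: "S \<in> borel_measurable borel" and fin: "(IB q. S q) < \<infinity>"
 shows "\<exists>R\<in>borel_measurable borel. (IB q. R q) < \<infinity> & (\<forall>q. S q <= R q) &
  (\<forall>n. \<exists>\<rho>. \<forall>q. norm q > \<rho> --> of_nat n * S q <= R q)"
proof -
 have [measurable]: "(indicator (- cball 0 \<rho>) :: 'a => ennreal) \<in> borel_measurable borel" for \<rho>
  by (rule borel_measurable_indicator) (auto intro: borel_comp)
 have "(%k. IB q. indicator (- cball 0 (real k)) q * S q) ----> (IB q. 0)"
 proof (rule nn_integral_dominated_convergence[where w = S])
  show "AE q in bB. indicator (- cball 0 (real k)) q * S q <= S q" for k by (intro AE_I2) (simp add: indicator_def)
  show "AE q in bB. (%k. indicator (- cball 0 (real k)) q * S q) ----> 0"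
  proof (rule AE_I2)
   fix q :: 'a
   obtain N :: nat where N: "norm q <= real N" using real_arch_simple by blast
   have "\<forall>\<^sub>F k in sequentially. (indicator (- cball 0 (real k)) q * S q) = 0"
    using eventually_ge_at_top[of N] by eventually_elim (use N in \<open>auto simp: indicator_def\<close>)
   then show "(%k. indicator (- cball 0 (real k)) q * S q) ----> 0" by (rule tendsto_eventually)
  qed
 qed (use fin in measurable)
 then have lim: "(%k. IB q. indicator (- cball 0 (real k)) q * S q) ----> 0" by simp
 have "\<exists>k. (IB q. indicator (- cball 0 (real k)) q * S q) < ennreal ((1/2) ^ Suc n)" for n
 proof -
  have "\<forall>\<^sub>F k in sequentially. (IB q. indicator (- cball 0 (real k)) q * S q) < ennreal ((1/2) ^ Suc n)"
   using lim by (rule order_tendstoD) (simp del: power_Suc)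
  then show ?thesis using eventually_happens by fastforce
 qed
 then obtain \<rho> where \<rho>: "\<And>n. (IB q. indicator (- cball 0 (real (\<rho> n))) q * S q) < ennreal ((1/2) ^ Suc n)" by metis
 define R where "R q = S q + (\<Sum>n. indicator (- cball 0 (real (\<rho> n))) q * S q)" for q
 have R: "R \<in> borel_measurable borel" unfolding R_def by measurable
 have "(IB q. R q) = (IB q. S q) + (IB q. (\<Sum>n. indicator (- cball 0 (real (\<rho> n))) q * S q))"
  unfolding R_def by (rule nn_integral_add) measurable
 also have "(IB q. (\<Sum>n. indicator (- cball 0 (real (\<rho> n))) q * S q)) = (\<Sum>n. IB q. indicator (- cball 0 (real (\<rho> n))) q * S q)"
  by (rule nn_integral_suminf) measurable
 finally have e: "(IB q. R q) = (IB q. S q) + (\<Sum>n. IB q. indicator (- cball 0 (real (\<rho> n))) q * S q)" .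
 have "(\<Sum>n. IB q. indicator (- cball 0 (real (\<rho> n))) q * S q) <= (\<Sum>n. ennreal ((1/2) ^ Suc n))"
  using \<rho> by (intro suminf_le summableI) (auto intro: less_imp_le)
 also have "\<dots> = ennreal 1" using power_half_series by (intro suminf_ennreal_eq) auto
 finally have "(IB q. R q) <= (IB q. S q) + 1" unfolding e by (simp add: add_left_mono)
 also have "\<dots> < \<infinity>" using fin by simp
 finally have Rfin: "(IB q. R q) < \<infinity>" .
 have "\<exists>M. \<forall>q. norm q > M --> of_nat n * S q <= R q" for n
 proof -
  define M where "M = (\<Sum>i<n. real (\<rho> i))"
  have "of_nat n * S q <= R q" if "norm q > M" for q
  proof -
   have "real (\<rho> i) <= M" if "i < n" for i unfolding M_def using that by (intro member_le_sum) auto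
   then have "indicator (- cball 0 (real (\<rho> i))) q * S q = S q" if "i < n" for i
    using that \<open>norm q > M\<close> by (force simp: indicator_def)
   then have "of_nat n * S q = (\<Sum>i<n. indicator (- cball 0 (real (\<rho> i))) q * S q)" by simp
   also have "\<dots> <= (\<Sum>i. indicator (- cball 0 (real (\<rho> i))) q * S q)" by (intro sum_le_suminf summableI) auto
   also have "\<dots> <= R q" by (simp add: R_def)
   finally show ?thesis .
  qed
  then show ?thesis by blast
 qed
 then show ?thesis using R Rfin by (intro bexI[of _ R]) (auto simp: R_def)
qed

end

section \<open>Vague compactness\<close>

text \<open>Weierstrass' M-test. On the same 0-1 sequences, r = 1/4 gives an embedding in the line
  and r = 1/2 gives binary expansions.\<close>

lemma weighted_digits_continuous:
 fixes r :: real
 assumes r: "0 < r" "r < 1"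
 defines "X \<equiv> PiE UNIV (%_::nat. {0, 1::real})"
 shows "continuous_on X (%b. \<Sum>k. b k * r ^ k)" "\<And>b. b \<in> X ==> summable (%k. b k * r ^ k)"
proof -
 have bd: "norm (b k * r ^ k) <= r ^ k" if "b \<in> X" for b k
 proof -
  have "b k \<in> {0, 1}" using that by (auto simp: X_def PiE_iff)
  then show ?thesis using r by auto
 qed
 have sr: "summable (%k. r ^ k)" using r by (intro summable_geometric) auto
 then show "summable (%k. b k * r ^ k)" if "b \<in> X" for b by (rule summable_comparison_test') (rule bd[OF that])
 show "continuous_on X (%b. \<Sum>k. b k * r ^ k)"
 proof (rule uniform_limit_theorem[OF _ Weierstrass_m_test[OF bd sr]])
  show "\<forall>\<^sub>F n in sequentially. continuous_on X (%x. \<Sum>i<n. x i * r ^ i)"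
   by (intro always_eventually allI continuous_on_sum continuous_on_mult continuous_on_const continuous_on_subset[OF continuous_on_product_coordinates]) auto
 qed auto
qed

text \<open>The digits come from the floors of 2^n x; they are indexed from 0, hence the factor
  2.\<close>

lemma binary_expansion:
 assumes x: "0 <= x" "x < (1::real)"
 shows "\<exists>b \<in> PiE UNIV (%_::nat. {0, 1::real}). (\<Sum>k. b k * (1/2) ^ k) = 2 * x"
proof -
 define a where "a n = \<lfloor>2 ^ n * x\<rfloor>" for n :: nat
 define b where "b k = real_of_int (a (Suc k) - 2 * a k)" for k
 have "a (Suc k) - 2 * a k = 0 \<or> a (Suc k) - 2 * a k = 1" for k unfolding a_def power_Suc mult.assoc by linarith
 then have "b k \<in> {0, 1}" for k unfolding b_def by (metis insertCI of_int_0 of_int_1)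
 then have bX: "b \<in> PiE UNIV (%_::nat. {0, 1::real})" by (auto simp: PiE_iff)
 have ps: "(\<Sum>k<n. b k * (1/2) ^ k) = 2 * (real_of_int (a n) / 2 ^ n)" for n
 proof (induction n)
  case 0 then show ?case using x by (simp add: a_def floor_eq_iff)
 next
  case (Suc n) then show ?case by (simp add: b_def field_simps)
 qed
 have "(%n. 2 * (real_of_int (a n) / 2 ^ n)) ----> 2 * x"
 proof (intro tendsto_mult tendsto_const, rule tendsto_sandwich)
  show "\<forall>\<^sub>F n in sequentially. x - (1/2) ^ n <= real_of_int (a n) / 2 ^ n"
  proof (intro always_eventually allI)
   fix n :: nat
   have "2 ^ n * x - 1 <= real_of_int (a n)" unfolding a_def by linarith
   then have "(2 ^ n * x - 1) / 2 ^ n <= real_of_int (a n) / 2 ^ n" by (rule divide_right_mono) simp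
   then show "x - (1/2) ^ n <= real_of_int (a n) / 2 ^ n" by (simp add: diff_divide_distrib power_one_over)
  qed
  show "\<forall>\<^sub>F n in sequentially. real_of_int (a n) / 2 ^ n <= x"
  proof (intro always_eventually allI)
   fix n :: nat
   have "real_of_int (a n) <= 2 ^ n * x" unfolding a_def by linarith
   then show "real_of_int (a n) / 2 ^ n <= x" by (simp add: field_simps)
  qed
  have "(%n. x - (1/2) ^ n) ----> x - 0" by (intro tendsto_diff tendsto_const LIMSEQ_power_zero) auto
  then show "(%n. x - (1/2) ^ n) ----> x" by simp
 qed auto
 then have "(%k. b k * (1/2) ^ k) sums (2 * x)" unfolding sums_def ps .
 then show ?thesis using bX sums_unique by metis
qed

text \<open>At the first differing digit n the sums differ by 4^-n, and all later digits together
  contribute at most a third of that.\<close>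

lemma cantor_injective: "inj_on (%b. \<Sum>k. b k * (1/4) ^ k) (PiE UNIV (%_::nat. {0, 1::real}))"
proof (rule inj_onI, rule ccontr)
 fix b b' :: "nat => real" assume b: "b \<in> PiE UNIV (%_. {0, 1})" and b': "b' \<in> PiE UNIV (%_. {0, 1})"
  and eq: "(\<Sum>k. b k * (1/4) ^ k) = (\<Sum>k. b' k * (1/4) ^ k)" and ne: "b \<noteq> b'"
 define d where "d k = b k - b' k" for k
 have s: "summable (%k. d k * (1/4) ^ k)" "(\<Sum>k. d k * (1/4) ^ k) = 0"
  using summable_diff[of "%k. b k * (1/4) ^ k" "%k. b' k * (1/4) ^ k"] suminf_diff[of "%k. b k * (1/4) ^ k" "%k. b' k * (1/4) ^ k"]
   weighted_digits_continuous(2)[of "1/4" b] weighted_digits_continuous(2)[of "1/4" b'] b b' eq by (auto simp: d_def algebra_simps)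
 have bv: "b k \<in> {0, 1}" "b' k \<in> {0, 1}" for k using b b' by (auto simp: PiE_iff)
 have d1: "\<bar>d k\<bar> <= 1" for k using bv[of k] by (auto simp: d_def)
 have ex: "\<exists>k. d k \<noteq> 0" using ne by (auto simp: d_def fun_eq_iff)
 define n where "n = (LEAST k. d k \<noteq> 0)"
 have n: "d n \<noteq> 0" "\<And>k. k < n ==> d k = 0" using LeastI_ex[OF ex] not_less_Least by (auto simp: n_def)
 have dn: "\<bar>d n\<bar> = 1" using bv[of n] n(1) by (auto simp: d_def)
 have "(\<Sum>k. d (k + Suc n) * (1/4) ^ (k + Suc n)) = (\<Sum>k. d k * (1/4) ^ k) - (\<Sum>k<Suc n. d k * (1/4) ^ k)"
  by (rule suminf_minus_initial_segment[OF s(1)])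
 also have "(\<Sum>k<Suc n. d k * (1/4) ^ k) = d n * (1/4) ^ n" using n(2) by simp
 finally have t: "\<bar>\<Sum>k. d (k + Suc n) * (1/4) ^ (k + Suc n)\<bar> = (1/4) ^ n" using s(2) dn by (simp add: abs_mult)
 have g: "summable (%k. (1/4::real) ^ (k + Suc n))" unfolding power_add by (intro summable_mult2 summable_geometric) auto
 have le: "norm (d (k + Suc n) * (1/4) ^ (k + Suc n)) <= (1/4) ^ (k + Suc n)" for k
  using mult_right_mono[OF d1[of "k + Suc n"], of "(1/4) ^ (k + Suc n)"] by (simp add: abs_mult)
 have "\<bar>\<Sum>k. d (k + Suc n) * (1/4) ^ (k + Suc n)\<bar> <= (\<Sum>k. (1/4::real) ^ (k + Suc n))" using norm_suminf_le[OF le g] by simp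
 also have "\<dots> = (\<Sum>k. (1/4::real) ^ k) * (1/4) ^ Suc n" unfolding power_add by (rule suminf_mult2[symmetric]) (auto intro: summable_geometric)
 also have "\<dots> = (1/3) * (1/4) ^ n" by (simp add: suminf_geometric)
 finally have "(1/4::real) ^ n <= (1/3) * (1/4) ^ n" unfolding t .
 moreover have "(1/4::real) ^ n > 0" by simp
 ultimately show False by linarith
qed

text \<open>Reduces weak compactness on the ball to the line. A Cantor set K maps continuously onto
  a set containing the ball, Tietze's theorem extends the map to G, and the least point of each
  fibre is a Borel section.\<close>

lemma line_covers_ball:
 "\<exists>(G :: real => 'a::euclidean_space) s B. continuous_on UNIV G & s \<in> borel_measurable borel & (\<forall>x \<in> cball 0 1. G (s x) = x) & (\<forall>x. \<bar>s x\<bar> <= B)"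
proof -
 define X where "X = PiE UNIV (%_::nat. {0, 1::real})"
 define c where "c b = (\<Sum>k. b k * (1/4::real) ^ k)" for b :: "nat => real"
 have "compactin (product_topology (%_::nat. euclidean :: real topology) UNIV) X" unfolding X_def by (subst compactin_PiE) auto
 then have cX: "compact X" by (simp add: euclidean_product_topology)
 have cc: "continuous_on X c" unfolding c_def X_def by (intro weighted_digits_continuous(1)) auto
 have ci: "inj_on c X" unfolding c_def X_def by (rule cantor_injective)
 define K where "K = c ` X"
 have cK: "compact K" unfolding K_def by (rule compact_continuous_image[OF cc cX])
 obtain \<iota> where \<iota>: "continuous_on K \<iota>" "\<And>b. b \<in> X ==> \<iota> (c b) = b"
  using homeomorphism_compact[OF cX cc K_def[symmetric] ci] unfolding homeomorphism_def by blast
 obtain ix :: "'a => nat" where ix: "inj_on ix Basis" using finite_imp_inj_to_nat_seg[OF finite_Basis] by blast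
 \<comment> \<open>The pairing function deals the digits out to the coordinates. A binary sum lies
   in [0, 2], so its double minus 2 covers [-2, 2], and the values needed for the ball are well
   inside.\<close>
 define g0 where "g0 b = (\<Sum>i\<in>Basis. (2 * (\<Sum>k. b (prod_encode (ix i, k)) * (1/2) ^ k) - 2) *\<^sub>R i)" for b :: "nat => real"
 have sub: "(%k. b (prod_encode (n, k))) \<in> X" if "b \<in> X" for b n using that by (auto simp: X_def PiE_iff)
 have cg0: "continuous_on X g0"
 proof -
  have "continuous_on X (%b. \<Sum>k. b (prod_encode (n, k)) * (1/2) ^ k)" for n
  proof -
   have "continuous_on X (%b k. b (prod_encode (n, k)))"
    by (intro continuous_on_coordinatewise_then_product continuous_on_subset[OF continuous_on_product_coordinates]) auto
   then show ?thesis
    using continuous_on_compose2[OF weighted_digits_continuous(1)[of "1/2"], of X "%b k. b (prod_encode (n, k))"] sub by (auto simp: X_def)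
  qed
  then show ?thesis unfolding g0_def by (intro continuous_intros) auto
 qed
 have g0s: "\<exists>b \<in> X. g0 b = x" if x: "x \<in> cball 0 1" for x
 proof -
  have "\<exists>\<beta>\<in>X. (\<Sum>k. \<beta> k * (1/2) ^ k) = 2 * ((x \<bullet> i + 2) / 4)" if "i \<in> Basis" for i
  proof -
   have "\<bar>x \<bullet> i\<bar> <= 1" using Basis_le_norm[OF that, of x] x by auto
   then show ?thesis unfolding X_def by (intro binary_expansion) auto
  qed
  then obtain \<beta> where \<beta>: "\<And>i. i \<in> Basis ==> \<beta> i \<in> X & (\<Sum>k. \<beta> i k * (1/2) ^ k) = 2 * ((x \<bullet> i + 2) / 4)" by metis
  define b where "b m = (case prod_decode m of (n, k) => if n \<in> ix ` Basis then \<beta> (the_inv_into Basis ix n) k else 0)" for m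
  have "b m \<in> {0, 1}" for m
  proof (cases "prod_decode m")
   case (Pair n k)
   show ?thesis
   proof (cases "n \<in> ix ` Basis")
    case True
    then have "\<beta> (the_inv_into Basis ix n) \<in> X" using \<beta> the_inv_into_into[OF ix True subset_refl] by blast
    then show ?thesis using Pair True by (auto simp: b_def X_def PiE_iff)
   qed (use Pair in \<open>simp add: b_def\<close>)
  qed
  then have bX: "b \<in> X" by (auto simp: X_def PiE_iff)
  have "b (prod_encode (ix i, k)) = \<beta> i k" if "i \<in> Basis" for i k using that by (simp add: b_def the_inv_into_f_f[OF ix])
  moreover have "2 * (\<Sum>k. \<beta> i k * (1/2) ^ k) - 2 = x \<bullet> i" if "i \<in> Basis" for i
  proof -
   have e: "(\<Sum>k. \<beta> i k * (1/2) ^ k) = 2 * ((x \<bullet> i + 2) / 4)" using \<beta>[OF that] by blast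
   show ?thesis unfolding e by (simp add: field_simps)
  qed
  ultimately have "g0 b = (\<Sum>i\<in>Basis. (x \<bullet> i) *\<^sub>R i)" unfolding g0_def by (intro sum.cong) simp_all
  then show ?thesis using bX by (auto simp: euclidean_representation)
 qed
 define g where "g t = g0 (\<iota> t)" for t
 have \<iota>X: "\<iota> ` K \<subseteq> X" using \<iota>(2) by (auto simp: K_def)
 have cg: "continuous_on K g" unfolding g_def by (rule continuous_on_compose2[OF cg0 \<iota>(1) \<iota>X])
 have "closedin (top_of_set UNIV) K" using compact_imp_closed[OF cK] by (simp add: closed_closedin[symmetric])
 then obtain G :: "real => 'a" where G: "continuous_on UNIV G" "\<And>t. t \<in> K ==> G t = g t" by (rule Tietze_unbounded[OF cg]) blast
 define s where "s x = (if x \<in> G ` K then Inf {t \<in> K. G t = x} else 0)" for x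
 have fib: "compact {t \<in> K. G t = x}" for x
 proof -
  have "closed {t. G t = x}" using closed_vimage[OF closed_singleton[of x] G(1)] by (simp add: vimage_def)
  then show ?thesis using compact_Int_closed[OF cK] by (simp add: Collect_conj_eq)
 qed
 have sK: "s x \<in> K & G (s x) = x" if "x \<in> G ` K" for x
 proof -
  have "{t \<in> K. G t = x} \<noteq> {}" using that by auto
  then have "Inf {t \<in> K. G t = x} \<in> {t \<in> K. G t = x}"
   by (intro closed_contains_Inf bounded_imp_bdd_below compact_imp_bounded compact_imp_closed fib)
  then show ?thesis using that by (simp add: s_def)
 qed
 have sG: "G (s x) = x" if x: "x \<in> cball 0 1" for x
 proof -
  obtain b where b: "b \<in> X" "g0 b = x" using g0s[OF x] by blast
  then have "c b \<in> K" "G (c b) = x" using G(2)[of "c b"] \<iota>(2)[OF b(1)] by (auto simp: K_def g_def)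
  then show ?thesis using sK by blast
 qed
 have "{x. s x <= a} \<in> sets borel" for a
 proof -
  \<comment> \<open>An image of a compact set, and for a >= 0 also the points off the image of K,
    where s has the default value 0.\<close>
  have "{x. s x <= a} = G ` (K \<inter> {..a}) \<union> (if 0 <= a then - G ` K else {})"
  proof (intro set_eqI iffI)
   fix x assume "x \<in> {x. s x <= a}"
   then show "x \<in> G ` (K \<inter> {..a}) \<union> (if 0 <= a then - G ` K else {})"
   proof (cases "x \<in> G ` K")
    case True
    then have "s x \<in> K \<inter> {..a}" "x = G (s x)" using sK[of x] \<open>x \<in> {x. s x <= a}\<close> by auto
    then show ?thesis by blast
   qed (use \<open>x \<in> {x. s x <= a}\<close> in \<open>auto simp: s_def\<close>)
  next
   fix x assume x: "x \<in> G ` (K \<inter> {..a}) \<union> (if 0 <= a then - G ` K else {})"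
   show "x \<in> {x. s x <= a}"
   proof (cases "x \<in> G ` K")
    case True
    then obtain t where t: "t \<in> K" "t <= a" "G t = x" using x by (auto split: if_splits)
    have "Inf {t \<in> K. G t = x} <= t" using t bounded_imp_bdd_below[OF compact_imp_bounded[OF fib[of x]]] by (intro cInf_lower) auto
    then show ?thesis using True t(2) by (simp add: s_def)
   qed (use x in \<open>auto simp: s_def split: if_splits\<close>)
  qed
  moreover have "compact (G ` (K \<inter> {..a}))" "compact (G ` K)"
   using cK by (auto intro!: compact_continuous_image continuous_on_subset[OF G(1)] compact_Int_closed)
  then have "G ` (K \<inter> {..a}) \<in> sets borel" "- G ` K \<in> sets borel" by (auto intro: borel_closed borel_open compact_imp_closed)
  ultimately show ?thesis by simp
 qed
 then have sm: "s \<in> borel_measurable borel" by (subst borel_measurable_iff_le) auto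
 obtain B where B: "\<And>t. t \<in> K ==> \<bar>t\<bar> <= B" using compact_imp_bounded[OF cK] unfolding bounded_iff by auto
 have "\<bar>s x\<bar> <= \<bar>B\<bar>" for x using sK[of x] B[of "s x"] by (cases "x \<in> G ` K") (auto simp: s_def)
 then show ?thesis using G(1) sm sG by blast
qed

text \<open>Push the measures to the line by s, select a weakly convergent subsequence there, and
  push its limit forward by G. For bounded continuous f, the composite with G is again such a
  function, and G undoes s on the ball.\<close>

lemma bounded_support_subsequence:
 fixes M :: "nat => 'a::euclidean_space measure"
 assumes M: "\<And>n. prob_space (M n)" "\<And>n. sets (M n) = sets borel" "\<And>n. AE x in M n. x \<in> cball 0 1"
 shows "\<exists>r N. strict_mono (r :: nat => nat) & prob_space N & sets N = sets borel &
  (\<forall>f :: 'a => real. \<forall>B. continuous_on UNIV f --> (\<forall>x. \<bar>f x\<bar> <= B) --> (%n. \<integral>x. f x \<partial>M (r n)) ----> (\<integral>x. f x \<partial>N))"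
proof -
 obtain G :: "real => 'a" and s B where G: "continuous_on UNIV G" and s[measurable]: "s \<in> borel_measurable borel"
  and Gs': "\<forall>x \<in> cball 0 1. G (s x) = x" and B': "\<forall>x. \<bar>s x\<bar> <= B"
  using line_covers_ball[where 'a = 'a] by (elim exE conjE) (rule that; assumption)
 note Gs = Gs'[rule_format] and B = B'[rule_format]
 note M(2)[measurable_cong]
 have Gm[measurable]: "G \<in> borel_measurable borel" by (rule borel_measurable_continuous_onI[OF G])
 define L where "L n = distr (M n) borel s" for n
 have rL: "real_distribution (L n)" for n unfolding L_def by (intro prob_space.real_distribution_distr M(1)) measurable
 have "tight L" unfolding tight_def
 proof (intro conjI allI impI rL)
  fix eps :: real assume "eps > 0"
  have "measure (L n) {- \<bar>B\<bar> - 1<..\<bar>B\<bar> + 1} = 1" for n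
  proof -
   interpret real_distribution "L n" by (rule rL)
   have "AE x in L n. x \<in> {- \<bar>B\<bar> - 1<..\<bar>B\<bar> + 1}" unfolding L_def using B
    by (subst AE_distr_iff) (auto intro!: AE_I2 simp: abs_le_iff, smt (verit), smt (verit))
   then show ?thesis by (subst prob_eq_1) auto
  qed
  then show "\<exists>a b. a < b & (\<forall>n. 1 - eps < measure (L n) {a<..b})" using \<open>eps > 0\<close>
   by (intro exI[of _ "- \<bar>B\<bar> - 1"] exI[of _ "\<bar>B\<bar> + 1"]) auto
 qed
 then obtain r N where r: "strict_mono r" and N: "real_distribution N" and w: "weak_conv_m (L \<circ> id \<circ> r) N"
  using tight_imp_convergent_subsubsequence[of L id] by (auto simp: strict_mono_def)
 interpret N: real_distribution N by (rule N)
 show ?thesis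
 proof (intro exI conjI allI impI)
  show "strict_mono r" by (rule r)
  show "prob_space (distr N borel G)" by (rule N.prob_space_distr) simp
  show "sets (distr N borel G) = sets borel" by simp
 next
  fix f :: "'a => real" and B assume f: "continuous_on UNIV f" and B: "\<forall>x. \<bar>f x\<bar> <= B"
  have [measurable]: "f \<in> borel_measurable borel" by (rule borel_measurable_continuous_onI[OF f])
  have c: "continuous_on UNIV (%t. f (G t))" by (rule continuous_on_compose2[OF f G]) auto
  have "(%n. integral\<^sup>L ((L \<circ> id \<circ> r) n) (%t. f (G t))) ----> integral\<^sup>L N (%t. f (G t))"
   using rL c B by (intro weak_conv_imp_integral_bdd_continuous_conv[OF _ N w, of _ B]) (auto simp: continuous_on_eq_continuous_at)
  moreover have "integral\<^sup>L ((L \<circ> id \<circ> r) n) (%t. f (G t)) = (\<integral>x. f x \<partial>M (r n))" for n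
  proof -
   have "integral\<^sup>L ((L \<circ> id \<circ> r) n) (%t. f (G t)) = (\<integral>x. f (G (s x)) \<partial>M (r n))"
    unfolding o_def id_def L_def by (rule integral_distr) measurable
   also have "\<dots> = (\<integral>x. f x \<partial>M (r n))" by (rule integral_cong_AE) (use M(3)[of "r n"] in \<open>auto simp: Gs\<close>)
   finally show ?thesis .
  qed
  moreover have "(\<integral>x. f x \<partial>distr N borel G) = integral\<^sup>L N (%t. f (G t))" by (rule integral_distr) auto
  ultimately show "(%n. \<integral>x. f x \<partial>M (r n)) ----> (\<integral>x. f x \<partial>distr N borel G)" by simp
 qed
qed

text \<open>Multiply by w, compress the space into the unit ball by \<open>\<kappa>\<close>, and
  normalize. A test function of bounded support, divided by w, extends continuously by zero beyond
  the ball, so compactness there applies. The masses converge along a further subsequence.\<close>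

lemma weighted_vague_subsequence:
 fixes M :: "nat => 'a::euclidean_space measure" and w :: "'a => real"
 assumes M: "\<And>n. sets (M n) = sets borel" and w: "continuous_on UNIV w" "\<And>x. w x > 0"
  and le: "\<And>n. (\<integral>\<^sup>+ x. ennreal (w x) \<partial>M n) <= 1"
 shows "\<exists>r N. strict_mono (r :: nat => nat) & sets N = sets borel & (\<integral>\<^sup>+ x. ennreal (w x) \<partial>N) <= 1 &
  (\<forall>f :: 'a => real. \<forall>R. continuous_on UNIV f --> (\<forall>x. 0 <= f x) --> (\<forall>x. norm x > R --> f x = 0) -->
   (%n. \<integral>\<^sup>+ x. ennreal (f x) \<partial>M (r n)) ----> (\<integral>\<^sup>+ x. ennreal (f x) \<partial>N))"
proof -
 note M[measurable_cong]
 have wm[measurable]: "w \<in> borel_measurable borel" by (rule borel_measurable_continuous_onI[OF w(1)])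
 define \<kappa> where "\<kappa> x = (1 / (1 + norm x)) *\<^sub>R x" for x :: 'a
 define l where "l y = (1 / (1 - norm y)) *\<^sub>R y" for y :: 'a
 have n\<kappa>: "norm (\<kappa> x) = norm x / (1 + norm x)" for x unfolding \<kappa>_def by (simp add: abs_of_pos add_pos_nonneg)
 have \<kappa>1: "norm (\<kappa> x) < 1" for x unfolding n\<kappa> by (simp add: add_pos_nonneg)
 have l\<kappa>: "l (\<kappa> x) = x" for x
 proof -
  have p: "1 + norm x > 0" by (simp add: add_pos_nonneg)
  have "1 - norm (\<kappa> x) = 1 / (1 + norm x)" unfolding n\<kappa> using p by (simp add: field_simps)
  then show ?thesis unfolding l_def using p by (simp add: \<kappa>_def)
 qed
 have nl: "norm (l y) = norm y / (1 - norm y)" if "norm y < 1" for y using that by (simp add: l_def)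
 have \<kappa>m[measurable]: "\<kappa> \<in> borel_measurable borel" unfolding \<kappa>_def by measurable
 have lm[measurable]: "l \<in> borel_measurable borel" unfolding l_def by measurable
 have lc: "isCont l y" if "norm y < 1" for y unfolding l_def using that by (intro continuous_intros) auto
 have wM: "(%x. ennreal (w x)) \<in> borel_measurable (M n)" for n by measurable
 define m where "m n = (\<integral>\<^sup>+ x. ennreal (w x) \<partial>M n)" for n
 have m1: "m n <= 1" for n unfolding m_def by (rule le)
 define mr where "mr n = enn2real (m n)" for n
 have mr: "m n = ennreal (mr n)" "0 <= mr n" "mr n <= 1" for n
 proof -
  have "m n \<noteq> \<infinity>" using m1[of n] by (auto simp: top_unique)
  then show e: "m n = ennreal (mr n)" unfolding mr_def by (simp add: less_top)
  show "0 <= mr n" by (simp add: mr_def)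
  show "mr n <= 1" using m1[of n] unfolding e by simp
 qed
 obtain r1 m\<^sub>0 where r1: "strict_mono r1" and m0: "(%n. mr (r1 n)) ----> m\<^sub>0"
  using compact_imp_seq_compact[OF compact_Icc[of 0 "1::real"]] mr unfolding seq_compact_def o_def by (metis atLeastAtMost_iff)
 have m0b: "0 <= m\<^sub>0" "m\<^sub>0 <= 1" using m0 mr by (auto intro: LIMSEQ_le_const LIMSEQ_le_const2)
 \<comment> \<open>If the weighted mass is 0, a point mass stands in; the factor \<open>mr n\<close>
   removes it from all formulas.\<close>
 define P where "P n = (if mr n = 0 then return borel 0 else distr (density (M n) (%x. ennreal (w x / mr n))) borel \<kappa>)" for n
 have sP: "sets (P n) = sets borel" for n unfolding P_def by simp
 have prP: "prob_space (P n)" for n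
 proof (cases "mr n = 0")
  case False
  then have p: "mr n > 0" using mr(2)[of n] by simp
  have "(\<integral>\<^sup>+ x. ennreal (w x / mr n) \<partial>M n) = (\<integral>\<^sup>+ x. ennreal (w x) \<partial>M n) / ennreal (mr n)"
   using p w(2) by (subst nn_integral_divide[symmetric]) (auto intro!: nn_integral_cong simp: divide_ennreal less_imp_le)
  also have "\<dots> = 1" using p unfolding m_def[symmetric] mr(1) by (simp add: divide_ennreal)
  finally have "prob_space (density (M n) (%x. ennreal (w x / mr n)))"
   by (intro prob_spaceI) (simp add: emeasure_density cong: nn_integral_cong_simp)
  then show ?thesis unfolding P_def using False by (simp add: prob_space.prob_space_distr)
 qed (simp add: P_def prob_space_return)
 have cP: "AE y in P n. y \<in> cball 0 1" for n
 proof (cases "mr n = 0")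
  case True
  show ?thesis unfolding P_def if_P[OF True] by (subst AE_return) auto
 next
  case False
  show ?thesis unfolding P_def if_not_P[OF False] using \<kappa>1 by (subst AE_distr_iff) (auto simp: less_imp_le)
 qed
 have P: "(\<integral>\<^sup>+ x. ennreal (f x) \<partial>M n) = ennreal (mr n) * (\<integral>\<^sup>+ y. ennreal (if norm y < 1 then f (l y) / w (l y) else 0) \<partial>P n)"
  if [measurable]: "f \<in> borel_measurable borel" and f0: "\<And>x. 0 <= f x" for f :: "'a => real" and n
 proof (cases "mr n = 0")
  case True
  then have "(\<integral>\<^sup>+ x. ennreal (w x) \<partial>M n) = 0" using mr(1)[of n] by (simp add: m_def)
  then have "AE x in M n. ennreal (w x) = 0" using nn_integral_0_iff_AE[OF wM[of n]] by simp
  then have "AE x in M n. ennreal (f x) = 0" by eventually_elim (use w(2) in \<open>simp add: ennreal_eq_0_iff not_le[symmetric]\<close>)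
  then have "(\<integral>\<^sup>+ x. ennreal (f x) \<partial>M n) = 0" by (subst nn_integral_0_iff_AE) auto
  then show ?thesis using True by simp
 next
  case False
  then have p: "mr n > 0" using mr(2)[of n] by simp
  have "(\<integral>\<^sup>+ y. ennreal (if norm y < 1 then f (l y) / w (l y) else 0) \<partial>P n) = (\<integral>\<^sup>+ x. ennreal (w x / mr n) * ennreal (f x / w x) \<partial>M n)"
   using False \<kappa>1 l\<kappa> by (simp add: P_def nn_integral_distr nn_integral_density)
  also have "\<dots> = (\<integral>\<^sup>+ x. ennreal (f x) / ennreal (mr n) \<partial>M n)"
   using w(2) f0 p by (intro nn_integral_cong) (simp add: ennreal_mult[symmetric] divide_ennreal less_imp_le less_imp_neq[symmetric])
  also have "\<dots> = (\<integral>\<^sup>+ x. ennreal (f x) \<partial>M n) / ennreal (mr n)" by (rule nn_integral_divide) measurable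
  finally show ?thesis using p by (simp add: ennreal_times_divide mult.commute[of "ennreal (mr n)"] ennreal_divide_times ennreal_mult_divide_eq)
 qed
 obtain r2 N' where r2: "strict_mono (r2 :: nat => nat)" and N': "prob_space N'" and sN[measurable_cong]: "sets N' = sets borel"
  and lim: "\<And>f :: 'a => real. \<And>B. continuous_on UNIV f ==> (\<And>x. \<bar>f x\<bar> <= B) ==> (%n. \<integral>x. f x \<partial>P (r1 (r2 n))) ----> (\<integral>x. f x \<partial>N')"
  using bounded_support_subsequence[of "%n. P (r1 n)", OF prP sP cP] by blast
 \<comment> \<open>Mass that reached the unit sphere has escaped to infinity and is dropped.\<close>
 define N where "N = distr (density N' (%y. ennreal (if norm y < 1 then m\<^sub>0 / w (l y) else 0))) borel l"
 have Nint: "(\<integral>\<^sup>+ x. ennreal (f x) \<partial>N) = ennreal m\<^sub>0 * (\<integral>\<^sup>+ y. ennreal (if norm y < 1 then f (l y) / w (l y) else 0) \<partial>N')"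
  if [measurable]: "f \<in> borel_measurable borel" and f0: "\<And>x. 0 <= f x" for f :: "'a => real"
 proof -
  have "(\<integral>\<^sup>+ x. ennreal (f x) \<partial>N) = (\<integral>\<^sup>+ y. ennreal (if norm y < 1 then m\<^sub>0 / w (l y) else 0) * ennreal (f (l y)) \<partial>N')"
   unfolding N_def by (simp add: nn_integral_distr nn_integral_density)
  also have "\<dots> = (\<integral>\<^sup>+ y. ennreal m\<^sub>0 * ennreal (if norm y < 1 then f (l y) / w (l y) else 0) \<partial>N')"
   using w(2) f0 m0b by (intro nn_integral_cong) (simp add: ennreal_mult[symmetric] less_imp_le)
  also have "\<dots> = ennreal m\<^sub>0 * (\<integral>\<^sup>+ y. ennreal (if norm y < 1 then f (l y) / w (l y) else 0) \<partial>N')" by (rule nn_integral_cmult) measurable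
  finally show ?thesis .
 qed
 show ?thesis
 proof (intro exI conjI allI impI)
  show "strict_mono (r1 \<circ> r2)" by (rule strict_mono_o[OF r1 r2])
  show "sets N = sets borel" by (simp add: N_def)
  have "(\<integral>\<^sup>+ y. ennreal (if norm y < 1 then w (l y) / w (l y) else 0) \<partial>N') <= (\<integral>\<^sup>+ y. 1 \<partial>N')"
   by (intro nn_integral_mono) (simp add: less_imp_neq[OF w(2), symmetric])
  also have "\<dots> = 1" using prob_space.emeasure_space_1[OF N'] by simp
  finally show "(\<integral>\<^sup>+ x. ennreal (w x) \<partial>N) <= 1"
   using m0b w(2) by (subst Nint) (auto intro!: mult_le_one simp: less_imp_le)
 next
  fix f :: "'a => real" and R assume f: "continuous_on UNIV f" and f0: "\<forall>x. 0 <= f x" and R: "\<forall>x. norm x > R --> f x = 0"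
  have fm[measurable]: "f \<in> borel_measurable borel" by (rule borel_measurable_continuous_onI[OF f])
  define h where "h y = (if norm y < 1 then f (l y) / w (l y) else 0)" for y
  \<comment> \<open>The image under \<open>\<kappa>\<close> of radius R: beyond it the transported
    test function vanishes, so no discontinuity arises at the sphere.\<close>
  define \<rho> where "\<rho> = \<bar>R\<bar> / (1 + \<bar>R\<bar>)"
  have \<rho>1: "\<rho> < 1" unfolding \<rho>_def by (simp add: add_pos_nonneg)
  have h0: "h y = 0" if "norm y > \<rho>" for y
  proof (cases "norm y < 1")
   case True
   have "\<bar>R\<bar> < norm (l y)" unfolding nl[OF True] using that True by (simp add: \<rho>_def field_simps)
   then show ?thesis using R by (simp add: h_def)
  qed (simp add: h_def)
  have "isCont h y" for y
  proof (cases "norm y < 1")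
   case True
   have "isCont (%y. f (l y) / w (l y)) y"
   proof (rule isCont_divide)
    show "isCont (%y. f (l y)) y" "isCont (%y. w (l y)) y"
     using f w(1) by (auto intro: isCont_o2[OF lc[OF True]] simp: continuous_on_eq_continuous_at)
   qed (use w(2)[of "l y"] in simp)
   moreover have "\<forall>\<^sub>F x in nhds y. h x = f (l x) / w (l x)"
    by (rule eventually_mono[OF eventually_nhds_in_open[of "ball 0 1"]]) (use True in \<open>auto simp: h_def\<close>)
   ultimately show ?thesis by (simp add: isCont_cong)
  next
   case False
   have "open {x :: 'a. \<rho> < norm x}" by (intro open_Collect_less continuous_intros)
   then have "\<forall>\<^sub>F x in nhds y. h x = 0" by (rule eventually_mono[OF eventually_nhds_in_open]) (use False \<rho>1 h0 in auto)
   then show ?thesis by (simp add: isCont_cong)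
  qed
  then have hc: "continuous_on UNIV h" by (simp add: continuous_on_eq_continuous_at)
  have hm[measurable]: "h \<in> borel_measurable borel" by (rule borel_measurable_continuous_onI[OF hc])
  have hp: "0 <= h y" for y using f0 w(2) by (simp add: h_def less_imp_le)
  have "compact (h ` cball 0 1)" using hc by (intro compact_continuous_image continuous_on_subset[OF hc]) auto
  then have "bounded (h ` cball 0 1)" by (rule compact_imp_bounded)
  then obtain B where "\<forall>z\<in>h ` cball 0 1. norm z <= B" unfolding bounded_iff by blast
  then have B: "\<bar>h y\<bar> <= B" if "y \<in> cball 0 1" for y using that by auto
  have hB: "\<bar>h y\<bar> <= \<bar>B\<bar>" for y using B[of y] by (cases "norm y <= 1") (auto simp: h_def)
  have ei: "(\<integral>\<^sup>+ y. ennreal (h y) \<partial>Q) = ennreal (\<integral>y. h y \<partial>Q)" if Q: "prob_space Q" "sets Q = sets borel" for Q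
  proof -
   interpret prob_space Q by (rule Q)
   note Q(2)[measurable_cong]
   have "integrable Q h" using hB by (intro integrable_const_bound[of _ "\<bar>B\<bar>"]) auto
   then show ?thesis using hp by (intro nn_integral_eq_integral) auto
  qed
  have "(%n. mr (r1 (r2 n)) * (\<integral>y. h y \<partial>P (r1 (r2 n)))) ----> m\<^sub>0 * (\<integral>y. h y \<partial>N')"
   using LIMSEQ_subseq_LIMSEQ[OF m0 r2] by (intro tendsto_mult lim[OF hc hB]) (simp add: o_def)
  then have "(%n. ennreal (mr (r1 (r2 n)) * (\<integral>y. h y \<partial>P (r1 (r2 n))))) ----> ennreal (m\<^sub>0 * (\<integral>y. h y \<partial>N'))" by (rule tendsto_ennrealI)
  then show "(%n. \<integral>\<^sup>+ x. ennreal (f x) \<partial>M ((r1 \<circ> r2) n)) ----> (\<integral>\<^sup>+ x. ennreal (f x) \<partial>N)"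
   using f0 mr(2) m0b by (simp add: P Nint h_def[symmetric] ei[OF prP sP] ei[OF N' sN] ennreal_mult integral_nonneg hp)
 qed
qed

text \<open>A series of tents supported in the balls of radius k, with coefficients small against
  the masses of these balls.\<close>

lemma weight_exists:
 fixes M :: "nat => 'a::euclidean_space measure"
 assumes M: "\<And>n. sets (M n) = sets borel" and A: "\<And>k :: nat. \<exists>A < \<infinity>. \<forall>n. emeasure (M n) (cball 0 (real k)) <= A"
 shows "\<exists>w. continuous_on UNIV w & (\<forall>x. w x > 0) & (\<forall>n. (\<integral>\<^sup>+ x. ennreal (w x) \<partial>M n) <= 1)"
proof -
 note M[measurable_cong]
 have "\<exists>a > 0. \<forall>n. emeasure (M n) (cball 0 (real k)) <= ennreal a" for k
 proof -
  obtain A' where A': "A' < \<infinity>" "\<And>n. emeasure (M n) (cball 0 (real k)) <= A'" using A by blast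
  have "A' <= ennreal (enn2real A' + 1)" using A'(1) by (subst ennreal_enn2real[symmetric]) (auto intro!: ennreal_leI)
  then show ?thesis using A'(2) by (intro exI[of _ "enn2real A' + 1"]) (auto intro: order_trans simp: add_nonneg_pos)
 qed
 then obtain a where a: "\<And>k. a k > 0" "\<And>k n. emeasure (M n) (cball 0 (real k)) <= ennreal (a k)" by metis
 \<comment> \<open>Small enough both for uniform convergence and for each tent to have mass at most
   2^-(k+1) in every \<open>M n\<close>.\<close>
 define c where "c k = (1/2) ^ Suc k / (1 + a k)" for k
 define t where "t k x = c k * max 0 (min 1 (real k - norm x))" for k and x :: 'a
 have c0: "c k > 0" for k using a(1)[of k] by (simp add: c_def)
 have cb: "c k * a k <= (1/2) ^ Suc k" "c k <= (1/2) ^ Suc k" for k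
  using a(1)[of k] mult_left_le[of "a k / (1 + a k)" "(1/2) ^ Suc k"] mult_left_le[of "1 / (1 + a k)" "(1/2) ^ Suc k"] by (auto simp: c_def)
 have t0: "0 <= t k x" for k x using c0[of k] by (simp add: t_def)
 have tb: "norm (t k x) <= (1/2) ^ Suc k" for k x
 proof -
  have "t k x <= c k * 1" unfolding t_def using c0[of k] by (intro mult_left_mono) auto
  then show ?thesis using t0[of k x] cb(2)[of k] by simp
 qed
 have s2: "(%k. (1/2::real) ^ Suc k) sums 1" by (rule power_half_series)
 have st: "summable (%k. t k x)" for x using sums_summable[OF s2] by (rule summable_comparison_test') (rule tb)
 define w where "w x = (\<Sum>k. t k x)" for x
 have "continuous_on UNIV w" unfolding w_def
 proof (rule uniform_limit_theorem[OF _ Weierstrass_m_test[OF tb sums_summable[OF s2]]])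
  show "\<forall>\<^sub>F n in sequentially. continuous_on UNIV (%x. \<Sum>i<n. t i x)"
   unfolding t_def by (intro always_eventually allI continuous_intros)
 qed auto
 moreover have "w x > 0" for x
 proof -
  obtain k :: nat where "norm x < real k" using reals_Archimedean2 by blast
  then have "t k x > 0" using c0[of k] by (simp add: t_def)
  then show ?thesis unfolding w_def using suminf_pos2[OF st t0] by blast
 qed
 moreover have "(\<integral>\<^sup>+ x. ennreal (w x) \<partial>M n) <= 1" for n
 proof -
  have tm: "t k \<in> borel_measurable borel" for k unfolding t_def by measurable
  have "(\<integral>\<^sup>+ x. ennreal (w x) \<partial>M n) = (\<integral>\<^sup>+ x. (\<Sum>k. ennreal (t k x)) \<partial>M n)"
   unfolding w_def using t0 st by (simp add: suminf_ennreal2)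
  also have "\<dots> = (\<Sum>k. \<integral>\<^sup>+ x. ennreal (t k x) \<partial>M n)" using tm by (intro nn_integral_suminf) measurable
  also have "\<dots> <= (\<Sum>k. ennreal ((1/2) ^ Suc k))"
  proof (intro suminf_le summableI)
   fix k
   have "(\<integral>\<^sup>+ x. ennreal (t k x) \<partial>M n) <= (\<integral>\<^sup>+ x. ennreal (c k) * indicator (cball 0 (real k)) x \<partial>M n)"
    using c0[of k] by (intro nn_integral_mono) (auto simp: t_def indicator_def intro!: ennreal_leI)
   also have "\<dots> = ennreal (c k) * emeasure (M n) (cball 0 (real k))" by (rule nn_integral_cmult_indicator) simp
   also have "\<dots> <= ennreal (c k) * ennreal (a k)" by (intro mult_left_mono a(2)) simp
   also have "\<dots> <= ennreal ((1/2) ^ Suc k)" using c0[of k] a(1)[of k] cb(1)[of k] by (simp add: ennreal_mult[symmetric] less_imp_le ennreal_leI del: power_Suc)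
   finally show "(\<integral>\<^sup>+ x. ennreal (t k x) \<partial>M n) <= ennreal ((1/2) ^ Suc k)" .
  qed
  also have "\<dots> = ennreal 1" by (rule suminf_ennreal_eq[OF _ s2]) simp
  finally show ?thesis by simp
 qed
 ultimately show ?thesis by blast
qed

section \<open>Averaging over the circle\<close>

text \<open>The Poisson kernel of the unit disc with pole \<alpha>.\<close>

definition pois :: "complex => complex => real" where "pois \<alpha> w = (1 - (cmod w)\<^sup>2) / (cmod (\<alpha> - w))\<^sup>2"

lemma pois_Re: "cmod \<alpha> = 1 ==> Re ((\<alpha> + w) / (\<alpha> - w)) = pois \<alpha> w"
proof -
 assume a: "cmod \<alpha> = 1"
 have "Re ((\<alpha> + w) * cnj (\<alpha> - w)) = (cmod \<alpha>)\<^sup>2 - (cmod w)\<^sup>2" unfolding cmod_power2 by (simp add: algebra_simps power2_eq_square)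
 moreover have "(\<alpha> + w) / (\<alpha> - w) = (\<alpha> + w) * cnj (\<alpha> - w) / complex_of_real ((cmod (\<alpha> - w))\<^sup>2)"
  using complex_div_cnj[of "\<alpha> + w" "\<alpha> - w"] by (simp only: of_real_power)
 ultimately show ?thesis using a by (simp add: pois_def del: of_real_power)
qed

lemma pois_nonneg [simp]: "cmod w < 1 ==> 0 <= pois \<alpha> w" by (simp add: pois_def abs_square_le_1 less_imp_le)

lemma measurable_pois [measurable (raw)]:
 assumes [measurable]: "f \<in> borel_measurable M" "g \<in> borel_measurable M"
 shows "(%x. pois (f x) (g x)) \<in> borel_measurable M" unfolding pois_def by measurable

lemma sets_circle_haar [measurable_cong]: "sets circle_haar = sets (restrict_space borel (sphere 0 1))" by (simp add: circle_haar_def)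

lemma space_circle_haar: "space circle_haar = sphere 0 1" by (simp add: circle_haar_def space_restrict_space)

lemma measurable_circle_haar_ident [measurable]: "(%\<alpha>. \<alpha>) \<in> borel_measurable circle_haar"
 by (simp add: measurable_cong_sets[OF sets_circle_haar refl] measurable_restrict_space1)

lemma measurable_circle_param:
 "(%t. cis (2 * pi * t)) \<in> measurable (uniform_measure lborel {0..1}) (restrict_space borel (sphere 0 1))"
proof (rule measurable_restrict_space2)
 have "(%t. cis (2 * pi * t)) \<in> borel_measurable borel" by (intro borel_measurable_continuous_onI continuous_intros)
 then show "(%t. cis (2 * pi * t)) \<in> borel_measurable (uniform_measure lborel {0..1})" by (simp cong: measurable_cong_sets)
qed auto

lemma prob_circle_haar: "prob_space circle_haar" unfolding circle_haar_def
 by (intro prob_space.prob_space_distr measurable_circle_param prob_space_uniform_measure) auto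

lemma nn_integral_circle_haar:
 assumes f: "f \<in> borel_measurable borel"
 shows "(\<integral>\<^sup>+\<alpha>. f \<alpha> \<partial>circle_haar) = (\<integral>\<^sup>+t\<in>{0..1}. f (cis (2 * pi * t)) \<partial>lborel)"
proof -
 have c: "(%t. cis (2 * pi * t)) \<in> borel_measurable borel" by (intro borel_measurable_continuous_onI continuous_intros)
 have "(\<integral>\<^sup>+\<alpha>. f \<alpha> \<partial>circle_haar) = (\<integral>\<^sup>+t. f (cis (2 * pi * t)) \<partial>uniform_measure lborel {0..1})"
  unfolding circle_haar_def by (rule nn_integral_distr[OF measurable_circle_param]) (use f in \<open>simp add: measurable_restrict_space1\<close>)
 also have "\<dots> = (\<integral>\<^sup>+t\<in>{0..1}. f (cis (2 * pi * t)) \<partial>lborel)"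
  using measurable_compose[OF c f] by (subst nn_integral_uniform_measure) (auto simp: divide_ennreal_def)
 finally show ?thesis .
qed

text \<open>As a function of \<alpha> on the circle this is the real part of (1 + cnj w \<alpha>) /
  (1 - cnj w \<alpha>), which is holomorphic on the disc and equal to 1 at the centre.\<close>

lemma pois_circle_mean:
 assumes w: "cmod w < 1"
 shows "(\<integral>\<^sup>+\<alpha>. ennreal (pois \<alpha> w) \<partial>circle_haar) = 1"
proof -
 define F where "F z = (1 + cnj w * z) / (1 - cnj w * z)" for z
 have nz: "1 - cnj w * z \<noteq> 0" if "cmod z <= 1" for z
 proof
  assume "1 - cnj w * z = 0"
  then have "cmod (cnj w * z) = 1" by simp
  moreover have "cmod (cnj w * z) < 1" using w mult_left_le[OF that, of "cmod w"] by (simp add: norm_mult)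
  ultimately show False by simp
 qed
 have "continuous_on (cball 0 1) F" "F holomorphic_on ball 0 1"
  unfolding F_def using nz by (auto intro!: continuous_intros holomorphic_intros simp: less_imp_le)
 then have "((%u. F u / (u - 0)) has_contour_integral (2 * of_real pi * \<i> * F 0)) (circlepath 0 1)"
  by (intro Cauchy_integral_circlepath) auto
 then have "((%x. F (circlepath 0 1 x) / (circlepath 0 1 x - 0) * vector_derivative (circlepath 0 1) (at x within {0..1}))
   has_integral (2 * of_real pi * \<i> * F 0)) {0..1}" by (simp add: has_contour_integral_def)
 moreover have path: "circlepath 0 1 x = cis (2 * pi * x)" for x by (simp add: circlepath cis_conv_exp mult_ac)
 have "F (circlepath 0 1 x) / (circlepath 0 1 x - 0) * vector_derivative (circlepath 0 1) (at x within {0..1}) = 2 * of_real pi * \<i> * F (cis (2 * pi * x))"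
  if "x \<in> {0..1}" for x
 proof -
  have "vector_derivative (circlepath 0 1) (at x within {0..1}) = 2 * of_real pi * \<i> * cis (2 * pi * x)"
   using that by (simp add: vector_derivative_circlepath01 cis_conv_exp mult_ac)
  then show ?thesis unfolding path by simp
 qed
 ultimately have "((%x. 2 * of_real pi * \<i> * F (cis (2 * pi * x))) has_integral (2 * of_real pi * \<i> * F 0)) {0..1}"
  by (subst (asm) has_integral_cong) auto
 then have "((%x. F (cis (2 * pi * x))) has_integral F 0) {0..1}" by (subst (asm) has_integral_mult_right_iff) auto
 from has_integral_linear[OF this bounded_linear_Re] have "((%x. Re (F (cis (2 * pi * x)))) has_integral 1) {0..1}" by (simp add: o_def F_def)
 moreover have Re: "Re (F \<alpha>) = pois \<alpha> w" if "cmod \<alpha> = 1" for \<alpha>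
 proof -
  have n: "\<alpha> \<noteq> w" "\<alpha> * cnj \<alpha> = 1" using that w by (auto simp: complex_norm_square[symmetric])
  have "cnj (F \<alpha>) = (1 + w * cnj \<alpha>) / (1 - w * cnj \<alpha>)" by (simp add: F_def)
  also have "\<dots> = (\<alpha> * (1 + w * cnj \<alpha>)) / (\<alpha> * (1 - w * cnj \<alpha>))" using that by (subst mult_divide_mult_cancel_left) auto
  also have "\<alpha> * (1 + w * cnj \<alpha>) = \<alpha> + w" using n(2) by (simp add: algebra_simps)
  also have "\<alpha> * (1 - w * cnj \<alpha>) = \<alpha> - w" using n(2) by (simp add: algebra_simps)
  finally have "Re (cnj (F \<alpha>)) = Re ((\<alpha> + w) / (\<alpha> - w))" by simp
  then show ?thesis using pois_Re[OF that] by simp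
 qed
 ultimately have I: "((%x. pois (cis (2 * pi * x)) w) has_integral 1) {0..1}" by simp
 have c: "(%t. cis (2 * pi * t)) \<in> borel_measurable borel" by (intro borel_measurable_continuous_onI continuous_intros)
 have "(\<integral>\<^sup>+x. ennreal (if x \<in> {0..1} then pois (cis (2 * pi * x)) w else 0) \<partial>lborel) = ennreal 1"
 proof (rule nn_integral_has_integral_lborel)
  show "((%x. if x \<in> {0..1} then pois (cis (2 * pi * x)) w else 0) has_integral 1) UNIV"
   using I by (simp only: has_integral_restrict_UNIV)
 qed (use c w in auto)
 moreover have "(\<integral>\<^sup>+\<alpha>. ennreal (pois \<alpha> w) \<partial>circle_haar) = (\<integral>\<^sup>+x. ennreal (if x \<in> {0..1} then pois (cis (2 * pi * x)) w else 0) \<partial>lborel)"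
  by (subst nn_integral_circle_haar) (auto intro!: nn_integral_cong simp: indicator_def)
 ultimately show ?thesis by simp
qed

text \<open>The difference is nonnegative with integral 0; finiteness of the common integral permits
  the subtraction.\<close>

lemma nn_integral_eq_imp_AE_eq:
 assumes m: "f \<in> borel_measurable M" "g \<in> borel_measurable M" and le: "AE x in M. f x <= g x"
  and eq: "(\<integral>\<^sup>+x. f x \<partial>M) = (\<integral>\<^sup>+x. g x \<partial>M)" and fin: "(\<integral>\<^sup>+x. f x \<partial>M) < \<infinity>"
 shows "AE x in M. f x = g x"
proof -
 have "(\<integral>\<^sup>+x. g x - f x \<partial>M) = (\<integral>\<^sup>+x. g x \<partial>M) - (\<integral>\<^sup>+x. f x \<partial>M)"
  using fin by (intro nn_integral_diff m le) auto
 also have "\<dots> = 0" using fin unfolding eq by simp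
 finally have "AE x in M. g x - f x = 0" using m by (subst (asm) nn_integral_0_iff_AE) auto
 then show ?thesis using le by eventually_elim (metis add.left_neutral diff_add_cancel_ennreal)
qed

section \<open>Averages of the Poisson densities over the parameter\<close>

context symmetric_siegel
begin

context
 fixes \<phi> :: "'a => complex"
 assumes \<phi>: "holomorphic_fun \<phi> dom" and \<phi>1: "\<And>p. p \<in> dom ==> cmod (\<phi> p) < 1"
begin

text \<open>Extension by zero keeps the modulus below 1 everywhere, so that \<open>pois\<close> is
  nonnegative on the whole space.\<close>

definition ext0 :: "'a => complex" where "ext0 p = (if p \<in> dom then \<phi> p else 0)"

lemma ext0: "ext0 \<in> borel_measurable borel" "cmod (ext0 p) < 1"
 using hfun_measurable[OF hfun_restrict[OF \<phi>]] \<phi>1 by (auto simp: ext0_def[abs_def])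

lemma measurable_ext0_up [measurable (raw)]:
 assumes [measurable]: "f \<in> borel_measurable M" shows "(%x. ext0 (up t (f x))) \<in> borel_measurable M"
 unfolding up_def by (intro measurable_compose[OF _ ext0(1)]) measurable

lemma pois_reproduces:
 assumes \<alpha>: "cmod \<alpha> = 1" and p: "p \<in> dom" and t: "t > 0" and r: "0 <= r" "r < 1"
 shows "(IB q. ennreal (pois \<alpha> (of_real r * ext0 (up t q)) * PK p q)) = ennreal (pois \<alpha> (of_real r * ext0 (up t p)))"
proof -
 define F where "F x = (\<alpha> + of_real r * \<phi> x) / (\<alpha> - of_real r * \<phi> x)" for x
 have r\<phi>: "cmod (of_real r * \<phi> x) <= r" if "x \<in> dom" for x
  using mult_left_le[of "cmod (\<phi> x)" r] \<phi>1[OF that] r by (simp add: norm_mult)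
 have den: "1 - r <= cmod (\<alpha> - of_real r * \<phi> x)" if "x \<in> dom" for x
  using norm_triangle_ineq2[of \<alpha> "of_real r * \<phi> x"] r\<phi>[OF that] \<alpha> by simp
 have "holomorphic_fun F dom" unfolding F_def
  using den r by (intro holomorphic_fun_divide holomorphic_fun_add holomorphic_fun_diff holomorphic_fun_const holomorphic_fun_cmult \<phi>) force
 moreover have "cmod (F x) <= 2 / (1 - r)" if "x \<in> dom" for x unfolding F_def norm_divide
  using norm_triangle_ineq[of \<alpha> "of_real r * \<phi> x"] r\<phi>[OF that] \<alpha> r den[OF that] by (intro frac_le) auto
 ultimately have I: "integrable bB (%q. F (up t q) * complex_of_real (PK p q))" "(\<integral>q. F (up t q) * complex_of_real (PK p q) \<partial>bB) = F (up t p)"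
  using PK_reproduces[OF _ _ p t] by blast+
 have Re: "Re (F x) = pois \<alpha> (of_real r * ext0 x)" if "x \<in> dom" for x using pois_Re[OF \<alpha>] that by (simp add: F_def ext0_def)
 have pos: "0 <= pois \<alpha> (of_real r * ext0 x)" for x using r\<phi>[of x] r by (intro pois_nonneg) (cases "x \<in> dom", auto simp: ext0_def)
 have "(IB q. ennreal (pois \<alpha> (of_real r * ext0 (up t q)) * PK p q)) = (IB q. ennreal (Re (F (up t q) * complex_of_real (PK p q))))"
  using t by (intro nn_integral_bB_cong) (simp add: Re up_dom)
 also have "\<dots> = ennreal (\<integral>q. Re (F (up t q) * complex_of_real (PK p q)) \<partial>bB)"
 proof (rule nn_integral_eq_integral[OF integrable_Re[OF I(1)]])
  show "AE q in bB. 0 <= Re (F (up t q) * complex_of_real (PK p q))"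
   using AE_bB by eventually_elim (use t p pos in \<open>simp add: Re up_dom\<close>)
 qed
 also have "(\<integral>q. Re (F (up t q) * complex_of_real (PK p q)) \<partial>bB) = Re (F (up t p))" unfolding integral_Re[OF I(1)] I(2) ..
 finally show ?thesis using p t by (simp add: Re up_dom)
qed

text \<open>As r tends to 1, Fatou's lemma retains only an inequality; what may be missing is
  Poisson mass at infinity.\<close>

lemma pois_subharmonic:
 assumes \<alpha>: "cmod \<alpha> = 1" and p: "p \<in> dom" and t: "t > 0"
 shows "(IB q. ennreal (pois \<alpha> (ext0 (up t q)) * PK p q)) <= ennreal (pois \<alpha> (ext0 (up t p)))"
proof -
 define r where "r n = 1 - tn n" for n
 have r: "0 <= r n" "r n < 1" for n by (auto simp: r_def field_simps)
 have "r ----> 1 - 0" unfolding r_def[abs_def] by (intro tendsto_diff tendsto_const tn_tendsto)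
 then have lim: "(%n. pois \<alpha> (of_real (r n) * ext0 x)) ----> pois \<alpha> (ext0 x)" for x
 proof -
  have ne: "cmod (\<alpha> - of_real 1 * ext0 x) \<noteq> 0" using ext0(2)[of x] \<alpha> by auto
  have "(%n. pois \<alpha> (of_real (r n) * ext0 x)) ----> pois \<alpha> (of_real 1 * ext0 x)"
   unfolding pois_def using \<open>r ----> 1 - 0\<close> ne by (intro tendsto_intros) auto
  then show ?thesis by simp
 qed
 have "(IB q. ennreal (pois \<alpha> (ext0 (up t q)) * PK p q)) = (IB q. liminf (%n. ennreal (pois \<alpha> (of_real (r n) * ext0 (up t q)) * PK p q)))"
  by (intro nn_integral_cong lim_imp_Liminf[symmetric] tendsto_ennrealI tendsto_mult tendsto_const lim) simp
 also have "\<dots> <= liminf (%n. IB q. ennreal (pois \<alpha> (of_real (r n) * ext0 (up t q)) * PK p q))"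
  by (rule nn_integral_liminf) measurable
 also have "\<dots> = liminf (%n. ennreal (pois \<alpha> (of_real (r n) * ext0 (up t p))))" by (simp only: pois_reproduces[OF \<alpha> p t r])
 also have "\<dots> = ennreal (pois \<alpha> (ext0 (up t p)))" by (intro lim_imp_Liminf tendsto_ennrealI lim) simp
 finally show ?thesis .
qed

lemma pair_sigma_circle: "pair_sigma_finite circle_haar bB"
 using prob_circle_haar sigma_finite_bB by (simp add: pair_sigma_finite_def prob_space_imp_sigma_finite)

lemma pois_average:
 assumes [measurable]: "R \<in> borel_measurable borel"
 shows "(\<integral>\<^sup>+\<alpha>. (IB q. ennreal (pois \<alpha> (ext0 (up t q))) * R q) \<partial>circle_haar) = (IB q. R q)"
  "(%\<alpha>. IB q. ennreal (pois \<alpha> (ext0 (up t q))) * R q) \<in> borel_measurable circle_haar"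
proof -
 interpret pair_sigma_finite circle_haar bB by (rule pair_sigma_circle)
 have m: "(%(\<alpha>, q). ennreal (pois \<alpha> (ext0 (up t q))) * R q) \<in> borel_measurable (circle_haar \<Otimes>\<^sub>M bB)" by measurable
 then show "(%\<alpha>. IB q. ennreal (pois \<alpha> (ext0 (up t q))) * R q) \<in> borel_measurable circle_haar"
  using M2.borel_measurable_nn_integral_fst[OF m] by simp
 have "(\<integral>\<^sup>+\<alpha>. (IB q. ennreal (pois \<alpha> (ext0 (up t q))) * R q) \<partial>circle_haar) = (IB q. (\<integral>\<^sup>+\<alpha>. ennreal (pois \<alpha> (ext0 (up t q))) * R q \<partial>circle_haar))"
  by (rule Fubini'[OF m, symmetric])
 also have "\<dots> = (IB q. R q)" by (intro nn_integral_cong) (subst nn_integral_multc, auto simp: pois_circle_mean[OF ext0(2)])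
 finally show "(\<integral>\<^sup>+\<alpha>. (IB q. ennreal (pois \<alpha> (ext0 (up t q))) * R q) \<partial>circle_haar) = (IB q. R q)" .
qed

text \<open>An inequality between functions of \<alpha> with the same finite mean.\<close>

lemma pois_ae_equality:
 assumes p: "p \<in> dom" and t: "t > 0"
 shows "AE \<alpha> in circle_haar. (IB q. ennreal (pois \<alpha> (ext0 (up t q))) * ennreal (PK p q)) = ennreal (pois \<alpha> (ext0 (up t p)))"
proof (rule nn_integral_eq_imp_AE_eq)
 have "(\<integral>\<^sup>+\<alpha>. (IB q. ennreal (pois \<alpha> (ext0 (up t q))) * ennreal (PK p q)) \<partial>circle_haar) = 1"
  by (subst pois_average(1)) (auto simp: PK_nn_integral[OF p])
 then show "(\<integral>\<^sup>+\<alpha>. (IB q. ennreal (pois \<alpha> (ext0 (up t q))) * ennreal (PK p q)) \<partial>circle_haar) < \<infinity>"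
  "(\<integral>\<^sup>+\<alpha>. (IB q. ennreal (pois \<alpha> (ext0 (up t q))) * ennreal (PK p q)) \<partial>circle_haar) = (\<integral>\<^sup>+\<alpha>. ennreal (pois \<alpha> (ext0 (up t p))) \<partial>circle_haar)"
  by (auto simp: pois_circle_mean[OF ext0(2)])
 show "AE \<alpha> in circle_haar. (IB q. ennreal (pois \<alpha> (ext0 (up t q))) * ennreal (PK p q)) <= ennreal (pois \<alpha> (ext0 (up t p)))"
  using pois_subharmonic[OF _ p t] ext0(2) by (intro AE_I2) (simp add: space_circle_haar ennreal_mult')
qed (use pois_average(2) in measurable)

text \<open>For every j the mean over the circle is the integral of R; Fatou's lemma in j then makes
  the liminf finite almost everywhere. The subsequence on which bounds hold depends on
  \<alpha>.\<close>

lemma pois_ae_tight: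
 assumes [measurable]: "R \<in> borel_measurable borel" and fin: "(IB q. R q) < \<infinity>"
 shows "AE \<alpha> in circle_haar. liminf (%j. IB q. ennreal (pois \<alpha> (ext0 (up (tn j) q))) * R q) < \<infinity>"
proof -
 have m: "(%\<alpha>. IB q. ennreal (pois \<alpha> (ext0 (up (tn j) q))) * R q) \<in> borel_measurable circle_haar" for j
  by (rule pois_average(2)) measurable
 have "(\<integral>\<^sup>+\<alpha>. liminf (%j. IB q. ennreal (pois \<alpha> (ext0 (up (tn j) q))) * R q) \<partial>circle_haar)
   <= liminf (%j. \<integral>\<^sup>+\<alpha>. (IB q. ennreal (pois \<alpha> (ext0 (up (tn j) q))) * R q) \<partial>circle_haar)"
  by (rule nn_integral_liminf) (rule m)
 also have "\<dots> = (IB q. R q)" by (simp add: pois_average(1) Liminf_const)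
 finally have "AE \<alpha> in circle_haar. liminf (%j. IB q. ennreal (pois \<alpha> (ext0 (up (tn j) q))) * R q) \<noteq> \<infinity>"
  using fin m by (intro nn_integral_PInf_AE borel_measurable_liminf) auto
 then show ?thesis by (simp add: less_top)
qed

end
end

section \<open>Boundary measures as vague limits of the translates\<close>

context symmetric_siegel
begin

section \<open>Boundary measures\<close>

text \<open>Null sets of \<alpha> can be discarded for countably many points only. From a dense set
  the equality spreads by continuity, with the majorant S for dominated convergence.\<close>

lemma PK_integral_equality_extends:
 fixes V :: "'a => real"
 assumes Vm [measurable]: "V \<in> borel_measurable borel" and Vc: "continuous_on dom V" and t: "t > 0"
  and Q: "Q \<subseteq> dom" "dom \<subseteq> closure Q"
  and eq: "\<And>p. p \<in> Q ==> (IB q. ennreal (V (up t q)) * ennreal (PK p q)) = ennreal (V (up t p))"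
  and S [measurable]: "S \<in> borel_measurable borel" and fin: "(IB q. ennreal (V (up t q)) * S q) < \<infinity>"
  and p: "p \<in> dom" and r: "r > 0" "ball p r \<subseteq> dom" "\<And>x q. x \<in> ball p r ==> q \<in> bdom ==> ennreal (PK x q) <= ennreal C * S q"
 shows "(IB q. ennreal (V (up t q)) * ennreal (PK p q)) = ennreal (V (up t p))"
proof -
 have Vt [measurable]: "(%q. V (up t q)) \<in> borel_measurable borel" unfolding up_def by measurable
 have "p \<in> closure Q" using p Q(2) by blast
 then obtain X where X: "\<And>n. X n \<in> Q" "X ----> p" by (auto simp: closure_sequential)
 obtain N where N: "\<And>n. n >= N ==> X n \<in> ball p r" using X(2) r(1) by (auto simp: lim_sequentially dist_commute)
 define Y where "Y n = X (n + N)" for n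
 have Y: "Y n \<in> Q" "Y n \<in> ball p r" "Y n \<in> dom" for n using X(1) N[of "n + N"] Q(1) by (auto simp: Y_def)
 have Yp: "Y ----> p" unfolding Y_def[abs_def] using X(2) by (rule LIMSEQ_ignore_initial_segment)
 have "(%n. IB q. ennreal (V (up t q)) * ennreal (PK (Y n) q)) ----> (IB q. ennreal (V (up t q)) * ennreal (PK p q))"
 proof (rule nn_integral_dominated_convergence[where w = "%q. ennreal C * (ennreal (V (up t q)) * S q)"])
  show "AE q in bB. ennreal (V (up t q)) * ennreal (PK (Y n) q) <= ennreal C * (ennreal (V (up t q)) * S q)" for n using AE_bB
  proof eventually_elim
   fix q assume "q \<in> bdom"
   from mult_left_mono[OF r(3)[OF Y(2)[of n] this], of "ennreal (V (up t q))"]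
   show "ennreal (V (up t q)) * ennreal (PK (Y n) q) <= ennreal C * (ennreal (V (up t q)) * S q)" by (simp add: mult_ac)
  qed
  have "(IB q. ennreal C * (ennreal (V (up t q)) * S q)) = ennreal C * (IB q. ennreal (V (up t q)) * S q)" by (rule nn_integral_cmult) measurable
  then show "(IB q. ennreal C * (ennreal (V (up t q)) * S q)) < \<infinity>" using fin by (simp add: ennreal_mult_less_top)
  show "AE q in bB. (%n. ennreal (V (up t q)) * ennreal (PK (Y n) q)) ----> ennreal (V (up t q)) * ennreal (PK p q)" using AE_bB
  proof eventually_elim
   fix q assume q: "q \<in> bdom"
   have "(%n. (%(p, q). PK p q) (Y n, q)) ----> (%(p, q). PK p q) (p, q)"
    using Y(3) p q Yp by (intro continuous_on_tendsto_compose[OF continuous_PK] tendsto_Pair tendsto_const) auto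
   then have "(%n. ennreal (PK (Y n) q)) ----> ennreal (PK p q)" by (auto intro: tendsto_ennrealI)
   then show "(%n. ennreal (V (up t q)) * ennreal (PK (Y n) q)) ----> ennreal (V (up t q)) * ennreal (PK p q)"
    by (intro ennreal_tendsto_cmult) auto
  qed
 qed measurable
 moreover have "(%n. IB q. ennreal (V (up t q)) * ennreal (PK (Y n) q)) ----> ennreal (V (up t p))"
 proof -
  have u: "(%n. up t (Y n)) ----> up t p"
   by (rule continuous_on_tendsto_compose[of UNIV "%p. up t p", OF _ Yp]) (auto intro!: continuous_intros)
  have "(%n. V (up t (Y n))) ----> V (up t p)"
   using Y(3) p t by (intro continuous_on_tendsto_compose[OF Vc u]) (auto intro!: always_eventually up_dom)
  then show ?thesis unfolding eq[OF Y(1)] by (rule tendsto_ennrealI)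
 qed
 ultimately show ?thesis by (rule LIMSEQ_unique)
qed

lemma frequently_bounded_subsequence:
 fixes X :: "nat => ennreal"
 assumes "liminf X < \<infinity>"
 shows "\<exists>r a. strict_mono (r :: nat => nat) & a > 0 & (\<forall>n. X (r n) <= ennreal a)"
proof -
 define a where "a = enn2real (liminf X) + 1"
 have "liminf X < ennreal a" using assms unfolding a_def by (cases "liminf X") (auto simp: ennreal_less_iff simp flip: ennreal_plus ennreal_1)
 have "infinite {n. X n <= ennreal a}"
 proof
  assume "finite {n. X n <= ennreal a}"
  then have "\<forall>\<^sub>F n in sequentially. \<not> X n <= ennreal a" by (simp add: cofinite_eq_sequentially[symmetric] eventually_cofinite)
  then have "\<forall>\<^sub>F n in sequentially. ennreal a <= X n" by eventually_elim simp
  then have "ennreal a <= liminf X" by (rule Liminf_bounded)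
  then show False using \<open>liminf X < ennreal a\<close> by simp
 qed
 from infinite_enumerate[OF this] obtain r :: "nat => nat" where "strict_mono r" "\<forall>n. r n \<in> {n. X n <= ennreal a}" by blast
 moreover from this have "\<forall>n. X (r n) <= ennreal a" by simp
 moreover have "a > 0" by (simp add: a_def add_nonneg_pos)
 ultimately show ?thesis by blast
qed

definition cutoff :: "nat => 'a => real" where "cutoff k x = max 0 (min 1 (real k - norm x))"

lemma cutoff: "0 <= cutoff k x" "cutoff k x <= 1" "norm x > real k ==> cutoff k x = 0" "norm x + 1 <= real k ==> cutoff k x = 1"
 and continuous_cutoff [continuous_intros]: "continuous_on A f ==> continuous_on A (%x. cutoff k (f x))"
 by (auto simp: cutoff_def intro!: continuous_intros)

lemma cutoff_mono: "k <= l ==> cutoff k x <= cutoff l x" by (auto simp: cutoff_def)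

lemma cutoff_Sup:
 assumes "f \<in> borel_measurable M" "sets M = sets borel" "\<And>x. 0 <= f x"
 shows "(\<integral>\<^sup>+x. ennreal (f x) \<partial>M) = (SUP k. \<integral>\<^sup>+x. ennreal (f x * cutoff k x) \<partial>M)"
proof -
 note assms(1)[measurable] assms(2)[measurable_cong]
 have [measurable]: "cutoff k \<in> borel_measurable borel" for k unfolding cutoff_def by measurable
 have "(SUP k. ennreal (f x * cutoff k x)) = ennreal (f x)" for x
 proof (rule antisym)
  show "(SUP k. ennreal (f x * cutoff k x)) <= ennreal (f x)" using cutoff(2) assms(3) by (intro SUP_least ennreal_leI mult_left_le) auto
  obtain k :: nat where "norm x + 1 <= real k" using real_arch_simple by blast
  then show "ennreal (f x) <= (SUP k. ennreal (f x * cutoff k x))" by (intro SUP_upper2[of k]) (auto simp: cutoff(4))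
 qed
 then have "(\<integral>\<^sup>+x. ennreal (f x) \<partial>M) = (\<integral>\<^sup>+x. (SUP k. ennreal (f x * cutoff k x)) \<partial>M)" by simp
 also have "\<dots> = (SUP k. \<integral>\<^sup>+x. ennreal (f x * cutoff k x) \<partial>M)" by (rule nn_integral_monotone_convergence_SUP)
    (auto intro!: incseq_SucI le_funI ennreal_leI mult_left_mono cutoff_mono assms(3))
 finally show ?thesis .
qed

text \<open>A continuous retraction onto \<open>bdom\<close>. \<open>PK p\<close> is set to 0 off
  \<open>bdom\<close>, which breaks continuity; composed with \<open>retr\<close> it is continuous
  on the whole space with the same values on \<open>bdom\<close>.\<close>

definition retr :: "'a => 'a" where "retr q = bpoint (prE q) (prF q)"

lemma retr: "retr q \<in> bdom" "q \<in> bdom ==> retr q = q" "continuous_on A retr" unfolding retr_def[abs_def] using bdom_bpoint[of q]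
 by (auto intro!: bpoint_bdom) (auto simp: bpoint_def point_def[abs_def] intro!: continuous_intros)

lemma continuous_PK_retr:
 assumes p: "p \<in> dom" shows "continuous_on UNIV (%q. PK p (retr q))"
proof -
 have "continuous_on UNIV (%q. (p, retr q))" by (intro continuous_on_Pair continuous_on_const retr(3))
 from continuous_on_compose2[OF continuous_PK this] show ?thesis using p retr(1) by auto
qed

text \<open>Tested against the distance to the closed set \<open>bdom\<close>, cut off to bounded
  support.\<close>

lemma vague_limit_AE_bdom:
 assumes N: "sets N = sets borel"
  and zero: "\<And>f R. continuous_on UNIV f ==> (\<And>x. 0 <= f x) ==> (\<And>x. norm x > R ==> f x = 0) ==> (\<And>x. x \<in> bdom ==> f x = 0) ==> (\<integral>\<^sup>+x. ennreal (f x) \<partial>N) = 0"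
 shows "AE x in N. x \<in> bdom"
proof -
 note N[measurable_cong]
 have bne: "bdom \<noteq> {}" using base_point(3) by blast
 have "AE x in N. infdist x bdom * cutoff k x = 0" for k
 proof -
  have c: "continuous_on UNIV (%x. infdist x bdom * cutoff k x)" by (intro continuous_intros)
  have "(\<integral>\<^sup>+x. ennreal (infdist x bdom * cutoff k x) \<partial>N) = 0"
   by (rule zero[OF c, of "real k"]) (auto simp: cutoff infdist_nonneg)
  moreover have "(%x. ennreal (infdist x bdom * cutoff k x)) \<in> borel_measurable N" using borel_measurable_continuous_onI[OF c] by measurable
  ultimately have "AE x in N. ennreal (infdist x bdom * cutoff k x) = 0" by (subst (asm) nn_integral_0_iff_AE) auto
  then show ?thesis
  proof eventually_elim
   fix x assume "ennreal (infdist x bdom * cutoff k x) = 0"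
   then have "infdist x bdom * cutoff k x <= 0" by (simp only: ennreal_eq_0_iff)
   moreover have "0 <= infdist x bdom * cutoff k x" by (intro mult_nonneg_nonneg infdist_nonneg cutoff(1))
   ultimately show "infdist x bdom * cutoff k x = 0" by (rule order.antisym)
  qed
 qed
 then have "AE x in N. \<forall>k. infdist x bdom * cutoff k x = 0" unfolding AE_all_countable by blast
 then show ?thesis
 proof eventually_elim
  fix x assume a: "\<forall>k. infdist x bdom * cutoff k x = 0"
  obtain k :: nat where "norm x + 1 <= real k" using real_arch_simple by blast
  then have "infdist x bdom = 0" using a[rule_format, of k] cutoff(4)[of x k] by simp
  then show "x \<in> bdom" using closed_bdom bne by (simp add: in_closed_iff_infdist_zero)
 qed
qed

lemma tendsto_V_up:
 assumes "continuous_on dom V" "p \<in> dom" "X ----> (0::real)" "\<And>n. X n > 0"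
 shows "(%n. ennreal (V (up (X n) p))) ----> ennreal (V p)"
 using assms up_dom by (intro tendsto_ennrealI continuous_on_tendsto_compose[OF assms(1) up_tn_tendsto]) (auto intro!: always_eventually)

text \<open>The Poisson integral of the limit is at most V by cutting off. For the converse, m times
  the Poisson kernel is far out at most C R, and the integrals against R are bounded by a; hence the
  loss at infinity is at most C a / m for every m.\<close>

lemma boundary_measure:
 fixes V :: "'a => real"
 assumes Vm [measurable]: "V \<in> borel_measurable borel" and Vc: "continuous_on dom V"
  and V0: "\<And>p. 0 <= V p"
  and Q: "Q \<subseteq> dom" "dom \<subseteq> closure Q"
  and eq: "\<forall>p\<in>Q. \<forall>j. (IB q. ennreal (V (up (tn j) q)) * ennreal (PK p q)) = ennreal (V (up (tn j) p))"
  and S [measurable]: "S \<in> borel_measurable borel"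
  and maj: "\<forall>p\<in>dom. \<exists>r>0. \<exists>C\<ge>0. ball p r \<subseteq> dom & (\<forall>x\<in>ball p r. \<forall>q\<in>bdom. ennreal (PK x q) <= ennreal C * S q)"
  and R [measurable]: "R \<in> borel_measurable borel" and SR: "\<And>q. S q <= R q"
  and tail: "\<And>n. \<exists>\<rho>. \<forall>q. norm q > \<rho> --> of_nat n * S q <= R q"
  and w: "continuous_on UNIV w" "\<And>x. w x > 0" "\<And>q. ennreal (w q) <= R q"
  and lim: "liminf (%j. IB q. ennreal (V (up (tn j) q)) * R q) < \<infinity>"
 shows "\<exists>N r. strict_mono (r :: nat => nat) & sets N = sets borel & (AE q in N. q \<in> bdom) & (\<forall>K. compact K --> emeasure N K < \<infinity>) &
  (\<forall>p\<in>dom. (\<integral>\<^sup>+q. ennreal (PK p q) \<partial>N) = ennreal (V p)) &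
  (\<forall>f R. continuous_on UNIV f --> (\<forall>x. 0 <= f x) --> (\<forall>x. norm x > R --> f x = 0) -->
   (%n. IB q. ennreal (V (up (tn (r n)) q)) * ennreal (f q)) ----> (\<integral>\<^sup>+x. ennreal (f x) \<partial>N))"
proof -
 have Vt [measurable]: "(%q. V (up t q)) \<in> borel_measurable borel" for t unfolding up_def by measurable
 have wm [measurable]: "w \<in> borel_measurable borel" by (rule borel_measurable_continuous_onI[OF w(1)])
 obtain r1 a where r1: "strict_mono (r1 :: nat => nat)" and a: "a > 0"
  and bd: "\<And>n. (IB q. ennreal (V (up (tn (r1 n)) q)) * R q) <= ennreal a" using frequently_bounded_subsequence[OF lim] by blast
 define \<nu> where "\<nu> n = density bB (%q. ennreal (V (up (tn (r1 n)) q)))" for n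
 have s\<nu>: "sets (\<nu> n) = sets borel" for n by (simp add: \<nu>_def)
 have i\<nu>: "(\<integral>\<^sup>+q. f q \<partial>\<nu> n) = (IB q. ennreal (V (up (tn (r1 n)) q)) * f q)" if "f \<in> borel_measurable borel" for f n
  unfolding \<nu>_def using that by (intro nn_integral_density) auto
 \<comment> \<open>Domination by S, hence by R, is what extends the equality from Q to p
   here.\<close>
 have P\<nu>: "(\<integral>\<^sup>+q. ennreal (PK p q) \<partial>\<nu> n) = ennreal (V (up (tn (r1 n)) p))" if p: "p \<in> dom" for p n
 proof -
  obtain \<delta> C where d: "\<delta> > 0" "ball p \<delta> \<subseteq> dom" "\<And>x q. x \<in> ball p \<delta> ==> q \<in> bdom ==> ennreal (PK x q) <= ennreal C * S q"
   using maj p by blast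
  have "(IB q. ennreal (V (up (tn (r1 n)) q)) * S q) <= ennreal a"
   by (rule order_trans[OF nn_integral_mono bd[of n]]) (intro mult_left_mono SR, simp)
  then have fin: "(IB q. ennreal (V (up (tn (r1 n)) q)) * S q) < \<infinity>" by (auto intro: le_less_trans)
  show ?thesis by (subst i\<nu>, simp) (rule PK_integral_equality_extends[OF Vm Vc _ Q eq[rule_format] S fin p d], auto)
 qed
 have "(\<integral>\<^sup>+x. ennreal (w x / a) \<partial>\<nu> n) <= 1" for n
 proof -
  have "(\<integral>\<^sup>+x. ennreal (w x / a) \<partial>\<nu> n) = (\<integral>\<^sup>+x. ennreal (w x) / ennreal a \<partial>\<nu> n)"
   using a w(2) by (intro nn_integral_cong) (simp add: divide_ennreal less_imp_le)
  also have "\<dots> = (\<integral>\<^sup>+x. ennreal (w x) \<partial>\<nu> n) / ennreal a" by (rule nn_integral_divide) (simp add: \<nu>_def)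
  also have "\<dots> <= ennreal a / ennreal a"
  proof (rule divide_right_mono_ennreal)
   have "(\<integral>\<^sup>+x. ennreal (w x) \<partial>\<nu> n) = (IB q. ennreal (V (up (tn (r1 n)) q)) * ennreal (w q))" by (rule i\<nu>) simp
   also have "\<dots> <= (IB q. ennreal (V (up (tn (r1 n)) q)) * R q)" by (intro nn_integral_mono mult_left_mono w(3)) simp
   also have "\<dots> <= ennreal a" by (rule bd)
   finally show "(\<integral>\<^sup>+x. ennreal (w x) \<partial>\<nu> n) <= ennreal a" .
  qed
  also have "\<dots> = 1" using a by (simp add: divide_ennreal)
  finally show ?thesis .
 qed
 note wa1 = this
 have wac: "continuous_on UNIV (%x. w x / a)" using a by (intro continuous_intros w(1)) simp
 have wa0: "w x / a > 0" for x using a w(2) by simp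
 from weighted_vague_subsequence[of \<nu> "%x. w x / a", OF s\<nu> wac wa0 wa1]
 obtain r2 N where r2: "strict_mono (r2 :: nat => nat)" and sN[measurable_cong]: "sets N = sets borel" and wN: "(\<integral>\<^sup>+ x. ennreal (w x / a) \<partial>N) <= 1"
  and conv': "\<forall>f :: 'a => real. \<forall>R. continuous_on UNIV f --> (\<forall>x. 0 <= f x) --> (\<forall>x. norm x > R --> f x = 0) -->
   (%n. \<integral>\<^sup>+ x. ennreal (f x) \<partial>\<nu> (r2 n)) ----> (\<integral>\<^sup>+ x. ennreal (f x) \<partial>N)"
  by (elim exE conjE) (rule that; assumption)
 have conv: "(%n. \<integral>\<^sup>+ x. ennreal (f x) \<partial>\<nu> (r2 n)) ----> (\<integral>\<^sup>+ x. ennreal (f x) \<partial>N)"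
  if "continuous_on UNIV f" "\<And>x. 0 <= f x" "\<And>x. norm x > R ==> f x = 0" for f :: "'a => real" and R
  using conv'[rule_format, of f R] that by blast
 define r where "r = r1 \<circ> r2"
 have sr: "strict_mono r" unfolding r_def by (rule strict_mono_o[OF r1 r2])
 have tr: "(%n. tn (r n)) ----> 0" using LIMSEQ_subseq_LIMSEQ[OF tn_tendsto sr] by (simp add: o_def)
 have Vlim: "(%n. ennreal (V (up (tn (r n)) p))) ----> ennreal (V p)" if "p \<in> dom" for p by (rule tendsto_V_up[OF Vc that tr]) simp
 have \<nu>bd: "AE q in \<nu> n. q \<in> bdom" for n unfolding \<nu>_def using AE_bB by (subst AE_density) auto
 have AEN: "AE q in N. q \<in> bdom"
 proof (rule vague_limit_AE_bdom[OF sN])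
  fix f :: "'a => real" and R assume f: "continuous_on UNIV f" "\<And>x. 0 <= f x" "\<And>x. norm x > R ==> f x = 0" "\<And>x. x \<in> bdom ==> f x = 0"
  have "(\<integral>\<^sup>+x. ennreal (f x) \<partial>\<nu> (r2 n)) = (\<integral>\<^sup>+x. 0 \<partial>\<nu> (r2 n))" for n
   by (rule nn_integral_cong_AE) (use \<nu>bd in eventually_elim, simp add: f(4))
  then have "(%n. \<integral>\<^sup>+x. ennreal (f x) \<partial>\<nu> (r2 n)) = (%n. 0)" by simp
  then show "(\<integral>\<^sup>+x. ennreal (f x) \<partial>N) = 0" using conv[OF f(1-3)] LIMSEQ_unique by (metis tendsto_const)
 qed
 \<comment> \<open>The weight w is bounded below on a compact set by a positive constant.\<close>
 have cK: "emeasure N K < \<infinity>" if K: "compact K" for K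
 proof (cases "K = {}")
  case False
  obtain x where x: "x \<in> K" "\<And>y. y \<in> K ==> w x <= w y" using continuous_attains_inf[OF K False continuous_on_subset[OF w(1)]] by auto
  have Kb: "K \<in> sets N" using K by (simp add: sN compact_imp_closed)
  have "ennreal (w x / a) * emeasure N K = (\<integral>\<^sup>+y. ennreal (w x / a) * indicator K y \<partial>N)" by (rule nn_integral_cmult_indicator[OF Kb, symmetric])
  also have "\<dots> <= (\<integral>\<^sup>+y. ennreal (w y / a) \<partial>N)" using x(2) a by (intro nn_integral_mono) (auto simp: indicator_def intro!: ennreal_leI divide_right_mono)
  also have "\<dots> < \<infinity>" using wN by (auto intro: le_less_trans)
  finally show ?thesis using a w(2)[of x] by (auto simp: ennreal_mult_less_top)
 qed simp
 have main: "(\<integral>\<^sup>+q. ennreal (PK p q) \<partial>N) = ennreal (V p)" if p: "p \<in> dom" for p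
 proof -
  define g where "g q = PK p (retr q)" for q
  have gc: "continuous_on UNIV g" unfolding g_def[abs_def] by (rule continuous_PK_retr[OF p])
  have gm [measurable]: "g \<in> borel_measurable borel" by (rule borel_measurable_continuous_onI[OF gc])
  have g0: "0 <= g q" for q unfolding g_def using p by simp
  have gP: "g q = PK p q" if "q \<in> bdom" for q using retr(2)[OF that] by (simp add: g_def)
  have gN: "(\<integral>\<^sup>+q. ennreal (PK p q) \<partial>N) = (\<integral>\<^sup>+q. ennreal (g q) \<partial>N)"
   by (rule nn_integral_cong_AE) (use AEN in eventually_elim, simp add: gP)
  have g\<nu>: "(\<integral>\<^sup>+q. ennreal (g q) \<partial>\<nu> (r2 n)) = ennreal (V (up (tn (r n)) p))" for n
   unfolding r_def o_def P\<nu>[OF p, symmetric] by (rule nn_integral_cong_AE) (use \<nu>bd in eventually_elim, simp add: gP)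
  have fc: "continuous_on UNIV (%q. g q * cutoff k q)" for k by (intro continuous_intros gc)
  have fm [measurable]: "(%q. g q * cutoff k q) \<in> borel_measurable borel" for k by (rule borel_measurable_continuous_onI[OF fc])
  have cv: "(%n. \<integral>\<^sup>+q. ennreal (g q * cutoff k q) \<partial>\<nu> (r2 n)) ----> (\<integral>\<^sup>+q. ennreal (g q * cutoff k q) \<partial>N)" for k
   by (rule conv[OF fc[of k], of "real k"]) (auto simp: cutoff g0)
  have up: "(\<integral>\<^sup>+q. ennreal (g q * cutoff k q) \<partial>N) <= ennreal (V p)" for k
  proof (rule LIMSEQ_le[OF cv[of k] Vlim[OF p]], intro exI allI impI)
   fix n show "(\<integral>\<^sup>+q. ennreal (g q * cutoff k q) \<partial>\<nu> (r2 n)) <= ennreal (V (up (tn (r n)) p))"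
    unfolding g\<nu>[symmetric] by (intro nn_integral_mono ennreal_leI mult_left_le cutoff g0)
  qed
  then have le: "(\<integral>\<^sup>+q. ennreal (g q) \<partial>N) <= ennreal (V p)" by (subst cutoff_Sup) (auto simp: sN g0 intro!: SUP_least)
  obtain \<delta> C where C: "\<delta> > 0" "C >= 0" "\<And>x q. x \<in> ball p \<delta> ==> q \<in> bdom ==> ennreal (PK x q) <= ennreal C * S q"
   using maj p by blast
  \<comment> \<open>The cutoff radius depends on m, but the error C a does not.\<close>
  have low: "of_nat m * ennreal (V p) <= of_nat m * (\<integral>\<^sup>+q. ennreal (g q) \<partial>N) + ennreal C * ennreal a" for m
  proof -
   obtain \<rho> where \<rho>: "\<And>q. norm q > \<rho> ==> of_nat m * S q <= R q" using tail by blast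
   obtain k :: nat where k: "\<rho> + 1 <= real k" using real_arch_simple by blast
   have pt: "of_nat m * ennreal (g q) <= of_nat m * ennreal (g q * cutoff k q) + ennreal C * R q" if q: "q \<in> bdom" for q
   proof (cases "norm q > \<rho>")
    case True
    have "of_nat m * ennreal (g q) <= of_nat m * (ennreal C * S q)" unfolding gP[OF q] using C(1) by (intro mult_left_mono C(3) q) auto
    also have "\<dots> = ennreal C * (of_nat m * S q)" by (simp add: mult_ac)
    also have "\<dots> <= ennreal C * R q" by (intro mult_left_mono \<rho> True) simp
    finally show ?thesis by (rule order_trans) simp
   next
    case False
    then have "cutoff k q = 1" using k by (intro cutoff(4)) simp
    then show ?thesis by simp
   qed
   have "of_nat m * ennreal (V (up (tn (r n)) p)) <= of_nat m * (\<integral>\<^sup>+q. ennreal (g q * cutoff k q) \<partial>\<nu> (r2 n)) + ennreal C * ennreal a" for n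
   proof -
    have "of_nat m * ennreal (V (up (tn (r n)) p)) = (\<integral>\<^sup>+q. of_nat m * ennreal (g q) \<partial>\<nu> (r2 n))"
     unfolding g\<nu>[symmetric] by (rule nn_integral_cmult[symmetric]) (simp add: \<nu>_def)
    also have "\<dots> <= (\<integral>\<^sup>+q. of_nat m * ennreal (g q * cutoff k q) + ennreal C * R q \<partial>\<nu> (r2 n))"
     by (rule nn_integral_mono_AE) (use \<nu>bd in eventually_elim, rule pt)
    also have "\<dots> = (\<integral>\<^sup>+q. of_nat m * ennreal (g q * cutoff k q) \<partial>\<nu> (r2 n)) + (\<integral>\<^sup>+q. ennreal C * R q \<partial>\<nu> (r2 n))"
     by (rule nn_integral_add) (simp_all add: \<nu>_def)
    also have "(\<integral>\<^sup>+q. of_nat m * ennreal (g q * cutoff k q) \<partial>\<nu> (r2 n)) = of_nat m * (\<integral>\<^sup>+q. ennreal (g q * cutoff k q) \<partial>\<nu> (r2 n))"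
     by (rule nn_integral_cmult) (simp add: \<nu>_def)
    also have "(\<integral>\<^sup>+q. ennreal C * R q \<partial>\<nu> (r2 n)) = ennreal C * (\<integral>\<^sup>+q. R q \<partial>\<nu> (r2 n))"
     by (rule nn_integral_cmult) (simp add: \<nu>_def)
    also have "(\<integral>\<^sup>+q. R q \<partial>\<nu> (r2 n)) = (IB q. ennreal (V (up (tn (r1 (r2 n))) q)) * R q)" by (rule i\<nu>[OF R])
    finally show ?thesis by (rule order_trans) (intro add_left_mono mult_left_mono bd zero_le)
   qed
   moreover have "(%n. of_nat m * ennreal (V (up (tn (r n)) p))) ----> of_nat m * ennreal (V p)"
    by (intro ennreal_tendsto_cmult Vlim p of_nat_less_top)
   moreover have "(%n. of_nat m * (\<integral>\<^sup>+q. ennreal (g q * cutoff k q) \<partial>\<nu> (r2 n)) + ennreal C * ennreal a) ----> of_nat m * (\<integral>\<^sup>+q. ennreal (g q * cutoff k q) \<partial>N) + ennreal C * ennreal a"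
    by (intro tendsto_add tendsto_const ennreal_tendsto_cmult cv of_nat_less_top)
   ultimately have "of_nat m * ennreal (V p) <= of_nat m * (\<integral>\<^sup>+q. ennreal (g q * cutoff k q) \<partial>N) + ennreal C * ennreal a"
    by (blast intro: LIMSEQ_le)
   also have "\<dots> <= of_nat m * (\<integral>\<^sup>+q. ennreal (g q) \<partial>N) + ennreal C * ennreal a"
    by (intro add_right_mono mult_left_mono nn_integral_mono ennreal_leI mult_left_le cutoff g0) simp
   finally show ?thesis .
  qed
  define y where "y = enn2real (\<integral>\<^sup>+q. ennreal (g q) \<partial>N)"
  have "(\<integral>\<^sup>+q. ennreal (g q) \<partial>N) < \<top>" using le by (rule le_less_trans) simp
  then have y: "(\<integral>\<^sup>+q. ennreal (g q) \<partial>N) = ennreal y" "y >= 0" by (simp_all add: y_def)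
  have "V p <= y"
  proof (rule field_le_epsilon)
   fix eps :: real assume "eps > 0"
   then obtain m :: nat where m: "C * a / eps < real m" using reals_Archimedean2 by blast
   have "ennreal (real m * V p) <= ennreal (real m * y + C * a)"
    using low[of m] V0[of p] y(2) C(2) a unfolding y(1) by (simp add: ennreal_of_nat_eq_real_of_nat less_imp_le flip: ennreal_mult ennreal_plus)
   then have 1: "real m * V p <= real m * y + C * a" using y(2) C(2) a by (subst (asm) ennreal_le_iff) auto
   have 2: "C * a <= real m * eps" using m \<open>eps > 0\<close> by (simp add: field_simps)
   have "0 <= C * a / eps" using C(2) a \<open>eps > 0\<close> by simp
   then have m0: "real m > 0" using m by linarith
   have "real m * V p <= real m * (y + eps)" using 1 2 by (simp add: algebra_simps)
   then show "V p <= y + eps" using m0 by simp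
  qed
  moreover have "y <= V p" using le V0[of p] unfolding y(1) by simp
  ultimately show ?thesis unfolding gN y(1) by simp
 qed
 have "(%n. IB q. ennreal (V (up (tn (r n)) q)) * ennreal (f q)) ----> (\<integral>\<^sup>+x. ennreal (f x) \<partial>N)"
  if f: "continuous_on UNIV f" "\<forall>x. 0 <= f x" "\<forall>x. norm x > R --> f x = 0" for f R
 proof -
  have "f \<in> borel_measurable borel" by (rule borel_measurable_continuous_onI[OF f(1)])
  then have "(\<integral>\<^sup>+x. ennreal (f x) \<partial>\<nu> (r2 n)) = (IB q. ennreal (V (up (tn (r n)) q)) * ennreal (f q))" for n
   unfolding r_def o_def by (intro i\<nu>) measurable
  then show ?thesis using conv[OF f(1), of R] f(2,3) by simp
 qed
 then show ?thesis using sr sN AEN cK main by (intro exI[of _ N] exI[of _ r]) blast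
qed

end

section \<open>Comparison of competing boundary measures\<close>

context symmetric_siegel
begin

lemma measurable_bdom_ident:
 assumes "sets \<nu> = sets (restrict_space borel bdom)" shows "(%x. x) \<in> borel_measurable \<nu>"
 by (simp add: measurable_cong_sets[OF assms refl] measurable_restrict_space1)

lemma space_bdom: "sets \<nu> = sets (restrict_space borel bdom) ==> space \<nu> = bdom"
 using sets_eq_imp_space_eq[of \<nu> "restrict_space borel bdom"] by (simp add: space_restrict_space)

text \<open>The symmetry \<open>PK_swap\<close> turns the Poisson integral of \<open>\<nu>\<close>, evaluated at \<open>up t q\<close>, into an
 approximate identity acting on \<open>\<nu>\<close>.\<close>

lemma boundary_measure_test_le:
 fixes V :: "'a => real"
 assumes Vm [measurable]: "V \<in> borel_measurable borel"
  and \<nu>: "sets \<nu> = sets borel" "AE q in \<nu>. q \<in> bdom" "sigma_finite_measure \<nu>"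
  and le: "\<And>p. p \<in> dom ==> (\<integral>\<^sup>+q. ennreal (PK p q) \<partial>\<nu>) <= ennreal (V p)"
  and f: "continuous_on UNIV f" "\<And>x. 0 <= f x" "\<And>x. f x <= B" and X: "\<And>n. X n > 0" "X ----> 0"
  and conv: "(%n. IB q. ennreal (V (up (X n) q)) * ennreal (f q)) ----> L"
 shows "(\<integral>\<^sup>+q. ennreal (f q) \<partial>\<nu>) <= L"
proof -
 note \<nu>(1)[measurable_cong]
 have fm [measurable]: "f \<in> borel_measurable borel" by (rule borel_measurable_continuous_onI[OF f(1)])
 have P: "pair_sigma_finite \<nu> bB" using \<nu>(3) sigma_finite_bB by (simp add: pair_sigma_finite_def)
 \<comment> \<open>\<open>PK (up t q) q'\<close> with the denominator frozen at the base point: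
   equal on \<open>bdom\<close>, and jointly measurable because only \<open>CK\<close> depends on
   q.\<close>
 define J where "J t q q' = ennreal ((cmod (CK (up t q) q'))\<^sup>2 / Re (repr_kernel (up t 0) (up t 0)))" for t q q'
 have J: "J t q q' = ennreal (PK (up t q) q')" if "q \<in> bdom" "t > 0" for t q q' using kernel_diag_boundary[OF that] by (simp add: J_def PK_def)
 have up [measurable (raw)]: "(%x. up t (g x)) \<in> borel_measurable M" if [measurable]: "g \<in> borel_measurable M" for t M and g :: "'a \<times> 'a => 'a"
  unfolding up_def by measurable
 have m: "(%(q, q'). ennreal (f q') * J t q q') \<in> borel_measurable (\<nu> \<Otimes>\<^sub>M bB)" for t
  unfolding J_def split_beta' by measurable
 have inner: "(%q. IB q'. ennreal (f q') * J t q q') \<in> borel_measurable \<nu>" for t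
 proof -
  interpret pair_sigma_finite \<nu> bB by (rule P)
  show ?thesis using M2.borel_measurable_nn_integral_fst[OF m] by simp
 qed
 have "(\<integral>\<^sup>+q. ennreal (f q) \<partial>\<nu>) = (\<integral>\<^sup>+q. liminf (%n. IB q'. ennreal (f q') * J (X n) q q') \<partial>\<nu>)"
 proof (rule nn_integral_cong_AE, use \<nu>(2) in eventually_elim)
  fix q assume q: "q \<in> bdom"
  have "(IB q'. ennreal (f q') * J (X n) q q') = (IB q'. ennreal (f q' * PK (up (X n) q) q'))" for n
   using J[OF q X(1)] f(2) by (simp add: ennreal_mult')
  then have "(%n. IB q'. ennreal (f q') * J (X n) q q') ----> ennreal (f q)" using PK_approx[OF f q X] by simp
  then show "ennreal (f q) = liminf (%n. IB q'. ennreal (f q') * J (X n) q q')" by (intro lim_imp_Liminf[symmetric]) auto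
 qed
 \<comment> \<open>Fatou's lemma is enough, as only an upper bound for \<nu> is sought.\<close>
 also have "\<dots> <= liminf (%n. \<integral>\<^sup>+q. (IB q'. ennreal (f q') * J (X n) q q') \<partial>\<nu>)"
  by (rule nn_integral_liminf[OF inner])
 also have "\<dots> <= liminf (%n. IB q. ennreal (V (up (X n) q)) * ennreal (f q))"
 proof (intro Liminf_mono always_eventually allI)
  fix n
  have "(\<integral>\<^sup>+q. (IB q'. ennreal (f q') * J (X n) q q') \<partial>\<nu>) = (IB q'. (\<integral>\<^sup>+q. ennreal (f q') * J (X n) q q' \<partial>\<nu>))"
   by (rule pair_sigma_finite.Fubini'[OF P m, symmetric])
  also have "\<dots> <= (IB q'. ennreal (V (up (X n) q')) * ennreal (f q'))"
  proof (rule nn_integral_mono_AE, use AE_bB in eventually_elim)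
   fix q' assume q': "q' \<in> bdom"
   have "(\<integral>\<^sup>+q. ennreal (f q') * J (X n) q q' \<partial>\<nu>) = (\<integral>\<^sup>+q. ennreal (f q') * ennreal (PK (up (X n) q') q) \<partial>\<nu>)"
   proof (rule nn_integral_cong_AE, use \<nu>(2) in eventually_elim)
    fix q assume q: "q \<in> bdom"
    show "ennreal (f q') * J (X n) q q' = ennreal (f q') * ennreal (PK (up (X n) q') q)" unfolding J[OF q X(1)] PK_swap[OF q q' X(1)] ..
   qed
   also have "\<dots> = ennreal (f q') * (\<integral>\<^sup>+q. ennreal (PK (up (X n) q') q) \<partial>\<nu>)" by (rule nn_integral_cmult) measurable
   also have "\<dots> <= ennreal (f q') * ennreal (V (up (X n) q'))" using q' X(1) by (intro mult_left_mono le up_dom) auto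
   finally show "(\<integral>\<^sup>+q. ennreal (f q') * J (X n) q q' \<partial>\<nu>) <= ennreal (V (up (X n) q')) * ennreal (f q')" by (simp add: mult.commute)
  qed
  finally show "(\<integral>\<^sup>+q. (IB q'. ennreal (f q') * J (X n) q q') \<partial>\<nu>) <= (IB q. ennreal (V (up (X n) q)) * ennreal (f q))" .
 qed
 also have "\<dots> = L" by (rule lim_imp_Liminf[OF _ conv]) simp
 finally show ?thesis .
qed

end

text \<open>Compact sets are approximated from above by tents on their neighbourhoods; Borel sets
  follow from inside by inner regularity.\<close>

lemma measure_le_of_test_functions:
 fixes M N :: "'a::euclidean_space measure"
 assumes M: "sets M = sets borel" "\<And>n::nat. emeasure M (cball 0 (real n)) < \<infinity>"
  and N: "sets N = sets borel" "\<And>K. compact K ==> emeasure N K < \<infinity>"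
  and le: "\<And>f R. continuous_on UNIV f ==> (\<And>x. 0 <= f x) ==> (\<And>x. f x <= 1) ==> (\<And>x. norm x > R ==> f x = 0) ==>
   (\<integral>\<^sup>+x. ennreal (f x) \<partial>M) <= (\<integral>\<^sup>+x. ennreal (f x) \<partial>N)"
  and B: "B \<in> sets borel"
 shows "emeasure M B <= emeasure N B"
proof -
 note M(1)[measurable_cong] N(1)[measurable_cong]
 have comp: "emeasure M K <= emeasure N K" if K: "compact K" for K
 proof (cases "K = {}")
  case False
  obtain b where b: "\<And>x. x \<in> K ==> norm x <= b" using compact_imp_bounded[OF K] unfolding bounded_iff by blast
  \<comment> \<open>Equal to 1 on K, vanishing at distance 1 / (k + 1); the support lies within
    distance 1 of K for every k.\<close>
  define f where "f k x = max 0 (1 - real (Suc k) * infdist x K)" for k x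
  have fc: "continuous_on UNIV (f k)" for k unfolding f_def by (intro continuous_intros)
  have fm [measurable]: "f k \<in> borel_measurable borel" for k by (rule borel_measurable_continuous_onI[OF fc])
  have f1: "0 <= f k x" "f k x <= 1" for k x by (simp_all add: f_def infdist_nonneg)
  have f0: "f k x = 0" if "norm x > b + 1" for k x
  proof -
   obtain y where y: "y \<in> K" "infdist x K = dist x y" using infdist_attains_inf[OF compact_imp_closed[OF K] False] by blast
   have "1 <= dist x y" using that b[OF y(1)] norm_triangle_ineq2[of x y] by (simp add: dist_norm)
   then have "1 * 1 <= real (Suc k) * infdist x K" unfolding y(2) by (intro mult_mono) auto
   then show ?thesis by (simp add: f_def)
  qed
  have Kb: "K \<in> sets borel" using K by (simp add: compact_imp_closed)
  have "(%k. \<integral>\<^sup>+x. ennreal (f k x) \<partial>N) ----> (\<integral>\<^sup>+x. indicator K x \<partial>N)"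
  proof (rule nn_integral_dominated_convergence[where w = "indicator (cball 0 (b + 1))"])
   show "AE x in N. ennreal (f k x) <= indicator (cball 0 (b + 1)) x" for k using f1 f0 by (intro AE_I2) (auto simp: indicator_def not_le)
   show "(\<integral>\<^sup>+x. indicator (cball 0 (b + 1)) x \<partial>N) < \<infinity>" using N(2)[of "cball 0 (b + 1)"] by (simp add: N(1))
   show "AE x in N. (%k. ennreal (f k x)) ----> indicator K x"
   proof (rule AE_I2)
    fix x
    show "(%k. ennreal (f k x)) ----> indicator K x"
    proof (cases "x \<in> K")
     case True then show ?thesis by (simp add: f_def)
    next
     case outside: False
     then have d: "infdist x K > 0" using infdist_pos_not_in_closed[OF compact_imp_closed[OF K] False] by blast
     obtain n :: nat where n: "1 / infdist x K < real n" using reals_Archimedean2 by blast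
     have "\<forall>\<^sub>F k in sequentially. ennreal (f k x) = 0" using eventually_ge_at_top[of n]
     proof eventually_elim
      fix k assume "n <= k"
      then have "1 / infdist x K <= real (Suc k)" using n by simp
      then have "1 <= real (Suc k) * infdist x K" using d by (simp add: divide_le_eq)
      then show "ennreal (f k x) = 0" by (simp add: f_def)
     qed
     then show ?thesis using outside by (auto intro: tendsto_eventually)
    qed
   qed
  qed (use Kb in \<open>auto intro!: borel_measurable_indicator simp: measurable_cong_sets[OF N(1) refl]\<close>)
  then have lim: "(%k. \<integral>\<^sup>+x. ennreal (f k x) \<partial>N) ----> emeasure N K" using Kb by (simp add: N(1))
  have "emeasure M K <= (\<integral>\<^sup>+x. ennreal (f k x) \<partial>N)" for k
  proof -
   have "emeasure M K = (\<integral>\<^sup>+x. indicator K x \<partial>M)" using Kb by (simp add: M(1))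
   also have "\<dots> <= (\<integral>\<^sup>+x. ennreal (f k x) \<partial>M)" by (intro nn_integral_mono) (auto simp: indicator_def f_def)
   also have "\<dots> <= (\<integral>\<^sup>+x. ennreal (f k x) \<partial>N)" by (rule le[OF fc f1 f0])
   finally show ?thesis .
  qed
  then show ?thesis by (intro LIMSEQ_le_const[OF lim]) auto
 qed simp
 have "emeasure M (B \<inter> cball 0 (real n)) <= emeasure N B" for n :: nat
 proof -
  \<comment> \<open>Inner regularity is applied to a finite measure, the restriction of M to a ball,
    before the balls exhaust the space.\<close>
  let ?M = "density M (indicator (cball 0 (real n)))"
  have r: "emeasure ?M A = emeasure M (cball 0 (real n) \<inter> A)" if "A \<in> sets borel" for A
   using that by (intro emeasure_restricted) (auto simp: M(1))
  have "emeasure ?M (space ?M) \<noteq> \<infinity>" using r[of UNIV] M(2)[of n] sets_eq_imp_space_eq[OF M(1)] by simp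
  then have "emeasure ?M B = (SUP K \<in> {K. K \<subseteq> B & compact K}. emeasure ?M K)" using M(1) B by (intro inner_regular) auto
  also have "\<dots> <= emeasure N B"
  proof (rule SUP_least)
   fix K assume K: "K \<in> {K. K \<subseteq> B & compact K}"
   then have "emeasure ?M K = emeasure M (cball 0 (real n) \<inter> K)" by (intro r) (auto intro: borel_compact)
   also have "\<dots> <= emeasure M K" using K by (intro emeasure_mono) (auto simp: M(1) intro: borel_compact)
   also have "\<dots> <= emeasure N K" using K comp by auto
   also have "\<dots> <= emeasure N B" using K B by (intro emeasure_mono) (auto simp: N(1))
   finally show "emeasure ?M K <= emeasure N B" .
  qed
  finally show ?thesis using r[OF B] by (simp add: Int_commute)
 qed
 moreover have "(SUP n::nat. emeasure M (B \<inter> cball 0 (real n))) = emeasure M (\<Union>n::nat. B \<inter> cball 0 (real n))"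
  using B by (intro SUP_emeasure_incseq) (auto simp: M(1) incseq_def)
 moreover have "(\<Union>n::nat. B \<inter> cball 0 (real n)) = B" using real_arch_simple by auto
 ultimately show ?thesis by (metis SUP_least)
qed

section \<open>Identification of the Clark measure\<close>

context symmetric_siegel
begin

text \<open>\<open>clark_measure\<close> is a greatest element, so exhibiting one determines it. The
  restriction of N to \<open>bdom\<close> is admissible with equality, and every competitor lies
  below it when tested against functions of bounded support.\<close>

lemma clark_measure_eq:
 fixes V :: "'a => real"
 assumes Vm: "V \<in> borel_measurable borel" and V: "\<And>p. p \<in> dom ==> Re ((\<alpha> + \<phi> p) / (\<alpha> - \<phi> p)) = V p"
  and N: "sets N = sets borel" "AE q in N. q \<in> bdom" "\<And>K. compact K ==> emeasure N K < \<infinity>"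
  and PN: "\<And>p. p \<in> dom ==> (\<integral>\<^sup>+q. ennreal (PK p q) \<partial>N) = ennreal (V p)"
  and X: "\<And>n. X n > 0" "X ----> 0"
  and conv: "\<And>f R. continuous_on UNIV f ==> (\<And>x. 0 <= f x) ==> (\<And>x. norm x > R ==> f x = 0) ==>
   (%n. IB q. ennreal (V (up (X n) q)) * ennreal (f q)) ----> (\<integral>\<^sup>+x. ennreal (f x) \<partial>N)"
  and p: "p \<in> dom"
 shows "poisson_int (clark_measure \<phi> \<alpha>) p = ennreal (V p)"
proof -
 define \<mu> where "\<mu> = restrict_space N bdom"
 have bb: "bdom \<in> sets borel" using closed_bdom by simp
 have sN: "space N = UNIV" using sets_eq_imp_space_eq[OF N(1)] by simp
 have s\<mu>: "sets \<mu> = sets (restrict_space borel bdom)" unfolding \<mu>_def by (rule sets_restrict_space_cong[OF N(1)])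
 have P\<mu>: "poisson_int \<mu> p = ennreal (V p)" if p: "p \<in> dom" for p
 proof -
  have "poisson_int \<mu> p = (\<integral>\<^sup>+q. ennreal (poisson p q) * indicator bdom q \<partial>N)"
   unfolding poisson_int_def \<mu>_def using bb by (intro nn_integral_restrict_space) (simp add: N(1) sN)
  also have "\<dots> = (\<integral>\<^sup>+q. ennreal (PK p q) \<partial>N)"
   by (rule nn_integral_cong_AE) (use N(2) in eventually_elim, simp add: PK_poisson[OF p])
  finally show ?thesis using PN[OF p] by simp
 qed
 have "clark_measure \<phi> \<alpha> = \<mu>" unfolding clark_measure_def
 proof (rule Greatest_equality)
  have "emeasure \<mu> K < \<infinity>" if "compact K" "K \<subseteq> bdom" for K
   using N(3)[OF that(1)] that bb unfolding \<mu>_def by (subst emeasure_restrict_space) (auto simp: N(1) sN)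
  moreover have "(\<integral>\<^sup>+ q. ennreal (poisson (point 0 0 e) q) \<partial>\<mu>) < \<infinity>"
   using P\<mu>[OF base_point(2)] unfolding poisson_int_def base_point(1) by simp
  ultimately show "\<mu> \<in> MP_pos & (\<forall>p\<in>dom. poisson_int \<mu> p <= ennreal (Re ((\<alpha> + \<phi> p) / (\<alpha> - \<phi> p))))"
   using s\<mu> P\<mu> V unfolding MP_pos_def by simp
 next
  fix \<nu> assume a: "\<nu> \<in> MP_pos & (\<forall>p\<in>dom. poisson_int \<nu> p <= ennreal (Re ((\<alpha> + \<phi> p) / (\<alpha> - \<phi> p))))"
  then have s\<nu>: "sets \<nu> = sets (restrict_space borel bdom)" and c\<nu>: "\<And>K. compact K ==> K \<subseteq> bdom ==> emeasure \<nu> K < \<infinity>"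
   and l\<nu>: "\<And>p. p \<in> dom ==> poisson_int \<nu> p <= ennreal (V p)" using V unfolding MP_pos_def by auto
  note id = measurable_bdom_ident[OF s\<nu>] and sp = space_bdom[OF s\<nu>]
  \<comment> \<open>The competitor lives on the Borel sets of \<open>bdom\<close>; it is moved to
    the whole space to be compared with N.\<close>
  define M where "M = distr \<nu> borel (%x. x)"
  have sM: "sets M = sets borel" by (simp add: M_def)
  have eM: "emeasure M A = emeasure \<nu> (A \<inter> bdom)" if "A \<in> sets borel" for A
   using that id unfolding M_def by (subst emeasure_distr) (auto simp: sp)
  have bM: "AE q in M. q \<in> bdom" unfolding M_def using bb id by (subst AE_distr_iff) (auto simp: sp)
  have cM: "emeasure M (cball 0 (real n)) < \<infinity>" for n :: nat
   using c\<nu>[OF compact_Int_closed[OF compact_cball closed_bdom], of 0 "real n"] by (simp add: eM)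
  have lM: "(\<integral>\<^sup>+q. ennreal (PK p q) \<partial>M) <= ennreal (V p)" if p: "p \<in> dom" for p
  proof -
   have "(\<integral>\<^sup>+q. ennreal (PK p q) \<partial>M) = (\<integral>\<^sup>+q. ennreal (PK p q) \<partial>\<nu>)"
    unfolding M_def by (rule nn_integral_distr[OF id]) measurable
   also have "\<dots> = poisson_int \<nu> p" unfolding poisson_int_def by (intro nn_integral_cong) (simp add: sp PK_poisson[OF p])
   finally show ?thesis using l\<nu>[OF p] by simp
  qed
  have "emeasure \<nu> A <= emeasure \<mu> A" for A
  proof (cases "A \<in> sets \<nu>")
   case True
   then have A: "A \<in> sets borel" "A \<subseteq> bdom" unfolding s\<nu> using bb by (auto simp: sets_restrict_space_iff)
   have "emeasure M A <= emeasure N A"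
   proof (rule measure_le_of_test_functions[OF sM cM N(1) N(3) _ A(1)])
    fix f :: "'a => real" and R assume f: "continuous_on UNIV f" "\<And>x. 0 <= f x" "\<And>x. f x <= 1" "\<And>x. norm x > R ==> f x = 0"
    show "(\<integral>\<^sup>+x. ennreal (f x) \<partial>M) <= (\<integral>\<^sup>+x. ennreal (f x) \<partial>N)"
     by (rule boundary_measure_test_le[OF Vm sM bM sigma_finite_cball[OF sM cM] lM f(1,2,3) X conv[OF f(1,2,4)]])
   qed
   then show ?thesis using eM[OF A(1)] A bb unfolding \<mu>_def by (subst emeasure_restrict_space) (auto simp: N(1) sN Int_absorb2)
  \<comment> \<open>The order on measures compares all sets; the measure of a nonmeasurable set is 0
    by convention.\<close>
  qed (simp add: emeasure_notin_sets)
  then show "\<nu> <= \<mu>" using s\<nu> s\<mu> sets_eq_imp_space_eq[of \<nu> \<mu>] by (simp add: le_measure_iff le_fun_def)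
 qed
 then show ?thesis using P\<mu>[OF p] by simp
qed

text \<open>Every condition on \<alpha> is one of countably many: points of a countable dense set,
  translates \<open>tn j\<close>, and one finite liminf. Afterwards \<alpha> is fixed, and the
  subsequence and the limit measure may depend on it.\<close>

lemma clark_measure_ae:
 assumes \<phi>: "holomorphic_fun \<phi> dom" and \<phi>1: "\<And>p. p \<in> dom ==> cmod (\<phi> p) < 1"
 shows "AE \<alpha> in circle_haar. \<forall>p\<in>dom. poisson_int (clark_measure \<phi> \<alpha>) p = ennreal (pois \<alpha> (\<phi> p))"
proof -
 note [measurable] = ext0(1)[OF \<phi> \<phi>1]
 obtain S where S [measurable]: "S \<in> borel_measurable borel" and Sf: "(IB q. S q) < \<infinity>"
  and maj: "\<forall>p\<in>dom. \<exists>r>0. \<exists>C\<ge>0. ball p r \<subseteq> dom & (\<forall>x\<in>ball p r. \<forall>q\<in>bdom. ennreal (PK x q) <= ennreal C * S q)"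
  using PK_majorant by (elim bexE conjE) (rule that; assumption)
 obtain R where R [measurable]: "R \<in> borel_measurable borel" and Rf: "(IB q. R q) < \<infinity>" and SR: "\<forall>q. S q <= R q"
  and tail: "\<forall>n. \<exists>\<rho>. \<forall>q. norm q > \<rho> --> of_nat n * S q <= R q"
  using tail_weight[OF S Sf] by (elim bexE conjE) (rule that; assumption)
 have "\<exists>A<\<infinity>. \<forall>n::nat. emeasure bB (cball 0 (real k)) <= A" for k :: nat using bB_cball[of "real k"] by blast
 from weight_exists[of "%_. bB", OF _ this]
 obtain w where w: "continuous_on UNIV w" "\<forall>x::'a. w x > 0" and wf: "\<forall>n::nat. (IB x. ennreal (w x)) <= 1" by auto
 have wm [measurable]: "w \<in> borel_measurable borel" by (rule borel_measurable_continuous_onI[OF w(1)])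
 \<comment> \<open>R controls the tails of the Poisson kernels, while w is the positive continuous
   weight required by vague compactness; one integrable function serves both.\<close>
 define R' where "R' q = R q + ennreal (w q)" for q
 have R' [measurable]: "R' \<in> borel_measurable borel" unfolding R'_def by measurable
 have "(IB q. R' q) = (IB q. R q) + (IB q. ennreal (w q))" unfolding R'_def by (rule nn_integral_add) measurable
 also have "\<dots> < \<infinity>" using Rf wf by (auto intro: le_less_trans)
 finally have R'f: "(IB q. R' q) < \<infinity>" .
 obtain D :: "'a set" where D: "countable D" "\<And>X. open X ==> X \<noteq> {} ==> \<exists>d\<in>D. d \<in> X" using countable_dense_exists by blast
 define Q where "Q = D \<inter> dom"
 have Q: "countable Q" "Q \<subseteq> dom" using D(1) by (auto simp: Q_def)
 have Qd: "dom \<subseteq> closure Q"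
 proof
  fix x assume x: "x \<in> dom"
  show "x \<in> closure Q" unfolding closure_approachable
  proof (intro allI impI)
   fix eps :: real assume "eps > 0"
   then have "ball x eps \<inter> dom \<noteq> {}" using x by (metis IntI centre_in_ball empty_iff)
   then obtain d where "d \<in> D" "d \<in> ball x eps \<inter> dom" using D(2)[of "ball x eps \<inter> dom"] open_dom by blast
   then show "\<exists>y\<in>Q. dist y x < eps" by (intro bexI[of _ d]) (auto simp: Q_def dist_commute)
  qed
 qed
 have 1: "AE \<alpha> in circle_haar. \<forall>p\<in>Q. \<forall>j. (IB q. ennreal (pois \<alpha> (ext0 \<phi> (up (tn j) q))) * ennreal (PK p q)) = ennreal (pois \<alpha> (ext0 \<phi> (up (tn j) p)))"
  unfolding AE_ball_countable[OF Q(1)] AE_all_countable using Q(2) by (intro ballI allI pois_ae_equality[OF \<phi> \<phi>1]) auto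
 have 2: "AE \<alpha> in circle_haar. liminf (%j. IB q. ennreal (pois \<alpha> (ext0 \<phi> (up (tn j) q))) * R' q) < \<infinity>"
  by (rule pois_ae_tight[OF \<phi> \<phi>1 R' R'f])
 have 3: "AE \<alpha> in circle_haar. \<alpha> \<in> sphere 0 1" by (rule AE_I2) (simp add: space_circle_haar)
 show ?thesis using 1 2 3
 proof eventually_elim
  fix \<alpha> assume eq: "\<forall>p\<in>Q. \<forall>j. (IB q. ennreal (pois \<alpha> (ext0 \<phi> (up (tn j) q))) * ennreal (PK p q)) = ennreal (pois \<alpha> (ext0 \<phi> (up (tn j) p)))"
   and lim: "liminf (%j. IB q. ennreal (pois \<alpha> (ext0 \<phi> (up (tn j) q))) * R' q) < \<infinity>" and "\<alpha> \<in> sphere 0 1"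
  then have \<alpha>: "cmod \<alpha> = 1" by simp
  define V where "V p = pois \<alpha> (ext0 \<phi> p)" for p
  have Vm: "V \<in> borel_measurable borel" unfolding V_def by measurable
  have V0: "0 <= V p" for p unfolding V_def by (intro pois_nonneg ext0(2)[OF \<phi> \<phi>1])
  have Vd: "V p = pois \<alpha> (\<phi> p)" if "p \<in> dom" for p using that by (simp add: V_def ext0_def[OF \<phi> \<phi>1])
  have Vc: "continuous_on dom V"
  proof (rule continuous_on_eq)
   show "continuous_on dom (%p. pois \<alpha> (\<phi> p))" unfolding pois_def
    using \<phi>1 \<alpha> by (intro continuous_intros holomorphic_fun_continuous[OF \<phi>]) force
  qed (simp add: Vd)
  have SR': "S q <= R' q" for q using SR by (simp add: R'_def add_increasing2)
  have tail': "\<exists>\<rho>. \<forall>q. norm q > \<rho> --> of_nat n * S q <= R' q" for n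
  proof -
   obtain \<rho> where "\<forall>q. norm q > \<rho> --> of_nat n * S q <= R q" using tail by blast
   then show ?thesis unfolding R'_def by (intro exI[of _ \<rho>]) (simp add: add_increasing2)
  qed
  have wR: "ennreal (w q) <= R' q" for q by (simp add: R'_def)
  have eq': "\<forall>p\<in>Q. \<forall>j. (IB q. ennreal (V (up (tn j) q)) * ennreal (PK p q)) = ennreal (V (up (tn j) p))"
   unfolding V_def by (rule eq)
  have lim': "liminf (%j. IB q. ennreal (V (up (tn j) q)) * R' q) < \<infinity>" unfolding V_def by (rule lim)
  from boundary_measure[OF Vm Vc V0 Q(2) Qd eq' S maj R' SR' tail' w(1) w(2)[rule_format] wR lim']
  obtain N r where r: "strict_mono (r :: nat => nat)" and N: "sets N = sets borel" "AE q in N. q \<in> bdom" "\<forall>K. compact K --> emeasure N K < \<infinity>"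
   and PN: "\<forall>p\<in>dom. (\<integral>\<^sup>+q. ennreal (PK p q) \<partial>N) = ennreal (V p)"
   and conv: "\<forall>f R. continuous_on UNIV f --> (\<forall>x. 0 <= f x) --> (\<forall>x. norm x > R --> f x = 0) -->
    (%n. IB q. ennreal (V (up (tn (r n)) q)) * ennreal (f q)) ----> (\<integral>\<^sup>+x. ennreal (f x) \<partial>N)"
   by (elim exE conjE) (rule that; assumption)
  have tr: "(%n. tn (r n)) ----> 0" using LIMSEQ_subseq_LIMSEQ[OF tn_tendsto r] by (simp add: o_def)
  have tp: "tn (r n) > 0" for n by simp
  have VR: "Re ((\<alpha> + \<phi> p) / (\<alpha> - \<phi> p)) = V p" if "p \<in> dom" for p using pois_Re[OF \<alpha>] Vd[OF that] by simp
  have conv': "(%n. IB q. ennreal (V (up (tn (r n)) q)) * ennreal (f q)) ----> (\<integral>\<^sup>+x. ennreal (f x) \<partial>N)"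
   if "continuous_on UNIV f" "\<And>x. 0 <= f x" "\<And>x. norm x > R ==> f x = 0" for f R using conv[rule_format, of f R] that by blast
  show "\<forall>p\<in>dom. poisson_int (clark_measure \<phi> \<alpha>) p = ennreal (pois \<alpha> (\<phi> p))"
  proof
   fix p assume p: "p \<in> dom"
   show "poisson_int (clark_measure \<phi> \<alpha>) p = ennreal (pois \<alpha> (\<phi> p))" unfolding Vd[OF p, symmetric]
    by (rule clark_measure_eq[OF Vm VR N(1,2) N(3)[rule_format] PN[rule_format] tp tr conv' p]; blast)
  qed
 qed
qed

end

theorem corollary7p6:
 fixes scaleC :: "complex \<Rightarrow> 'a::euclidean_space \<Rightarrow> 'a"
  and triple :: "'a \<Rightarrow> 'a \<Rightarrow> 'a \<Rightarrow> 'a"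
  and e :: 'a
  and \<phi> :: "'a \<Rightarrow> complex"
 assumes "symmetric_siegel scaleC triple e"
  and "positive_hermitian_jts.holomorphic_fun scaleC \<phi> (symmetric_siegel.dom scaleC triple e)"
  and "\<forall>p\<in>symmetric_siegel.dom scaleC triple e. \<phi> p \<in> ball 0 1"
 shows "{\<alpha> \<in> sphere 0 1. \<exists>p\<in>symmetric_siegel.dom scaleC triple e.
      symmetric_siegel.poisson_int scaleC triple e
       (symmetric_siegel.clark_measure scaleC triple e \<phi> \<alpha>) p
      \<noteq> ennreal ((1 - (cmod (\<phi> p))\<^sup>2) / (cmod (\<alpha> - \<phi> p))\<^sup>2)}
     \<in> null_sets (completion circle_haar)"
proof -
 interpret symmetric_siegel scaleC triple e by (rule assms(1))
 have "AE \<alpha> in circle_haar. \<forall>p\<in>dom. poisson_int (clark_measure \<phi> \<alpha>) p = ennreal (pois \<alpha> (\<phi> p))"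
  using assms(2,3) by (intro clark_measure_ae) auto
 then obtain Z where Z: "{\<alpha> \<in> space circle_haar. \<not> (\<forall>p\<in>dom. poisson_int (clark_measure \<phi> \<alpha>) p = ennreal (pois \<alpha> (\<phi> p)))} \<subseteq> Z" "Z \<in> null_sets circle_haar"
  by (auto elim: AE_E3 simp: eventually_ae_filter)
 \<comment> \<open>The exceptional set is known only to be contained in a Borel null set, whence the
   completion.\<close>
 show ?thesis
  by (rule null_sets_completion_subset[OF _ null_sets_completionI[OF Z(2)]]) (use Z(1) in \<open>auto simp: space_circle_haar pois_def\<close>)
qed

end
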